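(* (Soundness of transpose.) Let $\Gamma;\dot\Gamma\vdash d:(\sigma;\tau)$ be a Linear B judgment, $\theta$ an enumeration of $\dot\Gamma$, and $\dot u:\tau$ a fresh tangent variable. Then $$\mathcal T(\delta_\theta(d))\;\sim\;\delta_{(\dot u)}\big(\mathcal T^{\mathrm{Jax}}_{\theta;\dot u}(d)\big).$$
   Context: **Calculus $\lambda LL$.** Fix function symbols $\underline f$ with arities $n\ge 1$, each denoting a differentiable $f:\mathbb R^n\to\mathbb R$. Types: $A,B::=\mathbb R\mid A\multimap B\mid 1\mid A\otimes B\mid\top\mid A\& B\mid {!A}$. Each variable has a fixed type. Patterns: $p,q::=x\mid {!x}\mid ()\mid (p,q)\mid\langle p,q\rangle$, no variable repeated, typed by $x:A$, $!x:{!A}$ (for $x$ of type $A$), $():1$, $(p,q):A\otimes B$, $\langle p,q\rangle:A\& B$. An environment is a finite set of typed patterns with disjoint variables; $!\Gamma$ means all patterns are of the form $!x$; the comma is variable-disjoint union. Terms: $M,N::=x\mid {!M}\mid\lambda p.M\mid MN\mid ()\mid (M,N)\mid\langle\rangle\mid\langle M,N\rangle\mid\underline r\mid\underline f\mid\dot+\mid\dot*$ ($r\in\mathbb R$). Typing: $x:A\vdash x:A$; $!x:{!A}\vdash x:A$; $!\Gamma\vdash M:A\Rightarrow{!\Gamma}\vdash{!M}:{!A}$; $\Delta\vdash M:B\Rightarrow{!x}:{!A},\Delta\vdash M:B$; $p:A,\Delta\vdash M:B\Rightarrow\Delta\vdash\lambda p.M:A\multimap B$; if $!\Gamma_i,\Delta_i\vdash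 M_i:A_i$ ($i=1,2$) then $!\Gamma_1\cup{!\Gamma_2},\Delta_1,\Delta_2\vdash M_1M_2:B$ when $A_1=A_2\multimap B$, and $\vdash(M_1,M_2):A_1\otimes A_2$ in that same environment; $\vdash():1$; $\Delta\vdash M:B\Rightarrow():1,\Delta\vdash M:B$; $p:A,q:B,\Delta\vdash M:C\Rightarrow(p,q):A\otimes B,\Delta\vdash M:C$; $\Delta\vdash M_1:A_1$ and $\Delta\vdash M_2:A_2\Rightarrow\Delta\vdash\langle M_1,M_2\rangle:A_1\& A_2$; $p_i:A_i,\Delta\vdash M:B\Rightarrow\langle p_1,p_2\rangle:A_1\& A_2,\Delta\vdash M:B$ ($i=1$ or $2$); $\Delta\vdash\langle\rangle:\top$; $\vdash\underline r:\mathbb R$; $\Delta\vdash\underline0:\mathbb R$; $\vdash\underline f:({!\mathbb R}\otimes\dots\otimes{!\mathbb R})\multimap{!\mathbb R}$; $\vdash\dot+:\mathbb R\&\mathbb R\multimap\mathbb R$; $\vdash\dot*:\mathbb R\multimap\mathbb R\multimap\mathbb R$. Reduction $\rightarrow$ is the closure under all term contexts of: $(\lambda p.M)V\to M\{V/p\}$ for $V$ a value for $p$; $\underline f(!\underline{r_1},\dots,!\underline{r_n})\to{!\underline{f(r_1,\dots,r_n)}}$; $\dot+\langle\underline r,\underline s\rangle\to\underline{r+s}$; $\dot*\,\underline r\,\underline s\to\underline{rs}$. A value for $x$ is any term, for $!x$ any $!M$, for $()$ is $()$, for $(p_1,p_2)$ (resp. $\langle p_1,p_2\rangle$) a pair $(V_1,V_2)$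 (resp. $\langle V_1,V_2\rangle$) of values for $p_1,p_2$; substitution acts componentwise, with $M\{!N/!x\}=M\{N/x\}$ and $M\{()/()\}=M$. $=_\beta$ is the equivalence closure of $\rightarrow$. **Logical equivalence $\sim$.** On closed terms of the same type: $M\sim_{\mathbb R}N$ and $M\sim_1N$ iff $M=_\beta N$; $M\sim_{A_1\otimes A_2}N$ iff $M\to^*(M_1,M_2)$, $N\to^*(N_1,N_2)$ with $M_i\sim_{A_i}N_i$; $M\sim_{!A}N$ iff $M\to^*{!M'}$, $N\to^*{!N'}$ with $M'\sim_AN'$; $M\sim_\top N$ always; $M\sim_{A_1\& A_2}N$ iff $(\lambda\langle x_1,x_2\rangle.x_i)M\sim_{A_i}(\lambda\langle x_1,x_2\rangle.x_i)N$ for $i=1,2$; $M\sim_{A\multimap B}N$ iff $MM'\sim_BNN'$ whenever $M'\sim_AN'$. For $\Gamma=p_1:A_1,\dots,p_n:A_n$ and $\Gamma\vdash M,N:A$: $M\sim N$ iff $M\{V_i/p_i\}_i\sim_AN\{V'_i/p_i\}_i$ for all closed values $V_i,V'_i$ for $p_i$ with $V_i\sim_{A_i}V_i'$. **Abbreviations.** $\mathtt{let}\ p=N\ \mathtt{in}\ M:=(\lambda p.M)N$; $\S A:=1\& A$ and $\S M:=\langle(),M\rangle$ for terms and patterns $M$. $n$-ary tuples $\langle M_1,\dots,M_n\rangle$ (and $A_1\&\dots\& A_n$, and tuple patterns) are right-nested; the $1$-ary tuple is its component; the empty tuple is $\langle\rangle$, the empty $\&$ is $\top$, and the empty tuple pattern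 is a fresh variable of type $\top$. For types $H$ built from $\mathbb R,\top,\&$: $\underline0_{\mathbb R}=\underline0$, $\underline0_\top=\langle\rangle$, $\underline0_{H\& H'}=\langle\underline0_H,\underline0_{H'}\rangle$; $\dot+_{\mathbb R}=\dot+$, $\dot+_\top=\lambda\langle h,h'\rangle.\langle\rangle$, $\dot+_{H\& K}=\lambda\langle\langle h,k\rangle,\langle h',k'\rangle\rangle.\langle\dot+_H\langle h,h'\rangle,\dot+_K\langle k,k'\rangle\rangle$; for a variable $x:\mathbb R$: $\dot*_{\mathbb R}x=\dot*x$, $\dot*_\top x=\lambda h.\langle\rangle$, $\dot*_{H\& K}x=\lambda\langle h,k\rangle.\langle(\dot*_Hx)h,(\dot*_Kx)k\rangle$. **Linear A.** Types $\tau,\sigma::=\mathbb R\mid1\mid\tau\otimes\sigma$. There are primal variables $x,z,\dots$ and tangent variables $\dot x,\dot y,\dots$, with fixed types. Judgments $\Gamma;\dot\Gamma\vdash e:(\tau;\sigma)$ ($\Gamma$ primal context, $\dot\Gamma$ tangent context; comma = disjoint union, $\cup$ = union; weakening of the primal context $\Gamma$ is allowed): - $x:\tau;\dot y:\sigma\vdash(x;\dot y):(\tau;\sigma)$; - $\Gamma_1;\dot\Gamma_1\vdash e_1:(\tau_1;\sigma_1)$ and $\Gamma_2,x:\tau_1;\dot\Gamma_2,\dot y:\sigma_1\vdash e_2:(\tau;\sigma)$ give $\Gamma_1\cup\Gamma_2;\dot\Gamma_1,\dot\Gamma_2\vdash\mathtt{let}\,(x;\dot y)=e_1\,\mathtt{in}\,e_2:(\tau;\sigma)$;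 - $;\vdash\otimes():(1;1)$; $;\vdash\dot\otimes():(1;1)$; - $\Gamma;\dot\Gamma\vdash e:(\tau;\sigma)$ gives $\Gamma,z:1;\dot\Gamma\vdash\mathtt{let}\otimes()=z\,\mathtt{in}\,e:(\tau;\sigma)$ and $\Gamma;\dot\Gamma,\dot z:1\vdash\mathtt{let}\,\dot\otimes()=\dot z\,\mathtt{in}\,e:(\tau;\sigma)$; - $;\dot x_1:\tau_1,\dot x_2:\tau_2\vdash\dot\otimes(\dot x_1,\dot x_2):(1;\tau_1\otimes\tau_2)$; $\Gamma;\dot\Gamma,\dot x_1:\tau_1,\dot x_2:\tau_2\vdash e:(\tau;\sigma)$ gives $\Gamma;\dot\Gamma,\dot z:\tau_1\otimes\tau_2\vdash\mathtt{let}\,\dot\otimes(\dot x_1,\dot x_2)=\dot z\,\mathtt{in}\,e:(\tau;\sigma)$; - $;\vdash\dot0_\tau:(1;\tau)$; $;\dot x:\tau,\dot y:\tau\vdash\dot x\,\dot+\,\dot y:(1;\tau)$; $x:\mathbb R;\dot y:\tau\vdash x\,\dot*\,\dot y:(1;\tau)$; $;\vdash\underline r:(\mathbb R;1)$; $x_1:\mathbb R,\dots,x_n:\mathbb R;\vdash\underline f(x_1,\dots,x_n):(\mathbb R;1)$; $;\dot x:\tau\vdash\mathrm{dup}(\dot x):(1;\tau\otimes\tau)$; $\Gamma;\dot\Gamma\vdash e:(\tau;\sigma)$ gives $\Gamma;\dot\Gamma\vdash\mathrm{drop}(e):(1;1)$. $FV^t(e)$ is the set of free tangent variables of $e$. **Syntactic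 sugar** (fresh auxiliary variables): $\mathtt{let}\,x=e_1\,\mathtt{in}\,e_2:=\mathtt{let}\,(x;\dot y)=e_1\,\mathtt{in}\,\mathtt{let}\,\dot\otimes()=\dot y\,\mathtt{in}\,e_2$; $\mathtt{let}\,\dot y=e_1\,\mathtt{in}\,e_2:=\mathtt{let}\,(x;\dot y)=e_1\,\mathtt{in}\,\mathtt{let}\otimes()=x\,\mathtt{in}\,e_2$; expression $x:=\mathtt{let}\,\dot y=\dot\otimes()\,\mathtt{in}\,(x;\dot y)$; expression $\dot y:=\mathtt{let}\,x=\otimes()\,\mathtt{in}\,(x;\dot y)$; $(e_1;e_2):=\mathtt{let}\,x=e_1\,\mathtt{in}\,\mathtt{let}\,\dot y=e_2\,\mathtt{in}\,(x;\dot y)$; $\dot\otimes(e_1,e_2):=\mathtt{let}\,\dot x=e_1\,\mathtt{in}\,\mathtt{let}\,\dot y=e_2\,\mathtt{in}\,\dot\otimes(\dot x,\dot y)$. For a list $\theta$ of tangent variables: $\otimes\theta$ is the right-nested product of their types ($1$ if empty, the type itself if a singleton); the expression $\dot\otimes\theta$ is $\dot\otimes()$ if $\theta$ is empty, $\dot x$ if $\theta=(\dot x)$, and $\dot\otimes(\dot x,\dot\otimes\theta')$ if $\theta=(\dot x,\theta')$; $\mathtt{let}\,\dot\otimes\theta=e_1\,\mathtt{in}\,e_2$ is the corresponding iterated destructuring of the tangent result of $e_1$. **Linear B** (subset of Linear A, via sugar): $d::=(e^p;\dot e)\mid\mathtt{let}\,x=e^p\,\mathtt{in}\,d\mid\mathtt{let}\otimes()=z\,\mathtt{in}\,d$;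 primal $e^p::=x\mid\mathtt{let}\,x=e_1^p\,\mathtt{in}\,e_2^p\mid\underline r\mid\underline f(x_1,\dots,x_n)\mid\mathrm{drop}(e^p)\mid\otimes()\mid\mathtt{let}\otimes()=z\,\mathtt{in}\,e^p$; tangent $\dot e::=\dot x\mid\mathtt{let}\,\dot x=\dot e_1\,\mathtt{in}\,\dot e_2\mid\mathrm{dup}(\dot x)\mid\dot0_\tau\mid\dot x\dot+\dot y\mid x\dot*\dot y\mid\mathrm{drop}(\dot e)\mid\dot\otimes()\mid\dot\otimes(\dot e_1,\dot e_2)\mid\mathtt{let}\,\dot\otimes()=\dot z\,\mathtt{in}\,\dot e\mid\mathtt{let}\,\dot\otimes(\dot x_1,\dot x_2)=\dot z\,\mathtt{in}\,\dot e$. **$\mathcal T^{\mathrm{Jax}}$.** For a tangent $\Gamma;\dot\Gamma\vdash\dot e:(1;\tau)$, $\theta$ enumerating $\dot\Gamma$, $\dot u:\tau$: $\Gamma;\dot u:\tau\vdash\mathcal T^{\mathrm{Jax}}_{\theta;\dot u}(\dot e):(1;\otimes\theta)$. With $\theta_i=\theta\cap FV^t(\dot e_i)$ and $\theta'=\theta\setminus\dot z$: - $\dot x\mapsto\dot u$; - $\mathtt{let}\,\dot x=\dot e_1\,\mathtt{in}\,\dot e_2\mapsto\mathtt{let}\,\dot\otimes(\dot x,\theta_2)=\mathcal T^{\mathrm{Jax}}_{(\dot x,\theta_2);\dot u}(\dot e_2)\,\mathtt{in}\,\mathtt{let}\,\dot\otimes\theta_1=\mathcal T^{\mathrm{Jax}}_{\theta_1;\dot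 x}(\dot e_1)\,\mathtt{in}\,\dot\otimes\theta$; - $\dot\otimes()\mapsto\mathtt{let}\,\dot\otimes()=\dot u\,\mathtt{in}\,\dot\otimes()$; $\dot\otimes(\dot e_1,\dot e_2)\mapsto\mathtt{let}\,\dot\otimes(\dot u_1,\dot u_2)=\dot u\,\mathtt{in}\,\mathtt{let}\,\dot\otimes\theta_1=\mathcal T^{\mathrm{Jax}}_{\theta_1;\dot u_1}(\dot e_1)\,\mathtt{in}\,\mathtt{let}\,\dot\otimes\theta_2=\mathcal T^{\mathrm{Jax}}_{\theta_2;\dot u_2}(\dot e_2)\,\mathtt{in}\,\dot\otimes\theta$; - $\mathtt{let}\,\dot\otimes()=\dot z\,\mathtt{in}\,\dot e\mapsto\mathtt{let}\,\dot\otimes\theta'=\mathcal T^{\mathrm{Jax}}_{\theta';\dot u}(\dot e)\,\mathtt{in}\,\mathtt{let}\,\dot z=\dot\otimes()\,\mathtt{in}\,\dot\otimes\theta$; - $\mathtt{let}\,\dot\otimes(\dot x_1,\dot x_2)=\dot z\,\mathtt{in}\,\dot e\mapsto\mathtt{let}\,\dot\otimes(\dot x_1,\dot x_2,\theta')=\mathcal T^{\mathrm{Jax}}_{(\dot x_1,\dot x_2,\theta');\dot u}(\dot e)\,\mathtt{in}\,\mathtt{let}\,\dot z=\dot\otimes(\dot x_1,\dot x_2)\,\mathtt{in}\,\dot\otimes\theta$; - $\mathrm{dup}(\dot x)\mapsto\mathtt{let}\,\dot\otimes(\dot z,\dot w)=\dot u\,\mathtt{in}\,\dot z\dot+\dot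 w$; $\dot x\dot+\dot y\mapsto\mathrm{dup}(\dot u)$; $\dot0_\tau\mapsto\mathrm{drop}(\dot u)$; $\mathrm{drop}(\dot e)\mapsto\mathtt{let}\,\dot\otimes()=\dot u\,\mathtt{in}\,\dot0_{\otimes\theta}$; $x\dot*\dot y\mapsto x\dot*\dot u$. On $d$: $(e^p;\dot e)\mapsto(e^p;\mathcal T^{\mathrm{Jax}}_{\theta;\dot u}(\dot e))$; $\mathtt{let}\,x=e^p\,\mathtt{in}\,d\mapsto\mathtt{let}\,x=e^p\,\mathtt{in}\,\mathcal T^{\mathrm{Jax}}_{\theta;\dot u}(d)$; $\mathtt{let}\otimes()=z\,\mathtt{in}\,d\mapsto\mathtt{let}\otimes()=z\,\mathtt{in}\,\mathcal T^{\mathrm{Jax}}_{\theta;\dot u}(d)$. **Translation of types.** $\mathsf p(\mathbb R)=\mathbb R$, $\mathsf p(1)=1$, $\mathsf p(\tau\otimes\sigma)={!\mathsf p(\tau)}\otimes{!\mathsf p(\sigma)}$; $\mathsf t(\mathbb R)=\mathbb R$, $\mathsf t(1)=\top$, $\mathsf t(\tau\otimes\sigma)=\mathsf t(\tau)\&\mathsf t(\sigma)$. **Translation $\delta$.** For $\Gamma;\dot\Gamma\vdash e:(\tau;\sigma)$ and an enumeration $\theta$ of $\dot\Gamma=FV^t(e)$, $\delta_\theta(e)$ has type ${!\mathsf p(\tau)}\otimes\S((\&_{\dot y:\sigma'\in\theta}\mathsf t(\sigma'))\multimap\mathsf t(\sigma))$ in the environment $\{!x:{!\mathsf p(\tau')}\mid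 x:\tau'\in\Gamma\}$. Write $u_\theta=\langle u_{\dot y}\rangle_{\dot y\in\theta}$ for a tuple (pattern) of fresh variables $u_{\dot y}:\mathsf t(\sigma')$, for $\dot y:\sigma'$ in $\theta$. - $\delta_\theta((x;\dot y))=(!x,\S(\lambda u_\theta.u_{\dot y}))$; - $\delta_\theta(\mathtt{let}\,(x;\dot y)=e_1\,\mathtt{in}\,e_2)=\mathtt{let}\,(!x,\S f)=\delta_{\theta_1}(e_1)\,\mathtt{in}\,\mathtt{let}\,(!z,\S g)=\delta_{\dot y,\theta_2}(e_2)\,\mathtt{in}\,(!z,\S(\lambda u_\theta.\,g\langle f\,u_{\theta_1},u_{\dot w}\rangle_{\dot w\in\theta_2}))$, where $\theta_i=\theta\cap FV^t(e_i)$ and the argument of $g$ is the tuple with first component $f\,u_{\theta_1}$ followed by $u_{\dot w}$, $\dot w\in\theta_2$; - $\delta_\theta(\otimes())=\delta_\theta(\dot\otimes())=(!(),\S(\lambda y^\top.\langle\rangle))$; $\delta_\theta(\mathtt{let}\otimes()=z\,\mathtt{in}\,e)=\mathtt{let}\,()=z\,\mathtt{in}\,\delta_\theta(e)$; - $\delta_\theta(\mathtt{let}\,\dot\otimes()=\dot z\,\mathtt{in}\,e)=\mathtt{let}\,(!x,\S f)=\delta_{\theta\setminus\dot z}(e)\,\mathtt{in}\,(!x,\S(\lambda u_\theta.f\,u_{\theta\setminus\dot z}))$; - $\delta_\theta(\dot\otimes(\dot x_1,\dot x_2))=(!(),\S(\lambda u_\theta.\langle u_{\dot x_1},u_{\dot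 x_2}\rangle))$; - $\delta_\theta(\mathtt{let}\,\dot\otimes(\dot x_1,\dot x_2)=\dot z\,\mathtt{in}\,e)=\mathtt{let}\,(!x,\S f)=\delta_{\dot x_1,\dot x_2,\theta\setminus\dot z}(e)\,\mathtt{in}\,(!x,\S(\lambda u_\theta[\langle x_1,x_2\rangle/u_{\dot z}].\,f\langle x_1,x_2,u_{\dot w}\rangle_{\dot w\in\theta\setminus\dot z}))$, where $u_\theta[\langle x_1,x_2\rangle/u_{\dot z}]$ is $u_\theta$ with $u_{\dot z}$ replaced by $\langle x_1,x_2\rangle$; - $\delta_\theta(\underline r)=(!\underline r,\S(\lambda y^\top.\langle\rangle))$; $\delta_\theta(\underline f(x_1,\dots,x_n))=(\underline f(!x_1,\dots,!x_n),\S(\lambda y^\top.\langle\rangle))$; $\delta_\theta(\dot0_\sigma)=(!(),\S(\lambda y^\top.\underline0_{\mathsf t(\sigma)}))$; - for $\dot y_1,\dot y_2,\dot y:\tau$: $\delta_\theta(\dot y_1\dot+\dot y_2)=(!(),\S(\lambda u_\theta.\dot+_{\mathsf t(\tau)}\langle u_{\dot y_1},u_{\dot y_2}\rangle))$; $\delta_\theta(x\dot*\dot y)=(!(),\S(\lambda u_\theta.(\dot*_{\mathsf t(\tau)}x)u_{\dot y}))$; $\delta_\theta(\mathrm{dup}(\dot y))=(!(),\S(\lambda u_\theta.\langle u_{\dot y},u_{\dot y}\rangle))$; - $\delta_\theta(\mathrm{drop}(e))=\mathtt{let}\,(!x,\S f)=\delta_\theta(e)\,\mathtt{in}\,(!(),\S(\lambda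 y.\mathtt{let}\ z=f\,y\ \mathtt{in}\,\langle\rangle))$. **Fragments of $\lambda LL$** (containing all $\delta_\theta(e)$). Types $D,E::=\mathbb R\mid1\mid{!D}\otimes{!E}$ and $L,H::=\mathbb R\mid\top\mid L\& H$; variables $x,z$ have types $E$, variables $u$ types $L$, variables $f$ types $L\multimap H$; $p$ below ranges over patterns of types $L$ built from variables $u$ and $\langle\cdot,\cdot\rangle$. $P,Q::={!x}\mid{!\underline r}\mid{!()}\mid\underline f(!x_1,\dots,!x_n)\mid\mathtt{let}\,{!x}=Q\,\mathtt{in}\,P\mid\mathtt{let}\,()=z\,\mathtt{in}\,P$; $U::=u\mid\underline0\mid\langle\rangle\mid\langle U_1,U_2\rangle\mid FU$; $F,G::=f\mid\dot+\mid\dot*x\mid\lambda p.U\mid\mathtt{let}\,\S f=\S F\,\mathtt{in}\,G$; ($\lambda LL^{\mathtt A}$) $R,S::=(P,\S F)\mid\mathtt{let}\,(!x,\S f)=R\,\mathtt{in}\,S\mid\mathtt{let}\,\S f=\S F\,\mathtt{in}\,S\mid\mathtt{let}\,{!x}=P\,\mathtt{in}\,S\mid\mathtt{let}\,()=z\,\mathtt{in}\,S$; typed as $!\Sigma\vdash P:{!E}$; $!\Sigma,\S\Phi,p:L\vdash U:H$; $!\Sigma,\S\Phi\vdash F:L\multimap H$; $!\Sigma,\S\Phi\vdash R:{!E}\otimes\S(L\multimap H)$ ($!\Sigma$: patterns $!x:{!E}$; $\S\Phi$: patterns $\S f:\S(L\multimap H)$). **Transpose $\mathcal T$.** To each function variable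 $f:L\multimap H$ associate a variable $\overleftarrow f:H\multimap L$. A renaming $\alpha$ is a type-preserving bijection between finite sets of variables $\mathrm{Dom}(\alpha)$, $\mathrm{Cod}(\alpha)$; $\alpha[M]$ renames the free variables of $M$ (a term or pattern) in $\mathrm{Dom}(\alpha)$. For a pattern $p$: $\alpha\langle u\rangle=\alpha(u)$ if $u\in\mathrm{Dom}(\alpha)$; $\alpha\langle\langle p_1,p_2\rangle\rangle=\langle\alpha\langle p_1\rangle,\alpha\langle p_2\rangle\rangle$ if both $FV(p_i)$ meet $\mathrm{Dom}(\alpha)$, and $=\alpha\langle p_i\rangle$ if only $FV(p_i)$ does; $\alpha\langle p\rangle=t$, a fresh variable of type $\top$, if $FV(p)\cap\mathrm{Dom}(\alpha)=\emptyset$. For renamings $\alpha_1,\alpha_2$ with disjoint codomains and $p:L$: $\nu(p,\alpha_1,\alpha_2)=\underline0_L$ if $FV(p)\cap(\mathrm{Dom}(\alpha_1)\cup\mathrm{Dom}(\alpha_2))=\emptyset$; $\nu(u,\alpha_1,\alpha_2)=\dot+_L\langle\alpha_1(u),\alpha_2(u)\rangle$ if $u$ is in both domains, $=\alpha_i(u)$ if only in $\mathrm{Dom}(\alpha_i)$; otherwise $\nu(\langle p_1,p_2\rangle,\alpha_1,\alpha_2)=\langle\nu(p_1,\alpha_1,\alpha_2),\nu(p_2,\alpha_1,\alpha_2)\rangle$. On $U$ with $!\Sigma,\S\Phi,p:L\vdash U:H$, define $\mathcal T_p(U)$ together with a pattern $q_U:H$ (binding the input variables of $\mathcal T_p(U)$);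 write $\iota_{p,U}$ for the identity renaming on $FV(p)\cap FV(U)$; $\mathcal T_p(U)$ has the type of $\iota_{p,U}\langle p\rangle$: - $\mathcal T_p(u)=u$, $q_u=u$; $\mathcal T_p(\underline0)=\mathcal T_p(\langle\rangle)=\langle\rangle$, with $q$ a fresh variable; - $\mathcal T_p(FU')=(\lambda q_{U'}.\mathcal T_p(U'))(\mathcal T(F)\,v)$, $q=v$ a fresh variable; - $\mathcal T_p(\langle U_1,U_2\rangle)=\mathtt{let}\,\langle\alpha_1\langle p\rangle,\alpha_2\langle p\rangle\rangle=\langle\mathcal T_{\alpha_1[p]}(\alpha_1[U_1]),\mathcal T_{\alpha_2[p]}(\alpha_2[U_2])\rangle\,\mathtt{in}\,\nu(\iota_{p,\langle U_1,U_2\rangle}\langle p\rangle,\alpha_1,\alpha_2)$, where $\alpha_1,\alpha_2$ have disjoint fresh codomains and $\mathrm{Dom}(\alpha_i)=FV(U_i)\cap FV(p)$; $q=\langle q_{\alpha_1[U_1]},q_{\alpha_2[U_2]}\rangle$ (variables chosen disjoint). On $F$: $\mathcal T(\lambda p.U)=\lambda q_U.\mathtt{let}\,\iota_{p,U}\langle p\rangle=\mathcal T_p(U)\,\mathtt{in}\,\nu(p,\iota_{p,U},\emptyset)$; $\mathcal T(f)=\overleftarrow f$; $\mathcal T(\mathtt{let}\,\S f=\S F\,\mathtt{in}\,G)=\mathtt{let}\,\S\overleftarrow f=\S\mathcal T(F)\,\mathtt{in}\,\mathcal T(G)$ if $f\in FV(G)$, and $=\mathcal T(G)$ otherwise; $\mathcal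 T(\dot+)=\lambda u.\langle u,u\rangle$; $\mathcal T(\dot*x)=\dot*x$. On $\lambda LL^{\mathtt A}$: $\mathcal T((P,\S F))=(P,\S\mathcal T(F))$; $\mathcal T(\mathtt{let}\,(!x,\S f)=R\,\mathtt{in}\,S)=\mathtt{let}\,(!x,\S\overleftarrow f)=\mathcal T(R)\,\mathtt{in}\,\mathcal T(S)$ if $f\in FV(S)$, and $=\mathtt{let}\,{!x}=\epsilon[P]\,\mathtt{in}\,\mathcal T(S)$ with $\mathcal U^\bullet(R)=(\epsilon[\,],P,F)$ otherwise; $\mathcal T(\mathtt{let}\,{!x}=P\,\mathtt{in}\,S)=\mathtt{let}\,{!x}=P\,\mathtt{in}\,\mathcal T(S)$; $\mathcal T(\mathtt{let}\,()=z\,\mathtt{in}\,S)=\mathtt{let}\,()=z\,\mathtt{in}\,\mathcal T(S)$; $\mathcal T(\mathtt{let}\,\S f=\S F\,\mathtt{in}\,S)=\mathtt{let}\,\S\overleftarrow f=\S\mathcal T(F)\,\mathtt{in}\,\mathcal T(S)$ if $f\in FV(S)$, and $=\mathcal T(S)$ otherwise. Here $\mathcal U^\bullet$ is: $\mathcal U^\bullet((P,\S F))=([\,],P,F)$; and, with $\mathcal U^\bullet(S_i)=(\epsilon_i,P_i,F_i)$, $\mathcal U^\bullet(\mathtt{let}\,(!x,\S f)=S_1\,\mathtt{in}\,S_2)=(\epsilon_1[\mathtt{let}\,{!x}=P_1\,\mathtt{in}\,\epsilon_2],P_2,\mathtt{let}\,\S f=\S F_1\,\mathtt{in}\,F_2)$;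 $\mathcal U^\bullet(\mathtt{let}\,{!x}=P\,\mathtt{in}\,S_1)=(\mathtt{let}\,{!x}=P\,\mathtt{in}\,\epsilon_1,P_1,F_1)$; $\mathcal U^\bullet(\mathtt{let}\,()=z\,\mathtt{in}\,S_1)=(\mathtt{let}\,()=z\,\mathtt{in}\,\epsilon_1,P_1,F_1)$; $\mathcal U^\bullet(\mathtt{let}\,\S f=\S F\,\mathtt{in}\,S_1)=(\epsilon_1,P_1,\mathtt{let}\,\S f=\S F\,\mathtt{in}\,F_1)$. *)

theory Defs
  imports Complex_Main
begin

section \<open>The calculus \<open>\<lambda>LL\<close>\<close>

datatype ty =
    TReal
  | TLolli ty ty
  | TOne
  | TTensor ty ty
  | TTop
  | TWith ty ty
  | TBang ty

text \<open>A variable carries its type: two variables with the same name and different types are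
  different variables. The names \<open>Prim n\<close> and \<open>Tan n\<close> are those of the images of the primal and of
  the tangent variables of Linear A under the translation.\<close>

datatype name = Prim nat | Tan nat | Aux nat

datatype var = V (vname: name) (vty: ty)

datatype pat = PVar var | PBang var | PUnit | PTensor pat pat | PWith pat pat

primrec pvars :: "pat \<Rightarrow> var set" where
  "pvars (PVar x) = {x}"
| "pvars (PBang x) = {x}"
| "pvars PUnit = {}"
| "pvars (PTensor p q) = pvars p \<union> pvars q"
| "pvars (PWith p q) = pvars p \<union> pvars q"

primrec linear_pat :: "pat \<Rightarrow> bool" where
  "linear_pat (PVar x) = True"
| "linear_pat (PBang x) = True"
| "linear_pat PUnit = True"
| "linear_pat (PTensor p q) = (linear_pat p \<and> linear_pat q \<and> pvars p \<inter> pvars q = {})"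
| "linear_pat (PWith p q) = (linear_pat p \<and> linear_pat q \<and> pvars p \<inter> pvars q = {})"

primrec pat_ty :: "pat \<Rightarrow> ty" where
  "pat_ty (PVar x) = vty x"
| "pat_ty (PBang x) = TBang (vty x)"
| "pat_ty PUnit = TOne"
| "pat_ty (PTensor p q) = TTensor (pat_ty p) (pat_ty q)"
| "pat_ty (PWith p q) = TWith (pat_ty p) (pat_ty q)"

text \<open>\<open>'f\<close> is the type of function symbols. \<open>Unit\<close>, \<open>Tensor\<close> are the multiplicative pairs
  \<open>()\<close>, \<open>(M, N)\<close>, and \<open>Top\<close>, \<open>With\<close> the additive ones \<open>\<langle>\<rangle>\<close>, \<open>\<langle>M, N\<rangle>\<close>.\<close>

datatype 'f tm =
    Var var
  | Bang "'f tm"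
  | Lam pat "'f tm"
  | App "'f tm" "'f tm"
  | Unit
  | Tensor "'f tm" "'f tm"
  | Top
  | With "'f tm" "'f tm"
  | Num real
  | Fun 'f
  | Plus
  | Times

primrec fv :: "'f tm \<Rightarrow> var set" where
  "fv (Var x) = {x}"
| "fv (Bang M) = fv M"
| "fv (Lam p M) = fv M - pvars p"
| "fv (App M N) = fv M \<union> fv N"
| "fv Unit = {}"
| "fv (Tensor M N) = fv M \<union> fv N"
| "fv Top = {}"
| "fv (With M N) = fv M \<union> fv N"
| "fv (Num r) = {}"
| "fv (Fun f) = {}"
| "fv Plus = {}"
| "fv Times = {}"

primrec bv :: "'f tm \<Rightarrow> var set" where
  "bv (Var x) = {}"
| "bv (Bang M) = bv M"
| "bv (Lam p M) = pvars p \<union> bv M"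
| "bv (App M N) = bv M \<union> bv N"
| "bv Unit = {}"
| "bv (Tensor M N) = bv M \<union> bv N"
| "bv Top = {}"
| "bv (With M N) = bv M \<union> bv N"
| "bv (Num r) = {}"
| "bv (Fun f) = {}"
| "bv Plus = {}"
| "bv Times = {}"

primrec perm_pat :: "(var \<Rightarrow> var) \<Rightarrow> pat \<Rightarrow> pat" where
  "perm_pat \<pi> (PVar x) = PVar (\<pi> x)"
| "perm_pat \<pi> (PBang x) = PBang (\<pi> x)"
| "perm_pat \<pi> PUnit = PUnit"
| "perm_pat \<pi> (PTensor p q) = PTensor (perm_pat \<pi> p) (perm_pat \<pi> q)"
| "perm_pat \<pi> (PWith p q) = PWith (perm_pat \<pi> p) (perm_pat \<pi> q)"

text \<open>Renaming of all variables, bound ones included.\<close>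

primrec perm :: "(var \<Rightarrow> var) \<Rightarrow> 'f tm \<Rightarrow> 'f tm" where
  "perm \<pi> (Var x) = Var (\<pi> x)"
| "perm \<pi> (Bang M) = Bang (perm \<pi> M)"
| "perm \<pi> (Lam p M) = Lam (perm_pat \<pi> p) (perm \<pi> M)"
| "perm \<pi> (App M N) = App (perm \<pi> M) (perm \<pi> N)"
| "perm \<pi> Unit = Unit"
| "perm \<pi> (Tensor M N) = Tensor (perm \<pi> M) (perm \<pi> N)"
| "perm \<pi> Top = Top"
| "perm \<pi> (With M N) = With (perm \<pi> M) (perm \<pi> N)"
| "perm \<pi> (Num r) = Num r"
| "perm \<pi> (Fun f) = Fun f"
| "perm \<pi> Plus = Plus"
| "perm \<pi> Times = Times"

definition on_vars :: "var set \<Rightarrow> (var \<Rightarrow> 'f tm) \<Rightarrow> var \<Rightarrow> 'f tm" where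
  "on_vars X \<rho> = (\<lambda>x. if x \<in> X then \<rho> x else Var x)"

text \<open>Simultaneous substitution, without renaming of bound variables; it is only used where no
  free variable of a substituted term can be captured.\<close>

primrec subst :: "(var \<Rightarrow> 'f tm) \<Rightarrow> 'f tm \<Rightarrow> 'f tm" where
  "subst \<rho> (Var x) = \<rho> x"
| "subst \<rho> (Bang M) = Bang (subst \<rho> M)"
| "subst \<rho> (Lam p M) = Lam p (subst (on_vars (- pvars p) \<rho>) M)"
| "subst \<rho> (App M N) = App (subst \<rho> M) (subst \<rho> N)"
| "subst \<rho> Unit = Unit"
| "subst \<rho> (Tensor M N) = Tensor (subst \<rho> M) (subst \<rho> N)"
| "subst \<rho> Top = Top"
| "subst \<rho> (With M N) = With (subst \<rho> M) (subst \<rho> N)"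
| "subst \<rho> (Num r) = Num r"
| "subst \<rho> (Fun f) = Fun f"
| "subst \<rho> Plus = Plus"
| "subst \<rho> Times = Times"

text \<open>The values for a pattern \<open>p\<close> are the terms \<open>pat_val \<rho> p\<close>, and substituting
  \<open>pat_val \<rho> p\<close> for \<open>p\<close> in \<open>M\<close> is \<open>subst (on_vars (pvars p) \<rho>) M\<close>.\<close>

primrec pat_val :: "(var \<Rightarrow> 'f tm) \<Rightarrow> pat \<Rightarrow> 'f tm" where
  "pat_val \<rho> (PVar x) = \<rho> x"
| "pat_val \<rho> (PBang x) = Bang (\<rho> x)"
| "pat_val \<rho> PUnit = Unit"
| "pat_val \<rho> (PTensor p q) = Tensor (pat_val \<rho> p) (pat_val \<rho> q)"
| "pat_val \<rho> (PWith p q) = With (pat_val \<rho> p) (pat_val \<rho> q)"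

text \<open>Right-nested \<open>n\<close>-ary multiplicative tuples, for \<open>n \<ge> 1\<close>.\<close>

fun tensor_tm :: "'f tm list \<Rightarrow> 'f tm" where
  "tensor_tm [] = Unit"
| "tensor_tm [M] = M"
| "tensor_tm (M # Ms) = Tensor M (tensor_tm Ms)"

fun tensor_ty :: "ty list \<Rightarrow> ty" where
  "tensor_ty [] = TOne"
| "tensor_ty [A] = A"
| "tensor_ty (A # As) = TTensor A (tensor_ty As)"

subsection \<open>Typing\<close>

definition env_vars :: "pat set \<Rightarrow> var set" where
  "env_vars \<Gamma> = (\<Union>p\<in>\<Gamma>. pvars p)"

definition is_env :: "pat set \<Rightarrow> bool" where
  "is_env \<Gamma> \<longleftrightarrow> finite \<Gamma> \<and> (\<forall>p\<in>\<Gamma>. linear_pat p)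
     \<and> (\<forall>p\<in>\<Gamma>. \<forall>q\<in>\<Gamma>. p \<noteq> q \<longrightarrow> pvars p \<inter> pvars q = {})"

definition bang_env :: "pat set \<Rightarrow> bool" where
  "bang_env \<Gamma> \<longleftrightarrow> \<Gamma> \<subseteq> range PBang"

text \<open>The parameter \<open>ar\<close> gives the arities of the function symbols. The type of a pattern in an
  environment is determined by the types of its variables, so environments are sets of patterns.\<close>

inductive typed :: "('f \<Rightarrow> nat) \<Rightarrow> pat set \<Rightarrow> 'f tm \<Rightarrow> ty \<Rightarrow> bool"
  for ar :: "'f \<Rightarrow> nat" where
  var: "typed ar {PVar x} (Var x) (vty x)"
| dereliction: "typed ar {PBang x} (Var x) (vty x)"
| bang: "typed ar \<Gamma> M A \<Longrightarrow> bang_env \<Gamma> \<Longrightarrow> typed ar \<Gamma> (Bang M) (TBang A)"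
| weakening: "typed ar \<Delta> M B \<Longrightarrow> x \<notin> env_vars \<Delta> \<Longrightarrow> typed ar (insert (PBang x) \<Delta>) M B"
| lam: "typed ar (insert p \<Delta>) M B \<Longrightarrow> linear_pat p \<Longrightarrow> pvars p \<inter> env_vars \<Delta> = {}
    \<Longrightarrow> typed ar \<Delta> (Lam p M) (TLolli (pat_ty p) B)"
| app: "typed ar (\<Gamma>1 \<union> \<Delta>1) M (TLolli A B) \<Longrightarrow> typed ar (\<Gamma>2 \<union> \<Delta>2) N A
    \<Longrightarrow> bang_env \<Gamma>1 \<Longrightarrow> bang_env \<Gamma>2
    \<Longrightarrow> env_vars \<Delta>1 \<inter> env_vars \<Delta>2 = {}
    \<Longrightarrow> env_vars (\<Gamma>1 \<union> \<Gamma>2) \<inter> env_vars (\<Delta>1 \<union> \<Delta>2) = {}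
    \<Longrightarrow> typed ar (\<Gamma>1 \<union> \<Gamma>2 \<union> \<Delta>1 \<union> \<Delta>2) (App M N) B"
| tensor: "typed ar (\<Gamma>1 \<union> \<Delta>1) M A \<Longrightarrow> typed ar (\<Gamma>2 \<union> \<Delta>2) N B
    \<Longrightarrow> bang_env \<Gamma>1 \<Longrightarrow> bang_env \<Gamma>2
    \<Longrightarrow> env_vars \<Delta>1 \<inter> env_vars \<Delta>2 = {}
    \<Longrightarrow> env_vars (\<Gamma>1 \<union> \<Gamma>2) \<inter> env_vars (\<Delta>1 \<union> \<Delta>2) = {}
    \<Longrightarrow> typed ar (\<Gamma>1 \<union> \<Gamma>2 \<union> \<Delta>1 \<union> \<Delta>2) (Tensor M N) (TTensor A B)"
| unit: "typed ar {} Unit TOne"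
| unit_pat: "typed ar \<Delta> M B \<Longrightarrow> typed ar (insert PUnit \<Delta>) M B"
| tensor_pat: "typed ar (insert p (insert q \<Delta>)) M C
    \<Longrightarrow> linear_pat (PTensor p q) \<Longrightarrow> pvars (PTensor p q) \<inter> env_vars \<Delta> = {}
    \<Longrightarrow> typed ar (insert (PTensor p q) \<Delta>) M C"
| with_: "typed ar \<Delta> M A \<Longrightarrow> typed ar \<Delta> N B \<Longrightarrow> typed ar \<Delta> (With M N) (TWith A B)"
| with_pat1: "typed ar (insert p \<Delta>) M C
    \<Longrightarrow> linear_pat (PWith p q) \<Longrightarrow> pvars (PWith p q) \<inter> env_vars \<Delta> = {}
    \<Longrightarrow> typed ar (insert (PWith p q) \<Delta>) M C"
| with_pat2: "typed ar (insert q \<Delta>) M C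
    \<Longrightarrow> linear_pat (PWith p q) \<Longrightarrow> pvars (PWith p q) \<inter> env_vars \<Delta> = {}
    \<Longrightarrow> typed ar (insert (PWith p q) \<Delta>) M C"
| top: "is_env \<Delta> \<Longrightarrow> typed ar \<Delta> Top TTop"
| num: "typed ar {} (Num r) TReal"
| zero: "is_env \<Delta> \<Longrightarrow> typed ar \<Delta> (Num 0) TReal"
| fun_: "typed ar {} (Fun f) (TLolli (tensor_ty (replicate (ar f) (TBang TReal))) (TBang TReal))"
| plus: "typed ar {} Plus (TLolli (TWith TReal TReal) TReal)"
| times: "typed ar {} Times (TLolli TReal (TLolli TReal TReal))"

subsection \<open>Reduction\<close>

text \<open>The parameter \<open>den\<close> interprets the function symbols, a point of \<open>\<real>\<^sup>n\<close> being a list of length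
  \<open>n\<close>. Terms are considered up to renaming of bound variables: such a renaming counts as a
  reduction step (rule \<open>alpha\<close>), and \<open>beta\<close> applies once bound variables have been renamed so as to
  avoid capture.\<close>

inductive red :: "('f \<Rightarrow> nat) \<Rightarrow> ('f \<Rightarrow> real list \<Rightarrow> real) \<Rightarrow> 'f tm \<Rightarrow> 'f tm \<Rightarrow> bool"
  for ar :: "'f \<Rightarrow> nat" and den :: "'f \<Rightarrow> real list \<Rightarrow> real" where
  alpha: "bij \<pi> \<Longrightarrow> (\<And>x. vty (\<pi> x) = vty x) \<Longrightarrow> (\<And>x. x \<in> fv (Lam p M) \<Longrightarrow> \<pi> x = x)
    \<Longrightarrow> red ar den (Lam p M) (perm \<pi> (Lam p M))"
| beta: "linear_pat p \<Longrightarrow> (\<Union>x\<in>pvars p. fv (\<rho> x)) \<inter> bv M = {}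
    \<Longrightarrow> red ar den (App (Lam p M) (pat_val \<rho> p)) (subst (on_vars (pvars p) \<rho>) M)"
| fun_: "length rs = ar f
    \<Longrightarrow> red ar den (App (Fun f) (tensor_tm (map (\<lambda>r. Bang (Num r)) rs))) (Bang (Num (den f rs)))"
| plus: "red ar den (App Plus (With (Num r) (Num s))) (Num (r + s))"
| times: "red ar den (App (App Times (Num r)) (Num s)) (Num (r * s))"
| bang: "red ar den M M' \<Longrightarrow> red ar den (Bang M) (Bang M')"
| lam: "red ar den M M' \<Longrightarrow> red ar den (Lam p M) (Lam p M')"
| app1: "red ar den M M' \<Longrightarrow> red ar den (App M N) (App M' N)"
| app2: "red ar den N N' \<Longrightarrow> red ar den (App M N) (App M N')"
| tensor1: "red ar den M M' \<Longrightarrow> red ar den (Tensor M N) (Tensor M' N)"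
| tensor2: "red ar den N N' \<Longrightarrow> red ar den (Tensor M N) (Tensor M N')"
| with1: "red ar den M M' \<Longrightarrow> red ar den (With M N) (With M' N)"
| with2: "red ar den N N' \<Longrightarrow> red ar den (With M N) (With M N')"

abbreviation reds :: "('f \<Rightarrow> nat) \<Rightarrow> ('f \<Rightarrow> real list \<Rightarrow> real) \<Rightarrow> 'f tm \<Rightarrow> 'f tm \<Rightarrow> bool" where
  "reds ar den \<equiv> (red ar den)\<^sup>*\<^sup>*"

abbreviation beta_eq :: "('f \<Rightarrow> nat) \<Rightarrow> ('f \<Rightarrow> real list \<Rightarrow> real) \<Rightarrow> 'f tm \<Rightarrow> 'f tm \<Rightarrow> bool" where
  "beta_eq ar den \<equiv> equivclp (red ar den)"

text \<open>Differentiability of a function \<open>\<real>\<^sup>n \<rightarrow> \<real>\<close> at every point, for points given as lists of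
  length \<open>n\<close>; \<open>g\<close> is the gradient at \<open>x\<close>.\<close>

definition vec_norm :: "real list \<Rightarrow> real" where
  "vec_norm h = sqrt (\<Sum>i<length h. (h ! i)\<^sup>2)"

definition differentiable_fun :: "nat \<Rightarrow> (real list \<Rightarrow> real) \<Rightarrow> bool" where
  "differentiable_fun n F \<longleftrightarrow>
     (\<forall>x. length x = n \<longrightarrow> (\<exists>g. length g = n \<and>
        (\<forall>\<epsilon>>0. \<exists>\<delta>>0. \<forall>h. length h = n \<and> vec_norm h < \<delta> \<longrightarrow>
           \<bar>F (map2 (+) x h) - F x - (\<Sum>i<n. g ! i * h ! i)\<bar> \<le> \<epsilon> * vec_norm h)))"

subsection \<open>Logical equivalence\<close>

definition proj1 :: "ty \<Rightarrow> ty \<Rightarrow> 'f tm" where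
  "proj1 A B = Lam (PWith (PVar (V (Aux 0) A)) (PVar (V (Aux 1) B))) (Var (V (Aux 0) A))"

definition proj2 :: "ty \<Rightarrow> ty \<Rightarrow> 'f tm" where
  "proj2 A B = Lam (PWith (PVar (V (Aux 0) A)) (PVar (V (Aux 1) B))) (Var (V (Aux 1) B))"

primrec log_rel ::
  "('f \<Rightarrow> nat) \<Rightarrow> ('f \<Rightarrow> real list \<Rightarrow> real) \<Rightarrow> ty \<Rightarrow> 'f tm \<Rightarrow> 'f tm \<Rightarrow> bool" where
  "log_rel ar den TReal M N = beta_eq ar den M N"
| "log_rel ar den TOne M N = beta_eq ar den M N"
| "log_rel ar den (TTensor A B) M N =
     (\<exists>M1 M2 N1 N2. reds ar den M (Tensor M1 M2) \<and> reds ar den N (Tensor N1 N2)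
        \<and> log_rel ar den A M1 N1 \<and> log_rel ar den B M2 N2)"
| "log_rel ar den (TBang A) M N =
     (\<exists>M' N'. reds ar den M (Bang M') \<and> reds ar den N (Bang N') \<and> log_rel ar den A M' N')"
| "log_rel ar den TTop M N = True"
| "log_rel ar den (TWith A B) M N =
     (log_rel ar den A (App (proj1 A B) M) (App (proj1 A B) N)
      \<and> log_rel ar den B (App (proj2 A B) M) (App (proj2 A B) N))"
| "log_rel ar den (TLolli A B) M N =
     (\<forall>M' N'. typed ar {} M' A \<longrightarrow> typed ar {} N' A \<longrightarrow> log_rel ar den A M' N'
        \<longrightarrow> log_rel ar den B (App M M') (App N N'))"

text \<open>The families of closed values for the patterns of \<open>\<Gamma>\<close> are the families
  \<open>(pat_val \<rho> p)\<^sub>p\<close>.\<close>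

definition log_eq ::
  "('f \<Rightarrow> nat) \<Rightarrow> ('f \<Rightarrow> real list \<Rightarrow> real) \<Rightarrow> pat set \<Rightarrow> ty \<Rightarrow> 'f tm \<Rightarrow> 'f tm \<Rightarrow> bool" where
  "log_eq ar den \<Gamma> A M N \<longleftrightarrow> typed ar \<Gamma> M A \<and> typed ar \<Gamma> N A
     \<and> (\<forall>\<rho> \<rho>'. (\<forall>p\<in>\<Gamma>. typed ar {} (pat_val \<rho> p) (pat_ty p) \<and> typed ar {} (pat_val \<rho>' p) (pat_ty p)
             \<and> log_rel ar den (pat_ty p) (pat_val \<rho> p) (pat_val \<rho>' p))
        \<longrightarrow> log_rel ar den A (subst (on_vars (env_vars \<Gamma>) \<rho>) M)
                           (subst (on_vars (env_vars \<Gamma>) \<rho>') N))"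

section \<open>The fragments of \<open>\<lambda>LL\<close>\<close>

text \<open>The syntactic classes \<open>P\<close>, \<open>U\<close>, \<open>F\<close> and \<open>R\<close> (the last one being \<open>\<lambda>LL\<^sup>A\<close>) have a syntax of their
  own, and are read as \<open>\<lambda>LL\<close> terms by \<open>tm_of_P\<close>, \<open>tm_of_U\<close>, \<open>tm_of_F\<close> and \<open>tm_of_R\<close>. \<open>lpat\<close> is the
  class of the patterns built from variables and additive pairs.\<close>

datatype lpat = LVar var | LPair lpat lpat

primrec pat_of :: "lpat \<Rightarrow> pat" where
  "pat_of (LVar u) = PVar u"
| "pat_of (LPair p q) = PWith (pat_of p) (pat_of q)"

abbreviation lvars :: "lpat \<Rightarrow> var set" where
  "lvars p \<equiv> pvars (pat_of p)"

abbreviation lpat_ty :: "lpat \<Rightarrow> ty" where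
  "lpat_ty p \<equiv> pat_ty (pat_of p)"

datatype 'f P_tm =
    PVal var                      \<comment> \<open>\<open>!x\<close>\<close>
  | PNum real                     \<comment> \<open>\<open>!r\<close>\<close>
  | POne                          \<comment> \<open>\<open>!()\<close>\<close>
  | PFun 'f "var list"            \<comment> \<open>\<open>f (!x\<^sub>1, \<dots>, !x\<^sub>n)\<close>\<close>
  | PLet var "'f P_tm" "'f P_tm"  \<comment> \<open>\<open>let !x = Q in P\<close>\<close>
  | PLetOne var "'f P_tm"         \<comment> \<open>\<open>let () = z in P\<close>\<close>

datatype U_tm =
    UVar var
  | UZero
  | UTop
  | UPair U_tm U_tm
  | UApp F_tm U_tm
and F_tm =
    FVar var
  | FPlus
  | FTimes var                    \<comment> \<open>the product with \<open>x\<close>\<close>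
  | FLam lpat U_tm
  | FLet var F_tm F_tm            \<comment> \<open>\<open>let \<section>f = \<section>F in G\<close>\<close>

datatype 'f R_tm =
    RPair "'f P_tm" F_tm                \<comment> \<open>\<open>(P, \<section>F)\<close>\<close>
  | RLet var var "'f R_tm" "'f R_tm"    \<comment> \<open>\<open>let (!x, \<section>f) = R in S\<close>\<close>
  | RLetF var F_tm "'f R_tm"            \<comment> \<open>\<open>let \<section>f = \<section>F in S\<close>\<close>
  | RLetP var "'f P_tm" "'f R_tm"       \<comment> \<open>\<open>let !x = P in S\<close>\<close>
  | RLetOne var "'f R_tm"               \<comment> \<open>\<open>let () = z in S\<close>\<close>

abbreviation Let_tm :: "pat \<Rightarrow> 'f tm \<Rightarrow> 'f tm \<Rightarrow> 'f tm" where
  "Let_tm p N M \<equiv> App (Lam p M) N"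

abbreviation sec_ty :: "ty \<Rightarrow> ty" where
  "sec_ty A \<equiv> TWith TOne A"

abbreviation sec_pat :: "pat \<Rightarrow> pat" where
  "sec_pat p \<equiv> PWith PUnit p"

abbreviation sec_tm :: "'f tm \<Rightarrow> 'f tm" where
  "sec_tm M \<equiv> With Unit M"

primrec tm_of_P :: "'f P_tm \<Rightarrow> 'f tm" where
  "tm_of_P (PVal x) = Bang (Var x)"
| "tm_of_P (PNum r) = Bang (Num r)"
| "tm_of_P POne = Bang Unit"
| "tm_of_P (PFun f xs) = App (Fun f) (tensor_tm (map (\<lambda>x. Bang (Var x)) xs))"
| "tm_of_P (PLet x Q P) = Let_tm (PBang x) (tm_of_P Q) (tm_of_P P)"
| "tm_of_P (PLetOne z P) = Let_tm PUnit (Var z) (tm_of_P P)"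

primrec tm_of_U :: "U_tm \<Rightarrow> 'f tm" and tm_of_F :: "F_tm \<Rightarrow> 'f tm" where
  "tm_of_U (UVar u) = Var u"
| "tm_of_U UZero = Num 0"
| "tm_of_U UTop = Top"
| "tm_of_U (UPair U1 U2) = With (tm_of_U U1) (tm_of_U U2)"
| "tm_of_U (UApp F U) = App (tm_of_F F) (tm_of_U U)"
| "tm_of_F (FVar f) = Var f"
| "tm_of_F FPlus = Plus"
| "tm_of_F (FTimes x) = App Times (Var x)"
| "tm_of_F (FLam p U) = Lam (pat_of p) (tm_of_U U)"
| "tm_of_F (FLet f F G) = Let_tm (sec_pat (PVar f)) (sec_tm (tm_of_F F)) (tm_of_F G)"

primrec tm_of_R :: "'f R_tm \<Rightarrow> 'f tm" where
  "tm_of_R (RPair P F) = Tensor (tm_of_P P) (sec_tm (tm_of_F F))"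
| "tm_of_R (RLet x f R S) =
     Let_tm (PTensor (PBang x) (sec_pat (PVar f))) (tm_of_R R) (tm_of_R S)"
| "tm_of_R (RLetF f F S) = Let_tm (sec_pat (PVar f)) (sec_tm (tm_of_F F)) (tm_of_R S)"
| "tm_of_R (RLetP x P S) = Let_tm (PBang x) (tm_of_P P) (tm_of_R S)"
| "tm_of_R (RLetOne z S) = Let_tm PUnit (Var z) (tm_of_R S)"

text \<open>\<open>ULet p N M\<close> is \<open>let p = N in M\<close>.\<close>

abbreviation ULet :: "lpat \<Rightarrow> U_tm \<Rightarrow> U_tm \<Rightarrow> U_tm" where
  "ULet p N M \<equiv> UApp (FLam p M) N"

primrec fvU :: "U_tm \<Rightarrow> var set" and fvF :: "F_tm \<Rightarrow> var set" where
  "fvU (UVar u) = {u}"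
| "fvU UZero = {}"
| "fvU UTop = {}"
| "fvU (UPair U1 U2) = fvU U1 \<union> fvU U2"
| "fvU (UApp F U) = fvF F \<union> fvU U"
| "fvF (FVar f) = {f}"
| "fvF FPlus = {}"
| "fvF (FTimes x) = {x}"
| "fvF (FLam p U) = fvU U - lvars p"
| "fvF (FLet f F G) = fvF F \<union> (fvF G - {f})"

primrec fvP :: "'f P_tm \<Rightarrow> var set" where
  "fvP (PVal x) = {x}"
| "fvP (PNum r) = {}"
| "fvP POne = {}"
| "fvP (PFun f xs) = set xs"
| "fvP (PLet x Q P) = fvP Q \<union> (fvP P - {x})"
| "fvP (PLetOne z P) = insert z (fvP P)"

primrec fvR :: "'f R_tm \<Rightarrow> var set" where
  "fvR (RPair P F) = fvP P \<union> fvF F"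
| "fvR (RLet x f R S) = fvR R \<union> (fvR S - {x, f})"
| "fvR (RLetF f F S) = fvF F \<union> (fvR S - {f})"
| "fvR (RLetP x P S) = fvP P \<union> (fvR S - {x})"
| "fvR (RLetOne z S) = insert z (fvR S)"

text \<open>All variables occurring in a term, free or bound.\<close>

primrec varsU :: "U_tm \<Rightarrow> var set" and varsF :: "F_tm \<Rightarrow> var set" where
  "varsU (UVar u) = {u}"
| "varsU UZero = {}"
| "varsU UTop = {}"
| "varsU (UPair U1 U2) = varsU U1 \<union> varsU U2"
| "varsU (UApp F U) = varsF F \<union> varsU U"
| "varsF (FVar f) = {f}"
| "varsF FPlus = {}"
| "varsF (FTimes x) = {x}"
| "varsF (FLam p U) = lvars p \<union> varsU U"
| "varsF (FLet f F G) = insert f (varsF F \<union> varsF G)"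

primrec varsP :: "'f P_tm \<Rightarrow> var set" where
  "varsP (PVal x) = {x}"
| "varsP (PNum r) = {}"
| "varsP POne = {}"
| "varsP (PFun f xs) = set xs"
| "varsP (PLet x Q P) = insert x (varsP Q \<union> varsP P)"
| "varsP (PLetOne z P) = insert z (varsP P)"

primrec varsR :: "'f R_tm \<Rightarrow> var set" where
  "varsR (RPair P F) = varsP P \<union> varsF F"
| "varsR (RLet x f R S) = {x, f} \<union> varsR R \<union> varsR S"
| "varsR (RLetF f F S) = insert f (varsF F \<union> varsR S)"
| "varsR (RLetP x P S) = insert x (varsP P \<union> varsR S)"
| "varsR (RLetOne z S) = insert z (varsR S)"

fun dom_ty :: "ty \<Rightarrow> ty" where
  "dom_ty (TLolli A B) = A"

fun cod_ty :: "ty \<Rightarrow> ty" where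
  "cod_ty (TLolli A B) = B"

text \<open>The type of \<open>U\<close>, and the codomain \<open>H\<close> of the type \<open>L \<multimap> H\<close> of \<open>F\<close>.\<close>

primrec tyU :: "U_tm \<Rightarrow> ty" and codF :: "F_tm \<Rightarrow> ty" where
  "tyU (UVar u) = vty u"
| "tyU UZero = TReal"
| "tyU UTop = TTop"
| "tyU (UPair U1 U2) = TWith (tyU U1) (tyU U2)"
| "tyU (UApp F U) = codF F"
| "codF (FVar f) = cod_ty (vty f)"
| "codF FPlus = TReal"
| "codF (FTimes x) = TReal"
| "codF (FLam p U) = tyU U"
| "codF (FLet f F G) = codF G"

subsection \<open>Zero, sum and product at the types built from \<open>\<real>\<close>, \<open>\<top>\<close> and \<open>&\<close>\<close>

text \<open>Some variable of type \<open>A\<close> outside \<open>X\<close>; there is one when \<open>X\<close> is finite.\<close>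

definition fresh :: "var set \<Rightarrow> ty \<Rightarrow> var" where
  "fresh X A = (SOME x. vty x = A \<and> x \<notin> X)"

fun zeroU :: "ty \<Rightarrow> U_tm" where
  "zeroU TReal = UZero"
| "zeroU TTop = UTop"
| "zeroU (TWith H K) = UPair (zeroU H) (zeroU K)"

fun plusF :: "ty \<Rightarrow> F_tm" where
  "plusF TReal = FPlus"
| "plusF TTop = FLam (LPair (LVar (V (Aux 0) TTop)) (LVar (V (Aux 1) TTop))) UTop"
| "plusF (TWith H K) =
     (let h = V (Aux 0) H; k = V (Aux 1) K; h' = V (Aux 2) H; k' = V (Aux 3) K in
      FLam (LPair (LPair (LVar h) (LVar k)) (LPair (LVar h') (LVar k')))
        (UPair (UApp (plusF H) (UPair (UVar h) (UVar h')))
               (UApp (plusF K) (UPair (UVar k) (UVar k')))))"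

fun timesF :: "ty \<Rightarrow> var \<Rightarrow> F_tm" where
  "timesF TReal x = FTimes x"
| "timesF TTop x = FLam (LVar (fresh {x} TTop)) UTop"
| "timesF (TWith H K) x =
     (let h = fresh {x} H; k = fresh {x, h} K in
      FLam (LPair (LVar h) (LVar k))
        (UPair (UApp (timesF H x) (UVar h)) (UApp (timesF K x) (UVar k))))"

subsection \<open>Renamings\<close>

text \<open>A renaming is an injective partial map with finite domain. \<open>renU\<close>, \<open>renF\<close>, \<open>renP\<close>, \<open>renR\<close>
  rename the free variables; the codomain has to avoid the variables of the term.\<close>

definition ren :: "(var \<rightharpoonup> var) \<Rightarrow> var \<Rightarrow> var" where
  "ren \<alpha> x = (case \<alpha> x of None \<Rightarrow> x | Some y \<Rightarrow> y)"

primrec ren_lpat :: "(var \<rightharpoonup> var) \<Rightarrow> lpat \<Rightarrow> lpat" where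
  "ren_lpat \<alpha> (LVar u) = LVar (ren \<alpha> u)"
| "ren_lpat \<alpha> (LPair p q) = LPair (ren_lpat \<alpha> p) (ren_lpat \<alpha> q)"

primrec renU :: "(var \<rightharpoonup> var) \<Rightarrow> U_tm \<Rightarrow> U_tm" and renF :: "(var \<rightharpoonup> var) \<Rightarrow> F_tm \<Rightarrow> F_tm" where
  "renU \<alpha> (UVar u) = UVar (ren \<alpha> u)"
| "renU \<alpha> UZero = UZero"
| "renU \<alpha> UTop = UTop"
| "renU \<alpha> (UPair U1 U2) = UPair (renU \<alpha> U1) (renU \<alpha> U2)"
| "renU \<alpha> (UApp F U) = UApp (renF \<alpha> F) (renU \<alpha> U)"
| "renF \<alpha> (FVar f) = FVar (ren \<alpha> f)"
| "renF \<alpha> FPlus = FPlus"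
| "renF \<alpha> (FTimes x) = FTimes (ren \<alpha> x)"
| "renF \<alpha> (FLam p U) = FLam p (renU (\<alpha> |` (- lvars p)) U)"
| "renF \<alpha> (FLet f F G) = FLet f (renF \<alpha> F) (renF (\<alpha>(f := None)) G)"

primrec renP :: "(var \<rightharpoonup> var) \<Rightarrow> 'f P_tm \<Rightarrow> 'f P_tm" where
  "renP \<alpha> (PVal x) = PVal (ren \<alpha> x)"
| "renP \<alpha> (PNum r) = PNum r"
| "renP \<alpha> POne = POne"
| "renP \<alpha> (PFun f xs) = PFun f (map (ren \<alpha>) xs)"
| "renP \<alpha> (PLet x Q P) = PLet x (renP \<alpha> Q) (renP (\<alpha>(x := None)) P)"
| "renP \<alpha> (PLetOne z P) = PLetOne (ren \<alpha> z) (renP \<alpha> P)"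

primrec renR :: "(var \<rightharpoonup> var) \<Rightarrow> 'f R_tm \<Rightarrow> 'f R_tm" where
  "renR \<alpha> (RPair P F) = RPair (renP \<alpha> P) (renF \<alpha> F)"
| "renR \<alpha> (RLet x f R S) = RLet x f (renR \<alpha> R) (renR (\<alpha>(x := None, f := None)) S)"
| "renR \<alpha> (RLetF f F S) = RLetF f (renF \<alpha> F) (renR (\<alpha>(f := None)) S)"
| "renR \<alpha> (RLetP x P S) = RLetP x (renP \<alpha> P) (renR (\<alpha>(x := None)) S)"
| "renR \<alpha> (RLetOne z S) = RLetOne (ren \<alpha> z) (renR \<alpha> S)"

lemma size_ren [simp]: "size (renU \<alpha> U) = size U" "size (renF \<alpha> F) = size F"
  by (induction U and F arbitrary: \<alpha> and \<alpha>) auto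

lemma size_renP [simp]: "size (renP \<alpha> P) = size P"
  by (induction P arbitrary: \<alpha>) auto

lemma size_renR [simp]: "size (renR \<alpha> R) = size R"
  by (induction R arbitrary: \<alpha>) auto

text \<open>Some renaming with domain \<open>S\<close> whose codomain avoids \<open>X\<close>; there is one when \<open>S\<close> and \<open>X\<close> are
  finite.\<close>

definition fresh_ren :: "var set \<Rightarrow> var set \<Rightarrow> (var \<rightharpoonup> var)" where
  "fresh_ren X S = (SOME \<alpha>. dom \<alpha> = S \<and> inj_on \<alpha> S \<and> ran \<alpha> \<inter> X = {}
      \<and> (\<forall>x y. \<alpha> x = Some y \<longrightarrow> vty y = vty x))"

definition id_ren :: "var set \<Rightarrow> (var \<rightharpoonup> var)" where
  "id_ren S = Some |` S"

text \<open>\<open>restr_lpat t \<alpha> p\<close> is \<open>\<alpha>\<langle>p\<rangle>\<close>, with \<open>t\<close> the fresh variable of type \<open>\<top>\<close> used when \<open>p\<close> does not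
  meet the domain of \<open>\<alpha>\<close>.\<close>

fun restr_lpat :: "var \<Rightarrow> (var \<rightharpoonup> var) \<Rightarrow> lpat \<Rightarrow> lpat" where
  "restr_lpat t \<alpha> (LVar u) = (case \<alpha> u of Some v \<Rightarrow> LVar v | None \<Rightarrow> LVar t)"
| "restr_lpat t \<alpha> (LPair p1 p2) =
     (if lvars p1 \<inter> dom \<alpha> \<noteq> {} then
        if lvars p2 \<inter> dom \<alpha> \<noteq> {} then LPair (restr_lpat t \<alpha> p1) (restr_lpat t \<alpha> p2)
        else restr_lpat t \<alpha> p1
      else if lvars p2 \<inter> dom \<alpha> \<noteq> {} then restr_lpat t \<alpha> p2
      else LVar t)"

fun nu :: "lpat \<Rightarrow> (var \<rightharpoonup> var) \<Rightarrow> (var \<rightharpoonup> var) \<Rightarrow> U_tm" where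
  "nu (LVar u) \<alpha>1 \<alpha>2 =
     (case (\<alpha>1 u, \<alpha>2 u) of
        (None, None) \<Rightarrow> zeroU (vty u)
      | (Some v, None) \<Rightarrow> UVar v
      | (None, Some w) \<Rightarrow> UVar w
      | (Some v, Some w) \<Rightarrow> UApp (plusF (vty u)) (UPair (UVar v) (UVar w)))"
| "nu (LPair p1 p2) \<alpha>1 \<alpha>2 =
     (if lvars (LPair p1 p2) \<inter> (dom \<alpha>1 \<union> dom \<alpha>2) = {} then zeroU (lpat_ty (LPair p1 p2))
      else UPair (nu p1 \<alpha>1 \<alpha>2) (nu p2 \<alpha>1 \<alpha>2))"

section \<open>The transpose\<close>

text \<open>The variable associated with \<open>f : L \<multimap> H\<close> is the variable of type \<open>H \<multimap> L\<close> with the same name;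
  this is injective on function variables.\<close>

definition flip_var :: "var \<Rightarrow> var" where
  "flip_var f = V (vname f) (TLolli (cod_ty (vty f)) (dom_ty (vty f)))"

text \<open>\<open>trU X p U\<close> is the pair of \<open>\<T>\<^sub>p(U)\<close> and of the pattern \<open>q\<^sub>U\<close>. The fresh variables are chosen
  outside \<open>p\<close>, \<open>U\<close> and the set \<open>X\<close>, which serves to keep the variables of the patterns of the two
  components of a pair disjoint.\<close>

function (sequential) trU :: "var set \<Rightarrow> lpat \<Rightarrow> U_tm \<Rightarrow> U_tm \<times> lpat" and trF :: "F_tm \<Rightarrow> F_tm" where
  "trU X p (UVar u) = (UVar u, LVar u)"
| "trU X p UZero = (UTop, LVar (fresh (X \<union> lvars p) TReal))"
| "trU X p UTop = (UTop, LVar (fresh (X \<union> lvars p) TTop))"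
| "trU X p (UApp F U) =
     (let v = fresh (X \<union> lvars p \<union> varsU (UApp F U)) (codF F);
          (T, q) = trU (X \<union> varsF F) p U
      in (UApp (FLam q T) (UApp (trF F) (UVar v)), LVar v))"
| "trU X p (UPair U1 U2) =
     (let X0 = X \<union> lvars p \<union> varsU (UPair U1 U2);
          \<alpha>1 = fresh_ren X0 (fvU U1 \<inter> lvars p);
          \<alpha>2 = fresh_ren (X0 \<union> ran \<alpha>1) (fvU U2 \<inter> lvars p);
          X1 = X0 \<union> ran \<alpha>1 \<union> ran \<alpha>2;
          t = fresh X1 TTop;
          t1 = fresh X1 TTop;
          t2 = fresh (insert t1 X1) TTop;
          \<iota> = id_ren (lvars p \<inter> fvU (UPair U1 U2));
          (T1, q1) = trU X1 (ren_lpat \<alpha>1 p) (renU \<alpha>1 U1);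
          (T2, q2) = trU (X1 \<union> lvars q1) (ren_lpat \<alpha>2 p) (renU \<alpha>2 U2)
      in (ULet (LPair (restr_lpat t1 \<alpha>1 p) (restr_lpat t2 \<alpha>2 p)) (UPair T1 T2)
            (nu (restr_lpat t \<iota> p) \<alpha>1 \<alpha>2),
          LPair q1 q2))"
| "trF (FLam p U) =
     (let (T, q) = trU {} p U;
          t = fresh (lvars p \<union> varsU U) TTop;
          \<iota> = id_ren (lvars p \<inter> fvU U)
      in FLam q (ULet (restr_lpat t \<iota> p) T (nu p \<iota> Map.empty)))"
| "trF (FVar f) = FVar (flip_var f)"
| "trF (FLet f F G) = (if f \<in> fvF G then FLet (flip_var f) (trF F) (trF G) else trF G)"
| "trF FPlus = (let u = V (Aux 0) TReal in FLam (LVar u) (UPair (UVar u) (UVar u)))"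
| "trF (FTimes x) = FTimes x"
  by pat_completeness auto
termination
  by (relation "measure (\<lambda>s. case s of Inl (X, p, U) \<Rightarrow> size U | Inr F \<Rightarrow> size F)") auto

text \<open>Contexts \<open>\<epsilon>[ ]\<close> are lists of bindings, outermost first.\<close>

datatype 'f binding = BindP var "'f P_tm" | BindOne var

primrec fill :: "'f binding list \<Rightarrow> 'f P_tm \<Rightarrow> 'f P_tm" where
  "fill [] P = P"
| "fill (b # \<epsilon>) P =
     (case b of BindP x Q \<Rightarrow> PLet x Q (fill \<epsilon> P) | BindOne z \<Rightarrow> PLetOne z (fill \<epsilon> P))"

primrec binding_vars :: "'f binding \<Rightarrow> var set" where
  "binding_vars (BindP x Q) = {x}"
| "binding_vars (BindOne z) = {}"

text \<open>\<open>unfoldR X R\<close> is \<open>\<U>\<^sup>\<bullet>(R)\<close>. Since this extends the scope of the binders \<open>!x\<close> in \<open>R\<close>, they are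
  renamed so as to avoid capture; \<open>X\<close> is a set of variables to be avoided.\<close>

function (sequential) unfoldR :: "var set \<Rightarrow> 'f R_tm \<Rightarrow> 'f binding list \<times> 'f P_tm \<times> F_tm" where
  "unfoldR X (RPair P F) = ([], P, F)"
| "unfoldR X (RLet x f S1 S2) =
     (let X0 = X \<union> varsR (RLet x f S1 S2);
          (\<epsilon>1, P1, F1) = unfoldR X0 S1;
          X1 = X0 \<union> (\<Union>b\<in>set \<epsilon>1. binding_vars b);
          x' = fresh X1 (vty x);
          (\<epsilon>2, P2, F2) = unfoldR (insert x' X1) (renR [x \<mapsto> x'] S2)
      in (\<epsilon>1 @ BindP x' P1 # \<epsilon>2, P2, FLet f F1 F2))"
| "unfoldR X (RLetP x P S) =
     (let X0 = X \<union> varsR (RLetP x P S);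
          x' = fresh X0 (vty x);
          (\<epsilon>1, P1, F1) = unfoldR (insert x' X0) (renR [x \<mapsto> x'] S)
      in (BindP x' P # \<epsilon>1, P1, F1))"
| "unfoldR X (RLetOne z S) =
     (let (\<epsilon>1, P1, F1) = unfoldR (insert z X) S in (BindOne z # \<epsilon>1, P1, F1))"
| "unfoldR X (RLetF f F S) =
     (let (\<epsilon>1, P1, F1) = unfoldR (X \<union> varsR (RLetF f F S)) S in (\<epsilon>1, P1, FLet f F F1))"
  by pat_completeness auto
termination
  by (relation "measure (\<lambda>(X, R). size R)") auto

primrec trR :: "'f R_tm \<Rightarrow> 'f R_tm" where
  "trR (RPair P F) = RPair P (trF F)"
| "trR (RLet x f R S) =
     (if f \<in> fvR S then RLet x (flip_var f) (trR R) (trR S)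
      else (let (\<epsilon>, P, F) = unfoldR {} R in RLetP x (fill \<epsilon> P) (trR S)))"
| "trR (RLetP x P S) = RLetP x P (trR S)"
| "trR (RLetOne z S) = RLetOne z (trR S)"
| "trR (RLetF f F S) = (if f \<in> fvR S then RLetF (flip_var f) (trF F) (trR S) else trR S)"

section \<open>Linear A\<close>

datatype aty = AReal | AOne | ATensor aty aty

text \<open>The same type serves for primal and for tangent variables, which never occur in the same
  positions.\<close>

datatype avar = AV (aname: nat) (avty: aty)

datatype 'f aexp =
    AVar avar avar                              \<comment> \<open>\<open>(x; y)\<close>\<close>
  | ALet avar avar "'f aexp" "'f aexp"          \<comment> \<open>\<open>let (x; y) = e\<^sub>1 in e\<^sub>2\<close>\<close>
  | APrimUnit
  | ATanUnit
  | APrimLetUnit avar "'f aexp"                 \<comment> \<open>\<open>let \<otimes>() = z in e\<close>, primal \<open>z\<close>\<close>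
  | ATanLetUnit avar "'f aexp"                  \<comment> \<open>\<open>let \<otimes>() = z in e\<close>, tangent \<open>z\<close>\<close>
  | ATanPair avar avar
  | ATanLetPair avar avar avar "'f aexp"        \<comment> \<open>\<open>let \<otimes>(x\<^sub>1, x\<^sub>2) = z in e\<close>\<close>
  | AZero aty
  | APlus avar avar
  | ATimes avar avar                            \<comment> \<open>primal \<open>x\<close> times tangent \<open>y\<close>\<close>
  | ANum real
  | AFun 'f "avar list"
  | ADup avar
  | ADrop "'f aexp"

primrec fvp :: "'f aexp \<Rightarrow> avar set" where
  "fvp (AVar x y) = {x}"
| "fvp (ALet x y e1 e2) = fvp e1 \<union> (fvp e2 - {x})"
| "fvp APrimUnit = {}"
| "fvp ATanUnit = {}"
| "fvp (APrimLetUnit z e) = insert z (fvp e)"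
| "fvp (ATanLetUnit z e) = fvp e"
| "fvp (ATanPair x1 x2) = {}"
| "fvp (ATanLetPair x1 x2 z e) = fvp e"
| "fvp (AZero \<tau>) = {}"
| "fvp (APlus x y) = {}"
| "fvp (ATimes x y) = {x}"
| "fvp (ANum r) = {}"
| "fvp (AFun f xs) = set xs"
| "fvp (ADup x) = {}"
| "fvp (ADrop e) = fvp e"

primrec fvt :: "'f aexp \<Rightarrow> avar set" where
  "fvt (AVar x y) = {y}"
| "fvt (ALet x y e1 e2) = fvt e1 \<union> (fvt e2 - {y})"
| "fvt APrimUnit = {}"
| "fvt ATanUnit = {}"
| "fvt (APrimLetUnit z e) = fvt e"
| "fvt (ATanLetUnit z e) = insert z (fvt e)"
| "fvt (ATanPair x1 x2) = {x1, x2}"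
| "fvt (ATanLetPair x1 x2 z e) = insert z (fvt e - {x1, x2})"
| "fvt (AZero \<tau>) = {}"
| "fvt (APlus x y) = {x, y}"
| "fvt (ATimes x y) = {y}"
| "fvt (ANum r) = {}"
| "fvt (AFun f xs) = {}"
| "fvt (ADup x) = {x}"
| "fvt (ADrop e) = fvt e"

text \<open>\<open>linear_A ar \<Gamma> \<Delta> e \<tau> \<sigma>\<close> is the judgment \<open>\<Gamma>; \<Delta> \<turnstile> e : (\<tau>; \<sigma>)\<close>.\<close>

inductive linear_A ::
  "('f \<Rightarrow> nat) \<Rightarrow> avar set \<Rightarrow> avar set \<Rightarrow> 'f aexp \<Rightarrow> aty \<Rightarrow> aty \<Rightarrow> bool"
  for ar :: "'f \<Rightarrow> nat" where
  weakening: "linear_A ar \<Gamma> \<Delta> e \<tau> \<sigma> \<Longrightarrow> linear_A ar (insert x \<Gamma>) \<Delta> e \<tau> \<sigma>"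
| var: "linear_A ar {x} {y} (AVar x y) (avty x) (avty y)"
| let_: "linear_A ar \<Gamma>1 \<Delta>1 e1 (avty x) (avty y)
    \<Longrightarrow> linear_A ar (insert x \<Gamma>2) (insert y \<Delta>2) e2 \<tau> \<sigma>
    \<Longrightarrow> x \<notin> \<Gamma>2 \<Longrightarrow> y \<notin> \<Delta>2 \<Longrightarrow> \<Delta>1 \<inter> \<Delta>2 = {}
    \<Longrightarrow> linear_A ar (\<Gamma>1 \<union> \<Gamma>2) (\<Delta>1 \<union> \<Delta>2) (ALet x y e1 e2) \<tau> \<sigma>"
| prim_unit: "linear_A ar {} {} APrimUnit AOne AOne"
| tan_unit: "linear_A ar {} {} ATanUnit AOne AOne"
| prim_let_unit: "linear_A ar \<Gamma> \<Delta> e \<tau> \<sigma> \<Longrightarrow> z \<notin> \<Gamma> \<Longrightarrow> avty z = AOne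
    \<Longrightarrow> linear_A ar (insert z \<Gamma>) \<Delta> (APrimLetUnit z e) \<tau> \<sigma>"
| tan_let_unit: "linear_A ar \<Gamma> \<Delta> e \<tau> \<sigma> \<Longrightarrow> z \<notin> \<Delta> \<Longrightarrow> avty z = AOne
    \<Longrightarrow> linear_A ar \<Gamma> (insert z \<Delta>) (ATanLetUnit z e) \<tau> \<sigma>"
| tan_pair: "x1 \<noteq> x2
    \<Longrightarrow> linear_A ar {} {x1, x2} (ATanPair x1 x2) AOne (ATensor (avty x1) (avty x2))"
| tan_let_pair: "linear_A ar \<Gamma> (insert x1 (insert x2 \<Delta>)) e \<tau> \<sigma>
    \<Longrightarrow> x1 \<noteq> x2 \<Longrightarrow> x1 \<notin> \<Delta> \<Longrightarrow> x2 \<notin> \<Delta> \<Longrightarrow> z \<notin> \<Delta> \<Longrightarrow> avty z = ATensor (avty x1) (avty x2)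
    \<Longrightarrow> linear_A ar \<Gamma> (insert z \<Delta>) (ATanLetPair x1 x2 z e) \<tau> \<sigma>"
| zero: "linear_A ar {} {} (AZero \<tau>) AOne \<tau>"
| plus: "x \<noteq> y \<Longrightarrow> avty x = avty y \<Longrightarrow> linear_A ar {} {x, y} (APlus x y) AOne (avty x)"
| times: "avty x = AReal \<Longrightarrow> linear_A ar {x} {y} (ATimes x y) AOne (avty y)"
| num: "linear_A ar {} {} (ANum r) AReal AOne"
| fun_: "length xs = ar f \<Longrightarrow> distinct xs \<Longrightarrow> (\<forall>x\<in>set xs. avty x = AReal)
    \<Longrightarrow> linear_A ar (set xs) {} (AFun f xs) AReal AOne"
| dup: "linear_A ar {} {x} (ADup x) AOne (ATensor (avty x) (avty x))"
| drop: "linear_A ar \<Gamma> \<Delta> e \<tau> \<sigma> \<Longrightarrow> linear_A ar \<Gamma> \<Delta> (ADrop e) AOne AOne"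

text \<open>The types \<open>\<tau>\<close> and \<open>\<sigma>\<close> in \<open>\<Gamma>; \<Delta> \<turnstile> e : (\<tau>; \<sigma>)\<close> are determined by \<open>e\<close>.\<close>

primrec prim_ty :: "'f aexp \<Rightarrow> aty" where
  "prim_ty (AVar x y) = avty x"
| "prim_ty (ALet x y e1 e2) = prim_ty e2"
| "prim_ty APrimUnit = AOne"
| "prim_ty ATanUnit = AOne"
| "prim_ty (APrimLetUnit z e) = prim_ty e"
| "prim_ty (ATanLetUnit z e) = prim_ty e"
| "prim_ty (ATanPair x1 x2) = AOne"
| "prim_ty (ATanLetPair x1 x2 z e) = prim_ty e"
| "prim_ty (AZero \<tau>) = AOne"
| "prim_ty (APlus x y) = AOne"
| "prim_ty (ATimes x y) = AOne"
| "prim_ty (ANum r) = AReal"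
| "prim_ty (AFun f xs) = AReal"
| "prim_ty (ADup x) = AOne"
| "prim_ty (ADrop e) = AOne"

primrec tan_ty :: "'f aexp \<Rightarrow> aty" where
  "tan_ty (AVar x y) = avty y"
| "tan_ty (ALet x y e1 e2) = tan_ty e2"
| "tan_ty APrimUnit = AOne"
| "tan_ty ATanUnit = AOne"
| "tan_ty (APrimLetUnit z e) = tan_ty e"
| "tan_ty (ATanLetUnit z e) = tan_ty e"
| "tan_ty (ATanPair x1 x2) = ATensor (avty x1) (avty x2)"
| "tan_ty (ATanLetPair x1 x2 z e) = tan_ty e"
| "tan_ty (AZero \<tau>) = \<tau>"
| "tan_ty (APlus x y) = avty x"
| "tan_ty (ATimes x y) = avty y"
| "tan_ty (ANum r) = AOne"
| "tan_ty (AFun f xs) = AOne"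
| "tan_ty (ADup x) = ATensor (avty x) (avty x)"
| "tan_ty (ADrop e) = AOne"

subsection \<open>Syntactic sugar\<close>

definition afresh :: "avar set \<Rightarrow> aty \<Rightarrow> avar" where
  "afresh X \<tau> = (SOME x. avty x = \<tau> \<and> x \<notin> X)"

definition ALetPrim :: "avar \<Rightarrow> 'f aexp \<Rightarrow> 'f aexp \<Rightarrow> 'f aexp" where
  "ALetPrim x e1 e2 = (let y = afresh (fvt e2) AOne in ALet x y e1 (ATanLetUnit y e2))"

definition ALetTan :: "avar \<Rightarrow> 'f aexp \<Rightarrow> 'f aexp \<Rightarrow> 'f aexp" where
  "ALetTan y e1 e2 = (let x = afresh (fvp e2) AOne in ALet x y e1 (APrimLetUnit x e2))"

definition APrimVar :: "avar \<Rightarrow> 'f aexp" where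
  "APrimVar x = (let y = afresh {} AOne in ALetTan y ATanUnit (AVar x y))"

definition ATanVar :: "avar \<Rightarrow> 'f aexp" where
  "ATanVar y = (let x = afresh {} AOne in ALetPrim x APrimUnit (AVar x y))"

definition APair :: "'f aexp \<Rightarrow> 'f aexp \<Rightarrow> 'f aexp" where
  "APair e1 e2 =
     (let x = afresh (fvp e2) (prim_ty e1); y = afresh {} (tan_ty e2)
      in ALetPrim x e1 (ALetTan y e2 (AVar x y)))"

definition ATanTensor :: "'f aexp \<Rightarrow> 'f aexp \<Rightarrow> 'f aexp" where
  "ATanTensor e1 e2 =
     (let x = afresh (fvt e2) (tan_ty e1); y = afresh {x} (tan_ty e2)
      in ALetTan x e1 (ALetTan y e2 (ATanPair x y)))"

section \<open>Linear B\<close>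

datatype 'f bprim =
    BVar avar
  | BLet avar "'f bprim" "'f bprim"
  | BNum real
  | BFun 'f "avar list"
  | BDrop "'f bprim"
  | BUnit
  | BLetUnit avar "'f bprim"

datatype btan =
    TVar avar
  | TLet avar btan btan
  | TDup avar
  | TZero aty
  | TPlus avar avar
  | TTimes avar avar
  | TDrop btan
  | TUnit
  | TPair btan btan
  | TLetUnit avar btan
  | TLetPair avar avar avar btan

datatype 'f bexp =
    BPair "'f bprim" btan
  | BLetPrim avar "'f bprim" "'f bexp"
  | BLetPrimUnit avar "'f bexp"

primrec A_of_bprim :: "'f bprim \<Rightarrow> 'f aexp" where
  "A_of_bprim (BVar x) = APrimVar x"
| "A_of_bprim (BLet x e1 e2) = ALetPrim x (A_of_bprim e1) (A_of_bprim e2)"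
| "A_of_bprim (BNum r) = ANum r"
| "A_of_bprim (BFun f xs) = AFun f xs"
| "A_of_bprim (BDrop e) = ADrop (A_of_bprim e)"
| "A_of_bprim BUnit = APrimUnit"
| "A_of_bprim (BLetUnit z e) = APrimLetUnit z (A_of_bprim e)"

primrec A_of_btan :: "btan \<Rightarrow> 'f aexp" where
  "A_of_btan (TVar x) = ATanVar x"
| "A_of_btan (TLet x e1 e2) = ALetTan x (A_of_btan e1) (A_of_btan e2)"
| "A_of_btan (TDup x) = ADup x"
| "A_of_btan (TZero \<tau>) = AZero \<tau>"
| "A_of_btan (TPlus x y) = APlus x y"
| "A_of_btan (TTimes x y) = ATimes x y"
| "A_of_btan (TDrop e) = ADrop (A_of_btan e)"
| "A_of_btan TUnit = ATanUnit"
| "A_of_btan (TPair e1 e2) = ATanTensor (A_of_btan e1) (A_of_btan e2)"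
| "A_of_btan (TLetUnit z e) = ATanLetUnit z (A_of_btan e)"
| "A_of_btan (TLetPair x1 x2 z e) = ATanLetPair x1 x2 z (A_of_btan e)"

primrec A_of_bexp :: "'f bexp \<Rightarrow> 'f aexp" where
  "A_of_bexp (BPair ep et) = APair (A_of_bprim ep) (A_of_btan et)"
| "A_of_bexp (BLetPrim x ep d) = ALetPrim x (A_of_bprim ep) (A_of_bexp d)"
| "A_of_bexp (BLetPrimUnit z d) = APrimLetUnit z (A_of_bexp d)"

text \<open>Free tangent variables and tangent type of a tangent expression; these agree with
  \<open>fvt\<close> and \<open>tan_ty\<close> of the corresponding Linear A expression.\<close>

primrec fvb :: "btan \<Rightarrow> avar set" where
  "fvb (TVar x) = {x}"
| "fvb (TLet x e1 e2) = fvb e1 \<union> (fvb e2 - {x})"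
| "fvb (TDup x) = {x}"
| "fvb (TZero \<tau>) = {}"
| "fvb (TPlus x y) = {x, y}"
| "fvb (TTimes x y) = {y}"
| "fvb (TDrop e) = fvb e"
| "fvb TUnit = {}"
| "fvb (TPair e1 e2) = fvb e1 \<union> fvb e2"
| "fvb (TLetUnit z e) = insert z (fvb e)"
| "fvb (TLetPair x1 x2 z e) = insert z (fvb e - {x1, x2})"

primrec btan_ty :: "btan \<Rightarrow> aty" where
  "btan_ty (TVar x) = avty x"
| "btan_ty (TLet x e1 e2) = btan_ty e2"
| "btan_ty (TDup x) = ATensor (avty x) (avty x)"
| "btan_ty (TZero \<tau>) = \<tau>"
| "btan_ty (TPlus x y) = avty x"
| "btan_ty (TTimes x y) = avty y"
| "btan_ty (TDrop e) = AOne"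
| "btan_ty TUnit = AOne"
| "btan_ty (TPair e1 e2) = ATensor (btan_ty e1) (btan_ty e2)"
| "btan_ty (TLetUnit z e) = btan_ty e"
| "btan_ty (TLetPair x1 x2 z e) = btan_ty e"

section \<open>The transpose of Linear B\<close>

fun tensor_aty :: "aty list \<Rightarrow> aty" where
  "tensor_aty [] = AOne"
| "tensor_aty [\<tau>] = \<tau>"
| "tensor_aty (\<tau> # \<tau>s) = ATensor \<tau> (tensor_aty \<tau>s)"

abbreviation theta_ty :: "avar list \<Rightarrow> aty" where
  "theta_ty \<theta> \<equiv> tensor_aty (map avty \<theta>)"

fun tuple_tan :: "avar list \<Rightarrow> btan" where
  "tuple_tan [] = TUnit"
| "tuple_tan [x] = TVar x"
| "tuple_tan (x # \<theta>) = TPair (TVar x) (tuple_tan \<theta>)"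

text \<open>\<open>let_tuple \<theta> e1 e2\<close> is \<open>let \<otimes>\<theta> = e1 in e2\<close> (on tangents).\<close>

fun let_tuple :: "avar list \<Rightarrow> btan \<Rightarrow> btan \<Rightarrow> btan" where
  "let_tuple [] e1 e2 = (let w = afresh (fvb e2) AOne in TLet w e1 (TLetUnit w e2))"
| "let_tuple [x] e1 e2 = TLet x e1 e2"
| "let_tuple (x # y # \<theta>) e1 e2 =
     (let X = set (x # y # \<theta>) \<union> fvb e2;
          w = afresh X (theta_ty (x # y # \<theta>));
          w' = afresh (insert w X) (theta_ty (y # \<theta>))
      in TLet w e1 (TLetPair x w' w (let_tuple (y # \<theta>) (TVar w') e2)))"

definition sublist_in :: "avar list \<Rightarrow> avar set \<Rightarrow> avar list" where
  "sublist_in \<theta> S = filter (\<lambda>x. x \<in> S) \<theta>"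

text \<open>In the clause for \<open>TLet x e1 e2\<close> (and likewise in the translation \<open>\<delta>\<close> below), \<open>x\<close> is bound
  in \<open>e2\<close> and hence does not count as a variable of \<open>e2\<close> in \<open>\<theta>\<close>, even if it happens to be in \<open>\<theta>\<close>.\<close>

fun tjax_tan :: "avar list \<Rightarrow> avar \<Rightarrow> btan \<Rightarrow> btan" where
  "tjax_tan \<theta> u (TVar x) = TVar u"
| "tjax_tan \<theta> u (TLet x e1 e2) =
     (let \<theta>1 = sublist_in \<theta> (fvb e1); \<theta>2 = sublist_in \<theta> (fvb e2 - {x}) in
      let_tuple (x # \<theta>2) (tjax_tan (x # \<theta>2) u e2)
        (let_tuple \<theta>1 (tjax_tan \<theta>1 x e1) (tuple_tan \<theta>)))"
| "tjax_tan \<theta> u TUnit = TLetUnit u TUnit"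
| "tjax_tan \<theta> u (TPair e1 e2) =
     (let \<theta>1 = sublist_in \<theta> (fvb e1); \<theta>2 = sublist_in \<theta> (fvb e2);
          u1 = afresh (insert u (set \<theta>)) (btan_ty e1);
          u2 = afresh ({u, u1} \<union> set \<theta>) (btan_ty e2) in
      TLetPair u1 u2 u
        (let_tuple \<theta>1 (tjax_tan \<theta>1 u1 e1)
          (let_tuple \<theta>2 (tjax_tan \<theta>2 u2 e2) (tuple_tan \<theta>))))"
| "tjax_tan \<theta> u (TLetUnit z e) =
     (let \<theta>' = removeAll z \<theta> in
      let_tuple \<theta>' (tjax_tan \<theta>' u e) (TLet z TUnit (tuple_tan \<theta>)))"
| "tjax_tan \<theta> u (TLetPair x1 x2 z e) =
     (let \<theta>' = removeAll z \<theta> in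
      let_tuple (x1 # x2 # \<theta>') (tjax_tan (x1 # x2 # \<theta>') u e)
        (TLet z (TPair (TVar x1) (TVar x2)) (tuple_tan \<theta>)))"
| "tjax_tan \<theta> u (TDup x) =
     (let z = afresh {u} (avty x); w = afresh {u, z} (avty x) in TLetPair z w u (TPlus z w))"
| "tjax_tan \<theta> u (TPlus x y) = TDup u"
| "tjax_tan \<theta> u (TZero \<tau>) = TDrop (TVar u)"
| "tjax_tan \<theta> u (TDrop e) = TLetUnit u (TZero (theta_ty \<theta>))"
| "tjax_tan \<theta> u (TTimes x y) = TTimes x u"

primrec tjax :: "avar list \<Rightarrow> avar \<Rightarrow> 'f bexp \<Rightarrow> 'f bexp" where
  "tjax \<theta> u (BPair ep et) = BPair ep (tjax_tan \<theta> u et)"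
| "tjax \<theta> u (BLetPrim x ep d) = BLetPrim x ep (tjax \<theta> u d)"
| "tjax \<theta> u (BLetPrimUnit z d) = BLetPrimUnit z (tjax \<theta> u d)"

section \<open>The translation of Linear A into \<open>\<lambda>LL\<close>\<close>

primrec p_ty :: "aty \<Rightarrow> ty" where
  "p_ty AReal = TReal"
| "p_ty AOne = TOne"
| "p_ty (ATensor \<tau> \<sigma>) = TTensor (TBang (p_ty \<tau>)) (TBang (p_ty \<sigma>))"

primrec t_ty :: "aty \<Rightarrow> ty" where
  "t_ty AReal = TReal"
| "t_ty AOne = TTop"
| "t_ty (ATensor \<tau> \<sigma>) = TWith (t_ty \<tau>) (t_ty \<sigma>)"

definition pvar :: "avar \<Rightarrow> var" where
  "pvar x = V (Prim (aname x)) (p_ty (avty x))"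

text \<open>The variable \<open>u\<^sub>y\<close> associated with the tangent variable \<open>y\<close>.\<close>

definition tvar :: "avar \<Rightarrow> var" where
  "tvar y = V (Tan (aname y)) (t_ty (avty y))"

text \<open>Right-nested additive tuples. The empty tuple pattern is a variable of type \<open>\<top>\<close>.\<close>

fun with_ty :: "ty list \<Rightarrow> ty" where
  "with_ty [] = TTop"
| "with_ty [A] = A"
| "with_ty (A # As) = TWith A (with_ty As)"

fun with_pat :: "lpat list \<Rightarrow> lpat" where
  "with_pat [] = LVar (V (Aux 0) TTop)"
| "with_pat [p] = p"
| "with_pat (p # ps) = LPair p (with_pat ps)"

fun with_U :: "U_tm list \<Rightarrow> U_tm" where
  "with_U [] = UTop"
| "with_U [U] = U"
| "with_U (U # Us) = UPair U (with_U Us)"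

definition theta_with :: "avar list \<Rightarrow> ty" where
  "theta_with \<theta> = with_ty (map (\<lambda>y. t_ty (avty y)) \<theta>)"

definition theta_pat :: "avar list \<Rightarrow> lpat" where
  "theta_pat \<theta> = with_pat (map (\<lambda>y. LVar (tvar y)) \<theta>)"

definition theta_U :: "avar list \<Rightarrow> U_tm" where
  "theta_U \<theta> = with_U (map (\<lambda>y. UVar (tvar y)) \<theta>)"

text \<open>The name \<open>Aux\<close> is not used for the images of the variables of Linear A, which makes the
  auxiliary variables of the translation fresh.\<close>

fun delta :: "avar list \<Rightarrow> 'f aexp \<Rightarrow> 'f R_tm" where
  "delta \<theta> (AVar x y) = RPair (PVal (pvar x)) (FLam (theta_pat \<theta>) (UVar (tvar y)))"
| "delta \<theta> (ALet x y e1 e2) =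
     (let \<theta>1 = sublist_in \<theta> (fvt e1); \<theta>2 = sublist_in \<theta> (fvt e2 - {y});
          z = V (Aux 0) (p_ty (prim_ty e2));
          f = V (Aux 1) (TLolli (theta_with \<theta>1) (t_ty (avty y)));
          g = V (Aux 2) (TLolli (theta_with (y # \<theta>2)) (t_ty (tan_ty e2))) in
      RLet (pvar x) f (delta \<theta>1 e1)
        (RLet z g (delta (y # \<theta>2) e2)
          (RPair (PVal z)
            (FLam (theta_pat \<theta>)
              (UApp (FVar g)
                (with_U (UApp (FVar f) (theta_U \<theta>1) # map (\<lambda>w. UVar (tvar w)) \<theta>2)))))))"
| "delta \<theta> APrimUnit = RPair POne (FLam (with_pat []) UTop)"
| "delta \<theta> ATanUnit = RPair POne (FLam (with_pat []) UTop)"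
| "delta \<theta> (APrimLetUnit z e) = RLetOne (pvar z) (delta \<theta> e)"
| "delta \<theta> (ATanLetUnit z e) =
     (let \<theta>' = removeAll z \<theta>;
          x = V (Aux 0) (p_ty (prim_ty e));
          f = V (Aux 1) (TLolli (theta_with \<theta>') (t_ty (tan_ty e))) in
      RLet x f (delta \<theta>' e)
        (RPair (PVal x) (FLam (theta_pat \<theta>) (UApp (FVar f) (theta_U \<theta>')))))"
| "delta \<theta> (ATanPair x1 x2) =
     RPair POne (FLam (theta_pat \<theta>) (UPair (UVar (tvar x1)) (UVar (tvar x2))))"
| "delta \<theta> (ATanLetPair x1 x2 z e) =
     (let \<theta>' = removeAll z \<theta>;
          x = V (Aux 0) (p_ty (prim_ty e));
          f = V (Aux 1) (TLolli (theta_with (x1 # x2 # \<theta>')) (t_ty (tan_ty e)));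
          v1 = V (Aux 2) (t_ty (avty x1));
          v2 = V (Aux 3) (t_ty (avty x2)) in
      RLet x f (delta (x1 # x2 # \<theta>') e)
        (RPair (PVal x)
          (FLam (with_pat (map (\<lambda>w. if w = z then LPair (LVar v1) (LVar v2) else LVar (tvar w)) \<theta>))
            (UApp (FVar f) (with_U (UVar v1 # UVar v2 # map (\<lambda>w. UVar (tvar w)) \<theta>'))))))"
| "delta \<theta> (ANum r) = RPair (PNum r) (FLam (with_pat []) UTop)"
| "delta \<theta> (AFun f xs) = RPair (PFun f (map pvar xs)) (FLam (with_pat []) UTop)"
| "delta \<theta> (AZero \<sigma>) = RPair POne (FLam (with_pat []) (zeroU (t_ty \<sigma>)))"
| "delta \<theta> (APlus y1 y2) =
     RPair POne (FLam (theta_pat \<theta>)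
       (UApp (plusF (t_ty (avty y1))) (UPair (UVar (tvar y1)) (UVar (tvar y2)))))"
| "delta \<theta> (ATimes x y) =
     RPair POne (FLam (theta_pat \<theta>) (UApp (timesF (t_ty (avty y)) (pvar x)) (UVar (tvar y))))"
| "delta \<theta> (ADup y) = RPair POne (FLam (theta_pat \<theta>) (UPair (UVar (tvar y)) (UVar (tvar y))))"
| "delta \<theta> (ADrop e) =
     (let x = V (Aux 0) (p_ty (prim_ty e));
          f = V (Aux 1) (TLolli (theta_with \<theta>) (t_ty (tan_ty e)));
          y = V (Aux 2) (theta_with \<theta>);
          z = V (Aux 3) (t_ty (tan_ty e)) in
      RLet x f (delta \<theta> e)
        (RPair POne (FLam (LVar y) (ULet (LVar z) (UApp (FVar f) (UVar y)) UTop))))"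

definition prim_env :: "avar set \<Rightarrow> pat set" where
  "prim_env \<Gamma> = (\<lambda>x. PBang (pvar x)) ` \<Gamma>"

end

theory Submission
  imports Defs
begin

text \<open>At the types \<open>L\<close> built from \<open>\<real>\<close>, \<open>\<top>\<close> and \<open>&\<close>, closed terms compute vectors, and a term of type
  \<open>L \<multimap> H\<close> computes a map between vectors. In a denotational semantics of the fragments by such
  vectors and maps, the transpose of \<open>\<lambda>LL\<close> and the transpose of Linear B both send a term to an adjoint
  (for the standard inner products) of the map it denotes. Adjoints are unique since the inner products
  are nondegenerate, so the two sides denote the same map.

  Logical equivalence quantifies over arbitrary closed terms, of which one has to know that they
  compute a vector: this is weak normalization of the whole calculus, proved by computability. One
  also needs that convertible numerals are equal. Instead of proving confluence, we observe that
  otherwise all numerals are convertible, and then any two computable terms of the same type are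
  logically equivalent.\<close>

section \<open>Closed terms and their values\<close>

subsection \<open>Substitution\<close>

text \<open>The two transposes recurse on different syntaxes. That of Linear B takes every
  intermediate tuple apart explicitly; that of \<lambda>LL restricts patterns to the variables in
  use, renames the components of a pair apart and recombines them with \<open>nu\<close>. Matching
  their outputs term by term would mean tracking all this bookkeeping, whereas an adjoint depends on
  the map alone. A transpose returns components only for the variables that occur, so the adjoint
  identity goes through the inductions in coordinates: a sum over linear variables of inner
  products, one for each component. Values are untyped with total projections, so that these
  identities hold for all values; shapes matter only where an adjoint is recovered from its inner
  products. Logical equivalence compares terms by conversion and projections, not by reduction to a
  common normal form. Hence \<open>realizes\<close> records the value of a term, and
  \<open>realizes_unique\<close> shows that, if distinct numerals are not convertible, related
  closed terms have the same value. Only then can the two sides be evaluated at one point.\<close>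

lemma subst_cong: "(\<And>x. x \<in> fv M \<Longrightarrow> \<rho> x = \<sigma> x) \<Longrightarrow> subst \<rho> M = subst \<sigma> M"
proof (induction M arbitrary: \<rho> \<sigma>)
  case (Lam p M)
  show ?case unfolding subst.simps
    by (rule arg_cong[where f = "Lam p"], rule Lam.IH) (use Lam.prems in \<open>auto simp: on_vars_def\<close>)
next
  case (App M N)
  show ?case unfolding subst.simps
    by (rule arg_cong2[where f = App]; rule App.IH) (use App.prems in auto)
next
  case (Tensor M N)
  show ?case unfolding subst.simps
    by (rule arg_cong2[where f = Tensor]; rule Tensor.IH) (use Tensor.prems in auto)
next
  case (With M N)
  show ?case unfolding subst.simps
    by (rule arg_cong2[where f = With]; rule With.IH) (use With.prems in auto)
next
  case (Bang M)
  show ?case unfolding subst.simps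
    by (rule arg_cong[where f = Bang], rule Bang.IH) (use Bang.prems in auto)
qed auto

lemma subst_Var [simp]: "subst Var M = M"
proof (induction M)
  case (Lam p M)
  have "on_vars (- pvars p) (Var :: var \<Rightarrow> 'a tm) = Var" by (auto simp: on_vars_def)
  then show ?case using Lam by simp
qed auto

lemma subst_closed: "fv M = {} \<Longrightarrow> subst \<rho> M = M"
  using subst_cong[of M \<rho> Var] by simp

lemma fv_subst: "fv (subst \<rho> M) \<subseteq> (\<Union>x\<in>fv M. fv (\<rho> x))"
proof (induction M arbitrary: \<rho>)
  case (Lam p M)
  have "fv (subst (on_vars (- pvars p) \<rho>) M) \<subseteq> (\<Union>x\<in>fv M. fv (on_vars (- pvars p) \<rho> x))"
    using Lam.IH .
  then show ?case by (fastforce simp: on_vars_def split: if_splits)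
qed fastforce+

lemma closed_subst: "(\<And>x. x \<in> fv M \<Longrightarrow> fv (\<rho> x) = {}) \<Longrightarrow> fv (subst \<rho> M) = {}"
  using fv_subst[of \<rho> M] by auto

text \<open>\<open>subst\<close> never renames bound variables, so composing two substitutions is
  safe only if the first inserts nothing that a binder could capture: each free variable receives a
  closed term or itself. The second alternative is what \<open>on_vars\<close> produces outside its
  set, in particular at the variables of a pattern.\<close>

lemma subst_subst:
  "(\<And>x. x \<in> fv M \<Longrightarrow> fv (\<rho> x) = {} \<or> \<rho> x = Var x)
    \<Longrightarrow> subst \<sigma> (subst \<rho> M) = subst (\<lambda>x. subst \<sigma> (\<rho> x)) M"
proof (induction M arbitrary: \<rho> \<sigma>)
  case (Lam p M)
  have "subst (on_vars (- pvars p) \<sigma>) (subst (on_vars (- pvars p) \<rho>) M)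
      = subst (\<lambda>x. subst (on_vars (- pvars p) \<sigma>) (on_vars (- pvars p) \<rho> x)) M"
    using Lam.prems by (intro Lam.IH) (auto simp: on_vars_def)
  also have "\<dots> = subst (on_vars (- pvars p) (\<lambda>x. subst \<sigma> (\<rho> x))) M"
  proof (rule subst_cong)
    fix x assume x: "x \<in> fv M"
    show "subst (on_vars (- pvars p) \<sigma>) (on_vars (- pvars p) \<rho> x)
        = on_vars (- pvars p) (\<lambda>x. subst \<sigma> (\<rho> x)) x"
    proof (cases "x \<in> pvars p")
      case False
      then have "fv (\<rho> x) = {} \<or> \<rho> x = Var x" using x Lam.prems by auto
      with False show ?thesis by (auto simp: on_vars_def subst_closed)
    qed (simp add: on_vars_def)
  qed
  finally show ?case by simp
qed auto

text \<open>This is the shape of a beta step under a closing substitution: \<open>\<rho>\<close> has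
  already gone under the binder of a pattern with variables \<open>X\<close>, then
  \<open>\<sigma>\<close> fills these variables. The two merge because \<open>\<rho>\<close> inserts
  only closed terms, which \<open>\<sigma>\<close> leaves alone.\<close>

lemma subst_under:
  assumes "\<And>x. x \<in> fv M - X \<Longrightarrow> fv (\<rho> x) = {}"
  shows "subst (on_vars X \<sigma>) (subst (on_vars (- X) \<rho>) M)
    = subst (\<lambda>x. if x \<in> X then \<sigma> x else \<rho> x) M"
proof -
  have "subst (on_vars X \<sigma>) (subst (on_vars (- X) \<rho>) M)
      = subst (\<lambda>x. subst (on_vars X \<sigma>) (on_vars (- X) \<rho> x)) M"
    using assms by (intro subst_subst) (auto simp: on_vars_def)
  also have "\<dots> = subst (\<lambda>x. if x \<in> X then \<sigma> x else \<rho> x) M"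
    using assms by (intro subst_cong) (auto simp: on_vars_def subst_closed)
  finally show ?thesis .
qed

lemma pat_val_cong: "(\<And>x. x \<in> pvars p \<Longrightarrow> \<rho> x = \<sigma> x) \<Longrightarrow> pat_val \<rho> p = pat_val \<sigma> p"
  by (induction p) auto

section \<open>Congruence, inversion and convertibility for reduction\<close>

subsection \<open>Reduction\<close>

context
  fixes ar :: "'f \<Rightarrow> nat" and den :: "'f \<Rightarrow> real list \<Rightarrow> real"
begin

lemma reds_App:
  assumes "reds ar den M M'" "reds ar den N N'"
  shows "reds ar den (App M N) (App M' N')"
proof -
  have "reds ar den (App M N) (App M' N)"
    using assms(1) by induction (auto intro: rtranclp.rtrancl_into_rtrancl red.app1)
  also have "reds ar den (App M' N) (App M' N')"
    using assms(2) by induction (auto intro: rtranclp.rtrancl_into_rtrancl red.app2)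
  finally show ?thesis .
qed

lemma reds_Tensor:
  assumes "reds ar den M M'" "reds ar den N N'"
  shows "reds ar den (Tensor M N) (Tensor M' N')"
proof -
  have "reds ar den (Tensor M N) (Tensor M' N)"
    using assms(1) by induction (auto intro: rtranclp.rtrancl_into_rtrancl red.tensor1)
  also have "reds ar den (Tensor M' N) (Tensor M' N')"
    using assms(2) by induction (auto intro: rtranclp.rtrancl_into_rtrancl red.tensor2)
  finally show ?thesis .
qed

lemma reds_With:
  assumes "reds ar den M M'" "reds ar den N N'"
  shows "reds ar den (With M N) (With M' N')"
proof -
  have "reds ar den (With M N) (With M' N)"
    using assms(1) by induction (auto intro: rtranclp.rtrancl_into_rtrancl red.with1)
  also have "reds ar den (With M' N) (With M' N')"
    using assms(2) by induction (auto intro: rtranclp.rtrancl_into_rtrancl red.with2)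
  finally show ?thesis .
qed

lemma reds_Bang: "reds ar den M M' \<Longrightarrow> reds ar den (Bang M) (Bang M')"
  by (induction rule: rtranclp.induct) (auto intro: rtranclp.rtrancl_into_rtrancl red.bang)

text \<open>No rule contracts \<open>Bang\<close> itself, so all reduction of a box takes place
  inside it.\<close>

lemma red_Bang_inv: "red ar den (Bang M) N \<Longrightarrow> \<exists>M'. N = Bang M' \<and> red ar den M M'"
  by (erule red.cases) simp_all

lemma reds_Bang_inv: "reds ar den (Bang M) N \<Longrightarrow> \<exists>M'. N = Bang M' \<and> reds ar den M M'"
proof (induction rule: rtranclp_induct)
  case (step N N')
  then obtain M' where "N = Bang M'" "reds ar den M M'" by auto
  with red_Bang_inv step(2) show ?case by (metis rtranclp.rtrancl_into_rtrancl)
qed auto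

lemma beta_eqI: "reds ar den M N \<Longrightarrow> beta_eq ar den M N"
  by (induction rule: rtranclp.induct) (auto intro: equivclp_trans r_into_equivclp)

lemma beta_eq_App2: "beta_eq ar den N N' \<Longrightarrow> beta_eq ar den (App M N) (App M N')"
proof (induction rule: equivclp_induct)
  case (step y z)
  then have "beta_eq ar den (App M y) (App M z)"
    by (auto intro: red.app2 r_into_equivclp equivclp_sym)
  with step(3) show ?case by (rule equivclp_trans)
qed auto

lemma reds_proj1: "reds ar den (App (proj1 A B) (With M N)) M"
  and reds_proj2: "reds ar den (App (proj2 A B) (With M N)) N"
proof -
  let ?p = "PWith (PVar (V (Aux 0) A)) (PVar (V (Aux 1) B))"
  define \<rho> where "\<rho> = (\<lambda>x. if x = V (Aux 0) A then M else N)"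
  have v: "pat_val \<rho> ?p = With M N" by (simp add: \<rho>_def)
  show "reds ar den (App (proj1 A B) (With M N)) M"
    using red.beta[of ?p \<rho> "Var (V (Aux 0) A)" ar den] v
    by (simp add: proj1_def on_vars_def \<rho>_def r_into_rtranclp)
  show "reds ar den (App (proj2 A B) (With M N)) N"
    using red.beta[of ?p \<rho> "Var (V (Aux 1) B)" ar den] v
    by (simp add: proj2_def on_vars_def \<rho>_def r_into_rtranclp)
qed

text \<open>Applying \<open>\<lambda>!x. x\<close> to both sides turns convertible boxes into
  convertible contents, which gives injectivity without confluence. Reduction does not look at
  types, so the type of \<open>?x\<close> is an arbitrary choice.\<close>

lemma beta_eq_Bang_inj:
  assumes "beta_eq ar den (Bang M) (Bang N)" shows "beta_eq ar den M N"
proof -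
  let ?x = "V (Aux 0) TOne"
  have *: "beta_eq ar den (App (Lam (PBang ?x) (Var ?x)) (Bang K)) K" for K
    using red.beta[of "PBang ?x" "\<lambda>_. K" "Var ?x" ar den]
    by (intro beta_eqI) (simp add: on_vars_def r_into_rtranclp)
  show ?thesis
    using beta_eq_App2[OF assms, of "Lam (PBang ?x) (Var ?x)"] * equivclp_trans equivclp_sym by metis
qed

text \<open>The same argument with the two projections \<open>\<lambda>(x, y). x\<close> and
  \<open>\<lambda>(x, y). y\<close>.\<close>

lemma beta_eq_Tensor_inj:
  assumes "beta_eq ar den (Tensor M1 M2) (Tensor N1 N2)"
  shows "beta_eq ar den M1 N1 \<and> beta_eq ar den M2 N2"
proof -
  let ?x = "V (Aux 0) TOne" and ?y = "V (Aux 1) TOne"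
  let ?p = "PTensor (PVar ?x) (PVar ?y)"
  have *: "beta_eq ar den (App (Lam ?p (Var ?x)) (Tensor K L)) K"
    "beta_eq ar den (App (Lam ?p (Var ?y)) (Tensor K L)) L" for K L
    using red.beta[of ?p "\<lambda>z. if z = ?x then K else L" "Var ?x" ar den]
      red.beta[of ?p "\<lambda>z. if z = ?x then K else L" "Var ?y" ar den]
    by (auto intro!: beta_eqI simp: on_vars_def r_into_rtranclp)
  show ?thesis
    using beta_eq_App2[OF assms, of "Lam ?p (Var ?x)"] beta_eq_App2[OF assms, of "Lam ?p (Var ?y)"]
      * equivclp_trans equivclp_sym by metis
qed

text \<open>Closed pattern values meet the no-capture condition of \<open>beta\<close> outright, and
  \<open>subst_under\<close> fuses the closing substitution with the contracted one. All beta steps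
  of \<open>typed_Red\<close>, \<open>realizes_usem\<close> and \<open>realizes_rfun\<close> come
  from here.\<close>

lemma reds_beta_closed:
  assumes "linear_pat p" "\<And>x. x \<in> pvars p \<Longrightarrow> fv (\<sigma> x) = {}"
    and "\<And>x. x \<in> fv M - pvars p \<Longrightarrow> fv (\<rho> x) = {}"
    and "reds ar den N (pat_val \<sigma> p)"
  shows "reds ar den (App (subst \<rho> (Lam p M)) N) (subst (\<lambda>x. if x \<in> pvars p then \<sigma> x else \<rho> x) M)"
proof -
  have "reds ar den (App (subst \<rho> (Lam p M)) N) (App (subst \<rho> (Lam p M)) (pat_val \<sigma> p))"
    using assms(4) by (intro reds_App) auto
  also have "red ar den \<dots> (subst (on_vars (pvars p) \<sigma>) (subst (on_vars (- pvars p) \<rho>) M))"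
    using assms(1,2) by (auto intro!: red.beta)
  also have "subst (on_vars (pvars p) \<sigma>) (subst (on_vars (- pvars p) \<rho>) M)
      = subst (\<lambda>x. if x \<in> pvars p then \<sigma> x else \<rho> x) M"
    using assms(3) by (rule subst_under)
  finally show ?thesis .
qed

text \<open>Each clause of \<open>log_rel\<close> is stable under reduction steps put in front:
  conversion absorbs them, tensor and \<open>!\<close> reduce before inspecting, and at
  \<open>&\<close> and the linear arrow the steps happen inside an application.\<close>

lemma log_rel_expand:
  "log_rel ar den A M' N' \<Longrightarrow> reds ar den M M' \<Longrightarrow> reds ar den N N' \<Longrightarrow> log_rel ar den A M N"
proof (induction A arbitrary: M N M' N')
  case TReal
  then show ?case using beta_eqI equivclp_trans equivclp_sym by (metis log_rel.simps(1))
next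
  case TOne
  then show ?case using beta_eqI equivclp_trans equivclp_sym by (metis log_rel.simps(2))
next
  case (TTensor A B)
  then show ?case by (simp only: log_rel.simps) (meson rtranclp_trans)
next
  case (TBang A)
  then show ?case by (simp only: log_rel.simps) (meson rtranclp_trans)
next
  case (TWith A B)
  have "reds ar den (App P M) (App P M')" "reds ar den (App P N) (App P N')" for P
    using TWith.prems(2,3) by (auto intro: reds_App)
  then show ?case using TWith.prems(1) TWith.IH by (simp only: log_rel.simps) blast
next
  case (TLolli A B)
  show ?case unfolding log_rel.simps
  proof (intro allI impI)
    fix K L assume "typed ar {} K A" "typed ar {} L A" "log_rel ar den A K L"
    then have "log_rel ar den B (App M' K) (App N' L)" using TLolli.prems(1) by simp
    then show "log_rel ar den B (App M K) (App N L)"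
      using TLolli.IH(2) TLolli.prems(2,3) reds_App by blast
  qed
qed simp

text \<open>At \<open>&\<close> the relation is stated through projections. For terms that reduce to
  pairs each projection reduces to a component, so it is enough to relate components.\<close>

lemma log_rel_With:
  assumes M: "reds ar den M (With M1 M2)" and N: "reds ar den N (With N1 N2)"
    and "log_rel ar den A M1 N1" "log_rel ar den B M2 N2"
  shows "log_rel ar den (TWith A B) M N"
proof -
  have r1: "reds ar den (App (proj1 A B) K) K1"
    if "reds ar den K (With K1 K2)" for K K1 K2 :: "'f tm"
    by (rule rtranclp_trans[OF reds_App[OF rtranclp.rtrancl_refl that] reds_proj1])
  have r2: "reds ar den (App (proj2 A B) K) K2"
    if "reds ar den K (With K1 K2)" for K K1 K2 :: "'f tm"
    by (rule rtranclp_trans[OF reds_App[OF rtranclp.rtrancl_refl that] reds_proj2])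
  show ?thesis
    using log_rel_expand[OF assms(3) r1[OF M] r1[OF N]] log_rel_expand[OF assms(4) r2[OF M] r2[OF N]]
    by simp
qed

section \<open>Weak normalization of closed terms by computability\<close>

subsection \<open>Computability\<close>

text \<open>A Tait-style predicate. Unlike the diagonal of \<open>log_rel\<close>, it contains
  untyped closed terms as well, its arrow clause quantifies over all computable arguments, and at
  \<open>&\<close> a term must reduce to an actual pair, since a pair pattern only matches
  \<open>With\<close>.\<close>

primrec Red :: "ty \<Rightarrow> 'f tm \<Rightarrow> bool" where
  "Red TReal M = (fv M = {} \<and> (\<exists>r. reds ar den M (Num r)))"
| "Red (TLolli A B) M = (fv M = {} \<and> (\<forall>N. Red A N \<longrightarrow> Red B (App M N)))"
| "Red TOne M = (fv M = {} \<and> reds ar den M Unit)"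
| "Red (TTensor A B) M =
     (fv M = {} \<and> (\<exists>M1 M2. reds ar den M (Tensor M1 M2) \<and> Red A M1 \<and> Red B M2))"
| "Red TTop M = (fv M = {})"
| "Red (TWith A B) M =
     (fv M = {} \<and> (\<exists>M1 M2. reds ar den M (With M1 M2) \<and> Red A M1 \<and> Red B M2))"
| "Red (TBang A) M = (fv M = {} \<and> (\<exists>M'. reds ar den M (Bang M') \<and> Red A M'))"

lemma Red_closed: "Red A M \<Longrightarrow> fv M = {}"
  by (cases A) auto

text \<open>Closedness of \<open>M\<close> is a separate hypothesis: a step may erase free
  variables, so it does not follow from closedness of \<open>M'\<close>.\<close>

lemma Red_expand: "Red A M' \<Longrightarrow> reds ar den M M' \<Longrightarrow> fv M = {} \<Longrightarrow> Red A M"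
proof (induction A arbitrary: M M')
  case (TLolli A B)
  show ?case unfolding Red.simps
  proof (intro conjI allI impI)
    fix N assume N: "Red A N"
    show "Red B (App M N)"
    proof (rule TLolli.IH(2))
      show "Red B (App M' N)" using N TLolli.prems(1) by simp
      show "reds ar den (App M N) (App M' N)" using TLolli.prems(2) by (rule reds_App) simp
      show "fv (App M N) = {}" using TLolli.prems(3) Red_closed[OF N] by simp
    qed
  qed (use TLolli.prems in auto)
qed (simp only: Red.simps; (meson rtranclp_trans)?)+

text \<open>Computability at the type of a pattern is strong enough to expose a value for that
  pattern, which is what makes a beta redex fire. Linearity lets the assignments found for two
  subpatterns be glued into one.\<close>

lemma Red_pat:
  "linear_pat p \<Longrightarrow> Red (pat_ty p) N
    \<Longrightarrow> \<exists>\<sigma>. reds ar den N (pat_val \<sigma> p) \<and> (\<forall>x\<in>pvars p. Red (vty x) (\<sigma> x))"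
proof (induction p arbitrary: N)
  case (PVar x)
  then show ?case by (auto intro!: exI[of _ "\<lambda>_. N"])
next
  case (PBang x)
  then obtain M' where "reds ar den N (Bang M')" "Red (vty x) M'" by auto
  then show ?case by (auto intro!: exI[of _ "\<lambda>_. M'"])
next
  case (PTensor p q)
  then obtain M1 M2 where N: "reds ar den N (Tensor M1 M2)" "Red (pat_ty p) M1" "Red (pat_ty q) M2"
    by auto
  obtain s1 where s1: "reds ar den M1 (pat_val s1 p)" "\<forall>x\<in>pvars p. Red (vty x) (s1 x)"
    using PTensor.IH PTensor.prems(1) N by (meson linear_pat.simps(4))
  obtain s2 where s2: "reds ar den M2 (pat_val s2 q)" "\<forall>x\<in>pvars q. Red (vty x) (s2 x)"
    using PTensor.IH PTensor.prems(1) N by (meson linear_pat.simps(4))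
  define s where "s = (\<lambda>x. if x \<in> pvars p then s1 x else s2 x)"
  have "pat_val s p = pat_val s1 p" "pat_val s q = pat_val s2 q"
    using PTensor.prems(1) by (auto simp: s_def intro!: pat_val_cong)
  then have "reds ar den N (pat_val s (PTensor p q))"
    using N(1) reds_Tensor[OF s1(1) s2(1)] by (auto dest: rtranclp_trans)
  then show ?case using s1(2) s2(2) by (intro exI[of _ s]) (auto simp: s_def)
next
  case (PWith p q)
  then obtain M1 M2 where N: "reds ar den N (With M1 M2)" "Red (pat_ty p) M1" "Red (pat_ty q) M2"
    by auto
  obtain s1 where s1: "reds ar den M1 (pat_val s1 p)" "\<forall>x\<in>pvars p. Red (vty x) (s1 x)"
    using PWith.IH PWith.prems(1) N by (meson linear_pat.simps(5))
  obtain s2 where s2: "reds ar den M2 (pat_val s2 q)" "\<forall>x\<in>pvars q. Red (vty x) (s2 x)"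
    using PWith.IH PWith.prems(1) N by (meson linear_pat.simps(5))
  define s where "s = (\<lambda>x. if x \<in> pvars p then s1 x else s2 x)"
  have "pat_val s p = pat_val s1 p" "pat_val s q = pat_val s2 q"
    using PWith.prems(1) by (auto simp: s_def intro!: pat_val_cong)
  then have "reds ar den N (pat_val s (PWith p q))"
    using N(1) reds_With[OF s1(1) s2(1)] by (auto dest: rtranclp_trans)
  then show ?case using s1(2) s2(2) by (intro exI[of _ s]) (auto simp: s_def)
qed auto

text \<open>Right-nested tuples end in a bare component and not in a unit, so the induction starts
  from length 1.\<close>

lemma Red_reals:
  "Red (tensor_ty (replicate (Suc n) (TBang TReal))) N
    \<Longrightarrow> \<exists>rs. length rs = Suc n \<and> reds ar den N (tensor_tm (map (\<lambda>r. Bang (Num r)) rs))"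
proof (induction n arbitrary: N)
  case 0
  then obtain M' r where "reds ar den N (Bang M')" "reds ar den M' (Num r)" by auto
  then have "reds ar den N (Bang (Num r))" by (meson rtranclp_trans reds_Bang)
  then show ?case by (auto intro!: exI[of _ "[r]"])
next
  case (Suc n)
  then obtain M1 M2 M' r where N: "reds ar den N (Tensor M1 M2)"
    and M1: "reds ar den M1 (Bang M')" "reds ar den M' (Num r)"
    and M2: "Red (tensor_ty (replicate (Suc n) (TBang TReal))) M2" by auto
  from M1 have 1: "reds ar den M1 (Bang (Num r))" by (meson rtranclp_trans reds_Bang)
  from Suc.IH[OF M2] obtain rs where rs: "length rs = Suc n"
    "reds ar den M2 (tensor_tm (map (\<lambda>r. Bang (Num r)) rs))" by auto
  obtain s ss where "rs = s # ss" using rs(1) by (cases rs) auto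
  then have "reds ar den N (tensor_tm (map (\<lambda>r. Bang (Num r)) (r # rs)))"
    using N reds_Tensor[OF 1 rs(2)] by (auto dest: rtranclp_trans)
  then show ?case using rs(1) by (intro exI[of _ "r # rs"]) auto
qed

lemma env_vars_simps [simp]:
  "env_vars {} = {}" "env_vars (insert p \<Gamma>) = pvars p \<union> env_vars \<Gamma>"
  "env_vars (\<Gamma> \<union> \<Delta>) = env_vars \<Gamma> \<union> env_vars \<Delta>"
  by (auto simp: env_vars_def)

lemma fv_typed: "typed ar \<Gamma> M A \<Longrightarrow> fv M \<subseteq> env_vars \<Gamma>"
  by (induction rule: typed.induct) auto

text \<open>The fundamental lemma of computability, by induction on typing derivations. The
  substitution is indexed by variables, not by patterns, so the rules on patterns only regroup
  variables, and \<open>!x\<close> is handled like \<open>x\<close>, its value being the content of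
  the box.\<close>

theorem typed_Red:
  assumes ar: "\<And>f. ar f \<ge> 1"
  shows "typed ar \<Gamma> M A \<Longrightarrow> (\<And>x. x \<in> env_vars \<Gamma> \<Longrightarrow> Red (vty x) (\<rho> x)) \<Longrightarrow> Red A (subst \<rho> M)"
proof (induction arbitrary: \<rho> rule: typed.induct)
  case (bang \<Gamma> M A)
  then have "Red A (subst \<rho> M)" by auto
  then show ?case using Red_closed by auto
next
  case (lam p \<Delta> M B)
  have fvs: "fv M \<subseteq> pvars p \<union> env_vars \<Delta>" using fv_typed[OF lam(1)] by simp
  have cl: "fv (\<rho> x) = {}" if "x \<in> fv M - pvars p" for x
    using that fvs lam.prems Red_closed by blast
  show ?case unfolding Red.simps
  proof (intro conjI allI impI)
    show c: "fv (subst \<rho> (Lam p M)) = {}" using cl by (intro closed_subst) auto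
    fix N assume N: "Red (pat_ty p) N"
    then obtain \<sigma> where \<sigma>: "reds ar den N (pat_val \<sigma> p)" "\<forall>x\<in>pvars p. Red (vty x) (\<sigma> x)"
      using Red_pat lam.hyps by blast
    have "Red B (subst (\<lambda>x. if x \<in> pvars p then \<sigma> x else \<rho> x) M)"
      using lam.prems \<sigma>(2) by (intro lam.IH) auto
    moreover have "reds ar den (App (subst \<rho> (Lam p M)) N)
        (subst (\<lambda>x. if x \<in> pvars p then \<sigma> x else \<rho> x) M)"
      using \<sigma> Red_closed lam.hyps cl by (intro reds_beta_closed) auto
    moreover have "fv (App (subst \<rho> (Lam p M)) N) = {}" using c Red_closed[OF N] by simp
    ultimately show "Red B (App (subst \<rho> (Lam p M)) N)" by (rule Red_expand)
  qed
next
  case (tensor \<Gamma>1 \<Delta>1 M A \<Gamma>2 \<Delta>2 N B)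
  have "Red A (subst \<rho> M)" by (rule tensor.IH) (use tensor.prems in auto)
  moreover have "Red B (subst \<rho> N)" by (rule tensor.IH) (use tensor.prems in auto)
  ultimately show ?case using Red_closed by auto
next
  case (with_ \<Delta> M A N B)
  then have "Red A (subst \<rho> M)" "Red B (subst \<rho> N)" by auto
  then show ?case using Red_closed by auto
next
  case (app \<Gamma>1 \<Delta>1 M A B \<Gamma>2 \<Delta>2 N)
  have "Red (TLolli A B) (subst \<rho> M)" by (rule app.IH) (use app.prems in auto)
  moreover have "Red A (subst \<rho> N)" by (rule app.IH) (use app.prems in auto)
  ultimately show ?case by simp
next
  case (fun_ f)
  obtain n where n: "ar f = Suc n" using ar[of f] by (cases "ar f") auto
  have "Red (TBang TReal) (App (Fun f) N)"
    if N: "Red (tensor_ty (replicate (ar f) (TBang TReal))) N" for N :: "'f tm"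
  proof -
    obtain rs where rs: "length rs = ar f" "reds ar den N (tensor_tm (map (\<lambda>r. Bang (Num r)) rs))"
      using Red_reals[of n N] N n by auto
    have "reds ar den (App (Fun f) N) (App (Fun f) (tensor_tm (map (\<lambda>r. Bang (Num r)) rs)))"
      using rs(2) by (intro reds_App) auto
    also have "red ar den \<dots> (Bang (Num (den f rs)))" using rs(1) by (rule red.fun_)
    finally show ?thesis using Red_closed[OF N] by auto
  qed
  then show ?case by simp
next
  case plus
  have "Red TReal (App Plus N)" if N: "Red (TWith TReal TReal) N" for N :: "'f tm"
  proof -
    from N obtain M1 M2 r s where *: "reds ar den N (With M1 M2)"
      "reds ar den M1 (Num r)" "reds ar den M2 (Num s)" by auto
    have "reds ar den N (With (Num r) (Num s))" using * by (meson rtranclp_trans reds_With)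
    then have "reds ar den (App Plus N) (App Plus (With (Num r) (Num s)))" by (intro reds_App) auto
    also have "red ar den \<dots> (Num (r + s))" by (rule red.plus)
    finally show ?thesis using Red_closed[OF N] by auto
  qed
  then show ?case by simp
next
  case times
  have "Red TReal (App (App Times M) N)" if N: "Red TReal M" "Red TReal N" for M N :: "'f tm"
  proof -
    from N obtain r s where *: "reds ar den M (Num r)" "reds ar den N (Num s)" by auto
    then have "reds ar den (App (App Times M) N) (App (App Times (Num r)) (Num s))"
      by (intro reds_App) auto
    also have "red ar den \<dots> (Num (r * s))" by (rule red.times)
    finally show ?thesis using N by auto
  qed
  then show ?case by auto
qed (auto simp: closed_subst)

corollary typed_closed_Red:
  assumes "\<And>f. ar f \<ge> 1" "typed ar {} M A" shows "Red A M"
  using typed_Red[OF assms, of Var] by simp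

\<comment> \<open>First-order values, and how far logical equivalence determines them\<close>
subsection \<open>Values\<close>

end

text \<open>\<open>VU\<close> serves as the only value of both \<open>1\<close> and
  \<open>\<top>\<close>, and \<open>VP\<close> for both kinds of pairs. The projections below are
  total with junk defaults, so that the semantic operations are total functions and identities about
  them need no typing hypotheses.\<close>

datatype val = VR real | VU | VP val val

primrec vreal :: "val \<Rightarrow> real" where
  "vreal (VR r) = r" | "vreal VU = 0" | "vreal (VP a b) = 0"

primrec vfst :: "val \<Rightarrow> val" where
  "vfst (VR r) = VU" | "vfst VU = VU" | "vfst (VP a b) = a"

primrec vsnd :: "val \<Rightarrow> val" where
  "vsnd (VR r) = VU" | "vsnd VU = VU" | "vsnd (VP a b) = b"

primrec first_order :: "ty \<Rightarrow> bool" where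
  "first_order TReal = True"
| "first_order TOne = True"
| "first_order TTop = True"
| "first_order (TTensor A B) = (first_order A \<and> first_order B)"
| "first_order (TWith A B) = (first_order A \<and> first_order B)"
| "first_order (TBang A) = first_order A"
| "first_order (TLolli A B) = False"

primrec vtyped :: "ty \<Rightarrow> val \<Rightarrow> bool" where
  "vtyped TReal v = (\<exists>r. v = VR r)"
| "vtyped TOne v = (v = VU)"
| "vtyped TTop v = (v = VU)"
| "vtyped (TTensor A B) v = (\<exists>a b. v = VP a b \<and> vtyped A a \<and> vtyped B b)"
| "vtyped (TWith A B) v = (\<exists>a b. v = VP a b \<and> vtyped A a \<and> vtyped B b)"
| "vtyped (TBang A) v = vtyped A v"
| "vtyped (TLolli A B) v = False"

context
  fixes ar :: "'f \<Rightarrow> nat" and den :: "'f \<Rightarrow> real list \<Rightarrow> real"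
begin

text \<open>At first-order types this is \<open>Red\<close> that also records the value computed; a
  box has the value of its content. The arrow is excluded because \<open>val\<close> contains no
  functions; maps are treated by \<open>realizes_fun\<close>.\<close>

primrec realizes :: "ty \<Rightarrow> 'f tm \<Rightarrow> val \<Rightarrow> bool" where
  "realizes TReal M v = (fv M = {} \<and> (\<exists>r. v = VR r \<and> reds ar den M (Num r)))"
| "realizes (TLolli A B) M v = False"
| "realizes TOne M v = (fv M = {} \<and> v = VU \<and> reds ar den M Unit)"
| "realizes (TTensor A B) M v =
     (fv M = {} \<and> (\<exists>a b M1 M2. v = VP a b \<and> reds ar den M (Tensor M1 M2)
        \<and> realizes A M1 a \<and> realizes B M2 b))"
| "realizes TTop M v = (fv M = {} \<and> v = VU)"
| "realizes (TWith A B) M v =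
     (fv M = {} \<and> (\<exists>a b M1 M2. v = VP a b \<and> reds ar den M (With M1 M2)
        \<and> realizes A M1 a \<and> realizes B M2 b))"
| "realizes (TBang A) M v = (fv M = {} \<and> (\<exists>M'. reds ar den M (Bang M') \<and> realizes A M' v))"

lemma realizes_closed: "realizes A M v \<Longrightarrow> fv M = {}"
  by (cases A) auto

lemma realizes_vtyped: "realizes A M v \<Longrightarrow> vtyped A v"
  by (induction A arbitrary: M v) fastforce+

lemma realizes_expand:
  "realizes A M' v \<Longrightarrow> reds ar den M M' \<Longrightarrow> fv M = {} \<Longrightarrow> realizes A M v"
  by (induction A arbitrary: M M' v; clarsimp; (meson rtranclp_trans)?)

lemma Red_realizes: "Red ar den A M \<Longrightarrow> first_order A \<Longrightarrow> \<exists>v. realizes A M v"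
  by (induction A arbitrary: M) fastforce+

lemma realizes_log_rel: "realizes A M v \<Longrightarrow> realizes A N v \<Longrightarrow> log_rel ar den A M N"
proof (induction A arbitrary: M N v)
  case TReal
  then show ?case using beta_eqI equivclp_trans equivclp_sym
    by (metis log_rel.simps(1) realizes.simps(1) val.inject(1))
next
  case TOne
  then show ?case using beta_eqI equivclp_trans equivclp_sym
    by (metis log_rel.simps(2) realizes.simps(3))
next
  case (TWith A B)
  then obtain a b M1 M2 N1 N2 where v: "v = VP a b"
    and M: "reds ar den M (With M1 M2)" "realizes A M1 a" "realizes B M2 b"
    and N: "reds ar den N (With N1 N2)" "realizes A N1 a" "realizes B N2 b" by auto
  show ?case by (rule log_rel_With[OF M(1) N(1)]; rule TWith.IH) (use M N in auto)
next
  case (TTensor A B)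
  then obtain a b M1 M2 N1 N2 where "v = VP a b"
    and M: "reds ar den M (Tensor M1 M2)" "realizes A M1 a" "realizes B M2 b"
    and N: "reds ar den N (Tensor N1 N2)" "realizes A N1 a" "realizes B N2 b" by auto
  have "log_rel ar den A M1 N1" "log_rel ar den B M2 N2" using TTensor.IH M N by blast+
  then show ?case using M(1) N(1) by (simp only: log_rel.simps) blast
next
  case (TBang A)
  then obtain M1 N1 where M: "reds ar den M (Bang M1)" "realizes A M1 v"
    and N: "reds ar den N (Bang N1)" "realizes A N1 v" by auto
  have "log_rel ar den A M1 N1" using TBang.IH M N by blast
  then show ?case using M(1) N(1) by (simp only: log_rel.simps) blast
qed simp_all

text \<open>The relation between \<open>M\<close> and \<open>N\<close> does not descend along the
  reductions that compute their values: at \<open>&\<close> it speaks of projections, at tensor and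
  \<open>!\<close> of possibly different reducts. The statement is therefore generalized to terms
  \<open>M0\<close> and \<open>N0\<close> merely convertible to \<open>M\<close> and
  \<open>N\<close>, and conversion is carried down by projections and by injectivity of the
  constructors. The numerals reached at \<open>TReal\<close> are convertible, hence equal by
  assumption.\<close>

lemma realizes_unique:
  assumes "\<And>r s. beta_eq ar den (Num r) (Num s) \<Longrightarrow> r = s"
  shows "realizes A M0 a \<Longrightarrow> beta_eq ar den M0 M \<Longrightarrow> log_rel ar den A M N
    \<Longrightarrow> beta_eq ar den N N0 \<Longrightarrow> realizes A N0 b \<Longrightarrow> a = b"
proof (induction A arbitrary: M0 M N N0 a b)
  case TReal
  then obtain r s where *: "a = VR r" "reds ar den M0 (Num r)" "b = VR s" "reds ar den N0 (Num s)"
    by auto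
  have "beta_eq ar den (Num r) (Num s)"
    using *(2,4)[THEN beta_eqI] TReal(2-4) by (metis log_rel.simps(1) equivclp_trans equivclp_sym)
  then show ?case using assms * by simp
next
  case (TTensor A B)
  obtain a1 a2 P1 P2 where a: "a = VP a1 a2" "reds ar den M0 (Tensor P1 P2)"
    "realizes A P1 a1" "realizes B P2 a2" using TTensor.prems by auto
  obtain b1 b2 Q1 Q2 where b: "b = VP b1 b2" "reds ar den N0 (Tensor Q1 Q2)"
    "realizes A Q1 b1" "realizes B Q2 b2" using TTensor.prems by auto
  obtain M1 M2 N1 N2 where r: "reds ar den M (Tensor M1 M2)" "reds ar den N (Tensor N1 N2)"
    "log_rel ar den A M1 N1" "log_rel ar den B M2 N2" using TTensor.prems by auto
  have "beta_eq ar den (Tensor P1 P2) (Tensor M1 M2)" "beta_eq ar den (Tensor N1 N2) (Tensor Q1 Q2)"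
    using TTensor.prems(2,4) a(2)[THEN beta_eqI] b(2)[THEN beta_eqI] r(1,2)[THEN beta_eqI]
    by (meson equivclp_trans equivclp_sym)+
  then show ?case
    using TTensor.IH a b r beta_eq_Tensor_inj by metis
next
  case (TBang A)
  obtain P where a: "reds ar den M0 (Bang P)" "realizes A P a" using TBang.prems by auto
  obtain Q where b: "reds ar den N0 (Bang Q)" "realizes A Q b" using TBang.prems by auto
  obtain M1 N1 where r: "reds ar den M (Bang M1)" "reds ar den N (Bang N1)"
    "log_rel ar den A M1 N1" using TBang.prems by auto
  have "beta_eq ar den (Bang P) (Bang M1)" "beta_eq ar den (Bang N1) (Bang Q)"
    using TBang.prems(2,4) a(1)[THEN beta_eqI] b(1)[THEN beta_eqI] r(1,2)[THEN beta_eqI]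
    by (meson equivclp_trans equivclp_sym)+
  then show ?case
    using TBang.IH a b r beta_eq_Bang_inj by metis
next
  case (TWith A B)
  obtain a1 a2 P1 P2 where a: "a = VP a1 a2" "reds ar den M0 (With P1 P2)"
    "realizes A P1 a1" "realizes B P2 a2" using TWith.prems by auto
  obtain b1 b2 Q1 Q2 where b: "b = VP b1 b2" "reds ar den N0 (With Q1 Q2)"
    "realizes A Q1 b1" "realizes B Q2 b2" using TWith.prems by auto
  \<comment> \<open>The components of the pairs are convertible to the very projections that
    \<open>log_rel\<close> compares.\<close>
  have "beta_eq ar den P1 (App (proj1 A B) M)" "beta_eq ar den P2 (App (proj2 A B) M)"
    using TWith.prems(2) a(2)[THEN beta_eqI] beta_eq_App2 reds_proj1[THEN beta_eqI]
      reds_proj2[THEN beta_eqI] by (meson equivclp_trans equivclp_sym)+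
  moreover have "beta_eq ar den (App (proj1 A B) N) Q1" "beta_eq ar den (App (proj2 A B) N) Q2"
    using TWith.prems(4) b(2)[THEN beta_eqI] beta_eq_App2 reds_proj1[THEN beta_eqI]
      reds_proj2[THEN beta_eqI] by (meson equivclp_trans equivclp_sym)+
  ultimately show ?case using TWith a b by (metis log_rel.simps(6))
qed auto

text \<open>Two distinct convertible numerals make all numerals convertible, by an affine change of
  variable; this replaces a proof of consistency of \<open>beta_eq\<close>.\<close>

lemma numerals_convertible:
  assumes "beta_eq ar den (Num r) (Num s)" "r \<noteq> s"
  shows "beta_eq ar den (Num a) (Num b)"
proof -
  have *: "beta_eq ar den (App Plus (With (Num x) (App (App Times (Num c)) (Num y)))) (Num (x + c * y))"
    for x c y
  proof -
    have "reds ar den (App Plus (With (Num x) (App (App Times (Num c)) (Num y))))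
        (App Plus (With (Num x) (Num (c * y))))"
      by (intro reds_App reds_With) (auto intro: red.times)
    also have "red ar den \<dots> (Num (x + c * y))" by (rule red.plus)
    finally show ?thesis by (rule beta_eqI)
  qed
  \<comment> \<open>The affine map t -> x + c * t sends \<open>r\<close> to \<open>a\<close> and
    \<open>s\<close> to \<open>b\<close>, and it is definable from \<open>Plus\<close> and
    \<open>Times\<close>.\<close>
  define c where "c = (a - b) / (r - s)"
  define x where "x = a - c * r"
  have c': "c * s = c * r - (a - b)" using assms(2) by (simp add: c_def field_simps)
  have ab: "x + c * r = a" "x + c * s = b"
    by (auto simp: x_def c')
  define C where "C = (\<lambda>N :: 'f tm. App Plus (With (Num x) (App (App Times (Num c)) N)))"
  have "beta_eq ar den (C (Num r)) (C (Num s))"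
    using assms(1)
  proof (induction rule: equivclp_induct)
    case (step y z)
    then have "beta_eq ar den (C y) (C z)"
      unfolding C_def by (auto intro: red.app2 red.with2 r_into_equivclp equivclp_sym)
    with step(3) show ?case by (rule equivclp_trans)
  qed auto
  then show ?thesis
    using *[of x c r] *[of x c s] ab by (metis C_def equivclp_trans equivclp_sym)
qed

text \<open>If all numerals are convertible, the relation at \<open>TReal\<close> is total on
  computable terms, and this propagates through the types. At the arrow \<open>log_rel\<close>
  ranges over typed arguments, which are computable by \<open>typed_closed_Red\<close>.\<close>

lemma Red_log_rel:
  assumes num: "\<And>r s. beta_eq ar den (Num r) (Num s)" and ar: "\<And>f. ar f \<ge> 1"
  shows "Red ar den A M \<Longrightarrow> Red ar den A N \<Longrightarrow> log_rel ar den A M N"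
proof (induction A arbitrary: M N)
  case TReal
  then show ?case using num beta_eqI equivclp_trans equivclp_sym
    by (metis Red.simps(1) log_rel.simps(1))
next
  case TOne
  then show ?case using beta_eqI equivclp_trans equivclp_sym
    by (metis Red.simps(3) log_rel.simps(2))
next
  case (TWith A B)
  then obtain M1 M2 N1 N2
    where M: "reds ar den M (With M1 M2)" "Red ar den A M1" "Red ar den B M2"
    and N: "reds ar den N (With N1 N2)" "Red ar den A N1" "Red ar den B N2" by auto
  show ?case by (rule log_rel_With[OF M(1) N(1)]; rule TWith.IH) (use M N in auto)
next
  case (TLolli A B)
  show ?case unfolding log_rel.simps
  proof (intro allI impI)
    fix K L assume "typed ar {} K A" "typed ar {} L A"
    then have "Red ar den A K" "Red ar den A L" using typed_closed_Red[where ar = ar, OF ar] by auto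
    then show "log_rel ar den B (App M K) (App N L)"
      using TLolli.prems by (intro TLolli.IH(2)) auto
  qed
next
  case (TTensor A B)
  then obtain M1 M2 N1 N2 where
    M: "reds ar den M (Tensor M1 M2)" "Red ar den A M1" "Red ar den B M2"
    and N: "reds ar den N (Tensor N1 N2)" "Red ar den A N1" "Red ar den B N2" by auto
  have "log_rel ar den A M1 N1" "log_rel ar den B M2 N2" using TTensor.IH M N by blast+
  then show ?case using M(1) N(1) by (simp only: log_rel.simps) blast
next
  case (TBang A)
  then obtain M1 N1 where M: "reds ar den M (Bang M1)" "Red ar den A M1"
    and N: "reds ar den N (Bang N1)" "Red ar den A N1" by auto
  have "log_rel ar den A M1 N1" using TBang.IH M N by blast
  then show ?case using M(1) N(1) by (simp only: log_rel.simps) blast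
qed simp_all

end

section \<open>Conditions on free variables that make terms of the fragments typable\<close>

subsection \<open>Well-formed terms of the fragments\<close>

text \<open>Variables of arrow type are those bound by patterns \<open>\<section>f\<close>. Typing
  treats them linearly, while all other free variables occur in environments as
  \<open>!x\<close>.\<close>

definition fun_var :: "var \<Rightarrow> bool" where
  "fun_var x \<longleftrightarrow> (\<exists>A B. vty x = TLolli A B)"

primrec ltype :: "ty \<Rightarrow> bool" where
  "ltype TReal = True"
| "ltype TTop = True"
| "ltype (TWith A B) = (ltype A \<and> ltype B)"
| "ltype TOne = False"
| "ltype (TTensor A B) = False"
| "ltype (TBang A) = False"
| "ltype (TLolli A B) = False"

lemma ltype_not_fun_var: "ltype (vty x) \<Longrightarrow> \<not> fun_var x"
  by (auto simp: fun_var_def)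

lemma ltype_first_order: "ltype A \<Longrightarrow> first_order A"
  by (induction A) auto

definition wf_lpat :: "lpat \<Rightarrow> bool" where
  "wf_lpat p \<longleftrightarrow> linear_pat (pat_of p) \<and> (\<forall>u\<in>lvars p. ltype (vty u))"

lemma wf_lpat_simps [simp]:
  "wf_lpat (LVar u) \<longleftrightarrow> ltype (vty u)"
  "wf_lpat (LPair p q) \<longleftrightarrow> wf_lpat p \<and> wf_lpat q \<and> lvars p \<inter> lvars q = {}"
  by (auto simp: wf_lpat_def)

lemma wf_lpat_ty: "wf_lpat p \<Longrightarrow> ltype (lpat_ty p)"
  by (induction p) auto

lemma wf_lpat_var: "wf_lpat p \<Longrightarrow> u \<in> lvars p \<Longrightarrow> ltype (vty u)"
  by (simp add: wf_lpat_def)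

lemma finite_pvars [simp]: "finite (pvars p)"
  by (induction p) auto

lemma finite_fvU [simp]: "finite (fvU U)" "finite (fvF F)"
  by (induction U and F) auto

lemma finite_varsU [simp]: "finite (varsU U)" "finite (varsF F)"
  by (induction U and F) auto

lemma fvU_varsU: "fvU U \<subseteq> varsU U" "fvF F \<subseteq> varsF F"
  by (induction U and F) auto

lemma fv_tm_of_U: "fv (tm_of_U U :: 'f tm) = fvU U" "fv (tm_of_F F :: 'f tm) = fvF F"
  by (induction U and F) auto

primrec domF :: "F_tm \<Rightarrow> ty" where
  "domF (FVar f) = dom_ty (vty f)"
| "domF FPlus = TWith TReal TReal"
| "domF (FTimes x) = TReal"
| "domF (FLam p U) = lpat_ty p"
| "domF (FLet f F G) = domF G"

text \<open>\<open>wfU L U\<close>: \<open>U\<close> is typable when \<open>L\<close> is the set of variables of the linear pattern of its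
  environment. The construct \<open>FLet\<close>, which the translation \<open>delta\<close> does not produce, is excluded.\<close>

primrec wfU :: "var set \<Rightarrow> U_tm \<Rightarrow> bool" and wfF :: "F_tm \<Rightarrow> bool" where
  "wfU L (UVar u) = (u \<in> L)"
| "wfU L UZero = True"
| "wfU L UTop = True"
| "wfU L (UPair U1 U2) = (wfU L U1 \<and> wfU L U2)"
| "wfU L (UApp F U) = (wfF F \<and> wfU L U \<and> fvF F \<inter> L = {} \<and> domF F = tyU U
     \<and> (\<forall>f\<in>fvF F \<inter> fvU U. \<not> fun_var f))"
| "wfF (FVar f) = (\<exists>A B. vty f = TLolli A B \<and> ltype A \<and> ltype B)"
| "wfF FPlus = True"
| "wfF (FTimes x) = (vty x = TReal)"
| "wfF (FLam p U) = (wf_lpat p \<and> wfU (lvars p) U)"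
| "wfF (FLet f F G) = False"

text \<open>More linear variables may be allowed as long as none of them is already free in
  \<open>U\<close> in another role. This serves the two components of a transposed pair, which are
  typed under their joint pattern.\<close>

lemma wfU_mono: "wfU L U \<Longrightarrow> L \<subseteq> L' \<Longrightarrow> (fvU U - L) \<inter> L' = {} \<Longrightarrow> wfU L' U"
  by (induction U rule: U_tm.induct[where ?P2.0 = "\<lambda>_. True"]) auto

lemma wfU_ltype:
  "wfU L U \<Longrightarrow> (\<And>u. u \<in> L \<Longrightarrow> ltype (vty u)) \<Longrightarrow> ltype (tyU U)"
  "wfF F \<Longrightarrow> ltype (domF F) \<and> ltype (codF F)"
  by (induction U and F arbitrary: L) (auto simp: wf_lpat_ty wf_lpat_var)

text \<open>Typability is proved in the smallest environment, read off the set of free variables,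
  and weakened where needed.\<close>

definition env_of :: "var set \<Rightarrow> pat set" where
  "env_of X = (\<lambda>x. if fun_var x then sec_pat (PVar x) else PBang x) ` X"

lemma env_of_simps [simp]:
  "env_of {} = {}" "env_of (X \<union> Y) = env_of X \<union> env_of Y"
  "env_of (insert x X) = insert (if fun_var x then sec_pat (PVar x) else PBang x) (env_of X)"
  by (auto simp: env_of_def)

lemma env_vars_env_of [simp]: "env_vars (env_of X) = X"
  by (auto simp: env_of_def env_vars_def)

text \<open>Here the encoding \<open>\<section>A = 1 & A\<close> pays off: although linear, a
  function variable can be discarded by choosing the unit component. The pattern \<open>()\<close>
  is added first and then widened to \<open>\<section>f\<close>; ordinary variables use the
  weakening rule for \<open>!\<close>.\<close>

lemma typed_weaken:
  assumes "finite Y" "typed ar (env_of X \<union> \<Delta>) M A" "Y \<inter> env_vars \<Delta> = {}"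
  shows "typed ar (env_of (X \<union> Y) \<union> \<Delta>) M A"
  using assms(1,3)
proof (induction Y)
  case (insert y Y)
  then have IH: "typed ar (env_of (X \<union> Y) \<union> \<Delta>) M A" by auto
  show ?case
  proof (cases "y \<in> X")
    case True
    then have "X \<union> insert y Y = X \<union> Y" by auto
    then show ?thesis using IH by simp
  next
    case False
    then have y: "y \<notin> env_vars (env_of (X \<union> Y) \<union> \<Delta>)" using insert by auto
    show ?thesis
    proof (cases "fun_var y")
      case True
      have "typed ar (insert (sec_pat (PVar y)) (env_of (X \<union> Y) \<union> \<Delta>)) M A"
        using typed.unit_pat[OF IH] y by (intro typed.with_pat1) auto
      then show ?thesis using True by simp
    next
      case False
      have "typed ar (insert (PBang y) (env_of (X \<union> Y) \<union> \<Delta>)) M A"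
        using IH y by (rule typed.weakening)
      then show ?thesis using False by simp
    qed
  qed
qed (use assms in simp)

lemma env_of_split: "env_of X = env_of {x \<in> X. \<not> fun_var x} \<union> env_of {x \<in> X. fun_var x}"
  by (auto simp: env_of_def)

lemma bang_env_of: "bang_env (env_of {x \<in> X. \<not> fun_var x})"
  by (auto simp: env_of_def bang_env_def)

text \<open>Rule \<open>app\<close> shares only patterns \<open>!x\<close>. Each environment is
  split into its boxed part and its function part, and the latter goes to the linear side; hence the
  condition that no function variable is common to both terms.\<close>

lemma typed_App_env_of:
  assumes "typed ar (env_of X \<union> \<Delta>1) M (TLolli A B)" "typed ar (env_of Y \<union> \<Delta>2) N A"
    and "\<forall>f\<in>X \<inter> Y. \<not> fun_var f"
    and "env_vars \<Delta>1 \<inter> env_vars \<Delta>2 = {}" "(X \<union> Y) \<inter> env_vars (\<Delta>1 \<union> \<Delta>2) = {}"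
  shows "typed ar (env_of (X \<union> Y) \<union> (\<Delta>1 \<union> \<Delta>2)) (App M N) B"
proof -
  let ?B = "\<lambda>X. env_of {x \<in> X. \<not> fun_var x}" and ?F = "\<lambda>X. env_of {x \<in> X. fun_var x}"
  have "typed ar (?B X \<union> ?B Y \<union> (?F X \<union> \<Delta>1) \<union> (?F Y \<union> \<Delta>2)) (App M N) B"
    using assms env_of_split[of X] env_of_split[of Y]
    by (intro typed.app[where A = A] bang_env_of) (auto simp: Un_assoc)
  moreover have "?B X \<union> ?B Y \<union> (?F X \<union> \<Delta>1) \<union> (?F Y \<union> \<Delta>2) = env_of (X \<union> Y) \<union> (\<Delta>1 \<union> \<Delta>2)"
    using env_of_split[of X] env_of_split[of Y] by auto
  ultimately show ?thesis by simp
qed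

lemma typed_Tensor_env_of:
  assumes "typed ar (env_of X) M A" "typed ar (env_of Y) N B" "\<forall>f\<in>X \<inter> Y. \<not> fun_var f"
  shows "typed ar (env_of (X \<union> Y)) (Tensor M N) (TTensor A B)"
proof -
  let ?B = "\<lambda>X. env_of {x \<in> X. \<not> fun_var x}" and ?F = "\<lambda>X. env_of {x \<in> X. fun_var x}"
  have "typed ar (?B X \<union> ?B Y \<union> ?F X \<union> ?F Y) (Tensor M N) (TTensor A B)"
    using assms env_of_split[of X] env_of_split[of Y]
    by (intro typed.tensor bang_env_of) (auto simp: Un_assoc)
  moreover have "?B X \<union> ?B Y \<union> ?F X \<union> ?F Y = env_of (X \<union> Y)"
    using env_of_split[of X] env_of_split[of Y] by auto
  ultimately show ?thesis by simp
qed

lemma typed_lpat_var: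
  "wf_lpat p \<Longrightarrow> u \<in> lvars p \<Longrightarrow> typed ar {pat_of p} (Var u) (vty u)"
proof (induction p)
  case (LVar x)
  then show ?case using typed.var by simp
next
  case (LPair p1 p2)
  show ?case
  proof (cases "u \<in> lvars p1")
    case True
    then show ?thesis
      using LPair typed.with_pat1[of ar "pat_of p1" "{}" "Var u" "vty u" "pat_of p2"]
      by (auto simp: wf_lpat_def)
  next
    case False
    then show ?thesis
      using LPair typed.with_pat2[of ar "pat_of p2" "{}" "Var u" "vty u" "pat_of p1"]
      by (auto simp: wf_lpat_def)
  qed
qed

lemma is_env_lpat: "wf_lpat p \<Longrightarrow> is_env {pat_of p}"
  by (simp add: is_env_def wf_lpat_def)

lemma wfU_typed:
  "wf_lpat p \<Longrightarrow> wfU (lvars p) U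
    \<Longrightarrow> typed ar (env_of (fvU U - lvars p) \<union> {pat_of p}) (tm_of_U U) (tyU U)"
  "wfF F \<Longrightarrow> typed ar (env_of (fvF F)) (tm_of_F F) (TLolli (domF F) (codF F))"
proof (induction U and F arbitrary: p)
  case (UVar u)
  then show ?case using typed_lpat_var by simp
next
  case UZero
  then show ?case by (simp add: typed.zero is_env_lpat)
next
  case UTop
  then show ?case by (simp add: typed.top is_env_lpat)
next
  case (UPair U1 U2)
  \<comment> \<open>Both components of an additive pair are typed in one environment, so each is
    first weakened by the free variables of the other.\<close>
  let ?X = "fvU (UPair U1 U2) - lvars p"
  have "typed ar (env_of (fvU U1 - lvars p \<union> ?X) \<union> {pat_of p}) (tm_of_U U1) (tyU U1)"
    using UPair by (intro typed_weaken) auto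
  moreover have "typed ar (env_of (fvU U2 - lvars p \<union> ?X) \<union> {pat_of p}) (tm_of_U U2) (tyU U2)"
    using UPair by (intro typed_weaken) auto
  moreover have "fvU U1 - lvars p \<union> ?X = ?X" "fvU U2 - lvars p \<union> ?X = ?X" by auto
  ultimately show ?case by (metis tm_of_U.simps(4) tyU.simps(4) typed.with_)
next
  case (UApp F U)
  have "typed ar (env_of (fvF F \<union> (fvU U - lvars p)) \<union> ({} \<union> {pat_of p}))
      (App (tm_of_F F) (tm_of_U U)) (codF F)"
    using UApp by (intro typed_App_env_of[where A = "tyU U"]) auto
  moreover have "fvF F \<union> (fvU U - lvars p) = fvU (UApp F U) - lvars p" using UApp by auto
  ultimately show ?case by (simp del: env_of_simps)
next
  case (FVar f)
  then obtain A B where f: "vty f = TLolli A B" by auto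
  have "typed ar {sec_pat (PVar f)} (Var f) (vty f)"
    using typed.with_pat2[of ar "PVar f" "{}" "Var f" "vty f" PUnit] typed.var by auto
  then show ?case using f by (simp add: fun_var_def)
next
  case FPlus
  then show ?case using typed.plus by simp
next
  case (FTimes x)
  have "typed ar {PBang x} (Var x) TReal" using typed.dereliction[of ar x] FTimes by simp
  then have "typed ar ({} \<union> {PBang x} \<union> {} \<union> {}) (App Times (Var x)) (TLolli TReal TReal)"
    using typed.times by (intro typed.app[where A = TReal]) (auto simp: bang_env_def)
  then show ?case using FTimes by (simp add: fun_var_def)
next
  case (FLam p U)
  have "typed ar (env_of (fvU U - lvars p) \<union> {pat_of p}) (tm_of_U U) (tyU U)"
    using FLam by auto
  then show ?case
    using FLam by (auto simp: wf_lpat_def intro!: typed.lam)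
qed simp

section \<open>Vector semantics of \<open>U\<close> and \<open>F\<close>, and its agreement with
  reduction\<close>

subsection \<open>Semantics of \<open>U\<close> and \<open>F\<close>\<close>

primrec vadd :: "ty \<Rightarrow> val \<Rightarrow> val \<Rightarrow> val" where
  "vadd TReal a b = VR (vreal a + vreal b)"
| "vadd (TWith A B) a b = VP (vadd A (vfst a) (vfst b)) (vadd B (vsnd a) (vsnd b))"
| "vadd TTop a b = VU"
| "vadd TOne a b = VU"
| "vadd (TTensor A B) a b = VU"
| "vadd (TBang A) a b = VU"
| "vadd (TLolli A B) a b = VU"

primrec vzero :: "ty \<Rightarrow> val" where
  "vzero TReal = VR 0"
| "vzero (TWith A B) = VP (vzero A) (vzero B)"
| "vzero TTop = VU"
| "vzero TOne = VU"
| "vzero (TTensor A B) = VU"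
| "vzero (TBang A) = VU"
| "vzero (TLolli A B) = VU"

primrec vscale :: "ty \<Rightarrow> real \<Rightarrow> val \<Rightarrow> val" where
  "vscale TReal r a = VR (r * vreal a)"
| "vscale (TWith A B) r a = VP (vscale A r (vfst a)) (vscale B r (vsnd a))"
| "vscale TTop r a = VU"
| "vscale TOne r a = VU"
| "vscale (TTensor A B) r a = VU"
| "vscale (TBang A) r a = VU"
| "vscale (TLolli A B) r a = VU"

primrec bind :: "lpat \<Rightarrow> val \<Rightarrow> (var \<Rightarrow> val) \<Rightarrow> var \<Rightarrow> val" where
  "bind (LVar u) a \<eta> = \<eta>(u := a)"
| "bind (LPair p q) a \<eta> = bind q (vsnd a) (bind p (vfst a) \<eta>)"

text \<open>There are two environments because values contain no functions: \<open>\<phi>\<close>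
  interprets function variables, \<open>\<eta>\<close> all others.\<close>

primrec usem :: "(var \<Rightarrow> val \<Rightarrow> val) \<Rightarrow> (var \<Rightarrow> val) \<Rightarrow> U_tm \<Rightarrow> val"
  and fsem :: "(var \<Rightarrow> val \<Rightarrow> val) \<Rightarrow> (var \<Rightarrow> val) \<Rightarrow> F_tm \<Rightarrow> val \<Rightarrow> val" where
  "usem \<phi> \<eta> (UVar u) = \<eta> u"
| "usem \<phi> \<eta> UZero = VR 0"
| "usem \<phi> \<eta> UTop = VU"
| "usem \<phi> \<eta> (UPair U1 U2) = VP (usem \<phi> \<eta> U1) (usem \<phi> \<eta> U2)"
| "usem \<phi> \<eta> (UApp F U) = fsem \<phi> \<eta> F (usem \<phi> \<eta> U)"
| "fsem \<phi> \<eta> (FVar f) = \<phi> f"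
| "fsem \<phi> \<eta> FPlus = (\<lambda>a. VR (vreal (vfst a) + vreal (vsnd a)))"
| "fsem \<phi> \<eta> (FTimes x) = (\<lambda>a. VR (vreal (\<eta> x) * vreal a))"
| "fsem \<phi> \<eta> (FLam p U) = (\<lambda>a. usem \<phi> (bind p a \<eta>) U)"
| "fsem \<phi> \<eta> (FLet f F G) = fsem (\<phi>(f := fsem \<phi> \<eta> F)) \<eta> G"

lemma bind_outside: "x \<notin> lvars p \<Longrightarrow> bind p a \<eta> x = \<eta> x"
  by (induction p arbitrary: a \<eta>) auto

lemma bind_inside: "x \<in> lvars p \<Longrightarrow> bind p a \<eta> x = bind p a \<eta>' x"
  by (induction p arbitrary: a \<eta> \<eta>') (auto, metis bind_outside)

lemma usem_cong:
  "wfU L U \<Longrightarrow> (\<And>u. u \<in> L \<Longrightarrow> ltype (vty u))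
    \<Longrightarrow> (\<And>x. x \<in> fvU U \<Longrightarrow> (if fun_var x then \<phi> x = \<phi>' x else \<eta> x = \<eta>' x))
    \<Longrightarrow> usem \<phi> \<eta> U = usem \<phi>' \<eta>' U"
  "wfF F \<Longrightarrow> (\<And>x. x \<in> fvF F \<Longrightarrow> (if fun_var x then \<phi> x = \<phi>' x else \<eta> x = \<eta>' x))
    \<Longrightarrow> fsem \<phi> \<eta> F = fsem \<phi>' \<eta>' F"
proof (induction U and F arbitrary: L \<eta> \<eta>' and \<eta> \<eta>')
  case (UVar u)
  then show ?case using ltype_not_fun_var[of u] by force
next
  case (UPair U1 U2)
  have "usem \<phi> \<eta> U1 = usem \<phi>' \<eta>' U1" by (rule UPair.IH[of L]) (use UPair.prems in auto)
  moreover have "usem \<phi> \<eta> U2 = usem \<phi>' \<eta>' U2" by (rule UPair.IH[of L]) (use UPair.prems in auto)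
  ultimately show ?case by simp
next
  case (UApp F U)
  have "usem \<phi> \<eta> U = usem \<phi>' \<eta>' U" by (rule UApp.IH(2)[of L]) (use UApp.prems in auto)
  moreover have "fsem \<phi> \<eta> F = fsem \<phi>' \<eta>' F" by (rule UApp.IH) (use UApp.prems in auto)
  ultimately show ?case by simp
next
  case (FVar f)
  then show ?case by (auto simp: fun_var_def)
next
  case (FTimes x)
  then show ?case by (auto simp: fun_var_def)
next
  case (FLam p U)
  show ?case unfolding fsem.simps
  proof (rule ext, rule FLam.IH)
    fix a x assume x: "x \<in> fvU U"
    show "if fun_var x then \<phi> x = \<phi>' x else bind p a \<eta> x = bind p a \<eta>' x"
    proof (cases "x \<in> lvars p")
      case True
      then have "\<not> fun_var x" using FLam.prems wf_lpat_var ltype_not_fun_var by auto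
      then show ?thesis using bind_inside[OF True] by simp
    next
      case False
      then show ?thesis using x FLam.prems(2)[of x] by (simp add: bind_outside)
    qed
  qed (use FLam.prems wf_lpat_var in auto)
qed auto

text \<open>The arrow clause left out of \<open>realizes\<close>, for maps between first-order types
  given as functions on \<open>val\<close>.\<close>

definition realizes_fun ::
  "('f \<Rightarrow> nat) \<Rightarrow> ('f \<Rightarrow> real list \<Rightarrow> real) \<Rightarrow> ty \<Rightarrow> ty \<Rightarrow> 'f tm \<Rightarrow> (val \<Rightarrow> val) \<Rightarrow> bool" where
  "realizes_fun ar den A B M g \<longleftrightarrow> fv M = {}
     \<and> (\<forall>N a. realizes ar den A N a \<longrightarrow> realizes ar den B (App M N) (g a))"

definition realizes_var ::
  "('f \<Rightarrow> nat) \<Rightarrow> ('f \<Rightarrow> real list \<Rightarrow> real) \<Rightarrow> (var \<Rightarrow> 'f tm) \<Rightarrow> (var \<Rightarrow> val \<Rightarrow> val) \<Rightarrow> (var \<Rightarrow> val)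
    \<Rightarrow> var \<Rightarrow> bool" where
  "realizes_var ar den \<rho> \<phi> \<eta> x \<longleftrightarrow>
     (if fun_var x then realizes_fun ar den (dom_ty (vty x)) (cod_ty (vty x)) (\<rho> x) (\<phi> x)
      else realizes ar den (vty x) (\<rho> x) (\<eta> x))"

lemma realizes_var_closed: "realizes_var ar den \<rho> \<phi> \<eta> x \<Longrightarrow> fv (\<rho> x) = {}"
  by (auto simp: realizes_var_def realizes_fun_def dest: realizes_closed split: if_splits)

text \<open>The counterpart of \<open>Red_pat\<close> that keeps track of values, so that
  substitution in terms and \<open>bind\<close> in the semantics proceed in parallel.\<close>

lemma realizes_lpat:
  "wf_lpat p \<Longrightarrow> realizes ar den (lpat_ty p) N a
    \<Longrightarrow> \<exists>\<sigma>. reds ar den N (pat_val \<sigma> (pat_of p))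
          \<and> (\<forall>x\<in>lvars p. realizes ar den (vty x) (\<sigma> x) (bind p a \<eta> x))"
proof (induction p arbitrary: N a \<eta>)
  case (LVar x)
  then show ?case by (auto intro!: exI[of _ "\<lambda>_. N"])
next
  case (LPair p q)
  then obtain M1 M2 a1 a2 where N: "reds ar den N (With M1 M2)" and a: "a = VP a1 a2"
    "realizes ar den (lpat_ty p) M1 a1" "realizes ar den (lpat_ty q) M2 a2"
    by auto
  obtain s1 where s1: "reds ar den M1 (pat_val s1 (pat_of p))"
    "\<forall>x\<in>lvars p. realizes ar den (vty x) (s1 x) (bind p a1 \<eta> x)"
    using LPair.IH(1)[OF _ a(2), of \<eta>] LPair.prems(1) by auto
  obtain s2 where s2: "reds ar den M2 (pat_val s2 (pat_of q))"
    "\<forall>x\<in>lvars q. realizes ar den (vty x) (s2 x) (bind q a2 (bind p a1 \<eta>) x)"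
    using LPair.IH(2)[OF _ a(3), of "bind p a1 \<eta>"] LPair.prems(1) by auto
  define s where "s = (\<lambda>x. if x \<in> lvars p then s1 x else s2 x)"
  have *: "pat_val s (pat_of p) = pat_val s1 (pat_of p)" "pat_val s (pat_of q) = pat_val s2 (pat_of q)"
    using LPair.prems(1) by (auto simp: s_def intro!: pat_val_cong)
  have "reds ar den N (pat_val s (pat_of (LPair p q)))"
    using rtranclp_trans[OF N reds_With[OF s1(1) s2(1)]] * by simp
  moreover have "\<forall>x\<in>lvars (LPair p q). realizes ar den (vty x) (s x) (bind (LPair p q) a \<eta> x)"
  proof
    fix x assume x: "x \<in> lvars (LPair p q)"
    show "realizes ar den (vty x) (s x) (bind (LPair p q) a \<eta> x)"
    proof (cases "x \<in> lvars p")
      case True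
      then have "x \<notin> lvars q" using LPair.prems(1) by auto
      then show ?thesis using True s1(2) a(1) by (simp add: s_def bind_outside)
    next
      case False
      then show ?thesis using x s2(2) a(1) by (simp add: s_def)
    qed
  qed
  ultimately show ?case by blast
qed

text \<open>Adequacy of the semantics for closed instances: a beta step is matched by
  \<open>bind\<close>, and expansion along reduction carries the claim from the contracted term back
  to the redex.\<close>

lemma realizes_usem:
  fixes \<rho> :: "var \<Rightarrow> 'f tm"
  shows "wfU L U \<Longrightarrow> (\<And>u. u \<in> L \<Longrightarrow> ltype (vty u))
    \<Longrightarrow> (\<And>x. x \<in> fvU U \<Longrightarrow> realizes_var ar den \<rho> \<phi> \<eta> x)
    \<Longrightarrow> realizes ar den (tyU U) (subst \<rho> (tm_of_U U)) (usem \<phi> \<eta> U)"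
  and "wfF F \<Longrightarrow> (\<And>x. x \<in> fvF F \<Longrightarrow> realizes_var ar den \<rho> \<phi> \<eta> x)
    \<Longrightarrow> realizes_fun ar den (domF F) (codF F) (subst \<rho> (tm_of_F F)) (fsem \<phi> \<eta> F)"
proof (induction U and F arbitrary: L \<rho> \<eta> and \<rho> \<eta>)
  case (UVar u)
  then show ?case using ltype_not_fun_var[of u] by (force simp: realizes_var_def)
next
  case (UPair U1 U2)
  have 1: "realizes ar den (tyU U1) (subst \<rho> (tm_of_U U1)) (usem \<phi> \<eta> U1)"
    by (rule UPair.IH[of L]) (use UPair.prems in auto)
  have 2: "realizes ar den (tyU U2) (subst \<rho> (tm_of_U U2)) (usem \<phi> \<eta> U2)"
    by (rule UPair.IH[of L]) (use UPair.prems in auto)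
  show ?case using 1 2 realizes_closed[OF 1] realizes_closed[OF 2] by auto
next
  case (UApp F U)
  have "realizes ar den (tyU U) (subst \<rho> (tm_of_U U)) (usem \<phi> \<eta> U)"
    by (rule UApp.IH(2)[of L]) (use UApp.prems in auto)
  moreover have "realizes_fun ar den (domF F) (codF F) (subst \<rho> (tm_of_F F)) (fsem \<phi> \<eta> F)"
    by (rule UApp.IH) (use UApp.prems in auto)
  ultimately show ?case using UApp.prems by (simp add: realizes_fun_def)
next
  case (FVar f)
  then show ?case by (auto simp: realizes_var_def fun_var_def split: if_splits)
next
  case FPlus
  have "realizes ar den TReal (App Plus N) (VR (vreal (vfst a) + vreal (vsnd a)))"
    if N: "realizes ar den (TWith TReal TReal) N a" for N :: "'f tm" and a
  proof -
    from N obtain M1 M2 r s where *: "reds ar den N (With M1 M2)" "a = VP (VR r) (VR s)"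
      "reds ar den M1 (Num r)" "reds ar den M2 (Num s)" by auto
    have "reds ar den N (With (Num r) (Num s))"
      using rtranclp_trans[OF *(1) reds_With[OF *(3,4)]] .
    then have "reds ar den (App Plus N) (App Plus (With (Num r) (Num s)))" by (intro reds_App) auto
    also have "red ar den \<dots> (Num (r + s))" by (rule red.plus)
    finally show ?thesis using realizes_closed[OF N] *(2) by auto
  qed
  then show ?case by (simp add: realizes_fun_def)
next
  case (FTimes x)
  then have x: "realizes ar den TReal (\<rho> x) (\<eta> x)" by (auto simp: realizes_var_def fun_var_def)
  have "realizes ar den TReal (App (App Times (\<rho> x)) N) (VR (vreal (\<eta> x) * vreal a))"
    if N: "realizes ar den TReal N a" for N :: "'f tm" and a
  proof -
    from N x obtain r s where *: "reds ar den (\<rho> x) (Num r)" "reds ar den N (Num s)"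
      "\<eta> x = VR r" "a = VR s" by auto
    then have "reds ar den (App (App Times (\<rho> x)) N) (App (App Times (Num r)) (Num s))"
      by (intro reds_App) auto
    also have "red ar den \<dots> (Num (r * s))" by (rule red.times)
    finally show ?thesis using realizes_closed[OF N] realizes_closed[OF x] * by auto
  qed
  then show ?case using realizes_closed[OF x] FTimes.prems by (simp add: realizes_fun_def)
next
  case (FLam p U)
  have p: "wf_lpat p" "wfU (lvars p) U" using FLam.prems by auto
  have cl: "fv (\<rho> x) = {}" if "x \<in> fv (tm_of_U U :: 'f tm) - lvars p" for x
    using that realizes_var_closed[OF FLam.prems(2)[of x]] by (simp add: fv_tm_of_U)
  have c: "fv (subst \<rho> (tm_of_F (FLam p U))) = {}" using cl by (intro closed_subst) auto
  have "realizes ar den (tyU U) (App (subst \<rho> (tm_of_F (FLam p U))) N) (usem \<phi> (bind p a \<eta>) U)"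
    if N: "realizes ar den (lpat_ty p) N a" for N a
  proof -
    obtain \<sigma> where \<sigma>: "reds ar den N (pat_val \<sigma> (pat_of p))"
      "\<forall>x\<in>lvars p. realizes ar den (vty x) (\<sigma> x) (bind p a \<eta> x)"
      using realizes_lpat[OF p(1) N] by blast
    have "realizes ar den (tyU U) (subst (\<lambda>x. if x \<in> lvars p then \<sigma> x else \<rho> x) (tm_of_U U))
        (usem \<phi> (bind p a \<eta>) U)"
    proof (rule FLam.IH[OF p(2)])
      fix x assume x: "x \<in> fvU U"
      show "realizes_var ar den (\<lambda>x. if x \<in> lvars p then \<sigma> x else \<rho> x) \<phi> (bind p a \<eta>) x"
      proof (cases "x \<in> lvars p")
        \<comment> \<open>Pattern variables have types in \<open>ltype\<close>, so they are never
          looked up in \<open>\<phi>\<close>.\<close>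
        case True
        then show ?thesis using \<sigma>(2) ltype_not_fun_var[OF wf_lpat_var[OF p(1)]]
          by (auto simp: realizes_var_def)
      next
        case False
        then show ?thesis using x FLam.prems(2)[of x] by (auto simp: realizes_var_def bind_outside)
      qed
    qed (rule wf_lpat_var[OF p(1)])
    moreover have "reds ar den (App (subst \<rho> (Lam (pat_of p) (tm_of_U U))) N)
        (subst (\<lambda>x. if x \<in> lvars p then \<sigma> x else \<rho> x) (tm_of_U U))"
    proof (rule reds_beta_closed)
      show "linear_pat (pat_of p)" using p by (simp add: wf_lpat_def)
      show "fv (\<sigma> x) = {}" if "x \<in> lvars p" for x using \<sigma>(2) that realizes_closed by blast
    qed (use cl \<sigma>(1) in auto)
    moreover have "fv (App (subst \<rho> (tm_of_F (FLam p U))) N) = {}" using c realizes_closed[OF N] by simp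
    ultimately show ?thesis using realizes_expand by (metis tm_of_F.simps(4))
  qed
  then show ?case using c by (simp add: realizes_fun_def)
qed auto

section \<open>Semantics of \<open>P\<close> and \<open>R\<close>: a primal value together with a
  linear map\<close>

subsection \<open>Semantics of \<open>P\<close> and \<open>R\<close>\<close>

primrec tyP :: "'f P_tm \<Rightarrow> ty" where
  "tyP (PVal x) = vty x"
| "tyP (PNum r) = TReal"
| "tyP POne = TOne"
| "tyP (PFun f xs) = TReal"
| "tyP (PLet x Q P) = tyP P"
| "tyP (PLetOne z P) = tyP P"

primrec primR :: "'f R_tm \<Rightarrow> ty" where
  "primR (RPair P F) = tyP P"
| "primR (RLet x f R S) = primR S"
| "primR (RLetF f F S) = primR S"
| "primR (RLetP x P S) = primR S"
| "primR (RLetOne z S) = primR S"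

primrec domR :: "'f R_tm \<Rightarrow> ty" where
  "domR (RPair P F) = domF F"
| "domR (RLet x f R S) = domR S"
| "domR (RLetF f F S) = domR S"
| "domR (RLetP x P S) = domR S"
| "domR (RLetOne z S) = domR S"

primrec codR :: "'f R_tm \<Rightarrow> ty" where
  "codR (RPair P F) = codF F"
| "codR (RLet x f R S) = codR S"
| "codR (RLetF f F S) = codR S"
| "codR (RLetP x P S) = codR S"
| "codR (RLetOne z S) = codR S"

text \<open>Only the constructs that occur in the image of \<open>delta\<close> are considered.\<close>

primrec wfP :: "('f \<Rightarrow> nat) \<Rightarrow> 'f P_tm \<Rightarrow> bool" where
  "wfP ar (PVal x) = (first_order (vty x))"
| "wfP ar (PNum r) = True"
| "wfP ar POne = True"
| "wfP ar (PFun f xs) = (length xs = ar f \<and> xs \<noteq> [] \<and> (\<forall>x\<in>set xs. vty x = TReal))"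
| "wfP ar (PLet x Q P) = False"
| "wfP ar (PLetOne z P) = False"

text \<open>In \<open>RLet\<close> the bound term has no free function variable. This fits
  \<open>delta\<close>, which translates subexpressions to terms whose free variables are all
  primal, and it ensures that \<open>R\<close> and \<open>S\<close> never compete for a linear
  variable.\<close>

primrec wfR :: "('f \<Rightarrow> nat) \<Rightarrow> 'f R_tm \<Rightarrow> bool" where
  "wfR ar (RPair P F) = (wfP ar P \<and> wfF F)"
| "wfR ar (RLet x f R S) = (wfR ar R \<and> wfR ar S \<and> first_order (vty x) \<and> vty x = primR R
     \<and> vty f = TLolli (domR R) (codR R) \<and> (\<forall>g\<in>fvR R. \<not> fun_var g))"
| "wfR ar (RLetF f F S) = False"
| "wfR ar (RLetP x P S) = False"
| "wfR ar (RLetOne z S) = (vty z = TOne \<and> wfR ar S)"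

lemma first_order_not_fun_var: "first_order (vty x) \<Longrightarrow> \<not> fun_var x"
  by (auto simp: fun_var_def)

lemma wfP_not_fun_var: "wfP ar P \<Longrightarrow> x \<in> fvP P \<Longrightarrow> \<not> fun_var x"
  by (cases P) (auto simp: fun_var_def)

lemma finite_fvP [simp]: "finite (fvP P)"
  by (induction P) auto

lemma finite_fvR [simp]: "finite (fvR R)"
  by (induction R) auto

lemma fv_tensor_tm: "fv (tensor_tm Ms) = (\<Union>M\<in>set Ms. fv M)"
  by (induction Ms rule: tensor_tm.induct) auto

lemma fv_tm_of_P: "fv (tm_of_P P) = fvP P"
  by (induction P) (auto simp: fv_tensor_tm)

lemma fv_tm_of_R: "fv (tm_of_R R) = fvR R"
  by (induction R) (auto simp: fv_tm_of_P fv_tm_of_U)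

lemma typed_tensor_vars:
  "xs \<noteq> [] \<Longrightarrow> (\<forall>x\<in>set xs. vty x = TReal)
    \<Longrightarrow> typed ar (env_of (set xs)) (tensor_tm (map (\<lambda>x. Bang (Var x)) xs))
          (tensor_ty (replicate (length xs) (TBang TReal)))"
proof (induction xs rule: induct_list012)
  case (2 x)
  have "typed ar {PBang x} (Bang (Var x)) (TBang (vty x))"
    by (intro typed.bang typed.dereliction) (simp add: bang_env_def)
  then show ?case using 2 by (simp add: fun_var_def)
next
  case (3 x y xs)
  have "typed ar {PBang x} (Bang (Var x)) (TBang (vty x))"
    by (intro typed.bang typed.dereliction) (simp add: bang_env_def)
  then have "typed ar (env_of {x}) (Bang (Var x)) (TBang TReal)" using 3 by (simp add: fun_var_def)
  then have "typed ar (env_of ({x} \<union> set (y # xs)))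
      (Tensor (Bang (Var x)) (tensor_tm (map (\<lambda>x. Bang (Var x)) (y # xs))))
      (TTensor (TBang TReal) (tensor_ty (replicate (length (y # xs)) (TBang TReal))))"
    using 3 by (intro typed_Tensor_env_of) (auto simp: fun_var_def)
  moreover have "{x} \<union> set (y # xs) = set (x # y # xs)" by auto
  ultimately show ?case by (simp del: env_of_simps)
qed auto

lemma wfP_typed: "wfP ar P \<Longrightarrow> typed ar (env_of (fvP P)) (tm_of_P P) (TBang (tyP P))"
proof (cases P)
  case (PVal x)
  assume "wfP ar P"
  then have "\<not> fun_var x" using PVal first_order_not_fun_var by auto
  moreover have "typed ar {PBang x} (Bang (Var x)) (TBang (vty x))"
    by (intro typed.bang typed.dereliction) (simp add: bang_env_def)
  ultimately show ?thesis using PVal by simp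
next
  case (PFun f xs)
  assume P: "wfP ar P"
  have "typed ar (env_of ({} \<union> set xs) \<union> ({} \<union> {}))
      (App (Fun f) (tensor_tm (map (\<lambda>x. Bang (Var x)) xs))) (TBang TReal)"
  proof (rule typed_App_env_of)
    show "typed ar (env_of {} \<union> {}) (Fun f)
        (TLolli (tensor_ty (replicate (ar f) (TBang TReal))) (TBang TReal))"
      using typed.fun_ by simp
    show "typed ar (env_of (set xs) \<union> {}) (tensor_tm (map (\<lambda>x. Bang (Var x)) xs))
        (tensor_ty (replicate (ar f) (TBang TReal)))"
      using typed_tensor_vars[of xs ar] PFun P by simp
  qed auto
  then show ?thesis using PFun by simp
qed (auto intro: typed.bang typed.num typed.unit simp: bang_env_def)

theorem wfR_typed:
  "wfR ar R \<Longrightarrow> typed ar (env_of (fvR R)) (tm_of_R R)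
     (TTensor (TBang (primR R)) (sec_ty (TLolli (domR R) (codR R))))"
proof (induction R)
  case (RPair P F)
  have F: "typed ar (env_of (fvF F)) (tm_of_F F) (TLolli (domF F) (codF F))"
    using RPair wfU_typed by auto
  have "typed ar (env_of ({} \<union> fvF F) \<union> {}) Unit TOne"
    by (rule typed_weaken) (auto intro: typed.unit)
  then have "typed ar (env_of (fvF F)) (sec_tm (tm_of_F F)) (sec_ty (TLolli (domF F) (codF F)))"
    using F by (intro typed.with_) auto
  then have "typed ar (env_of (fvP P \<union> fvF F)) (Tensor (tm_of_P P) (sec_tm (tm_of_F F)))
      (TTensor (TBang (tyP P)) (sec_ty (TLolli (domF F) (codF F))))"
    using RPair wfP_typed[of ar P] wfP_not_fun_var[of ar P] by (intro typed_Tensor_env_of) auto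
  then show ?case by simp
next
  case (RLet x f R S)
  let ?T = "TTensor (TBang (primR S)) (sec_ty (TLolli (domR S) (codR S)))"
  let ?\<Delta> = "env_of (fvR S - {x, f})"
  have x: "\<not> fun_var x" "fun_var f"
    using RLet.prems first_order_not_fun_var[of x] by (auto simp: fun_var_def)
  then have x': "x \<noteq> f" by auto
  note x = x x'
  have "typed ar (env_of (fvR S \<union> {x, f}) \<union> {}) (tm_of_R S) ?T"
    using RLet by (intro typed_weaken) auto
  moreover have "env_of (fvR S \<union> {x, f}) = insert (PBang x) (insert (sec_pat (PVar f)) ?\<Delta>)"
  proof -
    have "fvR S \<union> {x, f} = insert x (insert f (fvR S - {x, f}))" by auto
    then show ?thesis using x env_of_simps(3) by metis
  qed
  ultimately have "typed ar (insert (PTensor (PBang x) (sec_pat (PVar f))) ?\<Delta>) (tm_of_R S) ?T"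
    using x by (intro typed.tensor_pat) auto
  then have S: "typed ar ?\<Delta> (Lam (PTensor (PBang x) (sec_pat (PVar f))) (tm_of_R S))
      (TLolli (pat_ty (PTensor (PBang x) (sec_pat (PVar f)))) ?T)"
    using x by (intro typed.lam) auto
  have "typed ar (env_of ((fvR S - {x, f}) \<union> fvR R) \<union> ({} \<union> {}))
      (App (Lam (PTensor (PBang x) (sec_pat (PVar f))) (tm_of_R S)) (tm_of_R R)) ?T"
    by (rule typed_App_env_of) (use S RLet in auto)
  moreover have "(fvR S - {x, f}) \<union> fvR R = fvR (RLet x f R S)" by auto
  ultimately show ?case by simp
next
  case (RLetOne z S)
  let ?T = "TTensor (TBang (primR S)) (sec_ty (TLolli (domR S) (codR S)))"
  have "typed ar (env_of (fvR S)) (Lam PUnit (tm_of_R S)) (TLolli (pat_ty PUnit) ?T)"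
    using RLetOne by (intro typed.lam typed.unit_pat) auto
  moreover have "typed ar (env_of {z}) (Var z) TOne"
    using RLetOne typed.dereliction[of ar z] by (simp add: fun_var_def)
  ultimately have "typed ar (env_of (fvR S \<union> {z}) \<union> ({} \<union> {})) (App (Lam PUnit (tm_of_R S)) (Var z)) ?T"
    using RLetOne by (intro typed_App_env_of) (auto simp: fun_var_def)
  then show ?case by simp
qed auto

primrec psem :: "('f \<Rightarrow> real list \<Rightarrow> real) \<Rightarrow> (var \<Rightarrow> val) \<Rightarrow> 'f P_tm \<Rightarrow> val" where
  "psem den \<eta> (PVal x) = \<eta> x"
| "psem den \<eta> (PNum r) = VR r"
| "psem den \<eta> POne = VU"
| "psem den \<eta> (PFun f xs) = VR (den f (map (\<lambda>x. vreal (\<eta> x)) xs))"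
| "psem den \<eta> (PLet x Q P) = psem den (\<eta>(x := psem den \<eta> Q)) P"
| "psem den \<eta> (PLetOne z P) = psem den \<eta> P"

primrec rprim :: "('f \<Rightarrow> real list \<Rightarrow> real) \<Rightarrow> (var \<Rightarrow> val) \<Rightarrow> 'f R_tm \<Rightarrow> val" where
  "rprim den \<eta> (RPair P F) = psem den \<eta> P"
| "rprim den \<eta> (RLet x f R S) = rprim den (\<eta>(x := rprim den \<eta> R)) S"
| "rprim den \<eta> (RLetF f F S) = rprim den \<eta> S"
| "rprim den \<eta> (RLetP x P S) = rprim den (\<eta>(x := psem den \<eta> P)) S"
| "rprim den \<eta> (RLetOne z S) = rprim den \<eta> S"

primrec rfun :: "('f \<Rightarrow> real list \<Rightarrow> real) \<Rightarrow> (var \<Rightarrow> val \<Rightarrow> val) \<Rightarrow> (var \<Rightarrow> val) \<Rightarrow> 'f R_tm \<Rightarrow> val \<Rightarrow> val"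
where
  "rfun den \<phi> \<eta> (RPair P F) = fsem \<phi> \<eta> F"
| "rfun den \<phi> \<eta> (RLet x f R S) =
     rfun den (\<phi>(f := rfun den \<phi> \<eta> R)) (\<eta>(x := rprim den \<eta> R)) S"
| "rfun den \<phi> \<eta> (RLetF f F S) = rfun den (\<phi>(f := fsem \<phi> \<eta> F)) \<eta> S"
| "rfun den \<phi> \<eta> (RLetP x P S) = rfun den \<phi> (\<eta>(x := psem den \<eta> P)) S"
| "rfun den \<phi> \<eta> (RLetOne z S) = rfun den \<phi> \<eta> S"

lemma reds_tensor_nums:
  fixes \<rho> :: "var \<Rightarrow> 'f tm"
  shows "(\<forall>x\<in>set xs. realizes ar den TReal (\<rho> x) (\<eta> x))
    \<Longrightarrow> reds ar den (tensor_tm (map (\<lambda>x. Bang (\<rho> x)) xs))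
          (tensor_tm (map (\<lambda>r. Bang (Num r)) (map (\<lambda>x. vreal (\<eta> x)) xs)))"
proof (induction xs rule: induct_list012)
  case (2 x)
  then have "reds ar den (\<rho> x) (Num (vreal (\<eta> x)))" by auto
  then show ?case by (auto intro: reds_Bang)
next
  case (3 x y xs)
  have "reds ar den (\<rho> x) (Num (vreal (\<eta> x)))" using 3(3) by fastforce
  moreover have "reds ar den (tensor_tm (map (\<lambda>x. Bang (\<rho> x)) (y # xs)))
          (tensor_tm (map (\<lambda>r. Bang (Num r)) (map (\<lambda>x. vreal (\<eta> x)) (y # xs))))"
    by (rule 3(2)) (use 3(3) in auto)
  ultimately show ?case by (auto intro!: reds_Tensor reds_Bang)
qed auto

lemma subst_tensor_tm: "subst \<rho> (tensor_tm Ms) = tensor_tm (map (subst \<rho>) Ms)"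
  by (induction Ms rule: tensor_tm.induct) auto

lemma realizes_psem:
  assumes "wfP ar P" "\<And>x. x \<in> fvP P \<Longrightarrow> realizes ar den (vty x) (\<rho> x) (\<eta> x)"
  shows "realizes ar den (TBang (tyP P)) (subst \<rho> (tm_of_P P)) (psem den \<eta> P)"
proof (cases P)
  case (PVal x)
  then have x: "realizes ar den (vty x) (\<rho> x) (\<eta> x)" using assms by auto
  then show ?thesis using PVal realizes_closed[OF x] by auto
next
  case (PFun f xs)
  have xs: "\<forall>x\<in>set xs. realizes ar den TReal (\<rho> x) (\<eta> x)" using assms PFun by force
  let ?rs = "map (\<lambda>x. vreal (\<eta> x)) xs"
  have c: "fv (subst \<rho> (tm_of_P P)) = {}"
    using xs PFun realizes_closed by (intro closed_subst) (auto simp: fv_tensor_tm)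
  have "subst \<rho> (tm_of_P P) = App (Fun f) (tensor_tm (map (\<lambda>x. Bang (\<rho> x)) xs))"
    by (simp add: PFun subst_tensor_tm comp_def)
  also have "reds ar den \<dots> (App (Fun f) (tensor_tm (map (\<lambda>r. Bang (Num r)) ?rs)))"
    using reds_tensor_nums[OF xs] by (intro reds_App) auto
  also have "red ar den \<dots> (Bang (Num (den f ?rs)))"
    using assms(1) PFun by (intro red.fun_) auto
  finally show ?thesis using c PFun by auto
qed (use assms in auto)

text \<open>The type of \<open>R\<close> contains an arrow and is thus out of reach of
  \<open>realizes\<close>. So the statement exposes the form \<open>(P, \<section>F)\<close> that
  \<open>R\<close> reduces to and speaks of the two halves separately.\<close>

theorem realizes_rfun:
  fixes \<rho> :: "var \<Rightarrow> 'f tm"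
  shows "wfR ar R \<Longrightarrow> (\<And>x. x \<in> fvR R \<Longrightarrow> realizes_var ar den \<rho> \<phi> \<eta> x)
    \<Longrightarrow> \<exists>P F. reds ar den (subst \<rho> (tm_of_R R)) (Tensor P (sec_tm F))
       \<and> realizes ar den (TBang (primR R)) P (rprim den \<eta> R)
       \<and> realizes_fun ar den (domR R) (codR R) F (rfun den \<phi> \<eta> R)"
proof (induction R arbitrary: \<rho> \<phi> \<eta>)
  case (RPair P F)
  have "realizes ar den (vty x) (\<rho> x) (\<eta> x)" if "x \<in> fvP P" for x
    using that RPair wfP_not_fun_var[of ar P x] by (force simp: realizes_var_def)
  then have "realizes ar den (TBang (tyP P)) (subst \<rho> (tm_of_P P)) (psem den \<eta> P)"
    using RPair by (intro realizes_psem) auto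
  moreover have "realizes_fun ar den (domF F) (codF F) (subst \<rho> (tm_of_F F)) (fsem \<phi> \<eta> F)"
    using RPair by (intro realizes_usem) auto
  ultimately show ?case
    by (intro exI[of _ "subst \<rho> (tm_of_P P)"] exI[of _ "subst \<rho> (tm_of_F F)"]) auto
next
  case (RLet x f R S)
  have x: "\<not> fun_var x" "fun_var f"
    using RLet.prems first_order_not_fun_var[of x] by (auto simp: fun_var_def)
  then have x': "x \<noteq> f" by auto
  note x = x x'
  obtain P F where R: "reds ar den (subst \<rho> (tm_of_R R)) (Tensor P (sec_tm F))"
    "realizes ar den (TBang (primR R)) P (rprim den \<eta> R)"
    "realizes_fun ar den (domR R) (codR R) F (rfun den \<phi> \<eta> R)"
    using RLet.IH(1)[of \<rho> \<phi> \<eta>] RLet.prems by (auto simp del: realizes.simps)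
  obtain P' where P': "reds ar den P (Bang P')" "realizes ar den (primR R) P' (rprim den \<eta> R)"
    using R(2) by auto
  let ?p = "PTensor (PBang x) (sec_pat (PVar f))"
  let ?\<sigma> = "\<lambda>y. if y = x then P' else F"
  let ?\<rho> = "\<lambda>y. if y \<in> pvars ?p then ?\<sigma> y else \<rho> y"
  \<comment> \<open>The first component is reduced as well, since the pattern \<open>!x\<close>
    matches only a term of the form \<open>Bang\<close>.\<close>
  have "reds ar den (subst \<rho> (tm_of_R R)) (pat_val ?\<sigma> ?p)"
    using rtranclp_trans[OF R(1) reds_Tensor[OF P'(1) rtranclp.rtrancl_refl]] x by simp
  note * = this
  have r: "reds ar den (subst \<rho> (tm_of_R (RLet x f R S))) (subst ?\<rho> (tm_of_R S))"
  proof -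
    have "fv (\<rho> y) = {}" if "y \<in> fv (tm_of_R S) - pvars ?p" for y
      using that realizes_var_closed[OF RLet.prems(2)[of y]] by (simp add: fv_tm_of_R)
    moreover have "fv (?\<sigma> y) = {}" for y
      using R(3) realizes_closed[OF P'(2)] by (simp add: realizes_fun_def)
    ultimately show ?thesis
      using reds_beta_closed[of ?p ?\<sigma> "tm_of_R S" \<rho> ar den "subst \<rho> (tm_of_R R)"]
        * x by simp
  qed
  have "realizes_var ar den ?\<rho> (\<phi>(f := rfun den \<phi> \<eta> R)) (\<eta>(x := rprim den \<eta> R)) y"
    if "y \<in> fvR S" for y
    using that x R(3) P'(2) RLet.prems(1) RLet.prems(2)[of y] by (auto simp: realizes_var_def)
  moreover have "wfR ar S" using RLet.prems(1) by simp
  ultimately obtain P2 F2 where "reds ar den (subst ?\<rho> (tm_of_R S)) (Tensor P2 (sec_tm F2))"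
    "realizes ar den (TBang (primR S)) P2 (rprim den (\<eta>(x := rprim den \<eta> R)) S)"
    "realizes_fun ar den (domR S) (codR S) F2
       (rfun den (\<phi>(f := rfun den \<phi> \<eta> R)) (\<eta>(x := rprim den \<eta> R)) S)"
    using RLet.IH(2)[of ?\<rho> "\<phi>(f := rfun den \<phi> \<eta> R)" "\<eta>(x := rprim den \<eta> R)"] by blast
  then show ?case
    using rtranclp_trans[OF r]
    by (simp only: rprim.simps rfun.simps primR.simps domR.simps codR.simps) blast
next
  case (RLetOne z S)
  have "realizes ar den TOne (\<rho> z) (\<eta> z)"
    using RLetOne.prems(2)[of z] RLetOne.prems(1) by (auto simp: realizes_var_def fun_var_def)
  moreover have "fv (\<rho> y) = {}" if "y \<in> fvR S" for y
    using that realizes_var_closed[OF RLetOne.prems(2)[of y]] by simp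
  ultimately have "reds ar den (subst \<rho> (tm_of_R (RLetOne z S))) (subst \<rho> (tm_of_R S))"
    using reds_beta_closed[of PUnit \<rho> "tm_of_R S" \<rho> ar den "\<rho> z"]
    by (auto simp: fv_tm_of_R)
  note r = this
  obtain P F where "reds ar den (subst \<rho> (tm_of_R S)) (Tensor P (sec_tm F))"
    "realizes ar den (TBang (primR S)) P (rprim den \<eta> S)"
    "realizes_fun ar den (domR S) (codR S) F (rfun den \<phi> \<eta> S)"
    using RLetOne.IH[of \<rho> \<phi> \<eta>] RLetOne.prems by (auto simp del: realizes.simps)
  then show ?case
    using rtranclp_trans[OF r]
    by (simp only: rprim.simps rfun.simps primR.simps domR.simps codR.simps) blast
qed auto

section \<open>Existence of fresh names; renaming of linear variables\<close>

subsection \<open>Fresh variables and renamings\<close>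

lemma fresh_spec:
  assumes "finite X" shows "vty (fresh X A) = A \<and> fresh X A \<notin> X"
proof -
  have "inj (\<lambda>n. V (Aux n) A)" by (auto intro: injI)
  then have "infinite (range (\<lambda>n. V (Aux n) A))" using finite_imageD infinite_UNIV_nat by blast
  then obtain x where "x \<in> range (\<lambda>n. V (Aux n) A) - X"
    using assms by (metis Diff_infinite_finite finite.emptyI ex_in_conv)
  then have "vty x = A \<and> x \<notin> X" by auto
  then have "\<exists>x. vty x = A \<and> x \<notin> X" ..
  then show ?thesis unfolding fresh_def by (rule someI_ex)
qed

definition renaming :: "(var \<rightharpoonup> var) \<Rightarrow> var set \<Rightarrow> var set \<Rightarrow> bool" where
  "renaming \<alpha> S X \<longleftrightarrow> dom \<alpha> = S \<and> inj_on \<alpha> S \<and> ran \<alpha> \<inter> X = {}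
     \<and> (\<forall>x y. \<alpha> x = Some y \<longrightarrow> vty y = vty x)"

lemma fresh_ren_spec:
  assumes "finite X" "finite S" shows "renaming (fresh_ren X S) S X"
proof -
  have "\<exists>\<alpha>. renaming \<alpha> S X"
    using assms(2)
  proof induction
    case empty
    then show ?case by (intro exI[of _ Map.empty]) (simp add: renaming_def)
  next
    case (insert x S)
    then obtain \<alpha> where \<alpha>: "renaming \<alpha> S X" by auto
    have fin: "finite (X \<union> ran \<alpha>)" using assms(1) insert(1) \<alpha>
      by (simp add: finite_ran renaming_def)
    define y where "y = fresh (X \<union> ran \<alpha>) (vty x)"
    have y: "vty y = vty x" "y \<notin> X" "y \<notin> ran \<alpha>" using fresh_spec[OF fin] by (auto simp: y_def)
    have "inj_on (\<alpha>(x \<mapsto> y)) (insert x S)"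
      using \<alpha> y(3) insert(2) by (force simp: renaming_def inj_on_def ran_def)
    then have "renaming (\<alpha>(x \<mapsto> y)) (insert x S) X"
      using \<alpha> y insert(2) by (auto simp: renaming_def ran_def)
    then show ?case by blast
  qed
  then show ?thesis unfolding fresh_ren_def renaming_def by (rule someI_ex)
qed

lemma ren_out: "x \<notin> dom \<alpha> \<Longrightarrow> ren \<alpha> x = x"
  by (auto simp: ren_def split: option.splits)

lemma renaming_vty: "renaming \<alpha> S X \<Longrightarrow> vty (ren \<alpha> x) = vty x"
  by (auto simp: ren_def renaming_def split: option.splits)

text \<open>Renamed variables leave \<open>X\<close> and the others stay in it, so two variables of
  \<open>X\<close> can collide only if both are renamed, and there \<open>\<alpha>\<close> is
  injective.\<close>

lemma renaming_inj: "renaming \<alpha> S X \<Longrightarrow> inj_on (ren \<alpha>) X"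
  unfolding inj_on_def
proof (intro ballI impI)
  fix x y assume \<alpha>: "renaming \<alpha> S X" and xy: "x \<in> X" "y \<in> X" "ren \<alpha> x = ren \<alpha> y"
  have r: "\<alpha> z = Some w \<Longrightarrow> w \<notin> X" for z w using \<alpha> by (auto simp: renaming_def ran_def)
  show "x = y"
  proof (cases "\<alpha> x")
    case None
    with xy r show ?thesis by (auto simp: ren_def split: option.splits)
  next
    case (Some w)
    with xy r have "\<alpha> y = Some w" by (auto simp: ren_def split: option.splits)
    with Some \<alpha> show ?thesis by (auto simp: renaming_def inj_on_def domI)
  qed
qed

lemma lvars_ren_lpat: "lvars (ren_lpat \<alpha> p) = ren \<alpha> ` lvars p"
  by (induction p) auto

lemma wf_ren_lpat: "wf_lpat p \<Longrightarrow> renaming \<alpha> S X \<Longrightarrow> lvars p \<subseteq> X \<Longrightarrow> wf_lpat (ren_lpat \<alpha> p)"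
proof (induction p)
  case (LPair p q)
  have "ren \<alpha> ` lvars p \<inter> ren \<alpha> ` lvars q = ren \<alpha> ` (lvars p \<inter> lvars q)"
    using LPair.prems renaming_inj[of \<alpha> S X] by (intro inj_on_image_Int[symmetric]) auto
  then show ?case using LPair by (simp add: lvars_ren_lpat)
qed (simp add: renaming_vty)

lemma ren_id: "dom \<alpha> \<inter> fvU U = {} \<Longrightarrow> renU \<alpha> U = U" "dom \<alpha> \<inter> fvF F = {} \<Longrightarrow> renF \<alpha> F = F"
proof (induction U and F arbitrary: \<alpha> and \<alpha>)
  case (FLam p U)
  then have "dom (\<alpha> |` (- lvars p)) \<inter> fvU U = {}" by auto
  then show ?case using FLam.IH by simp
next
  case (FLet f F G)
  then have "dom (\<alpha>(f := None)) \<inter> fvF G = {}" "dom \<alpha> \<inter> fvF F = {}" by auto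
  then show ?case using FLet.IH by (simp del: dom_fun_upd)
qed (simp_all add: ren_out Int_Un_distrib)

text \<open>Only linear variables are renamed, and these do not occur in function position; hence
  renaming leaves every \<open>F\<close> applied inside \<open>U\<close> unchanged.\<close>

lemma renU_wf:
  assumes \<alpha>: "renaming \<alpha> S X" "S \<subseteq> L" "L \<subseteq> X"
  shows "wfU L U \<Longrightarrow> varsU U \<subseteq> X
    \<Longrightarrow> wfU (ren \<alpha> ` L) (renU \<alpha> U) \<and> tyU (renU \<alpha> U) = tyU U \<and> fvU (renU \<alpha> U) = ren \<alpha> ` fvU U"
proof (induction U rule: U_tm.induct[where ?P2.0 = "\<lambda>_. True"])
  case (UVar u)
  then show ?case by (simp add: renaming_vty[OF \<alpha>(1)])
next
  case (UApp F U)
  have d: "dom \<alpha> \<inter> fvF F = {}" using UApp.prems \<alpha> by (auto simp: renaming_def)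
  then have F: "renF \<alpha> F = F" by (rule ren_id)
  have f: "ren \<alpha> x = x" if "x \<in> fvF F" for x using that d by (intro ren_out) auto
  have fX: "fvF F \<subseteq> X" using UApp.prems(2) fvU_varsU(2)[of F] by auto
  have inj: "inj_on (ren \<alpha>) X" by (rule renaming_inj[OF \<alpha>(1)])
  have UX: "fvU U \<subseteq> X" using UApp.prems(2) fvU_varsU(1)[of U] by auto
  have rf: "ren \<alpha> ` fvF F = fvF F" using f by auto
  have "ren \<alpha> ` fvF F \<inter> ren \<alpha> ` L = ren \<alpha> ` (fvF F \<inter> L)"
    using inj_on_image_Int[OF inj fX \<alpha>(3)] by simp
  then have "fvF F \<inter> ren \<alpha> ` L = {}" using UApp.prems rf by simp
  moreover have "ren \<alpha> ` fvF F \<inter> ren \<alpha> ` fvU U = ren \<alpha> ` (fvF F \<inter> fvU U)"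
    using inj_on_image_Int[OF inj fX UX] by simp
  then have "fvF F \<inter> ren \<alpha> ` fvU U = fvF F \<inter> fvU U" using f rf by auto
  moreover note rf
  ultimately show ?case using UApp F by (auto simp: image_Un)
qed auto

section \<open>The vector operations as terms\<close>

subsection \<open>Zero, sum and product\<close>

lemma zeroU_props:
  "ltype H \<Longrightarrow> fvU (zeroU H) = {} \<and> wfU L (zeroU H) \<and> tyU (zeroU H) = H
     \<and> usem \<phi> \<eta> (zeroU H) = vzero H"
  by (induction H) auto

lemma plusF_props:
  "ltype H \<Longrightarrow> fvF (plusF H) = {} \<and> wfF (plusF H) \<and> domF (plusF H) = TWith H H \<and> codF (plusF H) = H"
  by (induction H) (auto simp: Let_def)

lemma fsem_plusF: "ltype H \<Longrightarrow> fsem \<phi> \<eta> (plusF H) a = vadd H (vfst a) (vsnd a)"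
  by (induction H arbitrary: a \<eta>) (auto simp: Let_def)

lemma timesF_props:
  "ltype H \<Longrightarrow> vty x = TReal \<Longrightarrow> fvF (timesF H x) \<subseteq> {x} \<and> wfF (timesF H x)
     \<and> domF (timesF H x) = H \<and> codF (timesF H x) = H"
  "ltype H \<Longrightarrow> fsem \<phi> \<eta> (timesF H x) a = vscale H (vreal (\<eta> x)) a"
proof (induction H arbitrary: a \<eta>)
  case TTop
  {
    case 1
    show ?case using fresh_spec[of "{x}" TTop] by simp
  next
    case 2
    show ?case by simp
  }
next
  case (TWith H K)
  \<comment> \<open>The bound names \<open>h\<close> and \<open>k\<close> differ from
    \<open>x\<close>, so binding them does not change the scalar.\<close>
  define h where "h = fresh {x} H"
  define k where "k = fresh {x, h} K"
  have h: "vty h = H" "h \<noteq> x" using fresh_spec[of "{x}" H] by (auto simp: h_def)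
  have k: "vty k = K" "k \<noteq> x" "k \<noteq> h" using fresh_spec[of "{x, h}" K] by (auto simp: k_def)
  have T: "timesF (TWith H K) x = FLam (LPair (LVar h) (LVar k))
        (UPair (UApp (timesF H x) (UVar h)) (UApp (timesF K x) (UVar k)))"
    by (simp add: h_def k_def Let_def)
  {
    case 1
    then have IH: "fvF (timesF H x) \<subseteq> {x}" "wfF (timesF H x)" "domF (timesF H x) = H"
      "codF (timesF H x) = H" "fvF (timesF K x) \<subseteq> {x}" "wfF (timesF K x)"
      "domF (timesF K x) = K" "codF (timesF K x) = K"
      using TWith by auto
    show ?case unfolding T using IH h k 1 by auto
  next
    case 2
    then show ?case unfolding T using TWith(2,4) h k by auto
  }
qed auto

section \<open>Patterns restricted to the variables in use, and the recombining term
  \<open>nu\<close>\<close>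

subsection \<open>Restriction of patterns\<close>

text \<open>The type of the pattern \<open>\<alpha>\<langle>p\<rangle>\<close> for a renaming
  \<open>\<alpha>\<close> with domain \<open>S\<close>; it depends on \<open>\<alpha>\<close> only
  through its domain.\<close>

primrec restr_ty :: "var set \<Rightarrow> lpat \<Rightarrow> ty" where
  "restr_ty S (LVar u) = (if u \<in> S then vty u else TTop)"
| "restr_ty S (LPair p1 p2) =
     (if lvars p1 \<inter> S \<noteq> {} then
        if lvars p2 \<inter> S \<noteq> {} then TWith (restr_ty S p1) (restr_ty S p2) else restr_ty S p1
      else if lvars p2 \<inter> S \<noteq> {} then restr_ty S p2 else TTop)"

text \<open>\<open>restr_val S p v u\<close> is the component at \<open>u\<close> of a value \<open>v\<close> for the restriction of \<open>p\<close> to \<open>S\<close>.\<close>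

primrec restr_val :: "var set \<Rightarrow> lpat \<Rightarrow> val \<Rightarrow> var \<Rightarrow> val" where
  "restr_val S (LVar u) v x = v"
| "restr_val S (LPair p1 p2) v x =
     (if lvars p1 \<inter> S \<noteq> {} then
        if lvars p2 \<inter> S \<noteq> {} then
          if x \<in> lvars p1 then restr_val S p1 (vfst v) x else restr_val S p2 (vsnd v) x
        else restr_val S p1 v x
      else restr_val S p2 v x)"

lemma restr_cong:
  "lvars p \<inter> S = lvars p \<inter> S' \<Longrightarrow> restr_ty S p = restr_ty S' p \<and> restr_val S p = restr_val S' p"
proof (induction p)
  case (LVar u)
  then have "u \<in> S \<longleftrightarrow> u \<in> S'" by auto
  then show ?case by (simp add: fun_eq_iff)
next
  case (LPair p1 p2)
  have 1: "lvars p1 \<inter> S = lvars p1 \<inter> S'" "lvars p2 \<inter> S = lvars p2 \<inter> S'" using LPair.prems by auto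
  show ?case using LPair.IH(1)[OF 1(1)] LPair.IH(2)[OF 1(2)] 1 by (simp add: fun_eq_iff)
qed

lemma restr_ty_empty: "lvars p \<inter> S = {} \<Longrightarrow> restr_ty S p = TTop"
  by (cases p) auto

lemma restr_ty_single: "u \<in> lvars p \<Longrightarrow> wf_lpat p \<Longrightarrow> restr_ty {u} p = vty u"
  by (induction p) auto

lemma restr_val_single: "u \<in> lvars p \<Longrightarrow> wf_lpat p \<Longrightarrow> restr_val {u} p v u = v"
  by (induction p) auto

text \<open>An injective, type-preserving renaming moves \<open>p\<close> and \<open>S\<close>
  together, so the shape of the restriction and the position of each component stay the
  same.\<close>

lemma restr_ren:
  assumes inj: "inj_on r X" and ty: "\<And>x. vty (r x) = vty x" and S: "S \<subseteq> X"
    and r: "\<And>x. ren \<alpha> x = r x"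
  shows "lvars p \<subseteq> X \<Longrightarrow> restr_ty (r ` S) (ren_lpat \<alpha> p) = restr_ty S p"
    and "lvars p \<subseteq> X \<Longrightarrow> u \<in> lvars p \<inter> S \<Longrightarrow> restr_val (r ` S) (ren_lpat \<alpha> p) v (r u) = restr_val S p v u"
proof (induction p arbitrary: v)
  case (LVar x)
  {
    case 1
    then show ?case using assms by (auto simp: inj_on_def)
  next
    case 2
    then show ?case by simp
  }
next
  case (LPair p1 p2)
  have l: "lvars (ren_lpat \<alpha> q) = r ` lvars q" for q using r by (simp add: lvars_ren_lpat)
  have e: "lvars (ren_lpat \<alpha> q) \<inter> r ` S \<noteq> {} \<longleftrightarrow> lvars q \<inter> S \<noteq> {}" if "lvars q \<subseteq> X" for q
    using inj_on_image_Int[OF inj that S] by (simp add: l) blast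
  have m: "r u \<in> lvars (ren_lpat \<alpha> q) \<longleftrightarrow> u \<in> lvars q" if "lvars q \<subseteq> X" "u \<in> X" for q u
    using inj_on_image_mem_iff[OF inj that(2,1)] by (simp add: l)
  {
    case 1
    then show ?case using LPair.IH e by auto
  next
    case 2
    then have sub: "lvars p1 \<subseteq> X" "lvars p2 \<subseteq> X" "u \<in> X" by auto
    note E = e[OF sub(1)] e[OF sub(2)] and M = m[OF sub(1,3)]
    consider (both) "lvars p1 \<inter> S \<noteq> {}" "lvars p2 \<inter> S \<noteq> {}" "u \<in> lvars p1"
      | (both2) "lvars p1 \<inter> S \<noteq> {}" "lvars p2 \<inter> S \<noteq> {}" "u \<notin> lvars p1" "u \<in> lvars p2"
      | (left) "lvars p1 \<inter> S \<noteq> {}" "lvars p2 \<inter> S = {}" "u \<in> lvars p1"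
      | (right) "lvars p1 \<inter> S = {}" "u \<in> lvars p2"
      using 2 by auto
    then show ?case
      using LPair.IH(2)[OF sub(1)] LPair.IH(4)[OF sub(2)] 2 E M by cases auto
  }
qed

lemma lvars_restr_lpat:
  "lvars (restr_lpat t \<alpha> p)
     = (if lvars p \<inter> dom \<alpha> = {} then {t} else {y. \<exists>u\<in>lvars p. \<alpha> u = Some y})"
proof (induction p)
  case (LPair p1 p2)
  have e: "{y. \<exists>u\<in>lvars p. \<alpha> u = Some y} = {}" if "lvars p \<inter> dom \<alpha> = {}" for p
    using that by (auto simp: dom_def)
  have u: "{y. \<exists>u\<in>lvars (LPair p1 p2). \<alpha> u = Some y}
      = {y. \<exists>u\<in>lvars p1. \<alpha> u = Some y} \<union> {y. \<exists>u\<in>lvars p2. \<alpha> u = Some y}" by auto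
  show ?case unfolding u
    using e[of p1] e[of p2] LPair.IH by (simp add: Int_Un_distrib2)
qed (auto split: option.splits)

lemma lpat_ty_restr_lpat:
  "(\<And>x y. \<alpha> x = Some y \<Longrightarrow> vty y = vty x) \<Longrightarrow> vty t = TTop
    \<Longrightarrow> lpat_ty (restr_lpat t \<alpha> p) = restr_ty (dom \<alpha>) p"
  by (induction p) (auto split: option.splits)

lemma wf_restr_lpat:
  assumes ty: "\<And>x y. \<alpha> x = Some y \<Longrightarrow> vty y = vty x" and t: "vty t = TTop"
    and inj: "inj_on \<alpha> (dom \<alpha>)"
  shows "wf_lpat p \<Longrightarrow> wf_lpat (restr_lpat t \<alpha> p)"
proof (induction p)
  case (LVar u)
  then show ?case using ty t by (auto split: option.splits)
next
  case (LPair p1 p2)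
  have "lvars (restr_lpat t \<alpha> p1) \<inter> lvars (restr_lpat t \<alpha> p2) = {}"
    if "lvars p1 \<inter> dom \<alpha> \<noteq> {}" "lvars p2 \<inter> dom \<alpha> \<noteq> {}"
  proof -
    have "u1 = u2" if "\<alpha> u1 = Some y" "\<alpha> u2 = Some y" for u1 u2 y
      using that inj by (auto simp: inj_on_def dom_def)
    then show ?thesis using that LPair.prems unfolding lvars_restr_lpat by (simp split: if_splits) blast
  qed
  then show ?case using LPair t by auto
qed

text \<open>Ties the patterns that the transpose builds to \<open>restr_val\<close>. Injectivity of
  \<open>\<alpha>\<close> and linearity of \<open>p\<close> keep the right half of a pair from
  overwriting a variable bound by the left half.\<close>

lemma bind_restr_lpat:
  assumes inj: "inj_on \<alpha> (dom \<alpha>)"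
  shows "wf_lpat p \<Longrightarrow> u \<in> lvars p \<Longrightarrow> \<alpha> u = Some y
    \<Longrightarrow> bind (restr_lpat t \<alpha> p) v \<eta> y = restr_val (dom \<alpha>) p v u"
proof (induction p arbitrary: v \<eta>)
  case (LPair p1 p2)
  have eq: "u1 = u2" if "\<alpha> u1 = Some y" "\<alpha> u2 = Some y" for u1 u2 y
    using that inj by (auto simp: inj_on_def dom_def)
  have d: "u \<in> dom \<alpha>" using LPair.prems by auto
  show ?case
  proof (cases "u \<in> lvars p1")
    case True
    then have "u \<notin> lvars p2" using LPair.prems by auto
    then have "y \<notin> lvars (restr_lpat t \<alpha> p2)" if "lvars p2 \<inter> dom \<alpha> \<noteq> {}"
      using that LPair.prems(3) eq by (auto simp: lvars_restr_lpat)
    moreover have "lvars p1 \<inter> dom \<alpha> \<noteq> {}" using True d by auto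
    ultimately show ?thesis using True LPair.IH(1)[OF _ True LPair.prems(3)] LPair.prems(1)
      by (cases "lvars p2 \<inter> dom \<alpha> = {}") (simp_all add: bind_outside)
  next
    case False
    then have u: "u \<in> lvars p2" using LPair.prems(2) by simp
    then have "lvars p2 \<inter> dom \<alpha> \<noteq> {}" using d by auto
    then show ?thesis using False LPair.IH(2)[OF _ u LPair.prems(3)] LPair.prems(1)
      by (cases "lvars p1 \<inter> dom \<alpha> = {}") simp_all
  qed
qed auto

lemma nu_wf:
  assumes ty: "\<And>x y. \<alpha>1 x = Some y \<Longrightarrow> vty y = vty x" "\<And>x y. \<alpha>2 x = Some y \<Longrightarrow> vty y = vty x"
  shows "wf_lpat p \<Longrightarrow> (\<And>u v. u \<in> lvars p \<Longrightarrow> \<alpha>1 u = Some v \<or> \<alpha>2 u = Some v \<Longrightarrow> v \<in> L)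
    \<Longrightarrow> wfU L (nu p \<alpha>1 \<alpha>2) \<and> tyU (nu p \<alpha>1 \<alpha>2) = lpat_ty p \<and> fvU (nu p \<alpha>1 \<alpha>2) \<subseteq> L"
proof (induction p)
  case (LVar u)
  then have u: "ltype (vty u)" by simp
  show ?case using LVar.prems(2)[of u] ty[of u] zeroU_props[OF u] plusF_props[OF u]
    by (auto split: option.splits)
next
  case (LPair p1 p2)
  have z: "ltype (lpat_ty (LPair p1 p2))" using LPair.prems(1) by (rule wf_lpat_ty)
  have IH1: "wfU L (nu p1 \<alpha>1 \<alpha>2) \<and> tyU (nu p1 \<alpha>1 \<alpha>2) = lpat_ty p1 \<and> fvU (nu p1 \<alpha>1 \<alpha>2) \<subseteq> L"
    by (rule LPair.IH) (use LPair.prems in auto)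
  have IH2: "wfU L (nu p2 \<alpha>1 \<alpha>2) \<and> tyU (nu p2 \<alpha>1 \<alpha>2) = lpat_ty p2 \<and> fvU (nu p2 \<alpha>1 \<alpha>2) \<subseteq> L"
    by (rule LPair.IH) (use LPair.prems in auto)
  show ?case using IH1 IH2 zeroU_props[OF z, of L] by simp
qed

lemma id_ren_apply: "id_ren S x = (if x \<in> S then Some x else None)"
  by (simp add: id_ren_def restrict_map_def)

lemma id_ren_Some [simp]: "id_ren S x = Some y \<longleftrightarrow> x \<in> S \<and> y = x"
  by (auto simp: id_ren_apply)

lemma dom_id_ren [simp]: "dom (id_ren S) = S"
  by (auto simp: dom_def)

lemma inj_on_id_ren [simp]: "inj_on (id_ren S) S"
  by (auto simp: inj_on_def id_ren_apply)

section \<open>Types and free variables of the transpose\<close>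

subsection \<open>The transpose preserves well-formedness\<close>

text \<open>Extends \<open>flip_var\<close> by the identity to one map on all variables, so that the
  free variables of a transpose lie in the image of those of the original term.\<close>

definition flip :: "var \<Rightarrow> var" where
  "flip x = (if fun_var x then flip_var x else x)"

lemma fun_var_flip [simp]: "fun_var (flip x) \<longleftrightarrow> fun_var x"
  by (auto simp: flip_def flip_var_def fun_var_def)

lemma inj_flip: "inj flip"
proof (rule injI)
  fix x y assume xy: "flip x = flip y"
  then have "fun_var x \<longleftrightarrow> fun_var y" by (metis fun_var_flip)
  with xy show "x = y"
    by (cases x; cases y) (auto simp: flip_def flip_var_def fun_var_def)
qed

lemma flip_eq: "\<not> fun_var y \<Longrightarrow> y \<in> flip ` A \<longleftrightarrow> y \<in> A"
  by (metis flip_def fun_var_flip image_iff)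

text \<open>The induction invariant. \<open>q\<close> reads a cotangent of the type of
  \<open>U\<close>, and \<open>T\<close> returns one component for each linear variable that
  \<open>U\<close> uses, in the shape of the restricted pattern. By the last clause \<open>q\<close>
  consists of linear variables of \<open>U\<close> and of names outside \<open>X\<close>; this makes
  the patterns of the two components of a pair disjoint.\<close>

definition trU_wf :: "var set \<Rightarrow> lpat \<Rightarrow> U_tm \<Rightarrow> U_tm \<Rightarrow> lpat \<Rightarrow> bool" where
  "trU_wf X p U T q \<longleftrightarrow> wf_lpat q \<and> lpat_ty q = tyU U \<and> wfU (lvars q) T
     \<and> tyU T = restr_ty (fvU U) p \<and> fvU T - lvars q \<subseteq> flip ` (fvU U - lvars p)
     \<and> lvars q \<subseteq> (lvars p \<inter> fvU U) \<union> - X"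

definition trF_wf :: "F_tm \<Rightarrow> bool" where
  "trF_wf F \<longleftrightarrow> wfF (trF F) \<and> domF (trF F) = codF F \<and> codF (trF F) = domF F
     \<and> fvF (trF F) \<subseteq> flip ` fvF F"

lemma finite_ran_renaming: "renaming \<alpha> S X \<Longrightarrow> finite S \<Longrightarrow> finite (ran \<alpha>)"
  by (auto simp: renaming_def intro!: finite_ran)

lemma renaming_props:
  assumes "renaming \<alpha> S X"
  shows "dom \<alpha> = S" "inj_on \<alpha> (dom \<alpha>)" "\<And>x y. \<alpha> x = Some y \<Longrightarrow> vty y = vty x"
    "\<And>x y. \<alpha> x = Some y \<Longrightarrow> y \<notin> X" "\<And>x y. \<alpha> x = Some y \<Longrightarrow> y \<in> ran \<alpha>"
  using assms by (auto simp: renaming_def ran_def)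

text \<open>What the recursion on a pair sees: renaming a component apart preserves its type, its
  nonlinear free variables and the position of each coordinate, and the linear variables in use
  become exactly the range of \<open>\<alpha>\<close>.\<close>

lemma renamed_component:
  assumes p: "wf_lpat p" and U: "wfU (lvars p) U" and X: "lvars p \<union> varsU U \<subseteq> X"
    and \<alpha>: "renaming \<alpha> (fvU U \<inter> lvars p) X"
  shows "wf_lpat (ren_lpat \<alpha> p)" "wfU (lvars (ren_lpat \<alpha> p)) (renU \<alpha> U)"
    "tyU (renU \<alpha> U) = tyU U" "restr_ty (fvU (renU \<alpha> U)) (ren_lpat \<alpha> p) = restr_ty (fvU U) p"
    "fvU (renU \<alpha> U) - lvars (ren_lpat \<alpha> p) = fvU U - lvars p"
    "lvars (ren_lpat \<alpha> p) \<inter> fvU (renU \<alpha> U) = ren \<alpha> ` (lvars p \<inter> fvU U)"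
    "ren \<alpha> ` (lvars p \<inter> fvU U) = ran \<alpha>"
    "\<And>v u. u \<in> lvars p \<inter> fvU U
       \<Longrightarrow> restr_val (fvU (renU \<alpha> U)) (ren_lpat \<alpha> p) v (ren \<alpha> u) = restr_val (fvU U) p v u"
proof -
  have UX: "fvU U \<subseteq> X" "lvars p \<subseteq> X" "varsU U \<subseteq> X" using X fvU_varsU(1)[of U] by auto
  have inj: "inj_on (ren \<alpha>) X" by (rule renaming_inj[OF \<alpha>])
  show 1: "wf_lpat (ren_lpat \<alpha> p)" by (rule wf_ren_lpat[OF p \<alpha> UX(2)])
  have 2: "wfU (ren \<alpha> ` lvars p) (renU \<alpha> U) \<and> tyU (renU \<alpha> U) = tyU U
      \<and> fvU (renU \<alpha> U) = ren \<alpha> ` fvU U"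
    by (rule renU_wf[OF \<alpha> _ UX(2) U UX(3)]) auto
  then show "wfU (lvars (ren_lpat \<alpha> p)) (renU \<alpha> U)" "tyU (renU \<alpha> U) = tyU U"
    by (auto simp: lvars_ren_lpat)
  show "restr_ty (fvU (renU \<alpha> U)) (ren_lpat \<alpha> p) = restr_ty (fvU U) p"
    using restr_ren(1)[OF inj renaming_vty[OF \<alpha>] UX(1) refl UX(2)] 2 by simp
  show "lvars (ren_lpat \<alpha> p) \<inter> fvU (renU \<alpha> U) = ren \<alpha> ` (lvars p \<inter> fvU U)"
    using inj_on_image_Int[OF inj UX(2,1)] 2 by (simp add: lvars_ren_lpat)
  show "ren \<alpha> ` (lvars p \<inter> fvU U) = ran \<alpha>"
    using renaming_props(1)[OF \<alpha>] by (force simp: ran_def ren_def dom_def image_iff)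
  show "fvU (renU \<alpha> U) - lvars (ren_lpat \<alpha> p) = fvU U - lvars p"
  proof -
    have "ren \<alpha> ` fvU U - ren \<alpha> ` lvars p = ren \<alpha> ` (fvU U - lvars p)"
      using inj_on_image_set_diff[OF inj, of "fvU U" "lvars p"] UX by auto
    moreover have "ren \<alpha> x = x" if "x \<in> fvU U - lvars p" for x
      using that renaming_props(1)[OF \<alpha>] by (intro ren_out) auto
    ultimately show ?thesis using 2 by (simp add: lvars_ren_lpat)
  qed
  show "restr_val (fvU (renU \<alpha> U)) (ren_lpat \<alpha> p) v (ren \<alpha> u) = restr_val (fvU U) p v u"
    if "u \<in> lvars p \<inter> fvU U" for u v
    using restr_ren(2)[OF inj renaming_vty[OF \<alpha>] UX(1) refl UX(2) that] 2 by simp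
qed

text \<open>Unfolds the pair clause once, keeping of the fresh choices only their specifications;
  both inductions over \<open>trU\<close> use it.\<close>

lemma trU_UPair_cases:
  assumes X: "finite X"
  obtains X0 \<alpha>1 \<alpha>2 X1 t t1 t2 T1 q1 T2 q2 where
    "X0 = X \<union> lvars p \<union> varsU (UPair U1 U2)"
    "renaming \<alpha>1 (fvU U1 \<inter> lvars p) X0" "renaming \<alpha>2 (fvU U2 \<inter> lvars p) (X0 \<union> ran \<alpha>1)"
    "X1 = X0 \<union> ran \<alpha>1 \<union> ran \<alpha>2" "finite X1"
    "vty t = TTop" "t \<notin> X1" "vty t1 = TTop" "t1 \<notin> X1" "vty t2 = TTop" "t2 \<notin> X1" "t2 \<noteq> t1"
    "trU X1 (ren_lpat \<alpha>1 p) (renU \<alpha>1 U1) = (T1, q1)"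
    "trU (X1 \<union> lvars q1) (ren_lpat \<alpha>2 p) (renU \<alpha>2 U2) = (T2, q2)"
    "trU X p (UPair U1 U2) =
       (ULet (LPair (restr_lpat t1 \<alpha>1 p) (restr_lpat t2 \<alpha>2 p)) (UPair T1 T2)
          (nu (restr_lpat t (id_ren (lvars p \<inter> fvU (UPair U1 U2))) p) \<alpha>1 \<alpha>2), LPair q1 q2)"
proof -
  define X0 where "X0 = X \<union> lvars p \<union> varsU (UPair U1 U2)"
  have X0: "finite X0" using X by (simp add: X0_def)
  define \<alpha>1 where "\<alpha>1 = fresh_ren X0 (fvU U1 \<inter> lvars p)"
  have 1: "renaming \<alpha>1 (fvU U1 \<inter> lvars p) X0"
    unfolding \<alpha>1_def using X0 by (intro fresh_ren_spec) auto
  then have r1: "finite (ran \<alpha>1)" by (rule finite_ran_renaming) simp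
  define \<alpha>2 where "\<alpha>2 = fresh_ren (X0 \<union> ran \<alpha>1) (fvU U2 \<inter> lvars p)"
  have 2: "renaming \<alpha>2 (fvU U2 \<inter> lvars p) (X0 \<union> ran \<alpha>1)"
    unfolding \<alpha>2_def using X0 r1 by (intro fresh_ren_spec) auto
  then have r2: "finite (ran \<alpha>2)" by (rule finite_ran_renaming) simp
  define X1 where "X1 = X0 \<union> ran \<alpha>1 \<union> ran \<alpha>2"
  have X1: "finite X1" using X0 r1 r2 by (simp add: X1_def)
  \<comment> \<open>In the definition of \<open>trU\<close> the names \<open>t\<close> and
    \<open>t1\<close> are the same choice. This is harmless, since only \<open>t1\<close> and
    \<open>t2\<close> are bound in a common pattern.\<close>
  define t where "t = fresh X1 TTop"
  define t2 where "t2 = fresh (insert t X1) TTop"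
  obtain T1 q1 where q1: "trU X1 (ren_lpat \<alpha>1 p) (renU \<alpha>1 U1) = (T1, q1)" by fastforce
  obtain T2 q2 where q2: "trU (X1 \<union> lvars q1) (ren_lpat \<alpha>2 p) (renU \<alpha>2 U2) = (T2, q2)" by fastforce
  have t: "vty t = TTop" "t \<notin> X1" using fresh_spec[OF X1] by (auto simp: t_def)
  have t2: "vty t2 = TTop" "t2 \<notin> X1" "t2 \<noteq> t"
    using fresh_spec[of "insert t X1"] X1 by (auto simp: t2_def)
  have "trU X p (UPair U1 U2) =
       (ULet (LPair (restr_lpat t \<alpha>1 p) (restr_lpat t2 \<alpha>2 p)) (UPair T1 T2)
          (nu (restr_lpat t (id_ren (lvars p \<inter> fvU (UPair U1 U2))) p) \<alpha>1 \<alpha>2), LPair q1 q2)"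
    using q1 q2 unfolding trU.simps Let_def
    by (simp add: X0_def[symmetric] \<alpha>1_def[symmetric] \<alpha>2_def[symmetric] X1_def[symmetric]
        t_def[symmetric] t2_def[symmetric] del: varsU.simps fvU.simps)
  then show thesis using that[OF X0_def 1 2 X1_def X1 t t t2 q1 q2] by blast
qed

text \<open>The induction is on a bound for the size and not on terms: the pair clause recurses on
  renamed components, which are not subterms but have the size of subterms.\<close>

lemma trU_trF_wf:
  "(\<forall>X p U T q. size U < n \<longrightarrow> finite X \<longrightarrow> wf_lpat p \<longrightarrow> wfU (lvars p) U \<longrightarrow> trU X p U = (T, q)
       \<longrightarrow> trU_wf X p U T q)
   \<and> (\<forall>F. size F < n \<longrightarrow> wfF F \<longrightarrow> trF_wf F)"
proof (induction n)
  case (Suc n)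
  have IHU: "trU_wf X p U T q"
    if "size U < n" "finite X" "wf_lpat p" "wfU (lvars p) U" "trU X p U = (T, q)" for X p U T q
    using Suc that by blast
  have IHF: "trF_wf F" if "size F < n" "wfF F" for F
    using Suc that by blast
  have U: "trU_wf X p U T q"
    if sz: "size U < Suc n" and X: "finite X" and p: "wf_lpat p" and wf: "wfU (lvars p) U"
      and tr: "trU X p U = (T, q)" for X p U T q
  proof (cases U)
    case (UVar u)
    then show ?thesis using p wf tr restr_ty_single[of u p] wf_lpat_var[OF p, of u]
      by (auto simp: trU_wf_def)
  next
    case UZero
    then show ?thesis using X tr restr_ty_empty[of p "{}"] fresh_spec[of "X \<union> lvars p" TReal]
      by (auto simp: trU_wf_def)
  next
    case UTop
    then show ?thesis using X tr restr_ty_empty[of p "{}"] fresh_spec[of "X \<union> lvars p" TTop]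
      by (auto simp: trU_wf_def)
  next
    case (UApp F U')
    define v where "v = fresh (X \<union> lvars p \<union> varsU (UApp F U')) (codF F)"
    have v: "vty v = codF F" "v \<notin> X" "v \<notin> lvars p" "v \<notin> varsU (UApp F U')"
      using X fresh_spec[of "X \<union> lvars p \<union> varsU (UApp F U')" "codF F"] by (auto simp: v_def)
    obtain T' q' where tr': "trU (X \<union> varsF F) p U' = (T', q')" by fastforce
    have T: "T = UApp (FLam q' T') (UApp (trF F) (UVar v))" "q = LVar v"
      using tr tr' by (simp_all add: UApp v_def[symmetric] Let_def del: varsU.simps)
    have F: "trF_wf F" using sz wf by (intro IHF) (auto simp: UApp)
    have U': "trU_wf (X \<union> varsF F) p U' T' q'"
      using sz X p wf tr' by (intro IHU) (auto simp: UApp)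
    have lt: "ltype (codF F)" using wf wfU_ltype(2) by (simp add: UApp)
    then have nv: "\<not> fun_var v" using v ltype_not_fun_var by simp
    have vF: "v \<notin> fvF F" "v \<notin> fvU U'" using v(4) fvU_varsU by auto
    have "fvF (trF F) \<subseteq> flip ` fvF F" "fvU T' - lvars q' \<subseteq> flip ` (fvU U' - lvars p)"
      using F U' by (simp_all add: trF_wf_def trU_wf_def)
    moreover have "v \<notin> flip ` fvF F" "v \<notin> flip ` (fvU U' - lvars p)"
      using vF by (simp_all add: flip_eq[OF nv])
    ultimately have 1: "v \<notin> fvF (trF F)" "v \<notin> fvU T' - lvars q'" by blast+
    \<comment> \<open>\<open>g\<close> is the flip of a variable of \<open>U'\<close> and of a
      variable of \<open>F\<close>. By injectivity these coincide, and \<open>U'\<close> and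
      \<open>F\<close> share no function variable.\<close>
    have 2: "\<not> fun_var g" if g: "g \<in> fvU T' - lvars q'" "g \<in> fvF (trF F)" for g
    proof -
      obtain a where "g = flip a" "a \<in> fvU U' - lvars p" using g(1) U' by (auto simp: trU_wf_def)
      moreover obtain b where "g = flip b" "b \<in> fvF F" using g(2) F by (auto simp: trF_wf_def)
      ultimately show ?thesis using wf inj_flip by (auto simp: UApp inj_def)
    qed
    have rt: "restr_ty (fvU (UApp F U')) p = restr_ty (fvU U') p"
      using wf by (intro conjunct1[OF restr_cong]) (auto simp: UApp)
    have "wfU {v} T"
      using T F U' 1 2 v(1) wf nv by (auto simp: UApp trF_wf_def trU_wf_def)
    moreover have "fvU T - {v} \<subseteq> flip ` (fvU (UApp F U') - lvars p)"
      using T F U' wf unfolding trF_wf_def trU_wf_def by (simp add: UApp) blast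
    ultimately show ?thesis
      using T U' rt v(1,2) lt by (auto simp: UApp trU_wf_def)
  next
    case (UPair U1 U2)
    obtain X0 \<alpha>1 \<alpha>2 X1 t t1 t2 T1 q1 T2 q2 where
      X0: "X0 = X \<union> lvars p \<union> varsU (UPair U1 U2)"
      and \<alpha>1: "renaming \<alpha>1 (fvU U1 \<inter> lvars p) X0"
      and \<alpha>2: "renaming \<alpha>2 (fvU U2 \<inter> lvars p) (X0 \<union> ran \<alpha>1)"
      and X1: "X1 = X0 \<union> ran \<alpha>1 \<union> ran \<alpha>2" "finite X1"
      and t: "vty t = TTop" "t \<notin> X1" "vty t1 = TTop" "t1 \<notin> X1" "vty t2 = TTop" "t2 \<notin> X1" "t2 \<noteq> t1"
      and q1: "trU X1 (ren_lpat \<alpha>1 p) (renU \<alpha>1 U1) = (T1, q1)"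
      and q2: "trU (X1 \<union> lvars q1) (ren_lpat \<alpha>2 p) (renU \<alpha>2 U2) = (T2, q2)"
      and eq: "trU X p (UPair U1 U2) =
       (ULet (LPair (restr_lpat t1 \<alpha>1 p) (restr_lpat t2 \<alpha>2 p)) (UPair T1 T2)
          (nu (restr_lpat t (id_ren (lvars p \<inter> fvU (UPair U1 U2))) p) \<alpha>1 \<alpha>2), LPair q1 q2)"
      using trU_UPair_cases[OF X, of p U1 U2] by metis
    let ?r = "restr_lpat t (id_ren (lvars p \<inter> fvU (UPair U1 U2))) p"
    let ?r1 = "restr_lpat t1 \<alpha>1 p" and ?r2 = "restr_lpat t2 \<alpha>2 p"
    let ?nu = "nu ?r \<alpha>1 \<alpha>2"
    have wf12: "wfU (lvars p) U1" "wfU (lvars p) U2" using wf by (auto simp: UPair)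
    have X01: "lvars p \<union> varsU U1 \<subseteq> X0" "lvars p \<union> varsU U2 \<subseteq> X0 \<union> ran \<alpha>1" using X0 by auto
    note C1 = renamed_component[OF p wf12(1) X01(1) \<alpha>1]
    note C2 = renamed_component[OF p wf12(2) X01(2) \<alpha>2]
    note P1 = renaming_props[OF \<alpha>1] and P2 = renaming_props[OF \<alpha>2]
    have I1: "trU_wf X1 (ren_lpat \<alpha>1 p) (renU \<alpha>1 U1) T1 q1"
      using sz by (intro IHU X1 C1 q1) (simp add: UPair)
    have I2: "trU_wf (X1 \<union> lvars q1) (ren_lpat \<alpha>2 p) (renU \<alpha>2 U2) T2 q2"
      using sz X1(2) by (intro IHU C2 q2) (simp_all add: UPair)
    have q1v: "lvars q1 \<subseteq> ran \<alpha>1 \<union> - X1" using I1 C1(6,7) by (simp add: trU_wf_def)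
    have q2v: "lvars q2 \<subseteq> ran \<alpha>2 \<union> - (X1 \<union> lvars q1)" using I2 C2(6,7) by (simp add: trU_wf_def)
    have r1X: "ran \<alpha>1 \<inter> X0 = {}" using \<alpha>1 by (simp add: renaming_def)
    have r2X: "ran \<alpha>2 \<inter> X0 = {}" "ran \<alpha>2 \<inter> ran \<alpha>1 = {}" using \<alpha>2 by (auto simp: renaming_def)
    \<comment> \<open>Renamed variables are kept apart by the disjoint ranges of
      \<open>\<alpha>1\<close> and \<open>\<alpha>2\<close>, newly invented ones by the sets to be
      avoided that are passed to \<open>trU\<close>.\<close>
    have q12: "lvars q1 \<inter> lvars q2 = {}" using q1v q2v r2X X1(1) by blast
    have wfr: "wf_lpat ?r1" "wf_lpat ?r2" "wf_lpat ?r"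
      using p t P1 P2 by (auto intro!: wf_restr_lpat)
    have lr1: "lvars ?r1 \<subseteq> insert t1 (ran \<alpha>1)" and lr2: "lvars ?r2 \<subseteq> insert t2 (ran \<alpha>2)"
      by (auto simp: lvars_restr_lpat ran_def split: if_splits)
    have r12: "lvars ?r1 \<inter> lvars ?r2 = {}" using lr1 lr2 r2X t X1(1) by blast
    have rty1: "lpat_ty ?r1 = restr_ty (fvU U1) p"
      using lpat_ty_restr_lpat[of \<alpha>1 t1 p] P1 t restr_cong[of p "fvU U1 \<inter> lvars p" "fvU U1"] by auto
    have rty2: "lpat_ty ?r2 = restr_ty (fvU U2) p"
      using lpat_ty_restr_lpat[of \<alpha>2 t2 p] P2 t restr_cong[of p "fvU U2 \<inter> lvars p" "fvU U2"] by auto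
    have rty: "lpat_ty ?r = restr_ty (fvU (UPair U1 U2)) p"
      using lpat_ty_restr_lpat[of "id_ren (lvars p \<inter> fvU (UPair U1 U2))" t p] t
        restr_cong[of p "lvars p \<inter> fvU (UPair U1 U2)" "fvU (UPair U1 U2)"]
      by (auto split: if_splits)
    have nu: "wfU (lvars ?r1 \<union> lvars ?r2) ?nu \<and> tyU ?nu = lpat_ty ?r
        \<and> fvU ?nu \<subseteq> lvars ?r1 \<union> lvars ?r2"
    proof (rule nu_wf[OF P1(3) P2(3) wfr(3)])
      fix u v assume "\<alpha>1 u = Some v \<or> \<alpha>2 u = Some v"
      then show "v \<in> lvars ?r1 \<union> lvars ?r2"
      proof
        assume a: "\<alpha>1 u = Some v"
        then have "u \<in> lvars p \<inter> dom \<alpha>1" using P1(1) by auto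
        then show ?thesis using a by (auto simp: lvars_restr_lpat)
      next
        assume a: "\<alpha>2 u = Some v"
        then have "u \<in> lvars p \<inter> dom \<alpha>2" using P2(1) by auto
        then show ?thesis using a by (auto simp: lvars_restr_lpat)
      qed
    qed
    have T: "T = UApp (FLam (LPair ?r1 ?r2) ?nu) (UPair T1 T2)" "q = LPair q1 q2"
      using tr eq by (simp_all add: UPair)
    have f1: "fvU T1 - lvars q1 \<subseteq> flip ` (fvU U1 - lvars p)"
      and f2: "fvU T2 - lvars q2 \<subseteq> flip ` (fvU U2 - lvars p)"
      using I1 I2 C1(5) C2(5) by (auto simp: trU_wf_def)
    have wfq: "wf_lpat q1" "wf_lpat q2" using I1 I2 by (auto simp: trU_wf_def)
    have nq: "\<not> fun_var y" if "y \<in> lvars q1 \<union> lvars q2" for y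
      using that wfq wf_lpat_var ltype_not_fun_var by auto
    have UX: "fvU U1 \<subseteq> X0" "fvU U2 \<subseteq> X0" using X0 fvU_varsU(1)[of U1] fvU_varsU(1)[of U2] by auto
    \<comment> \<open>Pattern variables are not function variables, so a clash would be an unflipped
      free variable of \<open>U1\<close>; these lie in \<open>X0\<close>, which \<open>q2\<close>
      avoids.\<close>
    have d1: "(fvU T1 - lvars q1) \<inter> (lvars q1 \<union> lvars q2) = {}"
      using f1 nq flip_eq q2v r2X(1) UX(1) X1(1) by blast
    have d2: "(fvU T2 - lvars q2) \<inter> (lvars q1 \<union> lvars q2) = {}"
      using f2 nq flip_eq q1v r1X UX(2) X1(1) by blast
    have "wfU (lvars q1 \<union> lvars q2) T1" "wfU (lvars q1 \<union> lvars q2) T2"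
      using I1 I2 d1 d2 by (auto simp: trU_wf_def intro: wfU_mono)
    moreover have "fvF (FLam (LPair ?r1 ?r2) ?nu) = {}" using nu by auto
    moreover have "lpat_ty ?r1 = tyU T1" "lpat_ty ?r2 = tyU T2"
      using I1 I2 rty1 rty2 C1(4) C2(4) by (auto simp: trU_wf_def)
    ultimately have "wfU (lvars q) T" using T nu wfr r12 by auto
    moreover have "fvU T - lvars q \<subseteq> flip ` (fvU U - lvars p)"
      using T f1 f2 \<open>fvF (FLam (LPair ?r1 ?r2) ?nu) = {}\<close> by (auto simp: UPair)
    moreover have "lvars q \<subseteq> (lvars p \<inter> fvU U) \<union> - X"
      using T(2) q1v q2v r1X r2X X0 X1(1) by (simp add: UPair) blast
    moreover have "wf_lpat q" "lpat_ty q = tyU U" "tyU T = restr_ty (fvU U) p"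
      using T wfq q12 I1 I2 C1(3) C2(3) nu rty by (auto simp: trU_wf_def UPair)
    ultimately show ?thesis by (simp add: trU_wf_def)
  qed
  moreover have "trF_wf F" if sz: "size F < Suc n" and wf: "wfF F" for F
  proof (cases F)
    case (FVar f)
    then show ?thesis using wf by (auto simp: trF_wf_def flip_def flip_var_def fun_var_def)
  next
    case (FTimes x)
    then show ?thesis using wf by (auto simp: trF_wf_def flip_def fun_var_def)
  next
    case (FLam p U)
    have p: "wf_lpat p" "wfU (lvars p) U" using wf by (auto simp: FLam)
    obtain T q where tr: "trU {} p U = (T, q)" by fastforce
    define t where "t = fresh (lvars p \<union> varsU U) TTop"
    have t: "vty t = TTop" using fresh_spec[of "lvars p \<union> varsU U"] by (simp add: t_def)
    let ?\<iota> = "id_ren (lvars p \<inter> fvU U)"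
    let ?r = "restr_lpat t ?\<iota> p"
    have F: "trF F = FLam q (ULet ?r T (nu p ?\<iota> Map.empty))"
      using tr by (simp add: FLam Let_def t_def[symmetric])
    have I: "trU_wf {} p U T q" using sz p tr by (intro IHU) (auto simp: FLam)
    have wfr: "wf_lpat ?r" using p t by (auto intro!: wf_restr_lpat)
    have rty: "lpat_ty ?r = restr_ty (fvU U) p"
      using lpat_ty_restr_lpat[of ?\<iota> t p] t restr_cong[of p "lvars p \<inter> fvU U" "fvU U"]
      by (auto split: if_splits)
    have nu: "wfU (lvars ?r) (nu p ?\<iota> Map.empty) \<and> tyU (nu p ?\<iota> Map.empty) = lpat_ty p
        \<and> fvU (nu p ?\<iota> Map.empty) \<subseteq> lvars ?r"
      by (rule nu_wf[OF _ _ p(1)]) (auto simp: lvars_restr_lpat split: if_splits)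
    then have "fvF (FLam ?r (nu p ?\<iota> Map.empty)) = {}" by auto
    then show ?thesis using F I rty nu wfr by (auto simp: trF_wf_def trU_wf_def FLam)
  qed (use wf in \<open>auto simp: trF_wf_def Let_def\<close>)
  ultimately show ?case by blast
qed simp

lemma trU_wf:
  "finite X \<Longrightarrow> wf_lpat p \<Longrightarrow> wfU (lvars p) U \<Longrightarrow> trU X p U = (T, q) \<Longrightarrow> trU_wf X p U T q"
  using trU_trF_wf[of "Suc (size U)"] by blast

lemma trF_wf: "wfF F \<Longrightarrow> trF_wf F"
  using trU_trF_wf[of "Suc (size F)"] by blast

section \<open>Inner products and the adjoint identity in coordinates\<close>

subsection \<open>The transpose is the adjoint\<close>

primrec ip :: "ty \<Rightarrow> val \<Rightarrow> val \<Rightarrow> real" where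
  "ip TReal a b = vreal a * vreal b"
| "ip (TWith A B) a b = ip A (vfst a) (vfst b) + ip B (vsnd a) (vsnd b)"
| "ip TTop a b = 0"
| "ip TOne a b = 0"
| "ip (TTensor A B) a b = 0"
| "ip (TBang A) a b = 0"
| "ip (TLolli A B) a b = 0"

lemma ip_vadd: "ip A x (vadd A a b) = ip A x a + ip A x b"
  by (induction A arbitrary: x a b) (auto simp: algebra_simps)

lemma ip_vzero [simp]: "ip A x (vzero A) = 0" "ip A (vzero A) x = 0"
  by (induction A arbitrary: x) auto

lemma ip_vscale: "ip A x (vscale A r a) = r * ip A x a"
  by (induction A arbitrary: x a) (auto simp: algebra_simps)

lemma ip_vadd_left: "ip A (vadd A a b) x = ip A a x + ip A b x"
  by (induction A arbitrary: x a b) (auto simp: algebra_simps)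

lemma ip_vscale_left: "ip A (vscale A r a) x = r * ip A a x"
  by (induction A arbitrary: x a) (auto simp: algebra_simps)

text \<open>Test vectors that vanish outside one component isolate that component, and 1 isolates a
  real. Typing enters because \<open>ip\<close> cannot see the shape of a value.\<close>

lemma ip_nondegenerate:
  "ltype A \<Longrightarrow> vtyped A a \<Longrightarrow> vtyped A b \<Longrightarrow> (\<And>x. ip A x a = ip A x b) \<Longrightarrow> a = b"
proof (induction A arbitrary: a b)
  case TReal
  then show ?case using TReal(4)[of "VR 1"] by auto
next
  case (TWith A B)
  then obtain a1 a2 b1 b2 where ab: "a = VP a1 a2" "b = VP b1 b2"
    "vtyped A a1" "vtyped B a2" "vtyped A b1" "vtyped B b2" by auto
  have "ip A x a1 = ip A x b1" for x
    using TWith.prems(4)[of "VP x (vzero B)"] by (simp add: ab)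
  then have "a1 = b1" using TWith.IH(1)[of a1 b1] TWith.prems(1) ab by simp
  moreover have "ip B x a2 = ip B x b2" for x
    using TWith.prems(4)[of "VP (vzero A) x"] by (simp add: ab)
  then have "a2 = b2" using TWith.IH(2)[of a2 b2] TWith.prems(1) ab by simp
  ultimately show ?case using ab by simp
qed auto

text \<open>The quantifiers range over all values, of whatever shape; this is possible since
  \<open>ip\<close> accesses values through total projections only.\<close>

definition adjoint :: "ty \<Rightarrow> ty \<Rightarrow> (val \<Rightarrow> val) \<Rightarrow> (val \<Rightarrow> val) \<Rightarrow> bool" where
  "adjoint A B f g \<longleftrightarrow> (\<forall>a b. ip B (f a) b = ip A a (g b))"

primrec ptup :: "(var \<Rightarrow> val) \<Rightarrow> lpat \<Rightarrow> val" where
  "ptup \<eta> (LVar u) = \<eta> u"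
| "ptup \<eta> (LPair p q) = VP (ptup \<eta> p) (ptup \<eta> q)"

lemma ptup_cong: "(\<And>u. u \<in> lvars p \<Longrightarrow> \<eta> u = \<eta>' u) \<Longrightarrow> ptup \<eta> p = ptup \<eta>' p"
  by (induction p) auto

text \<open>Matching \<open>a\<close> against \<open>p\<close> and tupling again returns
  \<open>a\<close> only if \<open>a\<close> has the shape of \<open>p\<close>. For a misshapen
  \<open>a\<close> the two values may differ, but \<open>ip\<close> does not notice.\<close>

lemma ip_ptup_bind: "wf_lpat p \<Longrightarrow> ip (lpat_ty p) (ptup (bind p a \<eta>) p) w = ip (lpat_ty p) a w"
proof (induction p arbitrary: a \<eta> w)
  case (LPair p q)
  have "ptup (bind q (vsnd a) (bind p (vfst a) \<eta>)) p = ptup (bind p (vfst a) \<eta>) p"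
    using LPair.prems by (intro ptup_cong bind_outside) auto
  then show ?case using LPair by simp
qed simp

lemma ip_restr_lpat:
  "wf_lpat p \<Longrightarrow> vty t = TTop
    \<Longrightarrow> ip (lpat_ty (restr_lpat t (id_ren S) p)) (ptup \<eta> (restr_lpat t (id_ren S) p)) w
      = (\<Sum>u\<in>lvars p \<inter> S. ip (vty u) (\<eta> u) (restr_val S p w u))"
proof (induction p arbitrary: w)
  case (LVar u)
  then show ?case by (auto simp: id_ren_apply)
next
  case (LPair p1 p2)
  have d: "u \<notin> lvars p1" if "u \<in> lvars p2" for u using that LPair.prems(1) by auto
  have s: "(\<Sum>u\<in>lvars (LPair p1 p2) \<inter> S. f u) = (\<Sum>u\<in>lvars p1 \<inter> S. f u) + (\<Sum>u\<in>lvars p2 \<inter> S. f u)"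
    for f :: "var \<Rightarrow> real"
  proof -
    have "lvars (LPair p1 p2) \<inter> S = (lvars p1 \<inter> S) \<union> (lvars p2 \<inter> S)" by auto
    then show ?thesis using d by (simp only:) (intro sum.union_disjoint, auto)
  qed
  have IH: "ip (lpat_ty (restr_lpat t (id_ren S) p1)) (ptup \<eta> (restr_lpat t (id_ren S) p1)) w
      = (\<Sum>u\<in>lvars p1 \<inter> S. ip (vty u) (\<eta> u) (restr_val S p1 w u))"
    "ip (lpat_ty (restr_lpat t (id_ren S) p2)) (ptup \<eta> (restr_lpat t (id_ren S) p2)) w
      = (\<Sum>u\<in>lvars p2 \<inter> S. ip (vty u) (\<eta> u) (restr_val S p2 w u))" for w
    using LPair by auto
  show ?case unfolding s
    by (cases "lvars p1 \<inter> S = {}"; cases "lvars p2 \<inter> S = {}")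
      (use IH d LPair.prems(2) in \<open>auto intro!: arg_cong2[where f = "(+)"] sum.cong\<close>)
qed

text \<open>What the copy of \<open>u\<close> named by \<open>\<alpha>\<close> contributes to an
  inner product, if there is such a copy.\<close>

definition contrib :: "(var \<Rightarrow> val) \<Rightarrow> (var \<Rightarrow> val) \<Rightarrow> (var \<rightharpoonup> var) \<Rightarrow> var \<Rightarrow> real" where
  "contrib \<eta> \<zeta> \<alpha> u = (case \<alpha> u of None \<Rightarrow> 0 | Some v \<Rightarrow> ip (vty u) (\<eta> u) (\<zeta> v))"

text \<open>\<open>nu\<close> is the transpose of distributing variables to the components of a
  pair: a variable used nowhere gets zero, one used in both components the sum of two cotangents.
  Inside an inner product all cases become one sum.\<close>

lemma ip_nu:
  "wf_lpat p \<Longrightarrow> ip (lpat_ty p) (ptup \<eta> p) (usem \<phi> \<zeta> (nu p \<alpha>1 \<alpha>2))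
     = (\<Sum>u\<in>lvars p. contrib \<eta> \<zeta> \<alpha>1 u + contrib \<eta> \<zeta> \<alpha>2 u)"
proof (induction p)
  case (LVar u)
  then have u: "ltype (vty u)" by simp
  show ?case using zeroU_props[OF u] by (auto simp: contrib_def fsem_plusF[OF u] ip_vadd split: option.splits)
next
  case (LPair p1 p2)
  have z: "ltype (lpat_ty (LPair p1 p2))" using LPair.prems(1) by (rule wf_lpat_ty)
  show ?case
  proof (cases "lvars (LPair p1 p2) \<inter> (dom \<alpha>1 \<union> dom \<alpha>2) = {}")
    case True
    then have "contrib \<eta> \<zeta> \<alpha>1 u + contrib \<eta> \<zeta> \<alpha>2 u = 0" if "u \<in> lvars (LPair p1 p2)" for u
      using that by (auto simp: contrib_def split: option.splits)
    then have "(\<Sum>u\<in>lvars (LPair p1 p2). contrib \<eta> \<zeta> \<alpha>1 u + contrib \<eta> \<zeta> \<alpha>2 u) = 0"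
      by (intro sum.neutral) blast
    moreover have "usem \<phi> \<zeta> (nu (LPair p1 p2) \<alpha>1 \<alpha>2) = vzero (lpat_ty (LPair p1 p2))"
      using True zeroU_props[OF z] by simp
    ultimately show ?thesis by (simp only: ip_vzero)
  next
    case False
    then have "nu (LPair p1 p2) \<alpha>1 \<alpha>2 = UPair (nu p1 \<alpha>1 \<alpha>2) (nu p2 \<alpha>1 \<alpha>2)" by simp
    then show ?thesis using LPair by (simp add: sum.union_disjoint)
  qed
qed

lemma usem_ren:
  assumes \<alpha>: "renaming \<alpha> S X" "S \<subseteq> L" and \<eta>: "\<And>x. x \<in> X \<Longrightarrow> \<eta>1 (ren \<alpha> x) = \<eta> x"
  shows "wfU L U \<Longrightarrow> varsU U \<subseteq> X \<Longrightarrow> usem \<phi> \<eta>1 (renU \<alpha> U) = usem \<phi> \<eta> U"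
proof (induction U rule: U_tm.induct[where ?P2.0 = "\<lambda>_. True"])
  case (UVar u)
  then show ?case using \<eta> by simp
next
  case (UApp F U)
  have d: "dom \<alpha> \<inter> fvF F = {}" using UApp.prems \<alpha> by (auto simp: renaming_def)
  then have F: "renF \<alpha> F = F" by (rule ren_id)
  have "fsem \<phi> \<eta>1 F = fsem \<phi> \<eta> F"
  proof (rule usem_cong(2))
    show "wfF F" using UApp.prems by simp
    fix x assume x: "x \<in> fvF F"
    then have "ren \<alpha> x = x" using d by (intro ren_out) auto
    moreover have "x \<in> X" using x UApp.prems(2) fvU_varsU(2)[of F] by auto
    ultimately show "if fun_var x then \<phi> x = \<phi> x else \<eta>1 x = \<eta> x" using \<eta>[of x] by simp
  qed
  then show ?case using F UApp by simp
qed auto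

lemma sum_restr_renamed:
  assumes p: "wf_lpat p" and U: "wfU (lvars p) U" and X: "lvars p \<union> varsU U \<subseteq> X"
    and \<alpha>: "renaming \<alpha> (fvU U \<inter> lvars p) X" and \<eta>: "\<And>x. x \<in> X \<Longrightarrow> \<eta>1 (ren \<alpha> x) = \<eta> x"
  shows "(\<Sum>u\<in>lvars (ren_lpat \<alpha> p) \<inter> fvU (renU \<alpha> U).
        ip (vty u) (\<eta>1 u) (restr_val (fvU (renU \<alpha> U)) (ren_lpat \<alpha> p) w u))
    = (\<Sum>u\<in>lvars p \<inter> fvU U. ip (vty u) (\<eta> u) (restr_val (fvU U) p w u))"
proof -
  note C = renamed_component[OF p U X \<alpha>]
  have "inj_on (ren \<alpha>) (lvars p \<inter> fvU U)"
    using renaming_inj[OF \<alpha>] X by (auto simp: inj_on_def)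
  then show ?thesis
    unfolding C(6) using C(8) \<eta> X renaming_vty[OF \<alpha>] by (subst sum.reindex) (auto intro!: sum.cong)
qed

text \<open>\<open>U\<close> is read as a map of its linear variables, and component
  \<open>u\<close> of \<open>T\<close> is the adjoint with respect to \<open>u\<close>. Function
  variables are interpreted by adjoint pairs, the other nonlinear ones equally on both sides;
  \<open>T\<close> receives its input \<open>b\<close> through \<open>q\<close>.\<close>

definition trU_adj :: "lpat \<Rightarrow> U_tm \<Rightarrow> U_tm \<Rightarrow> lpat \<Rightarrow> bool" where
  "trU_adj p U T q \<longleftrightarrow> (\<forall>\<phi> \<phi>' \<eta> \<eta>' b.
     (\<forall>f\<in>fvU U. fun_var f \<longrightarrow> adjoint (dom_ty (vty f)) (cod_ty (vty f)) (\<phi> f) (\<phi>' (flip f)))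
     \<longrightarrow> (\<forall>x\<in>fvU U - lvars p. \<not> fun_var x \<longrightarrow> \<eta> x = \<eta>' x)
     \<longrightarrow> ip (tyU U) (usem \<phi> \<eta> U) b
       = (\<Sum>u\<in>lvars p \<inter> fvU U. ip (vty u) (\<eta> u) (restr_val (fvU U) p (usem \<phi>' (bind q b \<eta>') T) u)))"

definition trF_adj :: "F_tm \<Rightarrow> bool" where
  "trF_adj F \<longleftrightarrow> (\<forall>\<phi> \<phi>' \<eta> \<eta>'.
     (\<forall>f\<in>fvF F. fun_var f \<longrightarrow> adjoint (dom_ty (vty f)) (cod_ty (vty f)) (\<phi> f) (\<phi>' (flip f)))
     \<longrightarrow> (\<forall>x\<in>fvF F. \<not> fun_var x \<longrightarrow> \<eta> x = \<eta>' x)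
     \<longrightarrow> adjoint (domF F) (codF F) (fsem \<phi> \<eta> F) (fsem \<phi>' \<eta>' (trF F)))"

text \<open>An application is a composition and reverses: the adjoint of \<open>F\<close> turns
  \<open>b\<close> into the cotangent for the argument. A pair sums: each component returns
  cotangents for its own copies of the variables, and \<open>nu\<close> adds them. The induction
  runs on sizes as in \<open>trU_trF_wf\<close>.\<close>

lemma trU_trF_adj:
  "(\<forall>X p U T q. size U < n \<longrightarrow> finite X \<longrightarrow> wf_lpat p \<longrightarrow> wfU (lvars p) U \<longrightarrow> trU X p U = (T, q)
       \<longrightarrow> trU_adj p U T q)
   \<and> (\<forall>F. size F < n \<longrightarrow> wfF F \<longrightarrow> trF_adj F)"
proof (induction n)
  case (Suc n)
  have IHU: "trU_adj p U T q"
    if "size U < n" "finite X" "wf_lpat p" "wfU (lvars p) U" "trU X p U = (T, q)" for X p U T q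
    using Suc that by blast
  have IHF: "trF_adj F" if "size F < n" "wfF F" for F
    using Suc that by blast
  have U: "trU_adj p U T q"
    if sz: "size U < Suc n" and X: "finite X" and p: "wf_lpat p" and wf: "wfU (lvars p) U"
      and tr: "trU X p U = (T, q)" for X p U T q
    unfolding trU_adj_def
  proof (intro allI impI)
    fix \<phi> \<phi>' :: "var \<Rightarrow> val \<Rightarrow> val" and \<eta> \<eta>' :: "var \<Rightarrow> val" and b
    assume hf: "\<forall>f\<in>fvU U. fun_var f \<longrightarrow> adjoint (dom_ty (vty f)) (cod_ty (vty f)) (\<phi> f) (\<phi>' (flip f))"
      and hx: "\<forall>x\<in>fvU U - lvars p. \<not> fun_var x \<longrightarrow> \<eta> x = \<eta>' x"
    show "ip (tyU U) (usem \<phi> \<eta> U) b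
       = (\<Sum>u\<in>lvars p \<inter> fvU U. ip (vty u) (\<eta> u) (restr_val (fvU U) p (usem \<phi>' (bind q b \<eta>') T) u))"
    proof (cases U)
      case (UVar u)
      then have "lvars p \<inter> fvU U = {u}" using wf by auto
      then show ?thesis using UVar p wf tr restr_val_single[of u p] by auto
    next
      case (UApp F U')
      define v where "v = fresh (X \<union> lvars p \<union> varsU (UApp F U')) (codF F)"
      have v: "v \<notin> varsU (UApp F U')"
        using X fresh_spec[of "X \<union> lvars p \<union> varsU (UApp F U')" "codF F"] by (auto simp: v_def)
      obtain T' q' where tr': "trU (X \<union> varsF F) p U' = (T', q')" by fastforce
      have T: "T = UApp (FLam q' T') (UApp (trF F) (UVar v))" "q = LVar v"
        using tr tr' by (simp_all add: UApp v_def[symmetric] Let_def del: varsU.simps)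
      have F: "trF_adj F" using sz wf by (intro IHF) (auto simp: UApp)
      have U': "trU_adj p U' T' q'"
        using sz X p wf tr' by (intro IHU) (auto simp: UApp)
      have vF: "v \<notin> fvF F" "v \<notin> fvU U'" using v fvU_varsU by auto
      define \<eta>2 where "\<eta>2 = \<eta>'(v := b)"
      \<comment> \<open>\<open>b'\<close> is the cotangent handed to the argument \<open>U'\<close>.
        The name \<open>v\<close> is fresh, so binding it to \<open>b\<close> disturbs neither
        \<open>F\<close> nor \<open>U'\<close>.\<close>
      define b' where "b' = fsem \<phi>' \<eta>2 (trF F) b"
      have "adjoint (domF F) (codF F) (fsem \<phi> \<eta> F) (fsem \<phi>' \<eta>2 (trF F))"
        using F hf hx vF wf unfolding trF_adj_def \<eta>2_def by (auto simp: UApp disjoint_iff)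
      then have 1: "ip (tyU U) (usem \<phi> \<eta> U) b = ip (tyU U') (usem \<phi> \<eta> U') b'"
        using wf by (simp add: UApp adjoint_def b'_def)
      have "\<forall>x\<in>fvU U' - lvars p. \<not> fun_var x \<longrightarrow> \<eta> x = \<eta>2 x"
        using hx vF(2) by (auto simp: UApp \<eta>2_def)
      then have 2: "ip (tyU U') (usem \<phi> \<eta> U') b' = (\<Sum>u\<in>lvars p \<inter> fvU U'. ip (vty u) (\<eta> u)
          (restr_val (fvU U') p (usem \<phi>' (bind q' b' \<eta>2) T') u))"
        using U' hf unfolding trU_adj_def UApp by (simp del: fun_upd_apply)
      have 3: "lvars p \<inter> fvU U' = lvars p \<inter> fvU U" using wf by (auto simp: UApp)
      have 4: "restr_val (fvU U') p = restr_val (fvU U) p"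
        using wf by (intro conjunct2[OF restr_cong]) (auto simp: UApp)
      have "usem \<phi>' (bind q b \<eta>') T = usem \<phi>' (bind q' b' \<eta>2) T'"
        by (simp add: T b'_def \<eta>2_def)
      then show ?thesis unfolding 1 2 3 4 by simp
    next
      case (UPair U1 U2)
      obtain X0 \<alpha>1 \<alpha>2 X1 t t1 t2 T1 q1 T2 q2 where
        X0: "X0 = X \<union> lvars p \<union> varsU (UPair U1 U2)"
        and \<alpha>1: "renaming \<alpha>1 (fvU U1 \<inter> lvars p) X0"
        and \<alpha>2: "renaming \<alpha>2 (fvU U2 \<inter> lvars p) (X0 \<union> ran \<alpha>1)"
        and X1: "X1 = X0 \<union> ran \<alpha>1 \<union> ran \<alpha>2" "finite X1"
        and t: "vty t = TTop" "t \<notin> X1" "vty t1 = TTop" "t1 \<notin> X1" "vty t2 = TTop" "t2 \<notin> X1" "t2 \<noteq> t1"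
        and q1: "trU X1 (ren_lpat \<alpha>1 p) (renU \<alpha>1 U1) = (T1, q1)"
        and q2: "trU (X1 \<union> lvars q1) (ren_lpat \<alpha>2 p) (renU \<alpha>2 U2) = (T2, q2)"
        and eq: "trU X p (UPair U1 U2) =
         (ULet (LPair (restr_lpat t1 \<alpha>1 p) (restr_lpat t2 \<alpha>2 p)) (UPair T1 T2)
            (nu (restr_lpat t (id_ren (lvars p \<inter> fvU (UPair U1 U2))) p) \<alpha>1 \<alpha>2), LPair q1 q2)"
        using trU_UPair_cases[OF X, of p U1 U2] by metis
      let ?r = "restr_lpat t (id_ren (lvars p \<inter> fvU (UPair U1 U2))) p"
      let ?r1 = "restr_lpat t1 \<alpha>1 p" and ?r2 = "restr_lpat t2 \<alpha>2 p"
      let ?nu = "nu ?r \<alpha>1 \<alpha>2"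
      have wf12: "wfU (lvars p) U1" "wfU (lvars p) U2" using wf by (auto simp: UPair)
      have X01: "lvars p \<union> varsU U1 \<subseteq> X0" "lvars p \<union> varsU U2 \<subseteq> X0 \<union> ran \<alpha>1" using X0 by auto
      note C1 = renamed_component[OF p wf12(1) X01(1) \<alpha>1]
      note C2 = renamed_component[OF p wf12(2) X01(2) \<alpha>2]
      note P1 = renaming_props[OF \<alpha>1] and P2 = renaming_props[OF \<alpha>2]
      have fin: "finite (X1 \<union> lvars q1)" using X1(2) by simp
      have I1: "trU_adj (ren_lpat \<alpha>1 p) (renU \<alpha>1 U1) T1 q1"
        using sz by (intro IHU[OF _ X1(2)] C1 q1) (simp add: UPair)
      have I2: "trU_adj (ren_lpat \<alpha>2 p) (renU \<alpha>2 U2) T2 q2"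
        using sz by (intro IHU[OF _ fin] C2 q2) (simp add: UPair)
      have W1: "trU_wf X1 (ren_lpat \<alpha>1 p) (renU \<alpha>1 U1) T1 q1" by (intro trU_wf X1 C1 q1)
      have W2: "trU_wf (X1 \<union> lvars q1) (ren_lpat \<alpha>2 p) (renU \<alpha>2 U2) T2 q2"
        by (intro trU_wf fin C2 q2)
      have q1v: "lvars q1 \<subseteq> ran \<alpha>1 \<union> - X1" using W1 C1(6,7) by (simp add: trU_wf_def)
      have q2v: "lvars q2 \<subseteq> ran \<alpha>2 \<union> - (X1 \<union> lvars q1)" using W2 C2(6,7) by (simp add: trU_wf_def)
      have r1X: "ran \<alpha>1 \<inter> X0 = {}" using \<alpha>1 by (simp add: renaming_def)
      have r2X: "ran \<alpha>2 \<inter> X0 = {}" "ran \<alpha>2 \<inter> ran \<alpha>1 = {}" using \<alpha>2 by (auto simp: renaming_def)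
      have q12: "lvars q1 \<inter> lvars q2 = {}" using q1v q2v r2X X1(1) by blast
      have f1: "fvU T1 - lvars q1 \<subseteq> flip ` (fvU U1 - lvars p)"
        and f2: "fvU T2 - lvars q2 \<subseteq> flip ` (fvU U2 - lvars p)"
        using W1 W2 C1(5) C2(5) by (auto simp: trU_wf_def)
      have wfq: "wf_lpat q1" "wf_lpat q2" using W1 W2 by (auto simp: trU_wf_def)
      have UX: "fvU U1 \<subseteq> X0" "fvU U2 \<subseteq> X0" "lvars p \<subseteq> X0"
        using X0 fvU_varsU(1)[of U1] fvU_varsU(1)[of U2] by auto
      have wfr: "wf_lpat ?r"
        using p t by (auto intro!: wf_restr_lpat)
      have T: "T = UApp (FLam (LPair ?r1 ?r2) ?nu) (UPair T1 T2)" "q = LPair q1 q2"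
        using tr eq by (simp_all add: UPair)

      define w1 where "w1 = usem \<phi>' (bind q1 (vfst b) \<eta>') T1"
      define w2 where "w2 = usem \<phi>' (bind q2 (vsnd b) \<eta>') T2"
      \<comment> \<open>One argument for both components of the pair; \<open>U1\<close>,
        \<open>T1\<close>, \<open>q1\<close> are bound afresh in it.\<close>
      have S: "ip (tyU U1) (usem \<phi> \<eta> U1) c
          = (\<Sum>u\<in>lvars p \<inter> fvU U1. ip (vty u) (\<eta> u)
               (restr_val (fvU U1) p (usem \<phi>' (bind q1 c \<eta>') T1) u))"
        if I: "trU_adj (ren_lpat \<alpha> p) (renU \<alpha> U1) T1 q1"
          and C: "wfU (lvars p) U1" "lvars p \<union> varsU U1 \<subseteq> Y" "renaming \<alpha> (fvU U1 \<inter> lvars p) Y"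
          and sub: "fvU U1 \<subseteq> fvU U" for U1 T1 q1 \<alpha> Y c
      proof -
        note C' = renamed_component[OF p C]
        \<comment> \<open>The environment that gives each renamed variable the value of the
          original; it exists because the renaming is injective on \<open>Y\<close>.\<close>
        define \<eta>1 where "\<eta>1 = \<eta> \<circ> the_inv_into Y (ren \<alpha>)"
        have \<eta>1: "\<eta>1 (ren \<alpha> x) = \<eta> x" if "x \<in> Y" for x
          using that renaming_inj[OF C(3)] by (simp add: \<eta>1_def the_inv_into_f_f)
        have nf: "\<not> fun_var x" if "x \<in> lvars (ren_lpat \<alpha> p)" for x
          using that C'(1) wf_lpat_var ltype_not_fun_var by blast
        have fv': "x \<in> fvU U1 - lvars p" if "x \<in> fvU (renU \<alpha> U1)" "fun_var x" for x
          using that nf C'(5) by blast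
        have "\<eta>1 x = \<eta>' x" if "x \<in> fvU (renU \<alpha> U1) - lvars (ren_lpat \<alpha> p)" "\<not> fun_var x" for x
        proof -
          have x: "x \<in> fvU U1 - lvars p" using that(1) C'(5) by simp
          then have "ren \<alpha> x = x" using renaming_props(1)[OF C(3)] by (intro ren_out) auto
          moreover have "x \<in> Y" using x C(2) fvU_varsU(1)[of U1] by auto
          ultimately show ?thesis using \<eta>1[of x] hx x sub that(2) by auto
        qed
        moreover have "adjoint (dom_ty (vty f)) (cod_ty (vty f)) (\<phi> f) (\<phi>' (flip f))"
          if "f \<in> fvU (renU \<alpha> U1)" "fun_var f" for f
          using fv'[OF that] that(2) hf sub by blast
        ultimately have "ip (tyU (renU \<alpha> U1)) (usem \<phi> \<eta>1 (renU \<alpha> U1)) c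
            = (\<Sum>u\<in>lvars (ren_lpat \<alpha> p) \<inter> fvU (renU \<alpha> U1). ip (vty u) (\<eta>1 u)
               (restr_val (fvU (renU \<alpha> U1)) (ren_lpat \<alpha> p) (usem \<phi>' (bind q1 c \<eta>') T1) u))"
          using I unfolding trU_adj_def by blast
        moreover have "usem \<phi> \<eta>1 (renU \<alpha> U1) = usem \<phi> \<eta> U1"
          by (rule usem_ren[where L = "lvars p" and X = Y and S = "fvU U1 \<inter> lvars p"])
            (use C \<eta>1 in auto)
        ultimately show ?thesis
          using sum_restr_renamed[where ?\<eta>1.0 = \<eta>1, OF p C] \<eta>1 C'(3) by simp
      qed
      have S1: "ip (tyU U1) (usem \<phi> \<eta> U1) (vfst b)
          = (\<Sum>u\<in>lvars p \<inter> fvU U1. ip (vty u) (\<eta> u) (restr_val (fvU U1) p w1 u))"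
        unfolding w1_def by (rule S[OF I1 wf12(1) X01(1) \<alpha>1]) (simp add: UPair)
      have S2: "ip (tyU U2) (usem \<phi> \<eta> U2) (vsnd b)
          = (\<Sum>u\<in>lvars p \<inter> fvU U2. ip (vty u) (\<eta> u) (restr_val (fvU U2) p w2 u))"
        unfolding w2_def by (rule S[OF I2 wf12(2) X01(2) \<alpha>2]) (simp add: UPair)

      \<comment> \<open>\<open>\<zeta>0\<close> is the environment after matching both input
        patterns, \<open>\<zeta>\<close> the one in which the final \<open>nu\<close> is
        evaluated.\<close>
      define \<zeta>0 where "\<zeta>0 = bind q2 (vsnd b) (bind q1 (vfst b) \<eta>')"
      define \<zeta> where "\<zeta> = bind ?r2 w2 (bind ?r1 w1 \<zeta>0)"
      have e1: "usem \<phi>' \<zeta>0 T1 = w1"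
        unfolding w1_def
      proof (rule usem_cong(1))
        show "wfU (lvars q1) T1" using W1 by (simp add: trU_wf_def)
        show "ltype (vty u)" if "u \<in> lvars q1" for u using that wfq(1) wf_lpat_var by blast
        fix x assume x: "x \<in> fvU T1"
        show "if fun_var x then \<phi>' x = \<phi>' x else \<zeta>0 x = bind q1 (vfst b) \<eta>' x"
        proof (cases "fun_var x \<or> x \<in> lvars q1")
          case True
          then have "\<not> fun_var x \<longrightarrow> x \<notin> lvars q2" using q12 by auto
          then show ?thesis by (auto simp: \<zeta>0_def bind_outside)
        next
          case False
          then have "x \<in> fvU U1" using x f1 flip_eq[of x] by blast
          then have "x \<notin> lvars q2" using UX q2v r2X X1(1) by blast
          then show ?thesis by (simp add: \<zeta>0_def bind_outside)
        qed
      qed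
      have e2: "usem \<phi>' \<zeta>0 T2 = w2"
        unfolding w2_def
      proof (rule usem_cong(1))
        show "wfU (lvars q2) T2" using W2 by (simp add: trU_wf_def)
        show "ltype (vty u)" if "u \<in> lvars q2" for u using that wfq(2) wf_lpat_var by blast
        fix x assume x: "x \<in> fvU T2"
        show "if fun_var x then \<phi>' x = \<phi>' x else \<zeta>0 x = bind q2 (vsnd b) \<eta>' x"
        proof (cases "fun_var x \<or> x \<in> lvars q2")
          case True
          then show ?thesis using bind_inside[of x q2 "vsnd b"] by (auto simp: \<zeta>0_def)
        next
          case False
          then have "x \<in> fvU U2" using x f2 flip_eq[of x] by blast
          then have "x \<notin> lvars q1" using UX q1v r1X X1(1) by blast
          then show ?thesis using False by (simp add: \<zeta>0_def bind_outside)
        qed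
      qed
      have W: "usem \<phi>' (bind q b \<eta>') T = usem \<phi>' \<zeta> ?nu"
        using T e1 e2 by (simp add: \<zeta>_def \<zeta>0_def)
      have c1: "contrib \<eta> \<zeta> \<alpha>1 u = (if u \<in> fvU U1 then ip (vty u) (\<eta> u) (restr_val (fvU U1) p w1 u) else 0)"
        if u: "u \<in> lvars p" for u
      proof (cases "\<alpha>1 u")
        case None
        then show ?thesis using P1(1) u by (auto simp: contrib_def)
      next
        case (Some y)
        then have y: "y \<in> ran \<alpha>1" "u \<in> fvU U1" using P1 by auto
        have "lvars ?r2 \<subseteq> insert t2 (ran \<alpha>2)" by (auto simp: lvars_restr_lpat ran_def split: if_splits)
        then have "y \<notin> lvars ?r2" using y(1) r2X t X1(1) by blast
        then have "\<zeta> y = restr_val (dom \<alpha>1) p w1 u"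
          using bind_restr_lpat[OF P1(2) p u Some] by (simp add: \<zeta>_def bind_outside)
        moreover have "restr_val (dom \<alpha>1) p = restr_val (fvU U1) p"
          using P1(1) by (intro conjunct2[OF restr_cong]) auto
        ultimately show ?thesis using Some y by (simp add: contrib_def)
      qed
      have c2: "contrib \<eta> \<zeta> \<alpha>2 u = (if u \<in> fvU U2 then ip (vty u) (\<eta> u) (restr_val (fvU U2) p w2 u) else 0)"
        if u: "u \<in> lvars p" for u
      proof (cases "\<alpha>2 u")
        case None
        then show ?thesis using P2(1) u by (auto simp: contrib_def)
      next
        case (Some y)
        then have y: "u \<in> fvU U2" using P2 by auto
        have "\<zeta> y = restr_val (dom \<alpha>2) p w2 u"
          using bind_restr_lpat[OF P2(2) p u Some] by (simp add: \<zeta>_def)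
        moreover have "restr_val (dom \<alpha>2) p = restr_val (fvU U2) p"
          using P2(1) by (intro conjunct2[OF restr_cong]) auto
        ultimately show ?thesis using Some y by (simp add: contrib_def)
      qed
      let ?S = "lvars p \<inter> fvU U"
      have "(\<Sum>u\<in>?S. ip (vty u) (\<eta> u) (restr_val (fvU U) p (usem \<phi>' \<zeta> ?nu) u))
          = (\<Sum>u\<in>lvars p \<inter> ?S. ip (vty u) (\<eta> u) (restr_val ?S p (usem \<phi>' \<zeta> ?nu) u))"
        using restr_cong[of p ?S "fvU U"] by (intro sum.cong) auto
      also have "\<dots> = ip (lpat_ty ?r) (ptup \<eta> ?r) (usem \<phi>' \<zeta> ?nu)"
        using ip_restr_lpat[OF p t(1), of ?S \<eta> "usem \<phi>' \<zeta> ?nu"] by (simp add: UPair)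
      also have "\<dots> = (\<Sum>u\<in>lvars ?r. contrib \<eta> \<zeta> \<alpha>1 u + contrib \<eta> \<zeta> \<alpha>2 u)"
        by (rule ip_nu[OF wfr])
      also have "\<dots> = (\<Sum>u\<in>?S. contrib \<eta> \<zeta> \<alpha>1 u + contrib \<eta> \<zeta> \<alpha>2 u)"
      proof (cases "?S = {}")
        \<comment> \<open>Without linear variables the restricted pattern is the placeholder
          \<open>t\<close>, which lies outside both domains, so both sums vanish.\<close>
        case True
        then have r: "lvars ?r = {t}" by (simp add: lvars_restr_lpat UPair)
        have "t \<notin> dom \<alpha>1" "t \<notin> dom \<alpha>2" using P1(1) P2(1) t(2) X1(1) UX by auto
        then have "\<alpha>1 t = None" "\<alpha>2 t = None" by auto
        then have "contrib \<eta> \<zeta> \<alpha>1 t = 0" "contrib \<eta> \<zeta> \<alpha>2 t = 0" by (simp_all add: contrib_def)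
        then show ?thesis unfolding r True by simp
      next
        case False
        then have "lvars ?r = ?S" by (auto simp: lvars_restr_lpat UPair split: if_splits)
        then show ?thesis by simp
      qed
      also have "\<dots> = (\<Sum>u\<in>?S. contrib \<eta> \<zeta> \<alpha>1 u) + (\<Sum>u\<in>?S. contrib \<eta> \<zeta> \<alpha>2 u)"
        by (rule sum.distrib)
      also have "(\<Sum>u\<in>?S. contrib \<eta> \<zeta> \<alpha>1 u)
          = (\<Sum>u\<in>lvars p \<inter> fvU U1. ip (vty u) (\<eta> u) (restr_val (fvU U1) p w1 u))"
        using c1 by (intro sum.mono_neutral_cong_right) (auto simp: UPair)
      also have "(\<Sum>u\<in>?S. contrib \<eta> \<zeta> \<alpha>2 u)
          = (\<Sum>u\<in>lvars p \<inter> fvU U2. ip (vty u) (\<eta> u) (restr_val (fvU U2) p w2 u))"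
        using c2 by (intro sum.mono_neutral_cong_right) (auto simp: UPair)
      finally show ?thesis using S1 S2 W by (simp add: UPair)
    qed auto
  qed
  moreover have "trF_adj F" if sz: "size F < Suc n" and wf: "wfF F" for F
    unfolding trF_adj_def
  proof (intro allI impI)
    fix \<phi> \<phi>' :: "var \<Rightarrow> val \<Rightarrow> val" and \<eta> \<eta>' :: "var \<Rightarrow> val"
    assume hf: "\<forall>f\<in>fvF F. fun_var f \<longrightarrow> adjoint (dom_ty (vty f)) (cod_ty (vty f)) (\<phi> f) (\<phi>' (flip f))"
      and hx: "\<forall>x\<in>fvF F. \<not> fun_var x \<longrightarrow> \<eta> x = \<eta>' x"
    show "adjoint (domF F) (codF F) (fsem \<phi> \<eta> F) (fsem \<phi>' \<eta>' (trF F))"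
    proof (cases F)
      case (FVar f)
      then show ?thesis using wf hf by (auto simp: fun_var_def flip_def)
    next
      case FPlus
      then show ?thesis by (simp add: adjoint_def Let_def algebra_simps)
    next
      case (FTimes x)
      then show ?thesis using wf hx by (auto simp: adjoint_def fun_var_def)
    next
      case (FLam p U)
      have p: "wf_lpat p" "wfU (lvars p) U" using wf by (auto simp: FLam)
      obtain T q where tr: "trU {} p U = (T, q)" by fastforce
      define t where "t = fresh (lvars p \<union> varsU U) TTop"
      let ?\<iota> = "id_ren (lvars p \<inter> fvU U)"
      let ?r = "restr_lpat t ?\<iota> p"
      have F: "trF F = FLam q (ULet ?r T (nu p ?\<iota> Map.empty))"
        using tr by (simp add: FLam Let_def t_def[symmetric])
      have I: "trU_adj p U T q" using sz p tr by (intro IHU) (auto simp: FLam)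
      show ?thesis unfolding adjoint_def
      proof (intro allI)
        fix a b
        define w where "w = usem \<phi>' (bind q b \<eta>') T"
        define \<zeta> where "\<zeta> = bind ?r w (bind q b \<eta>')"
        have hf': "\<forall>f\<in>fvU U. fun_var f
            \<longrightarrow> adjoint (dom_ty (vty f)) (cod_ty (vty f)) (\<phi> f) (\<phi>' (flip f))"
          using hf wf_lpat_var[OF p(1)] ltype_not_fun_var by (auto simp: FLam)
        have hx': "\<forall>x\<in>fvU U - lvars p. \<not> fun_var x \<longrightarrow> bind p a \<eta> x = \<eta>' x"
          using hx by (simp add: FLam bind_outside)
        have "ip (codF F) (fsem \<phi> \<eta> F a) b = (\<Sum>u\<in>lvars p \<inter> fvU U. ip (vty u) (bind p a \<eta> u)
            (restr_val (fvU U) p w u))"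
          using I hf' hx' unfolding trU_adj_def w_def by (simp add: FLam)
        \<comment> \<open>Variables of the pattern that \<open>U\<close> ignores contribute 0, so
          the sum may run over the whole pattern.\<close>
        also have "\<dots> = (\<Sum>u\<in>lvars p. contrib (bind p a \<eta>) \<zeta> ?\<iota> u + contrib (bind p a \<eta>) \<zeta> Map.empty u)"
        proof (rule sum.mono_neutral_cong_left)
          fix u assume u: "u \<in> lvars p \<inter> fvU U"
          have "\<zeta> u = restr_val (lvars p \<inter> fvU U) p w u"
            using bind_restr_lpat[of ?\<iota> p u u t w] p u by (simp add: \<zeta>_def)
          moreover have "restr_val (lvars p \<inter> fvU U) p = restr_val (fvU U) p"
            by (intro conjunct2[OF restr_cong]) auto
          ultimately show "ip (vty u) (bind p a \<eta> u) (restr_val (fvU U) p w u)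
              = contrib (bind p a \<eta>) \<zeta> ?\<iota> u + contrib (bind p a \<eta>) \<zeta> Map.empty u"
            using u by (simp add: contrib_def id_ren_apply)
        qed (auto simp: contrib_def id_ren_apply)
        also have "\<dots> = ip (lpat_ty p) (ptup (bind p a \<eta>) p) (usem \<phi>' \<zeta> (nu p ?\<iota> Map.empty))"
          by (rule ip_nu[OF p(1), symmetric])
        also have "\<dots> = ip (lpat_ty p) a (usem \<phi>' \<zeta> (nu p ?\<iota> Map.empty))"
          by (rule ip_ptup_bind[OF p(1)])
        finally show "ip (codF F) (fsem \<phi> \<eta> F a) b = ip (domF F) a (fsem \<phi>' \<eta>' (trF F) b)"
          by (simp add: F) (simp add: FLam \<zeta>_def w_def)
      qed
    qed (use wf in auto)
  qed
  ultimately show ?case by blast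
qed simp

lemma trF_adj: "wfF F \<Longrightarrow> trF_adj F"
  using trU_trF_adj[of "Suc (size F)"] by blast

section \<open>Adjointness for \<open>R\<close>\<close>

subsection \<open>The transpose of \<open>R\<close>\<close>

text \<open>On such terms \<open>trR\<close> never resorts to \<open>unfoldR\<close>.\<close>

primrec usedR :: "'f R_tm \<Rightarrow> bool" where
  "usedR (RPair P F) = True"
| "usedR (RLet x f R S) = (f \<in> fvR S \<and> usedR R \<and> usedR S)"
| "usedR (RLetF f F S) = (f \<in> fvR S \<and> usedR S)"
| "usedR (RLetP x P S) = usedR S"
| "usedR (RLetOne z S) = usedR S"

lemma trR_wf:
  "wfR ar R \<Longrightarrow> usedR R \<Longrightarrow> wfR ar (trR R) \<and> primR (trR R) = primR R \<and> domR (trR R) = codR R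
     \<and> codR (trR R) = domR R \<and> fvR (trR R) \<subseteq> flip ` fvR R"
proof (induction R)
  case (RPair P F)
  have "fvP P \<subseteq> flip ` fvP P"
    using wfP_not_fun_var[of ar P] RPair.prems(1) flip_eq by auto
  then show ?case using RPair trF_wf[of F] by (auto simp: trF_wf_def)
next
  case (RLet x f R S)
  have f: "fun_var f" "\<not> fun_var x" using RLet.prems(1) by (auto simp: fun_var_def)
  have IH1: "wfR ar (trR R) \<and> primR (trR R) = primR R \<and> domR (trR R) = codR R
     \<and> codR (trR R) = domR R \<and> fvR (trR R) \<subseteq> flip ` fvR R"
    using RLet by simp
  have IH2: "wfR ar (trR S) \<and> primR (trR S) = primR S \<and> domR (trR S) = codR S
     \<and> codR (trR S) = domR S \<and> fvR (trR S) \<subseteq> flip ` fvR S"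
    using RLet by simp
  have e: "flip_var f = flip f" "flip x = x" using f by (auto simp: flip_def)
  have "flip ` fvR S - {x, flip f} \<subseteq> flip ` (fvR S - {x, f})" using e(2) by auto
  then have "fvR (RLet x (flip_var f) (trR R) (trR S)) \<subseteq> flip ` fvR (RLet x f R S)"
    using IH1 IH2 e(1) by (simp add: image_Un) blast
  moreover have "\<not> fun_var g" if "g \<in> fvR (trR R)" for g
    using that IH1 RLet.prems(1) by auto
  ultimately show ?case using IH1 IH2 RLet.prems by (auto simp: flip_var_def)
next
  case (RLetOne z S)
  have "flip z = z" using RLetOne.prems(1) by (auto simp: flip_def fun_var_def)
  then show ?case using RLetOne by auto
qed auto

lemma rprim_trR: "wfR ar R \<Longrightarrow> usedR R \<Longrightarrow> rprim den \<eta> (trR R) = rprim den \<eta> R"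
  by (induction R arbitrary: \<eta>) auto

text \<open>A \<open>let\<close> binds \<open>f\<close> to a map on one side and its flip to the
  adjoint of that map on the other, so the assumption on free function variables passes to the
  body.\<close>

theorem rfun_trR:
  "wfR ar R \<Longrightarrow> usedR R
    \<Longrightarrow> (\<And>f. f \<in> fvR R \<Longrightarrow> fun_var f
          \<Longrightarrow> adjoint (dom_ty (vty f)) (cod_ty (vty f)) (\<phi> f) (\<phi>' (flip f)))
    \<Longrightarrow> adjoint (domR R) (codR R) (rfun den \<phi> \<eta> R) (rfun den \<phi>' \<eta> (trR R))"
proof (induction R arbitrary: \<phi> \<phi>' \<eta>)
  case (RPair P F)
  then show ?case using trF_adj[of F] by (simp add: trF_adj_def)
next
  case (RLet x f R S)
  have f: "fun_var f" using RLet.prems(1) by (auto simp: fun_var_def)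
  have 1: "adjoint (domR R) (codR R) (rfun den \<phi> \<eta> R) (rfun den \<phi>' \<eta> (trR R))"
    using RLet.prems by (intro RLet.IH(1)) auto
  have "adjoint (domR S) (codR S)
      (rfun den (\<phi>(f := rfun den \<phi> \<eta> R)) (\<eta>(x := rprim den \<eta> R)) S)
      (rfun den (\<phi>'(flip f := rfun den \<phi>' \<eta> (trR R))) (\<eta>(x := rprim den \<eta> R)) (trR S))"
  proof (rule RLet.IH(2))
    fix g assume g: "g \<in> fvR S" "fun_var g"
    have gx: "g \<noteq> x" using g(2) RLet.prems(1) first_order_not_fun_var by auto
    show "adjoint (dom_ty (vty g)) (cod_ty (vty g)) ((\<phi>(f := rfun den \<phi> \<eta> R)) g)
        ((\<phi>'(flip f := rfun den \<phi>' \<eta> (trR R))) (flip g))"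
    proof (cases "g = f")
      case True
      then show ?thesis using 1 RLet.prems(1) by simp
    next
      case False
      then have "flip g \<noteq> flip f" using inj_flip by (auto dest: injD)
      then show ?thesis using False g gx RLet.prems(3)[of g] by simp
    qed
  qed (use RLet.prems in auto)
  then show ?case using RLet.prems f rprim_trR[of ar R den \<eta>] by (auto simp: flip_def)
next
  case (RLetOne z S)
  then show ?case by auto
qed auto

section \<open>Linear A: linearity conditions and a direct semantics\<close>

section \<open>Semantics of Linear A\<close>

text \<open>The conditions of \<open>linear_A\<close> rephrased on the expression alone. Tangent
  contexts are linear, so they equal the set of free tangent variables, whereas primal contexts
  merely contain the free primal ones.\<close>

primrec wfA :: "('f \<Rightarrow> nat) \<Rightarrow> 'f aexp \<Rightarrow> bool" where
  "wfA ar (AVar x y) = True"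
| "wfA ar (ALet x y e1 e2) = (wfA ar e1 \<and> wfA ar e2 \<and> prim_ty e1 = avty x \<and> tan_ty e1 = avty y
     \<and> y \<in> fvt e2 \<and> fvt e1 \<inter> (fvt e2 - {y}) = {})"
| "wfA ar APrimUnit = True"
| "wfA ar ATanUnit = True"
| "wfA ar (APrimLetUnit z e) = (wfA ar e \<and> avty z = AOne)"
| "wfA ar (ATanLetUnit z e) = (wfA ar e \<and> avty z = AOne \<and> z \<notin> fvt e)"
| "wfA ar (ATanPair x1 x2) = (x1 \<noteq> x2)"
| "wfA ar (ATanLetPair x1 x2 z e) = (wfA ar e \<and> x1 \<in> fvt e \<and> x2 \<in> fvt e \<and> x1 \<noteq> x2
     \<and> z \<notin> fvt e - {x1, x2} \<and> avty z = ATensor (avty x1) (avty x2))"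
| "wfA ar (AZero \<tau>) = True"
| "wfA ar (APlus x y) = (x \<noteq> y \<and> avty x = avty y)"
| "wfA ar (ATimes x y) = (avty x = AReal)"
| "wfA ar (ANum r) = True"
| "wfA ar (AFun f xs) = (length xs = ar f \<and> (\<forall>x\<in>set xs. avty x = AReal))"
| "wfA ar (ADup x) = True"
| "wfA ar (ADrop e) = wfA ar e"

lemma linear_A_wfA:
  "linear_A ar \<Gamma> \<Delta> e \<tau> \<sigma>
    \<Longrightarrow> wfA ar e \<and> fvp e \<subseteq> \<Gamma> \<and> fvt e = \<Delta> \<and> prim_ty e = \<tau> \<and> tan_ty e = \<sigma>"
  by (induction rule: linear_A.induct) auto

lemma finite_fvt [simp]: "finite (fvt e)"
  by (induction e) auto

lemma finite_fvp [simp]: "finite (fvp e)"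
  by (induction e) auto

text \<open>Primal results never depend on tangents, so no tangent environment is passed.\<close>

primrec aprim :: "('f \<Rightarrow> real list \<Rightarrow> real) \<Rightarrow> (avar \<Rightarrow> val) \<Rightarrow> 'f aexp \<Rightarrow> val" where
  "aprim den \<gamma> (AVar x y) = \<gamma> x"
| "aprim den \<gamma> (ALet x y e1 e2) = aprim den (\<gamma>(x := aprim den \<gamma> e1)) e2"
| "aprim den \<gamma> APrimUnit = VU"
| "aprim den \<gamma> ATanUnit = VU"
| "aprim den \<gamma> (APrimLetUnit z e) = aprim den \<gamma> e"
| "aprim den \<gamma> (ATanLetUnit z e) = aprim den \<gamma> e"
| "aprim den \<gamma> (ATanPair x1 x2) = VU"
| "aprim den \<gamma> (ATanLetPair x1 x2 z e) = aprim den \<gamma> e"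
| "aprim den \<gamma> (AZero \<tau>) = VU"
| "aprim den \<gamma> (APlus x y) = VU"
| "aprim den \<gamma> (ATimes x y) = VU"
| "aprim den \<gamma> (ANum r) = VR r"
| "aprim den \<gamma> (AFun f xs) = VR (den f (map (\<lambda>x. vreal (\<gamma> x)) xs))"
| "aprim den \<gamma> (ADup x) = VU"
| "aprim den \<gamma> (ADrop e) = VU"

primrec atan :: "('f \<Rightarrow> real list \<Rightarrow> real) \<Rightarrow> (avar \<Rightarrow> val) \<Rightarrow> (avar \<Rightarrow> val) \<Rightarrow> 'f aexp \<Rightarrow> val" where
  "atan den \<gamma> \<zeta> (AVar x y) = \<zeta> y"
| "atan den \<gamma> \<zeta> (ALet x y e1 e2) =
     atan den (\<gamma>(x := aprim den \<gamma> e1)) (\<zeta>(y := atan den \<gamma> \<zeta> e1)) e2"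
| "atan den \<gamma> \<zeta> APrimUnit = VU"
| "atan den \<gamma> \<zeta> ATanUnit = VU"
| "atan den \<gamma> \<zeta> (APrimLetUnit z e) = atan den \<gamma> \<zeta> e"
| "atan den \<gamma> \<zeta> (ATanLetUnit z e) = atan den \<gamma> \<zeta> e"
| "atan den \<gamma> \<zeta> (ATanPair x1 x2) = VP (\<zeta> x1) (\<zeta> x2)"
| "atan den \<gamma> \<zeta> (ATanLetPair x1 x2 z e) =
     atan den \<gamma> (\<zeta>(x1 := vfst (\<zeta> z), x2 := vsnd (\<zeta> z))) e"
| "atan den \<gamma> \<zeta> (AZero \<tau>) = vzero (t_ty \<tau>)"
| "atan den \<gamma> \<zeta> (APlus x y) = vadd (t_ty (avty x)) (\<zeta> x) (\<zeta> y)"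
| "atan den \<gamma> \<zeta> (ATimes x y) = vscale (t_ty (avty y)) (vreal (\<gamma> x)) (\<zeta> y)"
| "atan den \<gamma> \<zeta> (ANum r) = VU"
| "atan den \<gamma> \<zeta> (AFun f xs) = VU"
| "atan den \<gamma> \<zeta> (ADup x) = VP (\<zeta> x) (\<zeta> x)"
| "atan den \<gamma> \<zeta> (ADrop e) = VU"

lemma aprim_cong: "(\<And>x. x \<in> fvp e \<Longrightarrow> \<gamma> x = \<gamma>' x) \<Longrightarrow> aprim den \<gamma> e = aprim den \<gamma>' e"
proof (induction e arbitrary: \<gamma> \<gamma>')
  case (ALet x y e1 e2)
  have "aprim den \<gamma> e1 = aprim den \<gamma>' e1" by (rule ALet.IH) (use ALet.prems in auto)
  then show ?case unfolding aprim.simps by (intro ALet.IH(2)) (use ALet.prems in auto)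
next
  case (AFun f xs)
  then have "map (\<lambda>x. vreal (\<gamma> x)) xs = map (\<lambda>x. vreal (\<gamma>' x)) xs" by simp
  then show ?case by (simp only: aprim.simps)
next
  case (APrimLetUnit z e)
  show ?case unfolding aprim.simps by (rule APrimLetUnit.IH) (use APrimLetUnit.prems in auto)
next
  case (ATanLetUnit z e)
  show ?case unfolding aprim.simps by (rule ATanLetUnit.IH) (use ATanLetUnit.prems in auto)
next
  case (ATanLetPair x1 x2 z e)
  show ?case unfolding aprim.simps by (rule ATanLetPair.IH) (use ATanLetPair.prems in auto)
qed auto

lemma atan_cong:
  "(\<And>x. x \<in> fvp e \<Longrightarrow> \<gamma> x = \<gamma>' x) \<Longrightarrow> (\<And>y. y \<in> fvt e \<Longrightarrow> \<zeta> y = \<zeta>' y)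
    \<Longrightarrow> atan den \<gamma> \<zeta> e = atan den \<gamma>' \<zeta>' e"
proof (induction e arbitrary: \<gamma> \<gamma>' \<zeta> \<zeta>')
  case (ALet x y e1 e2)
  have "aprim den \<gamma> e1 = aprim den \<gamma>' e1" by (rule aprim_cong) (use ALet.prems in auto)
  moreover have "atan den \<gamma> \<zeta> e1 = atan den \<gamma>' \<zeta>' e1" by (rule ALet.IH) (use ALet.prems in auto)
  ultimately show ?case unfolding atan.simps by (intro ALet.IH(2)) (use ALet.prems in auto)
next
  case (APrimLetUnit z e)
  show ?case unfolding atan.simps by (rule APrimLetUnit.IH) (use APrimLetUnit.prems in auto)
next
  case (ATanLetUnit z e)
  show ?case unfolding atan.simps by (rule ATanLetUnit.IH) (use ATanLetUnit.prems in auto)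
next
  case (ATanLetPair x1 x2 z e)
  show ?case unfolding atan.simps by (rule ATanLetPair.IH) (use ATanLetPair.prems in auto)
qed auto

section \<open>Additive tuples indexed by lists of tangent variables\<close>

subsection \<open>Tuples\<close>

lemma first_order_p_ty [simp]: "first_order (p_ty \<tau>)"
  by (induction \<tau>) auto

lemma ltype_t_ty [simp]: "ltype (t_ty \<tau>)"
  by (induction \<tau>) auto

lemma vty_pvar [simp]: "vty (pvar x) = p_ty (avty x)" and vty_tvar [simp]: "vty (tvar x) = t_ty (avty x)"
  by (simp_all add: pvar_def tvar_def)

text \<open>Variables carry their types, so the translation of types must be injective to keep
  variables of equal name and different type apart.\<close>

lemma p_ty_inj: "p_ty \<tau> = p_ty \<sigma> \<Longrightarrow> \<tau> = \<sigma>"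
  by (induction \<tau> arbitrary: \<sigma>; case_tac \<sigma>) auto

lemma t_ty_inj: "t_ty \<tau> = t_ty \<sigma> \<Longrightarrow> \<tau> = \<sigma>"
  by (induction \<tau> arbitrary: \<sigma>; case_tac \<sigma>) auto

lemma pvar_eq [simp]: "pvar x = pvar y \<longleftrightarrow> x = y"
  by (cases x; cases y) (auto simp: pvar_def dest: p_ty_inj)

lemma tvar_eq [simp]: "tvar x = tvar y \<longleftrightarrow> x = y"
  by (cases x; cases y) (auto simp: tvar_def dest: t_ty_inj)

lemma var_neq [simp]: "tvar x \<noteq> V (Aux n) A" "V (Aux n) A \<noteq> tvar x" "pvar x \<noteq> V (Aux n) A"
  "V (Aux n) A \<noteq> pvar x"
  by (auto simp: pvar_def tvar_def)

lemma fun_var_pvar [simp]: "\<not> fun_var (pvar x)"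
  by (rule first_order_not_fun_var) simp

lemma fun_var_tvar [simp]: "\<not> fun_var (tvar x)"
  by (rule ltype_not_fun_var) simp

lemma ltype_with_ty: "(\<And>A. A \<in> set As \<Longrightarrow> ltype A) \<Longrightarrow> ltype (with_ty As)"
  by (induction As rule: with_ty.induct) auto

lemma ltype_theta_with [simp]: "ltype (theta_with \<theta>)"
  unfolding theta_with_def by (rule ltype_with_ty) auto

lemma lpat_ty_with_pat: "lpat_ty (with_pat ps) = with_ty (map lpat_ty ps)"
  by (induction ps rule: with_pat.induct) auto

lemma tyU_with_U: "tyU (with_U Us) = with_ty (map tyU Us)"
  by (induction Us rule: with_U.induct) auto

lemma fvU_with_U: "fvU (with_U Us) = (\<Union>U\<in>set Us. fvU U)"
  by (induction Us rule: with_U.induct) auto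

lemma wfU_with_U: "wfU L (with_U Us) \<longleftrightarrow> (\<forall>U\<in>set Us. wfU L U)"
  by (induction Us rule: with_U.induct) auto

fun vtuple :: "val list \<Rightarrow> val" where
  "vtuple [] = VU"
| "vtuple [a] = a"
| "vtuple (a # as) = VP a (vtuple as)"

lemma usem_with_U: "usem \<phi> \<eta> (with_U Us) = vtuple (map (usem \<phi> \<eta>) Us)"
  by (induction Us rule: with_U.induct) auto

text \<open>Lookup in a right-nested tuple. It is meaningful only for \<open>w\<close> in
  \<open>\<theta>\<close>, a condition that \<open>tbind\<close> tests.\<close>

fun tget :: "avar list \<Rightarrow> val \<Rightarrow> avar \<Rightarrow> val" where
  "tget [] a w = VU"
| "tget [y] a w = a"
| "tget (y # \<theta>) a w = (if w = y then vfst a else tget \<theta> (vsnd a) w)"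

definition tbind :: "avar list \<Rightarrow> val \<Rightarrow> (avar \<Rightarrow> val) \<Rightarrow> avar \<Rightarrow> val" where
  "tbind \<theta> a \<zeta> w = (if w \<in> set \<theta> then tget \<theta> a w else \<zeta> w)"

lemma tget_vtuple: "w \<in> set \<theta> \<Longrightarrow> tget \<theta> (vtuple (map h \<theta>)) w = h w"
  by (induction \<theta> rule: induct_list012) auto

lemma lvars_with_pat: "ps \<noteq> [] \<Longrightarrow> lvars (with_pat ps) = (\<Union>p\<in>set ps. lvars p)"
  by (induction ps rule: with_pat.induct) auto

lemma wf_with_pat:
  "distinct \<theta> \<Longrightarrow> (\<And>w. w \<in> set \<theta> \<Longrightarrow> wf_lpat (g w))
    \<Longrightarrow> (\<And>v w. v \<in> set \<theta> \<Longrightarrow> w \<in> set \<theta> \<Longrightarrow> v \<noteq> w \<Longrightarrow> lvars (g v) \<inter> lvars (g w) = {})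
    \<Longrightarrow> wf_lpat (with_pat (map g \<theta>))"
proof (induction \<theta> rule: induct_list012)
  case (3 x y \<theta>)
  have "lvars (g x) \<inter> lvars (with_pat (map g (y # \<theta>))) = {}"
    using 3(3,5) by (subst lvars_with_pat) auto
  moreover have "wf_lpat (with_pat (map g (y # \<theta>)))"
    by (rule 3(2)) (use 3(3-5) in auto)
  ultimately show ?case using 3(4) by simp
qed auto

text \<open>Stated for a family \<open>g\<close> of subpatterns, because the translation of a pair
  destructuring puts a pair pattern at one position of the tuple.\<close>

lemma bind_with_pat:
  "distinct \<theta>
    \<Longrightarrow> (\<And>v w. v \<in> set \<theta> \<Longrightarrow> w \<in> set \<theta> \<Longrightarrow> v \<noteq> w \<Longrightarrow> lvars (g v) \<inter> lvars (g w) = {})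
    \<Longrightarrow> w \<in> set \<theta> \<Longrightarrow> x \<in> lvars (g w)
    \<Longrightarrow> bind (with_pat (map g \<theta>)) a \<eta> x = bind (g w) (tget \<theta> a w) \<eta>' x"
proof (induction \<theta> arbitrary: a \<eta> rule: induct_list012)
  case (2 y)
  then show ?case using bind_inside by auto
next
  case (3 y z \<theta>)
  have eq: "bind (with_pat (map g (y # z # \<theta>))) a \<eta>
      = bind (with_pat (map g (z # \<theta>))) (vsnd a) (bind (g y) (vfst a) \<eta>)" by simp
  show ?case
  proof (cases "w = y")
    case True
    then have "x \<notin> lvars (with_pat (map g (z # \<theta>)))"
      using 3(3,4,6) by (subst lvars_with_pat) auto
    then show ?thesis unfolding eq using True bind_inside[of x "g y"] 3(6) by (simp add: bind_outside)
  next
    case False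
    have "bind (with_pat (map g (z # \<theta>))) (vsnd a) (bind (g y) (vfst a) \<eta>) x
        = bind (g w) (tget (z # \<theta>) (vsnd a) w) \<eta>' x"
      by (rule 3(2)) (use 3(3-6) False in auto)
    then show ?thesis unfolding eq using False by simp
  qed
qed auto

lemma lpat_ty_theta_pat [simp]: "lpat_ty (theta_pat \<theta>) = theta_with \<theta>"
  by (simp add: theta_pat_def theta_with_def lpat_ty_with_pat comp_def)

lemma wf_theta_pat [simp]: "distinct \<theta> \<Longrightarrow> wf_lpat (theta_pat \<theta>)"
  unfolding theta_pat_def by (rule wf_with_pat) auto

lemma lvars_theta_pat: "lvars (theta_pat \<theta>) = (if \<theta> = [] then {V (Aux 0) TTop} else tvar ` set \<theta>)"
  by (auto simp: theta_pat_def lvars_with_pat)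

lemma tvar_in_theta_pat: "w \<in> set \<theta> \<Longrightarrow> tvar w \<in> lvars (theta_pat \<theta>)"
  by (auto simp: lvars_theta_pat)

lemma fun_not_in_theta_pat: "fun_var f \<Longrightarrow> f \<notin> lvars (theta_pat \<theta>)"
  by (auto simp: lvars_theta_pat fun_var_def[of "V (Aux 0) TTop"])

lemma bind_theta_pat: "distinct \<theta> \<Longrightarrow> w \<in> set \<theta> \<Longrightarrow> bind (theta_pat \<theta>) a \<eta> (tvar w) = tget \<theta> a w"
  unfolding theta_pat_def by (subst bind_with_pat[where w = w and \<eta>' = \<eta>]) auto

lemma theta_U_props:
  "tyU (theta_U \<theta>) = theta_with \<theta>" "fvU (theta_U \<theta>) = tvar ` set \<theta>"
  "wfU L (theta_U \<theta>) \<longleftrightarrow> tvar ` set \<theta> \<subseteq> L"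
  "usem \<phi> \<eta> (theta_U \<theta>) = vtuple (map (\<lambda>y. \<eta> (tvar y)) \<theta>)"
  by (auto simp: theta_U_def theta_with_def tyU_with_U fvU_with_U wfU_with_U usem_with_U comp_def)

lemma set_sublist_in [simp]: "set (sublist_in \<theta> S) = set \<theta> \<inter> S"
  by (auto simp: sublist_in_def)

lemma distinct_sublist_in [simp]: "distinct \<theta> \<Longrightarrow> distinct (sublist_in \<theta> S)"
  by (simp add: sublist_in_def)

lemma theta_with_Cons: "theta_with (y # \<theta>) = with_ty (t_ty (avty y) # map (\<lambda>y. t_ty (avty y)) \<theta>)"
  by (simp add: theta_with_def)

section \<open>Typing and semantics of the translation\<close>

subsection \<open>The translation \<open>delta\<close>\<close>

text \<open>\<open>usedR\<close> holds because the map built for each \<open>let\<close> applies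
  every function variable bound for it. That all free variables are primal yields the no-sharing
  condition of \<open>wfR\<close> at each \<open>RLet\<close>.\<close>

theorem delta_wf:
  assumes ar: "\<And>f. ar f \<ge> 1"
  shows "wfA ar e \<Longrightarrow> distinct \<theta> \<Longrightarrow> set \<theta> = fvt e
    \<Longrightarrow> wfR ar (delta \<theta> e) \<and> usedR (delta \<theta> e) \<and> primR (delta \<theta> e) = p_ty (prim_ty e)
      \<and> domR (delta \<theta> e) = theta_with \<theta> \<and> codR (delta \<theta> e) = t_ty (tan_ty e)
      \<and> fvR (delta \<theta> e) \<subseteq> pvar ` fvp e"
proof (induction e arbitrary: \<theta>)
  case (AVar x y)
  then show ?case by (auto simp: lvars_theta_pat)
next
  case (ALet x y e1 e2)
  define \<theta>1 where "\<theta>1 = sublist_in \<theta> (fvt e1)"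
  define \<theta>2 where "\<theta>2 = sublist_in \<theta> (fvt e2 - {y})"
  define z where "z = V (Aux 0) (p_ty (prim_ty e2))"
  define f where "f = V (Aux 1) (TLolli (theta_with \<theta>1) (t_ty (avty y)))"
  define g where "g = V (Aux 2) (TLolli (theta_with (y # \<theta>2)) (t_ty (tan_ty e2)))"
  define F where "F = FLam (theta_pat \<theta>) (UApp (FVar g)
      (with_U (UApp (FVar f) (theta_U \<theta>1) # map (\<lambda>w. UVar (tvar w)) \<theta>2)))"
  have \<theta>: "distinct \<theta>1" "set \<theta>1 = fvt e1" "distinct (y # \<theta>2)" "set (y # \<theta>2) = fvt e2"
    using ALet.prems by (auto simp: \<theta>1_def \<theta>2_def)
  have s: "set \<theta>1 \<subseteq> set \<theta>" "set \<theta>2 \<subseteq> set \<theta>" by (auto simp: \<theta>1_def \<theta>2_def)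
  have D: "delta \<theta> (ALet x y e1 e2) =
      RLet (pvar x) f (delta \<theta>1 e1) (RLet z g (delta (y # \<theta>2) e2) (RPair (PVal z) F))"
    by (simp add: Let_def \<theta>1_def \<theta>2_def z_def f_def g_def F_def)
  have fg: "fun_var f" "fun_var g" "f \<noteq> g" "f \<noteq> z" "g \<noteq> z" "\<not> fun_var z"
    by (auto simp: f_def g_def z_def fun_var_def) (metis first_order.simps(7) first_order_p_ty)
  have F: "wfF F" "domF F = theta_with \<theta>" "codF F = t_ty (tan_ty e2)" "fvF F = {f, g}"
    using ALet.prems(2) s fg(1,2,3) tvar_in_theta_pat[of _ \<theta>]
      ltype_theta_with[of "y # \<theta>2", unfolded theta_with_Cons]
      fun_not_in_theta_pat[OF fg(1)] fun_not_in_theta_pat[OF fg(2)]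
    by (auto simp: F_def wfU_with_U theta_U_props fvU_with_U tyU_with_U theta_with_Cons comp_def
        f_def g_def)
  have IH1: "wfR ar (delta \<theta>1 e1) \<and> usedR (delta \<theta>1 e1) \<and> primR (delta \<theta>1 e1) = p_ty (prim_ty e1)
      \<and> domR (delta \<theta>1 e1) = theta_with \<theta>1 \<and> codR (delta \<theta>1 e1) = t_ty (tan_ty e1)
      \<and> fvR (delta \<theta>1 e1) \<subseteq> pvar ` fvp e1"
    using ALet \<theta> by auto
  have IH2: "wfR ar (delta (y # \<theta>2) e2) \<and> usedR (delta (y # \<theta>2) e2)
      \<and> primR (delta (y # \<theta>2) e2) = p_ty (prim_ty e2)
      \<and> domR (delta (y # \<theta>2) e2) = theta_with (y # \<theta>2) \<and> codR (delta (y # \<theta>2) e2) = t_ty (tan_ty e2)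
      \<and> fvR (delta (y # \<theta>2) e2) \<subseteq> pvar ` fvp e2"
    using ALet.IH(2)[OF _ \<theta>(3,4)] ALet.prems by simp
  have nf: "\<not> fun_var h" if "h \<in> fvR (delta \<theta>1 e1) \<union> fvR (delta (y # \<theta>2) e2)" for h
    using that IH1 IH2 by auto
  have z: "vty z = p_ty (prim_ty e2)" and f: "vty f = TLolli (theta_with \<theta>1) (t_ty (avty y))"
    and g: "vty g = TLolli (theta_with (y # \<theta>2)) (t_ty (tan_ty e2))"
    by (simp_all add: z_def f_def g_def)
  show ?case unfolding D using ALet.prems IH1 IH2 nf F fg z f g by auto
next
  case (ATanLetUnit z e)
  define \<theta>' where "\<theta>' = removeAll z \<theta>"
  have \<theta>: "distinct \<theta>'" "set \<theta>' = fvt e" "set \<theta>' \<subseteq> set \<theta>"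
    using ATanLetUnit.prems by (auto simp: \<theta>'_def distinct_removeAll)
  define x where "x = V (Aux 0) (p_ty (prim_ty e))"
  define f where "f = V (Aux 1) (TLolli (theta_with \<theta>') (t_ty (tan_ty e)))"
  have D: "delta \<theta> (ATanLetUnit z e) = RLet x f (delta \<theta>' e)
        (RPair (PVal x) (FLam (theta_pat \<theta>) (UApp (FVar f) (theta_U \<theta>'))))"
    by (simp add: Let_def \<theta>'_def x_def f_def)
  have f: "fun_var f" "f \<noteq> x" "vty f = TLolli (theta_with \<theta>') (t_ty (tan_ty e))"
    "vty x = p_ty (prim_ty e)"
    by (auto simp: f_def x_def fun_var_def)
  have IH: "wfR ar (delta \<theta>' e) \<and> usedR (delta \<theta>' e) \<and> primR (delta \<theta>' e) = p_ty (prim_ty e)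
      \<and> domR (delta \<theta>' e) = theta_with \<theta>' \<and> codR (delta \<theta>' e) = t_ty (tan_ty e)
      \<and> fvR (delta \<theta>' e) \<subseteq> pvar ` fvp e"
    using ATanLetUnit \<theta> by auto
  have nf: "\<not> fun_var h" if "h \<in> fvR (delta \<theta>' e)" for h
    using that IH by auto
  show ?case unfolding D
    using ATanLetUnit.prems IH nf f \<theta>(3) tvar_in_theta_pat[of _ \<theta>] fun_not_in_theta_pat[OF f(1)]
    by (auto simp: theta_U_props)
next
  case (ATanLetPair x1 x2 z e)
  define \<theta>' where "\<theta>' = removeAll z \<theta>"
  have \<theta>: "distinct (x1 # x2 # \<theta>')" "set (x1 # x2 # \<theta>') = fvt e" "set \<theta>' \<subseteq> set \<theta>" "z \<notin> set \<theta>'"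
      "z \<in> set \<theta>"
    using ATanLetPair.prems by (auto simp: \<theta>'_def distinct_removeAll)
  define x where "x = V (Aux 0) (p_ty (prim_ty e))"
  define f where "f = V (Aux 1) (TLolli (theta_with (x1 # x2 # \<theta>')) (t_ty (tan_ty e)))"
  define v1 where "v1 = V (Aux 2) (t_ty (avty x1))"
  define v2 where "v2 = V (Aux 3) (t_ty (avty x2))"
  define h where "h = (\<lambda>w. if w = z then LPair (LVar v1) (LVar v2) else LVar (tvar w))"
  define F where "F = FLam (with_pat (map h \<theta>))
      (UApp (FVar f) (with_U (UVar v1 # UVar v2 # map (\<lambda>w. UVar (tvar w)) \<theta>')))"
  have D: "delta \<theta> (ATanLetPair x1 x2 z e) = RLet x f (delta (x1 # x2 # \<theta>') e) (RPair (PVal x) F)"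
    by (simp add: Let_def \<theta>'_def x_def f_def v1_def v2_def F_def h_def cong: if_cong)
  have f: "fun_var f" "f \<noteq> x" "vty f = TLolli (theta_with (x1 # x2 # \<theta>')) (t_ty (tan_ty e))"
    "vty x = p_ty (prim_ty e)"
    by (auto simp: f_def x_def fun_var_def)
  have v: "v1 \<noteq> v2" "vty v1 = t_ty (avty x1)" "vty v2 = t_ty (avty x2)" "v1 \<noteq> tvar w" "v2 \<noteq> tvar w"
    "\<not> fun_var v1" "\<not> fun_var v2" "v1 \<noteq> f" "v2 \<noteq> f" "f \<noteq> tvar w" for w
    using ltype_not_fun_var[of v1] ltype_not_fun_var[of v2] by (auto simp: v1_def v2_def f_def)
  have ne: "\<theta> \<noteq> []" using \<theta>(5) by auto
  have L: "lvars (with_pat (map h \<theta>)) = {v1, v2} \<union> tvar ` set \<theta>'"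
    using ne ATanLetPair.prems \<theta>(5) by (subst lvars_with_pat) (auto simp: h_def \<theta>'_def)
  have "wf_lpat (with_pat (map h \<theta>))"
    using ATanLetPair.prems v by (intro wf_with_pat) (auto simp: h_def)
  moreover have "lpat_ty (with_pat (map h \<theta>)) = theta_with \<theta>"
  proof -
    have "lpat_ty (h w) = t_ty (avty w)" for w
      using ATanLetPair.prems(1) v by (auto simp: h_def)
    then show ?thesis by (simp add: lpat_ty_with_pat theta_with_def comp_def)
  qed
  ultimately have F: "wfF F" "domF F = theta_with \<theta>" "codF F = t_ty (tan_ty e)" "fvF F = {f}"
    using v f ltype_theta_with[of "x2 # \<theta>'", unfolded theta_with_Cons]
    by (auto simp: F_def wfU_with_U fvU_with_U tyU_with_U L theta_with_def comp_def)
  have IH: "wfR ar (delta (x1 # x2 # \<theta>') e) \<and> usedR (delta (x1 # x2 # \<theta>') e)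
      \<and> primR (delta (x1 # x2 # \<theta>') e) = p_ty (prim_ty e)
      \<and> domR (delta (x1 # x2 # \<theta>') e) = theta_with (x1 # x2 # \<theta>')
      \<and> codR (delta (x1 # x2 # \<theta>') e) = t_ty (tan_ty e)
      \<and> fvR (delta (x1 # x2 # \<theta>') e) \<subseteq> pvar ` fvp e"
    using ATanLetPair.IH[OF _ \<theta>(1,2)] ATanLetPair.prems by simp
  have nf: "\<not> fun_var k" if "k \<in> fvR (delta (x1 # x2 # \<theta>') e)" for k
    using that IH by auto
  show ?case unfolding D using IH nf f F by auto
next
  case (ADrop e)
  define x where "x = V (Aux 0) (p_ty (prim_ty e))"
  define f where "f = V (Aux 1) (TLolli (theta_with \<theta>) (t_ty (tan_ty e)))"
  define y where "y = V (Aux 2) (theta_with \<theta>)"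
  define z where "z = V (Aux 3) (t_ty (tan_ty e))"
  have D: "delta \<theta> (ADrop e) = RLet x f (delta \<theta> e)
        (RPair POne (FLam (LVar y) (ULet (LVar z) (UApp (FVar f) (UVar y)) UTop)))"
    by (simp add: Let_def x_def f_def y_def z_def)
  have f: "f \<noteq> x" "f \<noteq> y" "y \<noteq> f" "vty f = TLolli (theta_with \<theta>) (t_ty (tan_ty e))"
    "vty x = p_ty (prim_ty e)" "vty y = theta_with \<theta>" "vty z = t_ty (tan_ty e)"
    by (auto simp: f_def x_def y_def z_def)
  have IH: "wfR ar (delta \<theta> e) \<and> usedR (delta \<theta> e) \<and> primR (delta \<theta> e) = p_ty (prim_ty e)
      \<and> domR (delta \<theta> e) = theta_with \<theta> \<and> codR (delta \<theta> e) = t_ty (tan_ty e)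
      \<and> fvR (delta \<theta> e) \<subseteq> pvar ` fvp e"
    using ADrop by auto
  have nf: "\<not> fun_var h" if "h \<in> fvR (delta \<theta> e)" for h
    using that IH by auto
  show ?case unfolding D using IH nf f by auto
next
  case (ATanPair x1 x2)
  then show ?case using tvar_in_theta_pat[of _ \<theta>] by (auto simp: lvars_theta_pat)
next
  case (APlus x y)
  then show ?case
    using plusF_props[of "t_ty (avty x)"] tvar_in_theta_pat[of _ \<theta>] by (auto simp: lvars_theta_pat)
next
  case (ATimes x y)
  have "pvar x \<notin> lvars (theta_pat \<theta>)" by (auto simp: lvars_theta_pat pvar_def tvar_def)
  then show ?case using ATimes
    using timesF_props(1)[of "t_ty (avty y)" "pvar x"] tvar_in_theta_pat[of _ \<theta>]
    by (auto simp: lvars_theta_pat)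
next
  case (ADup x)
  then show ?case using tvar_in_theta_pat[of _ \<theta>] by (auto simp: lvars_theta_pat)
next
  case (AFun f xs)
  have "xs \<noteq> []" using AFun.prems(1) ar[of f] by auto
  then show ?case using AFun by (auto simp: theta_with_def)
next
  case (AZero \<sigma>)
  then show ?case using zeroU_props[of "t_ty \<sigma>"] by (auto simp: theta_with_def)
next
  case (APrimLetUnit z e)
  then show ?case by auto
qed (auto simp: theta_with_def)

theorem rprim_delta:
  "wfA ar e \<Longrightarrow> (\<And>x. x \<in> fvp e \<Longrightarrow> \<eta> (pvar x) = \<gamma> x) \<Longrightarrow> rprim den \<eta> (delta \<theta> e) = aprim den \<gamma> e"
proof (induction e arbitrary: \<theta> \<eta> \<gamma>)
  case (ALet x y e1 e2)
  let ?v = "rprim den \<eta> (delta (sublist_in \<theta> (fvt e1)) e1)"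
  have 1: "?v = aprim den \<gamma> e1" by (rule ALet.IH) (use ALet.prems in auto)
  have 2: "rprim den (\<eta>(pvar x := ?v)) (delta \<theta>' e2) = aprim den (\<gamma>(x := aprim den \<gamma> e1)) e2" for \<theta>'
    by (rule ALet.IH) (use ALet.prems 1 in auto)
  show ?case using 2 by (simp add: Let_def del: fun_upd_apply) simp
next
  case (AFun f xs)
  then have "map (\<lambda>x. vreal (\<eta> x)) (map pvar xs) = map (\<lambda>x. vreal (\<gamma> x)) xs" by simp
  then show ?case by (simp only: delta.simps rprim.simps psem.simps aprim.simps)
qed (auto simp: Let_def)

text \<open>The default \<open>\<zeta>\<close> is arbitrary since \<open>\<theta>\<close> lists all
  free tangent variables. In the cases that build a new tuple, it is written as
  \<open>vtuple\<close> of a function on variables, after which \<open>tget_vtuple\<close> and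
  \<open>atan_cong\<close> compare environments pointwise.\<close>

theorem rfun_delta:
  "wfA ar e \<Longrightarrow> distinct \<theta> \<Longrightarrow> set \<theta> = fvt e
    \<Longrightarrow> (\<And>x. x \<in> fvp e \<Longrightarrow> \<eta> (pvar x) = \<gamma> x)
    \<Longrightarrow> rfun den \<phi> \<eta> (delta \<theta> e) a = atan den \<gamma> (tbind \<theta> a \<zeta>) e"
proof (induction e arbitrary: \<theta> \<eta> \<gamma> \<phi> a \<zeta>)
  case (AVar x y)
  then show ?case by (auto simp: bind_theta_pat tbind_def)
next
  case (ALet x y e1 e2)
  define \<theta>1 where "\<theta>1 = sublist_in \<theta> (fvt e1)"
  define \<theta>2 where "\<theta>2 = sublist_in \<theta> (fvt e2 - {y})"
  define z where "z = V (Aux 0) (p_ty (prim_ty e2))"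
  define f where "f = V (Aux 1) (TLolli (theta_with \<theta>1) (t_ty (avty y)))"
  define g where "g = V (Aux 2) (TLolli (theta_with (y # \<theta>2)) (t_ty (tan_ty e2)))"
  define U where "U = UApp (FVar g)
      (with_U (UApp (FVar f) (theta_U \<theta>1) # map (\<lambda>w. UVar (tvar w)) \<theta>2))"
  have \<theta>: "distinct \<theta>1" "set \<theta>1 = fvt e1" "distinct (y # \<theta>2)" "set (y # \<theta>2) = fvt e2"
    "set \<theta>1 \<subseteq> set \<theta>" "set \<theta>2 \<subseteq> set \<theta>" "y \<notin> set \<theta>2"
    using ALet.prems by (auto simp: \<theta>1_def \<theta>2_def)
  have D: "delta \<theta> (ALet x y e1 e2) =
      RLet (pvar x) f (delta \<theta>1 e1) (RLet z g (delta (y # \<theta>2) e2) (RPair (PVal z) (FLam (theta_pat \<theta>) U)))"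
    by (simp add: Let_def \<theta>1_def \<theta>2_def z_def f_def g_def U_def)
  define v where "v = aprim den \<gamma> e1"
  have v: "rprim den \<eta> (delta \<theta>1 e1) = v"
    unfolding v_def by (rule rprim_delta[of ar]) (use ALet.prems in auto)
  define \<phi>1 where "\<phi>1 = \<phi>(f := rfun den \<phi> \<eta> (delta \<theta>1 e1))"
  define \<eta>1 where "\<eta>1 = \<eta>(pvar x := v)"
  define \<phi>2 where "\<phi>2 = \<phi>1(g := rfun den \<phi>1 \<eta>1 (delta (y # \<theta>2) e2))"
  define \<eta>2 where "\<eta>2 = \<eta>1(z := rprim den \<eta>1 (delta (y # \<theta>2) e2))"
  have R: "rfun den \<phi> \<eta> (delta \<theta> (ALet x y e1 e2)) a = usem \<phi>2 (bind (theta_pat \<theta>) a \<eta>2) U"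
    unfolding D by (simp add: v \<phi>1_def \<phi>2_def \<eta>1_def \<eta>2_def)
  have fg: "f \<noteq> g" by (simp add: f_def g_def)
  let ?\<zeta> = "tbind \<theta> a \<zeta>"
  have b: "bind (theta_pat \<theta>) a \<eta>2 (tvar w) = ?\<zeta> w" if "w \<in> set \<theta>" for w
    using that ALet.prems by (simp add: bind_theta_pat tbind_def)
  have m: "map (\<lambda>w. bind (theta_pat \<theta>) a \<eta>2 (tvar w)) \<theta>' = map ?\<zeta> \<theta>'" if "set \<theta>' \<subseteq> set \<theta>" for \<theta>'
    using that b by auto
  have fv: "\<phi>2 f c = atan den \<gamma> (tbind \<theta>1 c \<zeta>) e1" for c
    using fg ALet.prems \<theta>(1,2) by (simp add: \<phi>2_def \<phi>1_def ALet.IH(1))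
  have gv: "\<phi>2 g c = atan den (\<gamma>(x := v)) (tbind (y # \<theta>2) c \<zeta>) e2" for c
  proof -
    have "rfun den \<phi>1 \<eta>1 (delta (y # \<theta>2) e2) c = atan den (\<gamma>(x := v)) (tbind (y # \<theta>2) c \<zeta>) e2"
      by (rule ALet.IH(2)) (use ALet.prems \<theta> in \<open>auto simp: \<eta>1_def\<close>)
    then show ?thesis by (simp add: \<phi>2_def)
  qed
  define c1 where "c1 = \<phi>2 f (vtuple (map ?\<zeta> \<theta>1))"
  have c1: "c1 = atan den \<gamma> ?\<zeta> e1"
    unfolding c1_def fv using \<theta>(2) by (intro atan_cong) (auto simp: tbind_def[of \<theta>1] tget_vtuple)
  \<comment> \<open>\<open>h\<close> describes the argument tuple of \<open>g\<close> as a function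
    on variables, with the result of \<open>e1\<close> at \<open>y\<close>.\<close>
  define h where "h = (\<lambda>w. if w = y then c1 else ?\<zeta> w)"
  have "usem \<phi>2 (bind (theta_pat \<theta>) a \<eta>2) U
      = \<phi>2 g (vtuple (\<phi>2 f (vtuple (map (\<lambda>w. bind (theta_pat \<theta>) a \<eta>2 (tvar w)) \<theta>1))
          # map (\<lambda>w. bind (theta_pat \<theta>) a \<eta>2 (tvar w)) \<theta>2))"
    by (simp add: U_def usem_with_U theta_U_props comp_def)
  also have "\<dots> = \<phi>2 g (vtuple (c1 # map ?\<zeta> \<theta>2))"
    unfolding m[OF \<theta>(5)] m[OF \<theta>(6)] c1_def ..
  also have "c1 # map ?\<zeta> \<theta>2 = map h (y # \<theta>2)" using \<theta>(7) by (auto simp: h_def)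
  also have "\<phi>2 g (vtuple (map h (y # \<theta>2))) = atan den (\<gamma>(x := v)) (?\<zeta>(y := c1)) e2"
    unfolding gv
  proof (rule atan_cong)
    fix w assume "w \<in> fvt e2"
    then have w: "w \<in> set (y # \<theta>2)" using \<theta>(4) by simp
    then show "tbind (y # \<theta>2) (vtuple (map h (y # \<theta>2))) \<zeta> w = (?\<zeta>(y := c1)) w"
      using tget_vtuple[OF w, of h] unfolding tbind_def[of "y # \<theta>2"] by (simp only: if_True) (simp add: h_def)
  qed simp
  finally show ?case unfolding R by (simp add: c1 v_def)
next
  case (ATanLetUnit z e)
  define \<theta>' where "\<theta>' = removeAll z \<theta>"
  have \<theta>: "distinct \<theta>'" "set \<theta>' = fvt e" "set \<theta>' \<subseteq> set \<theta>"
    using ATanLetUnit.prems by (auto simp: \<theta>'_def distinct_removeAll)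
  define f where "f = V (Aux 1) (TLolli (theta_with \<theta>') (t_ty (tan_ty e)))"
  let ?\<zeta> = "tbind \<theta> a \<zeta>"
  have b: "map (\<lambda>w. bind (theta_pat \<theta>) a \<eta>' (tvar w)) \<theta>' = map ?\<zeta> \<theta>'" for \<eta>'
    using \<theta> ATanLetUnit.prems by (auto simp: bind_theta_pat tbind_def)
  have "rfun den \<phi> \<eta> (delta \<theta> (ATanLetUnit z e)) a
      = rfun den \<phi> \<eta> (delta \<theta>' e) (vtuple (map ?\<zeta> \<theta>'))"
    by (simp add: Let_def \<theta>'_def[symmetric] f_def[symmetric] theta_U_props b)
  also have "\<dots> = atan den \<gamma> (tbind \<theta>' (vtuple (map ?\<zeta> \<theta>')) \<zeta>) e"
    by (rule ATanLetUnit.IH) (use ATanLetUnit.prems \<theta> in auto)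
  also have "\<dots> = atan den \<gamma> ?\<zeta> e"
    using \<theta>(2) by (intro atan_cong) (auto simp: tbind_def[of \<theta>'] tget_vtuple)
  finally show ?case by simp
next
  case (ATanLetPair x1 x2 z e)
  define \<theta>' where "\<theta>' = removeAll z \<theta>"
  have \<theta>: "distinct (x1 # x2 # \<theta>')" "set (x1 # x2 # \<theta>') = fvt e" "set \<theta>' \<subseteq> set \<theta>" "z \<notin> set \<theta>'"
      "z \<in> set \<theta>"
    using ATanLetPair.prems by (auto simp: \<theta>'_def distinct_removeAll)
  define x where "x = V (Aux 0) (p_ty (prim_ty e))"
  define f where "f = V (Aux 1) (TLolli (theta_with (x1 # x2 # \<theta>')) (t_ty (tan_ty e)))"
  define v1 where "v1 = V (Aux 2) (t_ty (avty x1))"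
  define v2 where "v2 = V (Aux 3) (t_ty (avty x2))"
  define h where "h = (\<lambda>w. if w = z then LPair (LVar v1) (LVar v2) else LVar (tvar w))"
  define U where "U = UApp (FVar f) (with_U (UVar v1 # UVar v2 # map (\<lambda>w. UVar (tvar w)) \<theta>'))"
  have D: "delta \<theta> (ATanLetPair x1 x2 z e) = RLet x f (delta (x1 # x2 # \<theta>') e)
      (RPair (PVal x) (FLam (with_pat (map h \<theta>)) U))"
    by (simp add: Let_def \<theta>'_def x_def f_def v1_def v2_def U_def h_def cong: if_cong)
  have v: "v1 \<noteq> v2" "v1 \<noteq> tvar w" "v2 \<noteq> tvar w" for w by (auto simp: v1_def v2_def)
  let ?\<zeta> = "tbind \<theta> a \<zeta>"
  let ?\<zeta>' = "?\<zeta>(x1 := vfst (?\<zeta> z), x2 := vsnd (?\<zeta> z))"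
  have disj: "lvars (h w) \<inter> lvars (h w') = {}" if "w \<noteq> w'" for w w'
    using that v by (auto simp: h_def)
  have b: "bind (with_pat (map h \<theta>)) a \<eta>' y = bind (h w) (?\<zeta> w) \<eta>' y"
    if "w \<in> set \<theta>" "y \<in> lvars (h w)" for w y \<eta>'
    using that bind_with_pat[of \<theta> h w y a \<eta>' \<eta>'] ATanLetPair.prems(2) disj
    by (simp add: tbind_def)
  have b': "bind (with_pat (map h \<theta>)) a \<eta>' v1 = vfst (?\<zeta> z)"
    "bind (with_pat (map h \<theta>)) a \<eta>' v2 = vsnd (?\<zeta> z)"
    "map (\<lambda>w. bind (with_pat (map h \<theta>)) a \<eta>' (tvar w)) \<theta>' = map ?\<zeta> \<theta>'" for \<eta>'
  proof -
    show "bind (with_pat (map h \<theta>)) a \<eta>' v1 = vfst (?\<zeta> z)"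
      using b[OF \<theta>(5), of v1 \<eta>'] v by (simp add: h_def)
    show "bind (with_pat (map h \<theta>)) a \<eta>' v2 = vsnd (?\<zeta> z)"
      using b[OF \<theta>(5), of v2 \<eta>'] v by (simp add: h_def)
    show "map (\<lambda>w. bind (with_pat (map h \<theta>)) a \<eta>' (tvar w)) \<theta>' = map ?\<zeta> \<theta>'"
    proof (rule map_cong[OF refl])
      fix w assume w: "w \<in> set \<theta>'"
      then have "h w = LVar (tvar w)" using \<theta>(4) by (auto simp: h_def)
      then show "bind (with_pat (map h \<theta>)) a \<eta>' (tvar w) = ?\<zeta> w"
        using b[of w "tvar w" \<eta>'] w \<theta>(3) by auto
    qed
  qed
  have "rfun den \<phi> \<eta> (delta \<theta> (ATanLetPair x1 x2 z e)) a
      = rfun den \<phi> \<eta> (delta (x1 # x2 # \<theta>') e) (vtuple (vfst (?\<zeta> z) # vsnd (?\<zeta> z) # map ?\<zeta> \<theta>'))"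
    unfolding D by (simp add: U_def usem_with_U comp_def b')
  also have "vfst (?\<zeta> z) # vsnd (?\<zeta> z) # map ?\<zeta> \<theta>' = map ?\<zeta>' (x1 # x2 # \<theta>')"
    using \<theta>(1) by auto
  also have "rfun den \<phi> \<eta> (delta (x1 # x2 # \<theta>') e) (vtuple (map ?\<zeta>' (x1 # x2 # \<theta>')))
      = atan den \<gamma> (tbind (x1 # x2 # \<theta>') (vtuple (map ?\<zeta>' (x1 # x2 # \<theta>'))) \<zeta>) e"
    using ATanLetPair.prems \<theta>(1,2) by (intro ATanLetPair.IH) simp_all
  also have "\<dots> = atan den \<gamma> ?\<zeta>' e"
  proof (rule atan_cong)
    fix w assume "w \<in> fvt e"
    then have w: "w \<in> set (x1 # x2 # \<theta>')" using \<theta>(2) by simp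
    then show "tbind (x1 # x2 # \<theta>') (vtuple (map ?\<zeta>' (x1 # x2 # \<theta>'))) \<zeta> w = ?\<zeta>' w"
      unfolding tbind_def[of "x1 # x2 # \<theta>'"] tget_vtuple[OF w] by (simp only: if_True)
  qed simp
  finally show ?case by simp
next
  case (ATanPair x1 x2)
  then show ?case by (auto simp: bind_theta_pat tbind_def)
next
  case (APlus x y)
  then show ?case by (auto simp: bind_theta_pat tbind_def fsem_plusF)
next
  case (ATimes x y)
  have "pvar x \<notin> lvars (theta_pat \<theta>)" by (auto simp: lvars_theta_pat pvar_def tvar_def)
  then show ?case using ATimes by (auto simp: bind_theta_pat tbind_def timesF_props(2) bind_outside)
next
  case (ADup x)
  then show ?case by (auto simp: bind_theta_pat tbind_def)
next
  case (AZero \<sigma>)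
  then show ?case using zeroU_props[of "t_ty \<sigma>"] by simp
qed (auto simp: Let_def)

section \<open>Linear B: semantics of the syntactic sugar\<close>

section \<open>Linear B\<close>

lemma afresh_spec:
  assumes "finite X" shows "avty (afresh X \<tau>) = \<tau> \<and> afresh X \<tau> \<notin> X"
proof -
  have "inj (\<lambda>n. AV n \<tau>)" by (auto intro: injI)
  then have "infinite (range (\<lambda>n. AV n \<tau>))" using finite_imageD infinite_UNIV_nat by blast
  then obtain x where "x \<in> range (\<lambda>n. AV n \<tau>) - X"
    using assms by (metis Diff_infinite_finite finite.emptyI ex_in_conv)
  then have "avty x = \<tau> \<and> x \<notin> X" by auto
  then have "\<exists>x. avty x = \<tau> \<and> x \<notin> X" ..
  then show ?thesis unfolding afresh_def by (rule someI_ex)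
qed

lemmas afresh_ty = afresh_spec[THEN conjunct1] and afresh_notin = afresh_spec[THEN conjunct2]

text \<open>Derived clauses that hide the dummy unit variable of the sugar; being fresh, it is
  invisible to \<open>e2\<close>.\<close>

lemma ALetPrim_props:
  "fvt (ALetPrim x e1 e2) = fvt e1 \<union> fvt e2"
  "fvp (ALetPrim x e1 e2) = fvp e1 \<union> (fvp e2 - {x})"
  "prim_ty (ALetPrim x e1 e2) = prim_ty e2" "tan_ty (ALetPrim x e1 e2) = tan_ty e2"
  "wfA ar (ALetPrim x e1 e2) \<longleftrightarrow> wfA ar e1 \<and> wfA ar e2 \<and> prim_ty e1 = avty x \<and> tan_ty e1 = AOne
     \<and> fvt e1 \<inter> fvt e2 = {}"
  "aprim den \<gamma> (ALetPrim x e1 e2) = aprim den (\<gamma>(x := aprim den \<gamma> e1)) e2"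
  "atan den \<gamma> \<zeta> (ALetPrim x e1 e2) = atan den (\<gamma>(x := aprim den \<gamma> e1)) \<zeta> e2"
  using afresh_ty[of "fvt e2" AOne] afresh_notin[of "fvt e2" AOne]
  by (auto simp: ALetPrim_def Let_def intro: atan_cong)

lemma ALetTan_props:
  "fvt (ALetTan y e1 e2) = fvt e1 \<union> (fvt e2 - {y})"
  "fvp (ALetTan y e1 e2) = fvp e1 \<union> fvp e2"
  "prim_ty (ALetTan y e1 e2) = prim_ty e2" "tan_ty (ALetTan y e1 e2) = tan_ty e2"
  "wfA ar (ALetTan y e1 e2) \<longleftrightarrow> wfA ar e1 \<and> wfA ar e2 \<and> prim_ty e1 = AOne \<and> tan_ty e1 = avty y
     \<and> y \<in> fvt e2 \<and> fvt e1 \<inter> (fvt e2 - {y}) = {}"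
  "aprim den \<gamma> (ALetTan y e1 e2) = aprim den \<gamma> e2"
  "atan den \<gamma> \<zeta> (ALetTan y e1 e2) = atan den \<gamma> (\<zeta>(y := atan den \<gamma> \<zeta> e1)) e2"
  using afresh_ty[of "fvp e2" AOne] afresh_notin[of "fvp e2" AOne]
  by (auto simp: ALetTan_def Let_def intro: atan_cong aprim_cong)

lemma APrimVar_props:
  "fvt (APrimVar x) = {}" "fvp (APrimVar x) = {x}"
  by (auto simp: APrimVar_def Let_def ALetTan_props)

lemma ATanVar_props:
  "fvt (ATanVar y) = {y}" "fvp (ATanVar y) = {}" "prim_ty (ATanVar y) = AOne"
  "tan_ty (ATanVar y) = avty y" "wfA ar (ATanVar y)" "atan den \<gamma> \<zeta> (ATanVar y) = \<zeta> y"
  by (auto simp: ATanVar_def Let_def ALetPrim_props afresh_ty)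

lemma ATanTensor_props:
  "fvt (ATanTensor e1 e2) = fvt e1 \<union> fvt e2" "fvp (ATanTensor e1 e2) = fvp e1 \<union> fvp e2"
  "prim_ty (ATanTensor e1 e2) = AOne" "tan_ty (ATanTensor e1 e2) = ATensor (tan_ty e1) (tan_ty e2)"
  "wfA ar (ATanTensor e1 e2) \<longleftrightarrow> wfA ar e1 \<and> wfA ar e2 \<and> prim_ty e1 = AOne \<and> prim_ty e2 = AOne
     \<and> fvt e1 \<inter> fvt e2 = {}"
  "atan den \<gamma> \<zeta> (ATanTensor e1 e2) = VP (atan den \<gamma> \<zeta> e1) (atan den \<gamma> \<zeta> e2)"
proof -
  define x where "x = afresh (fvt e2) (tan_ty e1)"
  define y where "y = afresh {x} (tan_ty e2)"
  have x: "avty x = tan_ty e1" "x \<notin> fvt e2" using afresh_spec[of "fvt e2"] by (auto simp: x_def)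
  have y: "avty y = tan_ty e2" "y \<noteq> x" using afresh_spec[of "{x}"] by (auto simp: y_def)
  have E: "ATanTensor e1 e2 = ALetTan x e1 (ALetTan y e2 (ATanPair x y))"
    by (simp add: ATanTensor_def Let_def x_def y_def)
  have "atan den \<gamma> (\<zeta>(x := v)) e2 = atan den \<gamma> \<zeta> e2" for v
    using x(2) by (intro atan_cong) auto
  then show "atan den \<gamma> \<zeta> (ATanTensor e1 e2) = VP (atan den \<gamma> \<zeta> e1) (atan den \<gamma> \<zeta> e2)"
    unfolding E using y(2) by (simp add: ALetTan_props)
  show "fvt (ATanTensor e1 e2) = fvt e1 \<union> fvt e2" "fvp (ATanTensor e1 e2) = fvp e1 \<union> fvp e2"
    "prim_ty (ATanTensor e1 e2) = AOne" "tan_ty (ATanTensor e1 e2) = ATensor (tan_ty e1) (tan_ty e2)"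
    "wfA ar (ATanTensor e1 e2) \<longleftrightarrow> wfA ar e1 \<and> wfA ar e2 \<and> prim_ty e1 = AOne \<and> prim_ty e2 = AOne
       \<and> fvt e1 \<inter> fvt e2 = {}"
    unfolding E using x y by (auto simp: ALetTan_props)
qed

lemma APair_props:
  "fvt (APair e1 e2) = fvt e1 \<union> fvt e2" "fvp (APair e1 e2) = fvp e1 \<union> fvp e2"
  "prim_ty (APair e1 e2) = prim_ty e1" "tan_ty (APair e1 e2) = tan_ty e2"
  "wfA ar (APair e1 e2) \<longleftrightarrow> wfA ar e1 \<and> wfA ar e2 \<and> tan_ty e1 = AOne \<and> prim_ty e2 = AOne
     \<and> fvt e1 \<inter> fvt e2 = {}"
  "aprim den \<gamma> (APair e1 e2) = aprim den \<gamma> e1"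
  "atan den \<gamma> \<zeta> (APair e1 e2) = atan den \<gamma> \<zeta> e2"
proof -
  define x where "x = afresh (fvp e2) (prim_ty e1)"
  define y where "y = afresh {} (tan_ty e2)"
  have x: "avty x = prim_ty e1" "x \<notin> fvp e2" using afresh_spec[of "fvp e2"] by (auto simp: x_def)
  have y: "avty y = tan_ty e2" using afresh_spec[of "{}"] by (auto simp: y_def)
  have E: "APair e1 e2 = ALetPrim x e1 (ALetTan y e2 (AVar x y))"
    by (simp add: APair_def Let_def x_def y_def)
  have "atan den (\<gamma>(x := v)) \<zeta> e2 = atan den \<gamma> \<zeta> e2" for v
    using x(2) by (intro atan_cong) auto
  then show "atan den \<gamma> \<zeta> (APair e1 e2) = atan den \<gamma> \<zeta> e2" "aprim den \<gamma> (APair e1 e2) = aprim den \<gamma> e1"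
    unfolding E by (simp_all add: ALetPrim_props ALetTan_props)
  show "fvt (APair e1 e2) = fvt e1 \<union> fvt e2" "fvp (APair e1 e2) = fvp e1 \<union> fvp e2"
    "prim_ty (APair e1 e2) = prim_ty e1" "tan_ty (APair e1 e2) = tan_ty e2"
    "wfA ar (APair e1 e2) \<longleftrightarrow> wfA ar e1 \<and> wfA ar e2 \<and> tan_ty e1 = AOne \<and> prim_ty e2 = AOne
       \<and> fvt e1 \<inter> fvt e2 = {}"
    unfolding E using x y by (auto simp: ALetPrim_props ALetTan_props)
qed

lemma fvt_A_of_bprim [simp]: "fvt (A_of_bprim e) = {}"
  by (induction e) (auto simp: APrimVar_props ALetPrim_props)

section \<open>Tangent expressions and their tuples\<close>

subsection \<open>Tangent expressions\<close>

text \<open>\<open>fvpb\<close>, \<open>wfb\<close> and \<open>bsem\<close> restate notions of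
  Linear A on the grammar of tangent expressions, the one on which \<open>tjax_tan\<close>
  recurses.\<close>

primrec fvpb :: "btan \<Rightarrow> avar set" where
  "fvpb (TVar x) = {}"
| "fvpb (TLet x e1 e2) = fvpb e1 \<union> fvpb e2"
| "fvpb (TDup x) = {}"
| "fvpb (TZero \<tau>) = {}"
| "fvpb (TPlus x y) = {}"
| "fvpb (TTimes x y) = {x}"
| "fvpb (TDrop e) = fvpb e"
| "fvpb TUnit = {}"
| "fvpb (TPair e1 e2) = fvpb e1 \<union> fvpb e2"
| "fvpb (TLetUnit z e) = fvpb e"
| "fvpb (TLetPair x1 x2 z e) = fvpb e"

primrec wfb :: "btan \<Rightarrow> bool" where
  "wfb (TVar x) = True"
| "wfb (TLet x e1 e2) = (wfb e1 \<and> wfb e2 \<and> btan_ty e1 = avty x \<and> x \<in> fvb e2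
     \<and> fvb e1 \<inter> (fvb e2 - {x}) = {})"
| "wfb (TDup x) = True"
| "wfb (TZero \<tau>) = True"
| "wfb (TPlus x y) = (x \<noteq> y \<and> avty x = avty y)"
| "wfb (TTimes x y) = (avty x = AReal)"
| "wfb (TDrop e) = wfb e"
| "wfb TUnit = True"
| "wfb (TPair e1 e2) = (wfb e1 \<and> wfb e2 \<and> fvb e1 \<inter> fvb e2 = {})"
| "wfb (TLetUnit z e) = (wfb e \<and> avty z = AOne \<and> z \<notin> fvb e)"
| "wfb (TLetPair x1 x2 z e) = (wfb e \<and> x1 \<in> fvb e \<and> x2 \<in> fvb e \<and> x1 \<noteq> x2
     \<and> z \<notin> fvb e - {x1, x2} \<and> avty z = ATensor (avty x1) (avty x2))"

primrec bsem :: "(avar \<Rightarrow> val) \<Rightarrow> (avar \<Rightarrow> val) \<Rightarrow> btan \<Rightarrow> val" where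
  "bsem \<gamma> \<zeta> (TVar x) = \<zeta> x"
| "bsem \<gamma> \<zeta> (TLet x e1 e2) = bsem \<gamma> (\<zeta>(x := bsem \<gamma> \<zeta> e1)) e2"
| "bsem \<gamma> \<zeta> (TDup x) = VP (\<zeta> x) (\<zeta> x)"
| "bsem \<gamma> \<zeta> (TZero \<tau>) = vzero (t_ty \<tau>)"
| "bsem \<gamma> \<zeta> (TPlus x y) = vadd (t_ty (avty x)) (\<zeta> x) (\<zeta> y)"
| "bsem \<gamma> \<zeta> (TTimes x y) = vscale (t_ty (avty y)) (vreal (\<gamma> x)) (\<zeta> y)"
| "bsem \<gamma> \<zeta> (TDrop e) = VU"
| "bsem \<gamma> \<zeta> TUnit = VU"
| "bsem \<gamma> \<zeta> (TPair e1 e2) = VP (bsem \<gamma> \<zeta> e1) (bsem \<gamma> \<zeta> e2)"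
| "bsem \<gamma> \<zeta> (TLetUnit z e) = bsem \<gamma> \<zeta> e"
| "bsem \<gamma> \<zeta> (TLetPair x1 x2 z e) = bsem \<gamma> (\<zeta>(x1 := vfst (\<zeta> z), x2 := vsnd (\<zeta> z))) e"

lemma finite_fvb [simp]: "finite (fvb e)"
  by (induction e) auto

lemma A_of_btan_props:
  "fvt (A_of_btan e) = fvb e \<and> fvp (A_of_btan e) = fvpb e \<and> prim_ty (A_of_btan e) = AOne
     \<and> tan_ty (A_of_btan e) = btan_ty e"
  by (induction e) (auto simp: ATanVar_props ALetTan_props ATanTensor_props)

lemma wfA_A_of_btan: "wfA ar (A_of_btan e) \<longleftrightarrow> wfb e"
  by (induction e) (auto simp: ATanVar_props ALetTan_props ATanTensor_props A_of_btan_props)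

lemma atan_A_of_btan: "atan den \<gamma> \<zeta> (A_of_btan e) = bsem \<gamma> \<zeta> e"
  by (induction e arbitrary: \<zeta>) (auto simp: ATanVar_props ALetTan_props ATanTensor_props)

lemma bsem_cong: "(\<And>y. y \<in> fvb e \<Longrightarrow> \<zeta> y = \<zeta>' y) \<Longrightarrow> bsem \<gamma> \<zeta> e = bsem \<gamma> \<zeta>' e"
proof -
  assume *: "\<And>y. y \<in> fvb e \<Longrightarrow> \<zeta> y = \<zeta>' y"
  \<comment> \<open>Tangent expressions mention no function symbols, so any type and interpretation
    of these will do.\<close>
  have "atan (\<lambda>_ _. 0) \<gamma> \<zeta> (A_of_btan e :: unit aexp) = atan (\<lambda>_ _. 0) \<gamma> \<zeta>' (A_of_btan e :: unit aexp)"
    using * by (intro atan_cong) (auto simp: A_of_btan_props)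
  then show ?thesis by (simp add: atan_A_of_btan)
qed

lemma tuple_tan_props:
  "fvb (tuple_tan \<theta>) = set \<theta>" "fvpb (tuple_tan \<theta>) = {}" "btan_ty (tuple_tan \<theta>) = theta_ty \<theta>"
  "distinct \<theta> \<Longrightarrow> wfb (tuple_tan \<theta>)" "bsem \<gamma> \<zeta> (tuple_tan \<theta>) = vtuple (map \<zeta> \<theta>)"
  by (induction \<theta> rule: tuple_tan.induct) auto

lemma t_ty_theta_ty: "t_ty (theta_ty \<theta>) = theta_with \<theta>"
  unfolding theta_with_def by (induction \<theta> rule: induct_list012) auto

lemma let_tuple_fv:
  "distinct \<theta> \<Longrightarrow> fvb (let_tuple \<theta> e1 e2) = fvb e1 \<union> (fvb e2 - set \<theta>)
     \<and> fvpb (let_tuple \<theta> e1 e2) = fvpb e1 \<union> fvpb e2 \<and> btan_ty (let_tuple \<theta> e1 e2) = btan_ty e2"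
proof (induction \<theta> e1 e2 rule: let_tuple.induct)
  case (1 e1 e2)
  then show ?case using afresh_notin[of "fvb e2" AOne] by (auto simp: Let_def)
next
  case (3 x y \<theta> e1 e2)
  define X where "X = set (x # y # \<theta>) \<union> fvb e2"
  define w where "w = afresh X (theta_ty (x # y # \<theta>))"
  define w' where "w' = afresh (insert w X) (theta_ty (y # \<theta>))"
  have w: "w \<notin> X" "w' \<notin> X" "w' \<noteq> w"
    using afresh_spec[of X] afresh_spec[of "insert w X"] by (auto simp: X_def w_def w'_def)
  have E: "let_tuple (x # y # \<theta>) e1 e2 = TLet w e1 (TLetPair x w' w (let_tuple (y # \<theta>) (TVar w') e2))"
    by (simp add: Let_def X_def w_def w'_def)
  have IH: "fvb (let_tuple (y # \<theta>) (TVar w') e2) = {w'} \<union> (fvb e2 - set (y # \<theta>))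
     \<and> fvpb (let_tuple (y # \<theta>) (TVar w') e2) = fvpb e2
     \<and> btan_ty (let_tuple (y # \<theta>) (TVar w') e2) = btan_ty e2"
    using 3(1)[OF X_def w_def w'_def] 3(2) by simp
  show ?case unfolding E using IH w by (auto simp: X_def)
qed auto

lemma let_tuple_wf:
  "distinct \<theta> \<Longrightarrow> wfb e1 \<Longrightarrow> wfb e2 \<Longrightarrow> btan_ty e1 = theta_ty \<theta> \<Longrightarrow> set \<theta> \<subseteq> fvb e2
    \<Longrightarrow> fvb e1 \<inter> (fvb e2 - set \<theta>) = {} \<Longrightarrow> wfb (let_tuple \<theta> e1 e2)"
proof (induction \<theta> e1 e2 rule: let_tuple.induct)
  case (1 e1 e2)
  then show ?case using afresh_spec[of "fvb e2" AOne] by (auto simp: Let_def)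
next
  case (3 x y \<theta> e1 e2)
  define X where "X = set (x # y # \<theta>) \<union> fvb e2"
  define w where "w = afresh X (theta_ty (x # y # \<theta>))"
  define w' where "w' = afresh (insert w X) (theta_ty (y # \<theta>))"
  have w: "w \<notin> X" "w' \<notin> X" "w' \<noteq> w" "avty w = theta_ty (x # y # \<theta>)" "avty w' = theta_ty (y # \<theta>)"
    using afresh_spec[of X] afresh_spec[of "insert w X"] by (auto simp: X_def w_def w'_def)
  let ?K = "let_tuple (y # \<theta>) (TVar w') e2"
  have E: "let_tuple (x # y # \<theta>) e1 e2 = TLet w e1 (TLetPair x w' w ?K)"
    by (simp add: Let_def X_def w_def w'_def)
  have IH: "wfb ?K"
    using 3(1)[OF X_def w_def w'_def] 3(2-) w by (auto simp: X_def)
  have fv: "fvb ?K = {w'} \<union> (fvb e2 - set (y # \<theta>))" using let_tuple_fv[of "y # \<theta>"] 3(2) by simp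
  show ?case unfolding E using IH fv w 3(2-) by (auto simp: X_def)
qed auto

text \<open>The tuple is taken apart through auxiliary variables \<open>w\<close> and
  \<open>w'\<close>. Both avoid \<open>\<theta>\<close> and the free variables of \<open>e2\<close>,
  so only the bindings of \<open>\<theta>\<close> remain visible.\<close>

lemma bsem_let_tuple:
  "distinct \<theta> \<Longrightarrow> bsem \<gamma> \<zeta> (let_tuple \<theta> e1 e2) = bsem \<gamma> (tbind \<theta> (bsem \<gamma> \<zeta> e1) \<zeta>) e2"
proof (induction \<theta> e1 e2 arbitrary: \<zeta> rule: let_tuple.induct)
  case (1 e1 e2)
  show ?case using afresh_notin[of "fvb e2" AOne] by (auto simp: Let_def tbind_def intro: bsem_cong)
next
  case (2 x e1 e2)
  show ?case by (auto simp: tbind_def intro: bsem_cong)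
next
  case (3 x y \<theta> e1 e2)
  define X where "X = set (x # y # \<theta>) \<union> fvb e2"
  define w where "w = afresh X (theta_ty (x # y # \<theta>))"
  define w' where "w' = afresh (insert w X) (theta_ty (y # \<theta>))"
  have w: "w \<notin> X" "w' \<notin> X" "w' \<noteq> w"
    using afresh_spec[of X] afresh_spec[of "insert w X"] by (auto simp: X_def w_def w'_def)
  have E: "let_tuple (x # y # \<theta>) e1 e2 = TLet w e1 (TLetPair x w' w (let_tuple (y # \<theta>) (TVar w') e2))"
    by (simp add: Let_def X_def w_def w'_def)
  define a where "a = bsem \<gamma> \<zeta> e1"
  let ?\<zeta> = "\<zeta>(w := a, x := vfst a, w' := vsnd a)"
  have "bsem \<gamma> \<zeta> (let_tuple (x # y # \<theta>) e1 e2) = bsem \<gamma> ?\<zeta> (let_tuple (y # \<theta>) (TVar w') e2)"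
    unfolding E by (simp add: a_def)
  also have "\<dots> = bsem \<gamma> (tbind (y # \<theta>) (vsnd a) ?\<zeta>) e2"
    using 3(1)[OF X_def w_def w'_def, of ?\<zeta>] 3(2) by (simp del: fun_upd_apply add: fun_upd_same)
  also have "\<dots> = bsem \<gamma> (tbind (x # y # \<theta>) a \<zeta>) e2"
    using w 3(2) by (intro bsem_cong) (auto simp: tbind_def X_def)
  finally show ?case by (simp add: a_def)
qed

lemma tget_vzero: "y \<in> set \<theta> \<Longrightarrow> tget \<theta> (vzero (theta_with \<theta>)) y = vzero (t_ty (avty y))"
  unfolding theta_with_def by (induction \<theta> rule: induct_list012) auto

text \<open>Passes between the inner product of tuples and the sum over coordinates in which
  adjointness is proved for Linear B.\<close>

lemma ip_theta_with:
  "distinct \<theta> \<Longrightarrow> ip (theta_with \<theta>) a v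
     = (\<Sum>y\<in>set \<theta>. ip (t_ty (avty y)) (tget \<theta> a y) (tget \<theta> v y))"
  unfolding theta_with_def
proof (induction \<theta> arbitrary: a v rule: induct_list012)
  case (3 x y \<theta>)
  have "(\<Sum>z\<in>set (y # \<theta>). ip (t_ty (avty z)) (tget (x # y # \<theta>) a z) (tget (x # y # \<theta>) v z))
      = (\<Sum>z\<in>set (y # \<theta>). ip (t_ty (avty z)) (tget (y # \<theta>) (vsnd a) z) (tget (y # \<theta>) (vsnd v) z))"
    using 3(3) by (intro sum.cong) auto
  moreover have "set (x # y # \<theta>) = insert x (set (y # \<theta>))" "x \<notin> set (y # \<theta>)" using 3(3) by auto
  ultimately show ?case using 3(2)[of "vsnd a" "vsnd v"] 3(3) by (simp del: set_simps)
qed auto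

text \<open>For atomic expressions with one free tangent variable this determines
  \<open>\<theta>\<close>; the next lemma does so, up to order, for sums.\<close>

lemma distinct_singleton: "distinct \<theta> \<Longrightarrow> set \<theta> = {x} \<Longrightarrow> \<theta> = [x]"
  by (cases \<theta>) (auto simp: subset_singleton_iff)

lemma distinct_doubleton:
  assumes "distinct \<theta>" "set \<theta> = {x, y}" "x \<noteq> y" shows "\<theta> = [x, y] \<or> \<theta> = [y, x]"
proof -
  have "length \<theta> = 2" using assms distinct_card[of \<theta>] by simp
  then obtain a b where "\<theta> = [a, b]" by (auto simp: length_Suc_conv numeral_2_eq_2)
  then show ?thesis using assms by auto
qed

section \<open>The transpose of Linear B: well-formedness and adjointness\<close>

theorem tjax_tan_wf:
  "wfb e \<Longrightarrow> distinct \<theta> \<Longrightarrow> set \<theta> = fvb e \<Longrightarrow> avty u = btan_ty e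
    \<Longrightarrow> wfb (tjax_tan \<theta> u e) \<and> fvb (tjax_tan \<theta> u e) = {u} \<and> btan_ty (tjax_tan \<theta> u e) = theta_ty \<theta>
      \<and> fvpb (tjax_tan \<theta> u e) \<subseteq> fvpb e"
proof (induction e arbitrary: \<theta> u)
  case (TVar x)
  then show ?case using distinct_singleton[of \<theta> x] by simp
next
  case (TLet x e1 e2)
  define \<theta>1 where "\<theta>1 = sublist_in \<theta> (fvb e1)"
  define \<theta>2 where "\<theta>2 = sublist_in \<theta> (fvb e2 - {x})"
  have \<theta>: "distinct \<theta>1" "set \<theta>1 = fvb e1" "distinct (x # \<theta>2)" "set (x # \<theta>2) = fvb e2"
    "set \<theta> = set \<theta>1 \<union> set \<theta>2" "set \<theta>1 \<inter> set \<theta>2 = {}"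
    using TLet.prems by (auto simp: \<theta>1_def \<theta>2_def)
  let ?B = "let_tuple \<theta>1 (tjax_tan \<theta>1 x e1) (tuple_tan \<theta>)"
  have E: "tjax_tan \<theta> u (TLet x e1 e2) = let_tuple (x # \<theta>2) (tjax_tan (x # \<theta>2) u e2) ?B"
    by (simp add: Let_def \<theta>1_def \<theta>2_def)
  have 1: "wfb (tjax_tan \<theta>1 x e1) \<and> fvb (tjax_tan \<theta>1 x e1) = {x}
      \<and> btan_ty (tjax_tan \<theta>1 x e1) = theta_ty \<theta>1 \<and> fvpb (tjax_tan \<theta>1 x e1) \<subseteq> fvpb e1"
    using TLet.IH(1)[OF _ \<theta>(1,2), of x] TLet.prems by simp
  have 2: "wfb (tjax_tan (x # \<theta>2) u e2) \<and> fvb (tjax_tan (x # \<theta>2) u e2) = {u}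
      \<and> btan_ty (tjax_tan (x # \<theta>2) u e2) = theta_ty (x # \<theta>2)
      \<and> fvpb (tjax_tan (x # \<theta>2) u e2) \<subseteq> fvpb e2"
    using TLet.IH(2)[OF _ \<theta>(3,4), of u] TLet.prems by simp
  have fB: "fvb ?B = {x} \<union> set \<theta>2" "fvpb ?B \<subseteq> fvpb e1" "btan_ty ?B = theta_ty \<theta>"
    using let_tuple_fv[OF \<theta>(1)] 1 \<theta>(5,6) by (auto simp: tuple_tan_props)
  have wB: "wfb ?B"
    by (rule let_tuple_wf) (use 1 \<theta> TLet.prems(2) in \<open>auto simp: tuple_tan_props\<close>)
  show ?case unfolding E
    using let_tuple_fv[OF \<theta>(3), of "tjax_tan (x # \<theta>2) u e2" ?B] 2 fB
      let_tuple_wf[OF \<theta>(3), of "tjax_tan (x # \<theta>2) u e2" ?B] wB by auto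
next
  case (TDup x)
  define z where "z = afresh {u} (avty x)"
  define w where "w = afresh {u, z} (avty x)"
  have zw: "avty z = avty x" "avty w = avty x" "z \<noteq> u" "w \<noteq> u" "w \<noteq> z"
    using afresh_spec[of "{u}"] afresh_spec[of "{u, z}"] by (auto simp: z_def w_def)
  have "\<theta> = [x]" using TDup.prems distinct_singleton[of \<theta> x] by simp
  moreover have "tjax_tan \<theta> u (TDup x) = TLetPair z w u (TPlus z w)"
    by (simp add: Let_def z_def w_def)
  ultimately show ?case using TDup.prems zw by auto
next
  case (TPlus x y)
  then show ?case using distinct_doubleton[of \<theta> x y] by auto
next
  case (TTimes x y)
  then show ?case using distinct_singleton[of \<theta> y] by simp
next
  case (TPair e1 e2)
  define \<theta>1 where "\<theta>1 = sublist_in \<theta> (fvb e1)"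
  define \<theta>2 where "\<theta>2 = sublist_in \<theta> (fvb e2)"
  define u1 where "u1 = afresh (insert u (set \<theta>)) (btan_ty e1)"
  define u2 where "u2 = afresh ({u, u1} \<union> set \<theta>) (btan_ty e2)"
  have u: "avty u1 = btan_ty e1" "avty u2 = btan_ty e2" "u1 \<noteq> u" "u2 \<noteq> u" "u2 \<noteq> u1"
    "u1 \<notin> set \<theta>" "u2 \<notin> set \<theta>"
    using afresh_spec[of "insert u (set \<theta>)"] afresh_spec[of "{u, u1} \<union> set \<theta>"]
    by (auto simp: u1_def u2_def)
  have \<theta>: "distinct \<theta>1" "set \<theta>1 = fvb e1" "distinct \<theta>2" "set \<theta>2 = fvb e2"
    "set \<theta> = set \<theta>1 \<union> set \<theta>2" "set \<theta>1 \<inter> set \<theta>2 = {}"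
    using TPair.prems by (auto simp: \<theta>1_def \<theta>2_def)
  let ?C = "let_tuple \<theta>2 (tjax_tan \<theta>2 u2 e2) (tuple_tan \<theta>)"
  let ?B = "let_tuple \<theta>1 (tjax_tan \<theta>1 u1 e1) ?C"
  have E: "tjax_tan \<theta> u (TPair e1 e2) = TLetPair u1 u2 u ?B"
    by (simp add: Let_def \<theta>1_def \<theta>2_def u1_def u2_def)
  have 1: "wfb (tjax_tan \<theta>1 u1 e1) \<and> fvb (tjax_tan \<theta>1 u1 e1) = {u1}
      \<and> btan_ty (tjax_tan \<theta>1 u1 e1) = theta_ty \<theta>1 \<and> fvpb (tjax_tan \<theta>1 u1 e1) \<subseteq> fvpb e1"
    using TPair.IH(1)[OF _ \<theta>(1,2), of u1] TPair.prems u by simp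
  have 2: "wfb (tjax_tan \<theta>2 u2 e2) \<and> fvb (tjax_tan \<theta>2 u2 e2) = {u2}
      \<and> btan_ty (tjax_tan \<theta>2 u2 e2) = theta_ty \<theta>2 \<and> fvpb (tjax_tan \<theta>2 u2 e2) \<subseteq> fvpb e2"
    using TPair.IH(2)[OF _ \<theta>(3,4), of u2] TPair.prems u by simp
  have fC: "fvb ?C = {u2} \<union> set \<theta>1" "fvpb ?C \<subseteq> fvpb e2" "btan_ty ?C = theta_ty \<theta>"
    using let_tuple_fv[OF \<theta>(3)] 2 \<theta>(5,6) by (auto simp: tuple_tan_props)
  have wC: "wfb ?C"
    by (rule let_tuple_wf) (use 2 \<theta> u TPair.prems(2) in \<open>auto simp: tuple_tan_props\<close>)
  have fB: "fvb ?B = {u1, u2}" "fvpb ?B \<subseteq> fvpb e1 \<union> fvpb e2" "btan_ty ?B = theta_ty \<theta>"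
    using let_tuple_fv[OF \<theta>(1), of "tjax_tan \<theta>1 u1 e1" ?C] 1 fC u \<theta>(5) by auto
  have wB: "wfb ?B"
    by (rule let_tuple_wf) (use 1 fC wC \<theta> u in auto)
  show ?case unfolding E using fB wB u TPair.prems by auto
next
  case (TLetUnit z e)
  define \<theta>' where "\<theta>' = removeAll z \<theta>"
  have \<theta>: "distinct \<theta>'" "set \<theta>' = fvb e" "set \<theta> = insert z (set \<theta>')" "z \<notin> set \<theta>'"
    using TLetUnit.prems by (auto simp: \<theta>'_def distinct_removeAll)
  have 1: "wfb (tjax_tan \<theta>' u e) \<and> fvb (tjax_tan \<theta>' u e) = {u}
      \<and> btan_ty (tjax_tan \<theta>' u e) = theta_ty \<theta>' \<and> fvpb (tjax_tan \<theta>' u e) \<subseteq> fvpb e"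
    using TLetUnit.IH[OF _ \<theta>(1,2), of u] TLetUnit.prems by simp
  let ?B = "TLet z TUnit (tuple_tan \<theta>)"
  have E: "tjax_tan \<theta> u (TLetUnit z e) = let_tuple \<theta>' (tjax_tan \<theta>' u e) ?B"
    by (simp add: Let_def \<theta>'_def)
  have B: "fvb ?B = set \<theta>'" "fvpb ?B = {}" "btan_ty ?B = theta_ty \<theta>" "wfb ?B"
    using \<theta> TLetUnit.prems by (auto simp: tuple_tan_props)
  show ?case unfolding E
    using let_tuple_fv[OF \<theta>(1), of "tjax_tan \<theta>' u e" ?B] let_tuple_wf[OF \<theta>(1), of "tjax_tan \<theta>' u e" ?B]
      1 B by auto
next
  case (TLetPair x1 x2 z e)
  define \<theta>' where "\<theta>' = removeAll z \<theta>"
  define \<psi> where "\<psi> = x1 # x2 # \<theta>'"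
  have \<theta>: "distinct \<psi>" "set \<psi> = fvb e" "set \<theta> = insert z (set \<theta>')" "z \<notin> set \<theta>'"
    "set \<psi> = {x1, x2} \<union> set \<theta>'"
    using TLetPair.prems by (auto simp: \<psi>_def \<theta>'_def distinct_removeAll)
  let ?T = "tjax_tan \<psi> u e"
  have 1: "wfb ?T \<and> fvb ?T = {u} \<and> btan_ty ?T = theta_ty \<psi> \<and> fvpb ?T \<subseteq> fvpb e"
    using TLetPair.IH[OF _ \<theta>(1,2), of u] TLetPair.prems by simp
  let ?B = "TLet z (TPair (TVar x1) (TVar x2)) (tuple_tan \<theta>)"
  have E: "tjax_tan \<theta> u (TLetPair x1 x2 z e) = let_tuple \<psi> ?T ?B"
    by (simp add: Let_def \<theta>'_def \<psi>_def)
  have B: "fvb ?B = set \<psi>" "fvpb ?B = {}" "btan_ty ?B = theta_ty \<theta>" "wfb ?B"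
    using \<theta> TLetPair.prems by (auto simp: tuple_tan_props)
  have "wfb (let_tuple \<psi> ?T ?B)"
    by (rule let_tuple_wf) (use 1 B \<theta>(1) in simp_all)
  then show ?case unfolding E fvpb.simps(11)
    using let_tuple_fv[OF \<theta>(1), of ?T ?B] 1 B by (simp del: fvb.simps fvpb.simps)
qed auto

text \<open>A \<open>let\<close> is a composition and runs backwards: transposing \<open>e2\<close>
  yields cotangents for its variables, and the one for \<open>x\<close> is fed to the transpose of
  \<open>e1\<close>. Every tangent variable is used once, so the sum splits without overlap, and
  cotangents are added only in the case of \<open>TDup\<close>. The environment
  \<open>\<zeta>'\<close> is arbitrary because \<open>u\<close> is the only free tangent variable of
  the transpose.\<close>

theorem bsem_tjax_tan:
  "wfb e \<Longrightarrow> distinct \<theta> \<Longrightarrow> set \<theta> = fvb e \<Longrightarrow> avty u = btan_ty e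
    \<Longrightarrow> ip (t_ty (btan_ty e)) (bsem \<gamma> \<zeta> e) b
      = (\<Sum>y\<in>set \<theta>. ip (t_ty (avty y)) (\<zeta> y) (tget \<theta> (bsem \<gamma> (\<zeta>'(u := b)) (tjax_tan \<theta> u e)) y))"
proof (induction e arbitrary: \<theta> u \<zeta> \<zeta>' b)
  case (TVar x)
  then show ?case using distinct_singleton[of \<theta> x] by simp
next
  case (TLet x e1 e2)
  define \<theta>1 where "\<theta>1 = sublist_in \<theta> (fvb e1)"
  define \<theta>2 where "\<theta>2 = sublist_in \<theta> (fvb e2 - {x})"
  have \<theta>: "distinct \<theta>1" "set \<theta>1 = fvb e1" "distinct (x # \<theta>2)" "set (x # \<theta>2) = fvb e2"
    "set \<theta> = set \<theta>1 \<union> set \<theta>2" "set \<theta>1 \<inter> set \<theta>2 = {}" "x \<notin> set \<theta>2"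
    using TLet.prems by (auto simp: \<theta>1_def \<theta>2_def)
  have E: "tjax_tan \<theta> u (TLet x e1 e2) = let_tuple (x # \<theta>2) (tjax_tan (x # \<theta>2) u e2)
      (let_tuple \<theta>1 (tjax_tan \<theta>1 x e1) (tuple_tan \<theta>))"
    by (simp add: Let_def \<theta>1_def \<theta>2_def)
  define c where "c = bsem \<gamma> \<zeta> e1"
  define v2 where "v2 = bsem \<gamma> (\<zeta>'(u := b)) (tjax_tan (x # \<theta>2) u e2)"
  define \<zeta>1 where "\<zeta>1 = tbind (x # \<theta>2) v2 (\<zeta>'(u := b))"
  define v1 where "v1 = bsem \<gamma> \<zeta>1 (tjax_tan \<theta>1 x e1)"
  define \<zeta>2 where "\<zeta>2 = tbind \<theta>1 v1 \<zeta>1"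
  have R: "bsem \<gamma> (\<zeta>'(u := b)) (tjax_tan \<theta> u (TLet x e1 e2)) = vtuple (map \<zeta>2 \<theta>)"
    unfolding E using \<theta>(1,3) by (simp add: bsem_let_tuple tuple_tan_props \<zeta>2_def \<zeta>1_def v1_def v2_def)
  have "ip (t_ty (btan_ty e2)) (bsem \<gamma> (\<zeta>(x := c)) e2) b
      = (\<Sum>y\<in>set (x # \<theta>2). ip (t_ty (avty y)) ((\<zeta>(x := c)) y) (tget (x # \<theta>2) v2 y))"
    unfolding v2_def using TLet.prems \<theta>(3,4) by (intro TLet.IH(2)) simp_all
  also have "\<dots> = (\<Sum>y\<in>set (x # \<theta>2). ip (t_ty (avty y)) ((\<zeta>(x := c)) y) (\<zeta>1 y))"
    by (intro sum.cong) (auto simp: \<zeta>1_def tbind_def)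
  also have "\<dots> = ip (t_ty (avty x)) c (\<zeta>1 x) + (\<Sum>y\<in>set \<theta>2. ip (t_ty (avty y)) ((\<zeta>(x := c)) y) (\<zeta>1 y))"
    using \<theta>(7) by simp
  \<comment> \<open>\<open>\<theta>2\<close> contains neither \<open>x\<close> nor a variable of
    \<open>\<theta>1\<close>, so the updates leave its coordinates alone.\<close>
  also have "(\<Sum>y\<in>set \<theta>2. ip (t_ty (avty y)) ((\<zeta>(x := c)) y) (\<zeta>1 y))
      = (\<Sum>y\<in>set \<theta>2. ip (t_ty (avty y)) (\<zeta> y) (\<zeta>2 y))"
    using \<theta>(6,7) by (intro sum.cong) (auto simp: \<zeta>2_def tbind_def)
  \<comment> \<open>The cotangent of \<open>x\<close> obtained from \<open>e2\<close> is the input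
    of the transpose of \<open>e1\<close>; the hypothesis for \<open>e1\<close> is used with the
    trivial update \<open>\<zeta>1(x := \<zeta>1 x)\<close>.\<close>
  also have "ip (t_ty (avty x)) c (\<zeta>1 x) = (\<Sum>y\<in>set \<theta>1. ip (t_ty (avty y)) (\<zeta> y) (tget \<theta>1 v1 y))"
  proof -
    have "ip (t_ty (btan_ty e1)) (bsem \<gamma> \<zeta> e1) (\<zeta>1 x) = (\<Sum>y\<in>set \<theta>1. ip (t_ty (avty y)) (\<zeta> y)
        (tget \<theta>1 (bsem \<gamma> (\<zeta>1(x := \<zeta>1 x)) (tjax_tan \<theta>1 x e1)) y))"
      using TLet.prems \<theta>(1,2) by (intro TLet.IH(1)) simp_all
    then show ?thesis using TLet.prems(1) by (simp add: c_def v1_def)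
  qed
  also have "\<dots> = (\<Sum>y\<in>set \<theta>1. ip (t_ty (avty y)) (\<zeta> y) (\<zeta>2 y))"
    by (intro sum.cong) (auto simp: \<zeta>2_def tbind_def)
  finally have "ip (t_ty (btan_ty e2)) (bsem \<gamma> (\<zeta>(x := c)) e2) b
      = (\<Sum>y\<in>set \<theta>. ip (t_ty (avty y)) (\<zeta> y) (\<zeta>2 y))"
    unfolding \<theta>(5) using \<theta>(6) by (simp add: sum.union_disjoint del: fun_upd_apply)
  also have "\<dots> = (\<Sum>y\<in>set \<theta>. ip (t_ty (avty y)) (\<zeta> y) (tget \<theta> (vtuple (map \<zeta>2 \<theta>)) y))"
    by (intro sum.cong) (auto simp: tget_vtuple)
  finally show ?case unfolding R by (simp add: c_def del: fun_upd_apply)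
next
  case (TDup x)
  define z where "z = afresh {u} (avty x)"
  define w where "w = afresh {u, z} (avty x)"
  have zw: "avty z = avty x" "w \<noteq> z"
    using afresh_spec[of "{u}"] afresh_spec[of "{u, z}"] by (auto simp: z_def w_def)
  have "\<theta> = [x]" using TDup.prems distinct_singleton[of \<theta> x] by simp
  moreover have "tjax_tan \<theta> u (TDup x) = TLetPair z w u (TPlus z w)"
    by (simp add: Let_def z_def w_def)
  ultimately show ?case using zw by (simp add: ip_vadd)
next
  case (TPlus x y)
  then have "\<theta> = [x, y] \<or> \<theta> = [y, x]" "x \<noteq> y" "avty y = avty x"
    using distinct_doubleton[of \<theta> x y] by auto
  then show ?case by (auto simp: ip_vadd_left)
next
  case (TTimes x y)
  then have "\<theta> = [y]" "avty u = avty y" using distinct_singleton[of \<theta> y] by simp_all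
  then show ?case by (simp add: ip_vscale ip_vscale_left)
next
  case (TDrop e)
  \<comment> \<open>Nothing flows back from a dropped result: the adjoint of the map into
    \<open>\<top>\<close> is zero.\<close>
  have "tget \<theta> (bsem \<gamma> (\<zeta>'(u := b)) (tjax_tan \<theta> u (TDrop e))) y = vzero (t_ty (avty y))"
    if "y \<in> set \<theta>" for y
    using that by (simp add: t_ty_theta_ty tget_vzero)
  then show ?case by simp
next
  case (TPair e1 e2)
  define \<theta>1 where "\<theta>1 = sublist_in \<theta> (fvb e1)"
  define \<theta>2 where "\<theta>2 = sublist_in \<theta> (fvb e2)"
  define u1 where "u1 = afresh (insert u (set \<theta>)) (btan_ty e1)"
  define u2 where "u2 = afresh ({u, u1} \<union> set \<theta>) (btan_ty e2)"
  have u: "avty u1 = btan_ty e1" "avty u2 = btan_ty e2" "u2 \<noteq> u1" "u1 \<notin> set \<theta>" "u2 \<notin> set \<theta>"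
    using afresh_spec[of "insert u (set \<theta>)"] afresh_spec[of "{u, u1} \<union> set \<theta>"]
    by (auto simp: u1_def u2_def)
  have \<theta>: "distinct \<theta>1" "set \<theta>1 = fvb e1" "distinct \<theta>2" "set \<theta>2 = fvb e2"
    "set \<theta> = set \<theta>1 \<union> set \<theta>2" "set \<theta>1 \<inter> set \<theta>2 = {}"
    using TPair.prems by (auto simp: \<theta>1_def \<theta>2_def)
  have E: "tjax_tan \<theta> u (TPair e1 e2) = TLetPair u1 u2 u
      (let_tuple \<theta>1 (tjax_tan \<theta>1 u1 e1) (let_tuple \<theta>2 (tjax_tan \<theta>2 u2 e2) (tuple_tan \<theta>)))"
    by (simp add: Let_def \<theta>1_def \<theta>2_def u1_def u2_def)
  define \<zeta>0 where "\<zeta>0 = \<zeta>'(u := b, u1 := vfst b, u2 := vsnd b)"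
  define v1 where "v1 = bsem \<gamma> \<zeta>0 (tjax_tan \<theta>1 u1 e1)"
  define \<zeta>1 where "\<zeta>1 = tbind \<theta>1 v1 \<zeta>0"
  define v2 where "v2 = bsem \<gamma> \<zeta>1 (tjax_tan \<theta>2 u2 e2)"
  define \<zeta>2 where "\<zeta>2 = tbind \<theta>2 v2 \<zeta>1"
  have R: "bsem \<gamma> (\<zeta>'(u := b)) (tjax_tan \<theta> u (TPair e1 e2)) = vtuple (map \<zeta>2 \<theta>)"
    unfolding E using \<theta>(1,3) by (simp add: bsem_let_tuple tuple_tan_props \<zeta>0_def \<zeta>2_def \<zeta>1_def v1_def v2_def)
  have "\<zeta>0 u1 = vfst b" using u(3) by (simp add: \<zeta>0_def)
  \<comment> \<open>Brings \<open>\<zeta>0\<close> into the form of an update at \<open>u1\<close>,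
    as the induction hypothesis demands.\<close>
  then have z0: "\<zeta>0 = \<zeta>0(u1 := vfst b)" by (simp only: fun_upd_idem)
  have "u2 \<notin> set \<theta>1" using u(5) \<theta>(5) by simp
  then have "\<zeta>1 u2 = vsnd b" by (simp add: \<zeta>0_def \<zeta>1_def tbind_def)
  then have z1: "\<zeta>1 = \<zeta>1(u2 := vsnd b)" by (simp only: fun_upd_idem)
  have "ip (t_ty (btan_ty e1)) (bsem \<gamma> \<zeta> e1) (vfst b)
      = (\<Sum>y\<in>set \<theta>1. ip (t_ty (avty y)) (\<zeta> y) (tget \<theta>1 v1 y))"
    unfolding v1_def by (subst z0, rule TPair.IH(1)) (use TPair.prems \<theta> u in auto)
  also have "\<dots> = (\<Sum>y\<in>set \<theta>1. ip (t_ty (avty y)) (\<zeta> y) (\<zeta>2 y))"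
    using \<theta>(6) by (intro sum.cong) (auto simp: \<zeta>2_def \<zeta>1_def tbind_def)
  finally have 1: "ip (t_ty (btan_ty e1)) (bsem \<gamma> \<zeta> e1) (vfst b)
      = (\<Sum>y\<in>set \<theta>1. ip (t_ty (avty y)) (\<zeta> y) (\<zeta>2 y))" .
  have "ip (t_ty (btan_ty e2)) (bsem \<gamma> \<zeta> e2) (vsnd b)
      = (\<Sum>y\<in>set \<theta>2. ip (t_ty (avty y)) (\<zeta> y) (tget \<theta>2 v2 y))"
    unfolding v2_def by (subst z1, rule TPair.IH(2)) (use TPair.prems \<theta> u in auto)
  also have "\<dots> = (\<Sum>y\<in>set \<theta>2. ip (t_ty (avty y)) (\<zeta> y) (\<zeta>2 y))"
    by (intro sum.cong) (auto simp: \<zeta>2_def tbind_def)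
  finally have "ip (t_ty (btan_ty (TPair e1 e2))) (bsem \<gamma> \<zeta> (TPair e1 e2)) b
      = (\<Sum>y\<in>set \<theta>. ip (t_ty (avty y)) (\<zeta> y) (\<zeta>2 y))"
    unfolding \<theta>(5) using 1 \<theta>(6) by (simp add: sum.union_disjoint)
  also have "\<dots> = (\<Sum>y\<in>set \<theta>. ip (t_ty (avty y)) (\<zeta> y) (tget \<theta> (vtuple (map \<zeta>2 \<theta>)) y))"
    by (intro sum.cong) (auto simp: tget_vtuple)
  finally show ?case unfolding R .
next
  case (TLetUnit z e)
  define \<theta>' where "\<theta>' = removeAll z \<theta>"
  have \<theta>: "distinct \<theta>'" "set \<theta>' = fvb e" "set \<theta> = insert z (set \<theta>')" "z \<notin> set \<theta>'"
    using TLetUnit.prems by (auto simp: \<theta>'_def distinct_removeAll)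
  define v where "v = bsem \<gamma> (\<zeta>'(u := b)) (tjax_tan \<theta>' u e)"
  define \<zeta>2 where "\<zeta>2 = (tbind \<theta>' v (\<zeta>'(u := b)))(z := VU)"
  have R: "bsem \<gamma> (\<zeta>'(u := b)) (tjax_tan \<theta> u (TLetUnit z e)) = vtuple (map \<zeta>2 \<theta>)"
    using \<theta>(1) by (simp add: Let_def \<theta>'_def[symmetric] bsem_let_tuple tuple_tan_props \<zeta>2_def v_def)
  have "ip (t_ty (btan_ty e)) (bsem \<gamma> \<zeta> e) b = (\<Sum>y\<in>set \<theta>'. ip (t_ty (avty y)) (\<zeta> y) (tget \<theta>' v y))"
    unfolding v_def using TLetUnit.prems \<theta>(1,2) by (intro TLetUnit.IH) simp_all
  also have "\<dots> = (\<Sum>y\<in>set \<theta>'. ip (t_ty (avty y)) (\<zeta> y) (\<zeta>2 y))"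
    using \<theta>(4) by (intro sum.cong) (auto simp: \<zeta>2_def tbind_def)
  \<comment> \<open>The additional coordinate \<open>z\<close> has type \<open>AOne\<close>, at
    which the inner product is 0.\<close>
  also have "\<dots> = (\<Sum>y\<in>set \<theta>. ip (t_ty (avty y)) (\<zeta> y) (\<zeta>2 y))"
    using \<theta>(3,4) TLetUnit.prems(1) by simp
  also have "\<dots> = (\<Sum>y\<in>set \<theta>. ip (t_ty (avty y)) (\<zeta> y) (tget \<theta> (vtuple (map \<zeta>2 \<theta>)) y))"
    by (intro sum.cong) (auto simp: tget_vtuple)
  finally show ?case unfolding R by simp
next
  case (TLetPair x1 x2 z e)
  define \<theta>' where "\<theta>' = removeAll z \<theta>"
  have \<theta>: "distinct (x1 # x2 # \<theta>')" "set (x1 # x2 # \<theta>') = fvb e" "set \<theta> = insert z (set \<theta>')"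
    "z \<notin> set \<theta>'" "x1 \<noteq> x2" "x1 \<notin> set \<theta>'" "x2 \<notin> set \<theta>'"
    using TLetPair.prems by (auto simp: \<theta>'_def distinct_removeAll)
  define v where "v = bsem \<gamma> (\<zeta>'(u := b)) (tjax_tan (x1 # x2 # \<theta>') u e)"
  define \<zeta>1 where "\<zeta>1 = tbind (x1 # x2 # \<theta>') v (\<zeta>'(u := b))"
  define \<zeta>2 where "\<zeta>2 = \<zeta>1(z := VP (\<zeta>1 x1) (\<zeta>1 x2))"
  let ?\<zeta> = "\<zeta>(x1 := vfst (\<zeta> z), x2 := vsnd (\<zeta> z))"
  have "tjax_tan \<theta> u (TLetPair x1 x2 z e) = let_tuple (x1 # x2 # \<theta>') (tjax_tan (x1 # x2 # \<theta>') u e)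
      (TLet z (TPair (TVar x1) (TVar x2)) (tuple_tan \<theta>))"
    by (simp add: Let_def \<theta>'_def)
  note E = this
  have R: "bsem \<gamma> (\<zeta>'(u := b)) (tjax_tan \<theta> u (TLetPair x1 x2 z e)) = vtuple (map \<zeta>2 \<theta>)"
    unfolding E bsem_let_tuple[OF \<theta>(1)] by (simp add: tuple_tan_props \<zeta>2_def \<zeta>1_def v_def)
  have "ip (t_ty (btan_ty e)) (bsem \<gamma> ?\<zeta> e) b
      = (\<Sum>y\<in>set (x1 # x2 # \<theta>'). ip (t_ty (avty y)) (?\<zeta> y) (tget (x1 # x2 # \<theta>') v y))"
    unfolding v_def using TLetPair.prems \<theta>(1,2) by (intro TLetPair.IH) simp_all
  also have "\<dots> = (\<Sum>y\<in>set (x1 # x2 # \<theta>'). ip (t_ty (avty y)) (?\<zeta> y) (\<zeta>1 y))"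
    by (intro sum.cong) (auto simp: \<zeta>1_def tbind_def)
  also have "\<dots> = ip (t_ty (avty x1)) (vfst (\<zeta> z)) (\<zeta>1 x1) + ip (t_ty (avty x2)) (vsnd (\<zeta> z)) (\<zeta>1 x2)
      + (\<Sum>y\<in>set \<theta>'. ip (t_ty (avty y)) (?\<zeta> y) (\<zeta>1 y))"
    using \<theta>(5-7) by simp
  also have "(\<Sum>y\<in>set \<theta>'. ip (t_ty (avty y)) (?\<zeta> y) (\<zeta>1 y))
      = (\<Sum>y\<in>set \<theta>'. ip (t_ty (avty y)) (\<zeta> y) (\<zeta>2 y))"
    using \<theta>(4-7) by (intro sum.cong) (auto simp: \<zeta>2_def)
  \<comment> \<open>The coordinates of \<open>x1\<close> and \<open>x2\<close> recombine into that
    of \<open>z\<close>, whose type is their product.\<close>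
  also have "ip (t_ty (avty x1)) (vfst (\<zeta> z)) (\<zeta>1 x1) + ip (t_ty (avty x2)) (vsnd (\<zeta> z)) (\<zeta>1 x2)
      = ip (t_ty (avty z)) (\<zeta> z) (\<zeta>2 z)"
    using TLetPair.prems(1) by (simp add: \<zeta>2_def)
  also have "ip (t_ty (avty z)) (\<zeta> z) (\<zeta>2 z) + (\<Sum>y\<in>set \<theta>'. ip (t_ty (avty y)) (\<zeta> y) (\<zeta>2 y))
      = (\<Sum>y\<in>set \<theta>. ip (t_ty (avty y)) (\<zeta> y) (\<zeta>2 y))"
    using \<theta>(3,4) by simp
  also have "\<dots> = (\<Sum>y\<in>set \<theta>. ip (t_ty (avty y)) (\<zeta> y) (tget \<theta> (vtuple (map \<zeta>2 \<theta>)) y))"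
    by (intro sum.cong) (auto simp: tget_vtuple)
  finally show ?case unfolding R by (simp del: fun_upd_apply)
qed auto

theorem tjax_wf:
  "wfA ar (A_of_bexp d) \<Longrightarrow> distinct \<theta> \<Longrightarrow> set \<theta> = fvt (A_of_bexp d) \<Longrightarrow> avty u = tan_ty (A_of_bexp d)
    \<Longrightarrow> wfA ar (A_of_bexp (tjax \<theta> u d)) \<and> fvt (A_of_bexp (tjax \<theta> u d)) = {u}
      \<and> tan_ty (A_of_bexp (tjax \<theta> u d)) = theta_ty \<theta>
      \<and> prim_ty (A_of_bexp (tjax \<theta> u d)) = prim_ty (A_of_bexp d)
      \<and> fvp (A_of_bexp (tjax \<theta> u d)) \<subseteq> fvp (A_of_bexp d)"
proof (induction d)
  case (BPair ep et)
  then show ?case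
    using tjax_tan_wf[of et \<theta> u]
    by (auto simp: APair_props A_of_btan_props wfA_A_of_btan)
qed (auto simp: ALetPrim_props)

lemma aprim_tjax: "aprim den \<gamma> (A_of_bexp (tjax \<theta> u d)) = aprim den \<gamma> (A_of_bexp d)"
  by (induction d arbitrary: \<gamma>) (auto simp: APair_props ALetPrim_props)

theorem atan_tjax:
  "wfA ar (A_of_bexp d) \<Longrightarrow> distinct \<theta> \<Longrightarrow> set \<theta> = fvt (A_of_bexp d) \<Longrightarrow> avty u = tan_ty (A_of_bexp d)
    \<Longrightarrow> ip (t_ty (tan_ty (A_of_bexp d))) (atan den \<gamma> \<zeta> (A_of_bexp d)) b
      = (\<Sum>y\<in>set \<theta>. ip (t_ty (avty y)) (\<zeta> y)
           (tget \<theta> (atan den \<gamma> (\<zeta>'(u := b)) (A_of_bexp (tjax \<theta> u d))) y))"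
proof (induction d arbitrary: \<gamma>)
  case (BPair ep et)
  then show ?case
    using bsem_tjax_tan[of et \<theta> u \<gamma> \<zeta> b \<zeta>']
    by (simp add: APair_props A_of_btan_props wfA_A_of_btan atan_A_of_btan del: fun_upd_apply)
qed (auto simp: ALetPrim_props)

section \<open>Comparison of the two transposes up to logical equivalence\<close>

section \<open>Soundness\<close>

text \<open>Both outputs have the same inner product with every vector, and nondegeneracy applies
  once they are known to have the right shape.\<close>

lemma adjoint_unique:
  assumes "adjoint A B f g" "adjoint A B f g'" "ltype A" "vtyped A (g b)" "vtyped A (g' b)"
  shows "g b = g' b"
  using assms by (intro ip_nondegenerate[of A]) (auto simp: adjoint_def)

lemma finite_linear_A: "linear_A ar \<Gamma> \<Delta> e \<tau> \<sigma> \<Longrightarrow> finite \<Gamma>"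
  by (induction rule: linear_A.induct) auto

lemma wfR_typed_prim_env:
  assumes R: "wfR ar R" and fv: "fvR R \<subseteq> pvar ` \<Gamma>" and fin: "finite \<Gamma>"
  shows "typed ar (prim_env \<Gamma>) (tm_of_R R) (TTensor (TBang (primR R)) (sec_ty (TLolli (domR R) (codR R))))"
proof -
  have "typed ar (env_of (fvR R \<union> pvar ` \<Gamma>) \<union> {}) (tm_of_R R)
      (TTensor (TBang (primR R)) (sec_ty (TLolli (domR R) (codR R))))"
    using fin wfR_typed[OF R] by (intro typed_weaken) auto
  moreover have "fvR R \<union> pvar ` \<Gamma> = pvar ` \<Gamma>" using fv by auto
  moreover have "env_of (pvar ` \<Gamma>) = prim_env \<Gamma>" by (auto simp: env_of_def prim_env_def)
  ultimately show ?thesis by simp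
qed

text \<open>An environment supplies boxes; computability of the content follows because a box
  reduces only inside.\<close>

lemma typed_Bang_Red:
  assumes "\<And>f. ar f \<ge> 1" "typed ar {} (Bang M) (TBang A)"
  shows "Red ar den A M"
proof -
  have "Red ar den (TBang A) (Bang M)" using typed_closed_Red[where ar = ar, OF assms] .
  then obtain M' where "reds ar den (Bang M) (Bang M')" "Red ar den A M'" "fv M = {}" by auto
  then show ?thesis using reds_Bang_inv Red_expand by (metis tm.inject(2))
qed

lemma log_rel_Bang_unique:
  assumes cons: "\<And>r s. beta_eq ar den (Num r) (Num s) \<Longrightarrow> r = s"
    and "log_rel ar den (TBang A) (Bang M) (Bang N)" "realizes ar den A M a" "realizes ar den A N b"
  shows "a = b"
proof -
  obtain M' N' where *: "reds ar den (Bang M) (Bang M')" "reds ar den (Bang N) (Bang N')"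
    "log_rel ar den A M' N'" using assms(2) by auto
  then have "reds ar den M M'" "reds ar den N N'"
    using reds_Bang_inv by (metis tm.inject(2))+
  then have "beta_eq ar den M M'" "beta_eq ar den N' N"
    by (auto intro: beta_eqI equivclp_sym)
  then show ?thesis
    using realizes_unique[where ar = ar and den = den, OF cons assms(3) _ *(3) _ assms(4)] by blast
qed

theorem theorem7p2:
  fixes ar :: "'f \<Rightarrow> nat" and den :: "'f \<Rightarrow> real list \<Rightarrow> real"
    and d :: "'f bexp" and \<Gamma> \<Delta> :: "avar set" and \<sigma> \<tau> :: aty
    and \<theta> :: "avar list" and u :: avar
  assumes "\<And>f. ar f \<ge> 1"
    and "\<And>f. differentiable_fun (ar f) (den f)"
    and "linear_A ar \<Gamma> \<Delta> (A_of_bexp d) \<sigma> \<tau>"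
    and "distinct \<theta>" and "set \<theta> = \<Delta>"
    and "avty u = \<tau>" and "u \<notin> \<Delta>"
  shows "log_eq ar den (prim_env \<Gamma>)
           (TTensor (TBang (p_ty \<sigma>)) (sec_ty (TLolli (t_ty \<tau>) (theta_with \<theta>))))
           (tm_of_R (trR (delta \<theta> (A_of_bexp d))))
           (tm_of_R (delta [u] (A_of_bexp (tjax \<theta> u d))))"
proof -
  define e where "e = A_of_bexp d"
  define e' where "e' = A_of_bexp (tjax \<theta> u d)"
  define R where "R = trR (delta \<theta> e)"
  define S where "S = delta [u] e'"
  define T where "T = TTensor (TBang (p_ty \<sigma>)) (sec_ty (TLolli (t_ty \<tau>) (theta_with \<theta>)))"
  have fin: "finite \<Gamma>" using assms(3) by (rule finite_linear_A)
  have e: "wfA ar e" "fvp e \<subseteq> \<Gamma>" "set \<theta> = fvt e" "prim_ty e = \<sigma>" "tan_ty e = \<tau>" "avty u = tan_ty e"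
    using linear_A_wfA[OF assms(3)] assms(5,6) by (auto simp: e_def)
  have e': "wfA ar e'" "fvp e' \<subseteq> \<Gamma>" "fvt e' = {u}" "prim_ty e' = \<sigma>" "tan_ty e' = theta_ty \<theta>"
    using tjax_wf[of ar d \<theta> u] e assms(4) by (auto simp: e_def e'_def)
  have D: "wfR ar (delta \<theta> e) \<and> usedR (delta \<theta> e) \<and> primR (delta \<theta> e) = p_ty \<sigma>
      \<and> domR (delta \<theta> e) = theta_with \<theta> \<and> codR (delta \<theta> e) = t_ty \<tau> \<and> fvR (delta \<theta> e) \<subseteq> pvar ` fvp e"
    using delta_wf[OF assms(1) e(1) assms(4) e(3)] e by simp
  have "fvR R \<subseteq> flip ` fvR (delta \<theta> e)" using trR_wf[of ar "delta \<theta> e"] D by (simp add: R_def)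
  also have "\<dots> \<subseteq> flip ` pvar ` fvp e" using D by (intro image_mono) simp
  \<comment> \<open>Primal variables are not function variables, so \<open>flip\<close> fixes
    them.\<close>
  also have "\<dots> = pvar ` fvp e" unfolding image_image by (rule image_cong) (simp_all add: flip_def)
  also have "\<dots> \<subseteq> pvar ` \<Gamma>" using e(2) by (rule image_mono)
  finally have fvR: "fvR R \<subseteq> pvar ` \<Gamma>" .
  have R: "wfR ar R" "primR R = p_ty \<sigma>" "domR R = t_ty \<tau>" "codR R = theta_with \<theta>"
    using trR_wf[of ar "delta \<theta> e"] D by (simp_all add: R_def)
  note R = R fvR
  have S: "wfR ar S" "primR S = p_ty \<sigma>" "domR S = t_ty \<tau>" "codR S = theta_with \<theta>"
    and fvS': "fvR S \<subseteq> pvar ` fvp e'"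
    using delta_wf[OF assms(1) e'(1), of "[u]"] e e' by (auto simp: S_def t_ty_theta_ty theta_with_def)
  have fvS: "fvR S \<subseteq> pvar ` \<Gamma>" using fvS' image_mono[OF e'(2), of pvar] by (rule subset_trans)
  note S = S fvS
  have tyR: "typed ar (prim_env \<Gamma>) (tm_of_R R) T" and tyS: "typed ar (prim_env \<Gamma>) (tm_of_R S) T"
    using wfR_typed_prim_env[OF R(1) R(5) fin] wfR_typed_prim_env[OF S(1) S(5) fin] R S
    by (simp_all add: T_def)
  have vars: "env_vars (prim_env \<Gamma>) = pvar ` \<Gamma>" by (auto simp: env_vars_def prim_env_def)
  have "log_rel ar den T (subst (on_vars (pvar ` \<Gamma>) \<rho>) (tm_of_R R))
      (subst (on_vars (pvar ` \<Gamma>) \<rho>') (tm_of_R S))"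
    if env: "\<forall>p\<in>prim_env \<Gamma>. typed ar {} (pat_val \<rho> p) (pat_ty p)
        \<and> typed ar {} (pat_val \<rho>' p) (pat_ty p) \<and> log_rel ar den (pat_ty p) (pat_val \<rho> p) (pat_val \<rho>' p)"
    for \<rho> \<rho>'
  proof -
    let ?\<rho> = "on_vars (pvar ` \<Gamma>) \<rho>" and ?\<rho>' = "on_vars (pvar ` \<Gamma>) \<rho>'"
    have x: "typed ar {} (Bang (\<rho> x)) (TBang (vty x))" "typed ar {} (Bang (\<rho>' x)) (TBang (vty x))"
      "log_rel ar den (TBang (vty x)) (Bang (\<rho> x)) (Bang (\<rho>' x))" if "x \<in> pvar ` \<Gamma>" for x
      using that env by (force simp: prim_env_def)+
    have red: "Red ar den (vty x) (\<rho> x)" "Red ar den (vty x) (\<rho>' x)" if "x \<in> pvar ` \<Gamma>" for x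
      using x[OF that] typed_Bang_Red[where ar = ar, OF assms(1)] by auto
    show ?thesis
    proof (cases "\<forall>r s. beta_eq ar den (Num r) (Num s) \<longrightarrow> r = s")
      case False
      then have num: "beta_eq ar den (Num a) (Num b)" for a b
        using numerals_convertible by blast
      have "Red ar den T (subst ?\<rho> (tm_of_R R))"
        by (rule typed_Red[OF assms(1) tyR]) (use red vars in \<open>auto simp: on_vars_def\<close>)
      moreover have "Red ar den T (subst ?\<rho>' (tm_of_R S))"
        by (rule typed_Red[OF assms(1) tyS]) (use red vars in \<open>auto simp: on_vars_def\<close>)
      ultimately show ?thesis using Red_log_rel[where ar = ar and den = den, OF num assms(1)] by blast
    next
      case True
      then have cons: "\<And>r s. beta_eq ar den (Num r) (Num s) \<Longrightarrow> r = s" by blast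
      \<comment> \<open>The two environments may assign different terms to \<open>x\<close>, but
        related ones compute the same value. This yields a single \<open>\<eta>\<close> under which
        both sides are interpreted.\<close>
      have "\<exists>a. realizes ar den (vty x) (\<rho> x) a \<and> realizes ar den (vty x) (\<rho>' x) a"
        if x\<Gamma>: "x \<in> pvar ` \<Gamma>" for x
      proof -
        have "first_order (vty x)" using x\<Gamma> by auto
        then obtain a b where "realizes ar den (vty x) (\<rho> x) a" "realizes ar den (vty x) (\<rho>' x) b"
          using red[OF x\<Gamma>] Red_realizes by meson
        then show ?thesis using log_rel_Bang_unique[OF cons x(3)[OF x\<Gamma>]] by blast
      qed
      then obtain \<eta> where \<eta>: "realizes ar den (vty x) (\<rho> x) (\<eta> x)" "realizes ar den (vty x) (\<rho>' x) (\<eta> x)"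
        if "x \<in> pvar ` \<Gamma>" for x by metis
      define \<gamma> where "\<gamma> = (\<lambda>x. \<eta> (pvar x))"
      \<comment> \<open>No function variable is free on either side, so any interpretation of them
        can be taken.\<close>
      define \<phi> where "\<phi> = (\<lambda>(_ :: var) (_ :: val). VU)"
      have rv: "realizes_var ar den ?\<rho> \<phi> \<eta> x" "realizes_var ar den ?\<rho>' \<phi> \<eta> x"
        if "x \<in> pvar ` \<Gamma>" for x
        using that \<eta>[OF that] by (auto simp: realizes_var_def on_vars_def)
      obtain P F where P: "reds ar den (subst ?\<rho> (tm_of_R R)) (Tensor P (sec_tm F))"
        "realizes ar den (TBang (p_ty \<sigma>)) P (rprim den \<eta> R)"
        "realizes_fun ar den (t_ty \<tau>) (theta_with \<theta>) F (rfun den \<phi> \<eta> R)"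
      proof -
        have "realizes_var ar den ?\<rho> \<phi> \<eta> x" if "x \<in> fvR R" for x
          using rv(1) R(5) that by blast
        from realizes_rfun[OF R(1) this] show thesis
          unfolding R(2-4) using that by blast
      qed
      obtain P' F' where P': "reds ar den (subst ?\<rho>' (tm_of_R S)) (Tensor P' (sec_tm F'))"
        "realizes ar den (TBang (p_ty \<sigma>)) P' (rprim den \<eta> S)"
        "realizes_fun ar den (t_ty \<tau>) (theta_with \<theta>) F' (rfun den \<phi> \<eta> S)"
      proof -
        have "realizes_var ar den ?\<rho>' \<phi> \<eta> x" if "x \<in> fvR S" for x
          using rv(2) S(5) that by blast
        from realizes_rfun[OF S(1) this] show thesis
          unfolding S(2-4) using that by blast
      qed
      have "rprim den \<eta> R = aprim den \<gamma> e"
        using rprim_trR[of ar "delta \<theta> e"] rprim_delta[OF e(1)] D by (simp add: R_def \<gamma>_def)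
      moreover have "rprim den \<eta> S = aprim den \<gamma> e"
        using rprim_delta[OF e'(1), of \<eta> \<gamma> den "[u]"] aprim_tjax[of den \<gamma> \<theta> u d]
        by (simp add: S_def \<gamma>_def e_def e'_def)
      ultimately have prim: "rprim den \<eta> R = rprim den \<eta> S" by simp
      have adjR: "adjoint (theta_with \<theta>) (t_ty \<tau>) (rfun den \<phi> \<eta> (delta \<theta> e)) (rfun den \<phi> \<eta> R)"
      proof -
        have nf: "\<not> fun_var f" if "f \<in> fvR (delta \<theta> e)" for f
          using that D by (metis fun_var_pvar imageE subsetD)
        have "adjoint (domR (delta \<theta> e)) (codR (delta \<theta> e)) (rfun den \<phi> \<eta> (delta \<theta> e)) (rfun den \<phi> \<eta> R)"
          unfolding R_def using D nf by (intro rfun_trR[of ar]) blast+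
        then show ?thesis using D by simp
      qed
      \<comment> \<open>\<open>rfun_delta\<close> expresses both maps through Linear A, and
        \<open>ip_theta_with\<close> assembles the sum over \<open>\<theta>\<close> into an inner
        product of tuples.\<close>
      have adjS: "adjoint (theta_with \<theta>) (t_ty \<tau>) (rfun den \<phi> \<eta> (delta \<theta> e)) (rfun den \<phi> \<eta> S)"
        unfolding adjoint_def
      proof (intro allI)
        fix a b
        let ?z = "\<lambda>_ :: avar. VU"
        have 1: "rfun den \<phi> \<eta> (delta \<theta> e) a = atan den \<gamma> (tbind \<theta> a ?z) e"
          by (rule rfun_delta[OF e(1) assms(4) e(3)]) (simp add: \<gamma>_def)
        have "rfun den \<phi> \<eta> S b = atan den \<gamma> (tbind [u] b ?z) e'"
          unfolding S_def by (rule rfun_delta[OF e'(1)]) (simp_all add: e' \<gamma>_def)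
        also have "tbind [u] b ?z = ?z(u := b)" by (auto simp: tbind_def)
        finally have 2: "rfun den \<phi> \<eta> S b = atan den \<gamma> (?z(u := b)) e'" .
        have "ip (t_ty \<tau>) (atan den \<gamma> (tbind \<theta> a ?z) e) b
            = (\<Sum>y\<in>set \<theta>. ip (t_ty (avty y)) (tbind \<theta> a ?z y) (tget \<theta> (atan den \<gamma> (?z(u := b)) e') y))"
          using atan_tjax[of ar d \<theta> u den \<gamma> "tbind \<theta> a ?z" b ?z] e assms(4) by (simp add: e_def e'_def)
        also have "\<dots> = ip (theta_with \<theta>) a (atan den \<gamma> (?z(u := b)) e')"
          unfolding ip_theta_with[OF assms(4)] by (intro sum.cong) (auto simp: tbind_def)
        finally show "ip (t_ty \<tau>) (rfun den \<phi> \<eta> (delta \<theta> e) a) b = ip (theta_with \<theta>) a (rfun den \<phi> \<eta> S b)"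
          by (simp only: 1 2)
      qed
      have "log_rel ar den (TLolli (t_ty \<tau>) (theta_with \<theta>)) F F'"
        unfolding log_rel.simps
      proof (intro allI impI)
        fix M N assume MN: "typed ar {} M (t_ty \<tau>)" "typed ar {} N (t_ty \<tau>)" "log_rel ar den (t_ty \<tau>) M N"
        obtain a where a: "realizes ar den (t_ty \<tau>) M a"
          using Red_realizes[OF typed_closed_Red[where ar = ar and den = den, OF assms(1) MN(1)]]
            ltype_first_order by auto
        obtain b where b: "realizes ar den (t_ty \<tau>) N b"
          using Red_realizes[OF typed_closed_Red[where ar = ar and den = den, OF assms(1) MN(2)]]
            ltype_first_order by auto
        \<comment> \<open>\<open>M\<close> and \<open>N\<close> are arbitrary related closed terms;
          their common value allows the two maps to be compared at one point.\<close>
        have "a = b"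
          using realizes_unique[where ar = ar and den = den, OF cons a _ MN(3) _ b] by simp
        then have ab: "realizes ar den (theta_with \<theta>) (App F M) (rfun den \<phi> \<eta> R a)"
          "realizes ar den (theta_with \<theta>) (App F' N) (rfun den \<phi> \<eta> S a)"
          using P(3) P'(3) a b by (auto simp: realizes_fun_def)
        \<comment> \<open>Both outputs are realized, hence of the right shape, as uniqueness of
          adjoints requires.\<close>
        have "rfun den \<phi> \<eta> R a = rfun den \<phi> \<eta> S a"
          by (rule adjoint_unique[OF adjR adjS]) (use ab realizes_vtyped in auto)
        then show "log_rel ar den (theta_with \<theta>) (App F M) (App F' N)"
          using ab realizes_log_rel by metis
      qed
      then have "log_rel ar den (sec_ty (TLolli (t_ty \<tau>) (theta_with \<theta>))) (sec_tm F) (sec_tm F')"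
        by (intro log_rel_With[where ?M1.0 = Unit and ?N1.0 = Unit]) auto
      moreover have "log_rel ar den (TBang (p_ty \<sigma>)) P P'"
        using P(2) P'(2) prim realizes_log_rel by metis
      ultimately show ?thesis
        unfolding T_def log_rel.simps(3) using P(1) P'(1) by blast
    qed
  qed
  then show ?thesis
    using tyR tyS unfolding log_eq_def vars T_def R_def S_def e_def e'_def by blast
qed

end
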